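(* Let $p\in\mathbb{N}$, let $(R_j)_{0\le j\le p}$ be a $(p+1)$-tuple of positive reals, and consider a system in reduced controllability form with $q\ge1$ inputs: $$\dot x_0=A_{00}x_0+\sum_{j=1}^q A_{0j}x_j+\sum_{j=1}^q b_{0j}u_j,\qquad \dot x_i=\sum_{j=i}^q A_{ij}x_j+\sum_{j=i}^q b_{ij}u_j\quad (i=1,\dots,q),$$ where $x_i\in\mathbb{R}^{n_i}$, $u_i\in\mathbb{R}$, $n_0\in\mathbb{N}$, $n_1,\dots,n_q\ge1$, $A_{00}$ is Hurwitz, for each $i\in\{1,\dots,q\}$ all eigenvalues of $A_{ii}$ have zero real part, $b_{ii}\in\mathbb{R}^{n_i\times1}$, and $(A_{ii},b_{ii})$ is controllable ($A_{ij},b_{ij}$ are arbitrary real matrices of compatible sizes). Then there exist maps $\kappa_i:\mathbb{R}^{n_i}\to\mathbb{R}$, $i=1,\dots,q$, such that: (i) for every $i$, $\kappa_i$ is a feedback law $p$-bounded and $SISS_L$-stabilizing for $\dot x_i=A_{ii}x_i+b_{ii}u_i$; (ii) the feedback $\mu=(\mu_1,\dots,\mu_q)^T$ defined by $$\mu_i(x_i,\dots,x_q):=\frac{\kappa_i(x_i)}{\big(1+\|x_{i+1}\|^2+\dots+\|x_q\|^2\big)^{p+1}},\ i\in\{1,\dots,q-1\},\qquad \mu_q(x_q):=\kappa_q(x_q),$$ is a feedback law $p$-bounded by $(R_j)_{0\le j\le p}$ and $SISS_L$-stabilizing for the full system above.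
   Context: $\|\cdot\|$ is the Euclidean norm. Feedback law $p$-bounded: given a system $\dot x=Ax+Bu$ with $x\in\mathbb{R}^n$, $u\in\mathbb{R}^m$, $p\in\mathbb{N}$ and positive reals $(R_j)_{0\le j\le p}$, a map $\nu:\mathbb{R}^n\to\mathbb{R}^m$ is a feedback law $p$-bounded by $(R_j)_{0\le j\le p}$ if $\nu$ is of class $C^p$ and, for every trajectory $x(\cdot)$ of the closed loop $\dot x=Ax+B\nu(x)$ (defined on $[0,\infty)$), the signal $U(t):=\nu(x(t))$ satisfies $\sup_{t\ge0}\|U^{(j)}(t)\|\le R_j$ for all $j\in\{0,\dots,p\}$. It is called a feedback law $p$-bounded if it is $p$-bounded by some $(p+1)$-tuple of positive reals. Eventually bounded: $f:\mathbb{R}_{\ge0}\to\mathbb{R}^k$ is eventually bounded by $\delta$ if there is $T>0$ with $\|f(t)\|\le\delta$ for all $t\ge T$. $SISS_L$: for $\Delta,N>0$, the control system $\dot x=f(x,u)$ is $SISS_L(\Delta,N)$ if for every $\delta\in(0,\Delta]$ and every bounded measurable $e:\mathbb{R}_{\ge0}\to\mathbb{R}^m$ eventually bounded by $\delta$, every solution of $\dot x=f(x,e)$ is eventually bounded by $N\delta$. It is $SISS_L$ if it is $SISS_L(\Delta,N)$ for some $\Delta,N>0$. An input-free system $\dot x=f(x)$ is $SISS_L(\Delta,N)$ (resp. $SISS_L$) if $\dot x=f(x)+u$ is. $SISS_L$-stabilizing: a feedback $\nu$ for $\dot x=f(x,u)$ is stabilizing if the origin of $\dot x=f(x,\nu(x))$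 is globally asymptotically stable; it is $SISS_L$-stabilizing if moreover $\dot x=f(x,\nu(x))$ is $SISS_L$. *)

theory Defs
  imports "HOL-Analysis.Analysis"
begin

primrec Cp :: "nat \<Rightarrow> ('a::euclidean_space \<Rightarrow> 'b::real_normed_vector) \<Rightarrow> bool" where
  "Cp 0 g = continuous_on UNIV g"
| "Cp (Suc k) g = ((\<forall>x. g differentiable (at x)) \<and>
      (\<forall>v\<in>Basis. Cp k (\<lambda>x. frechet_derivative g (at x) v)))"

primrec vder :: "nat \<Rightarrow> (real \<Rightarrow> 'a::real_normed_vector) \<Rightarrow> real \<Rightarrow> 'a" where
  "vder 0 U = U"
| "vder (Suc j) U = (\<lambda>t. vector_derivative (vder j U) (at t within {0..}))"

definition traj :: "'a::real_normed_vector set \<Rightarrow> ('a \<Rightarrow> 'a) \<Rightarrow> (real \<Rightarrow> 'a) \<Rightarrow> bool" where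
  "traj X F x \<longleftrightarrow> x 0 \<in> X \<and>
     (\<forall>t\<ge>0. (x has_vector_derivative F (x t)) (at t within {0..}))"

definition csol :: "'a::euclidean_space set \<Rightarrow> ('a \<Rightarrow> 'a) \<Rightarrow> (real \<Rightarrow> 'a) \<Rightarrow> (real \<Rightarrow> 'a) \<Rightarrow> bool" where
  "csol X F e x \<longleftrightarrow> x 0 \<in> X \<and>
     (\<forall>t\<ge>0. ((\<lambda>s. F (x s) + e s) has_integral (x t - x 0)) {0..t})"

definition ev_bdd :: "(real \<Rightarrow> 'a::real_normed_vector) \<Rightarrow> real \<Rightarrow> bool" where
  "ev_bdd f \<delta> \<longleftrightarrow> (\<exists>T>0. \<forall>t\<ge>T. norm (f t) \<le> \<delta>)"

definition admissible :: "'a::euclidean_space set \<Rightarrow> (real \<Rightarrow> 'a) \<Rightarrow> bool" where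
  "admissible X e \<longleftrightarrow> (\<forall>t\<ge>0. e t \<in> X) \<and> bounded (e ` {0..}) \<and>
     set_borel_measurable lborel {0..} e"

text \<open>SISS_L(Delta,N) for x' = F x (+ u), states and disturbances in the (invariant) subspace X.
  Solutions are required to exist globally (forward completeness), so that
  ``every solution is eventually bounded'' refers to complete solutions.\<close>
definition SISS_L_param :: "'a::euclidean_space set \<Rightarrow> ('a \<Rightarrow> 'a) \<Rightarrow> real \<Rightarrow> real \<Rightarrow> bool" where
  "SISS_L_param X F \<Delta> N \<longleftrightarrow>
     (\<forall>\<delta>. 0 < \<delta> \<and> \<delta> \<le> \<Delta> \<longrightarrow>
        (\<forall>e. admissible X e \<and> ev_bdd e \<delta> \<longrightarrow>
            (\<forall>x0\<in>X. \<exists>x. csol X F e x \<and> x 0 = x0) \<and>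
            (\<forall>x. csol X F e x \<longrightarrow> ev_bdd x (N * \<delta>))))"

definition SISS_L :: "'a::euclidean_space set \<Rightarrow> ('a \<Rightarrow> 'a) \<Rightarrow> bool" where
  "SISS_L X F \<longleftrightarrow> (\<exists>\<Delta>>0. \<exists>N>0. SISS_L_param X F \<Delta> N)"

definition GAS :: "'a::real_normed_vector set \<Rightarrow> ('a \<Rightarrow> 'a) \<Rightarrow> bool" where
  "GAS X F \<longleftrightarrow>
     (\<forall>\<epsilon>>0. \<exists>\<delta>>0. \<forall>x. traj X F x \<and> norm (x 0) < \<delta> \<longrightarrow> (\<forall>t\<ge>0. norm (x t) < \<epsilon>)) \<and>
     (\<forall>x. traj X F x \<longrightarrow> (x \<longlongrightarrow> 0) at_top)"

definition stabilizing :: "'a::real_normed_vector set \<Rightarrow> ('a \<Rightarrow> 'u \<Rightarrow> 'a) \<Rightarrow> ('a \<Rightarrow> 'u) \<Rightarrow> bool" where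
  "stabilizing X f \<nu> \<longleftrightarrow> GAS X (\<lambda>y. f y (\<nu> y))"

definition SISS_L_stabilizing :: "'a::euclidean_space set \<Rightarrow> ('a \<Rightarrow> 'u \<Rightarrow> 'a) \<Rightarrow> ('a \<Rightarrow> 'u) \<Rightarrow> bool" where
  "SISS_L_stabilizing X f \<nu> \<longleftrightarrow> stabilizing X f \<nu> \<and> SISS_L X (\<lambda>y. f y (\<nu> y))"

definition fb_bounded_by :: "'a::euclidean_space set \<Rightarrow> ('a \<Rightarrow> 'u::real_normed_vector \<Rightarrow> 'a) \<Rightarrow>
    ('a \<Rightarrow> 'u) \<Rightarrow> nat \<Rightarrow> (nat \<Rightarrow> real) \<Rightarrow> bool" where
  "fb_bounded_by X f \<nu> p R \<longleftrightarrow> Cp p \<nu> \<and>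
     (\<forall>x. traj X (\<lambda>y. f y (\<nu> y)) x \<longrightarrow>
        (\<forall>j<p. \<forall>t\<ge>0. (vder j (\<nu> \<circ> x) has_vector_derivative vder (Suc j) (\<nu> \<circ> x) t)
                          (at t within {0..})) \<and>
        (\<forall>j\<le>p. \<forall>t\<ge>0. norm (vder j (\<nu> \<circ> x) t) \<le> R j))"

definition fb_bounded :: "'a::euclidean_space set \<Rightarrow> ('a \<Rightarrow> 'u::real_normed_vector \<Rightarrow> 'a) \<Rightarrow>
    ('a \<Rightarrow> 'u) \<Rightarrow> nat \<Rightarrow> bool" where
  "fb_bounded X f \<nu> p \<longleftrightarrow> (\<exists>R. (\<forall>j\<le>p. R j > 0) \<and> fb_bounded_by X f \<nu> p R)"

text \<open>blk r is the index of the block containing coordinate r (block 0 = x_0).\<close>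
definition blk_space :: "('n \<Rightarrow> nat) \<Rightarrow> nat \<Rightarrow> (real^'n) set" where
  "blk_space blk i = {x. \<forall>r. blk r \<noteq> i \<longrightarrow> x $ r = 0}"

definition blk_proj :: "('n \<Rightarrow> nat) \<Rightarrow> nat \<Rightarrow> real^'n \<Rightarrow> real^'n" where
  "blk_proj blk i x = (\<chi> r. if blk r = i then x $ r else 0)"

definition blk_mat :: "('n \<Rightarrow> nat) \<Rightarrow> nat \<Rightarrow> real^'n^'n \<Rightarrow> real^'n^'n" where
  "blk_mat blk i A = (\<chi> r c. if blk r = i \<and> blk c = i then A $ r $ c else 0)"

definition blk_eigenvalue :: "('n::finite \<Rightarrow> nat) \<Rightarrow> nat \<Rightarrow> real^'n^'n \<Rightarrow> complex \<Rightarrow> bool" where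
  "blk_eigenvalue blk i A lam \<longleftrightarrow>
     (\<exists>v::complex^'n. v \<noteq> 0 \<and> (\<forall>r. blk r \<noteq> i \<longrightarrow> v $ r = 0) \<and>
        (\<forall>r. blk r = i \<longrightarrow> (\<Sum>c\<in>{c. blk c = i}. of_real (A $ r $ c) * v $ c) = lam * v $ r))"

definition blk_controllable :: "('n::finite \<Rightarrow> nat) \<Rightarrow> nat \<Rightarrow> real^'n^'n \<Rightarrow> real^'n \<Rightarrow> bool" where
  "blk_controllable blk i A b \<longleftrightarrow>
     span (range (\<lambda>k. ((\<lambda>v. blk_mat blk i A *v v) ^^ k) b)) = blk_space blk i"

end

theory Submission
  imports Defs "HOL-Computational_Algebra.Fundamental_Theorem_Algebra"
begin

text \<open>Each critical block \<open>(A, b)\<close> is stabilized by a low-gain feedback with a scheduled gain. Let \<open>P(\<epsilon>)\<close> be the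
  inverse of the Gramian \<open>\<integral> exp(- \<epsilon> t) \<phi> \<phi>\<^sup>T dt\<close> over \<open>t \<ge> 0\<close>, where \<open>\<phi>(t) = exp(- t A) b\<close>; it solves the Riccati equation
  \<open>P A + A\<^sup>T P + \<epsilon> P = P b b\<^sup>T P\<close>. The feedback is \<open>\<kappa>(x) = - b\<^sup>T P(\<epsilon>) x\<close>, with \<open>\<epsilon> = \<epsilon>(x)\<close> defined implicitly by
  \<open>\<epsilon> (1 + x\<^sup>T P(\<epsilon>) x) = \<rho>\<close>. Since the spectrum is imaginary, \<open>t \<mapsto> y\<^sup>T \<phi>(t)\<close> satisfies recurrences whose coefficients do not
  depend on the step up to modulus-one factors, and Turan-type inequalities for them show that \<open>P(\<epsilon>)\<close> is of order \<open>\<epsilon>\<close>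
  and that its \<open>k\<close>-th derivative is dominated by \<open>\<epsilon>\<^sup>-\<^sup>k P(\<epsilon>)\<close>. Hence \<open>\<kappa>\<close> and all its Lie derivatives are of order
  \<open>\<surd>\<rho>\<close>, each Lie derivative costing one power of the size of the signal that drives the block. The denominators in
  \<open>\<mu>\<close> pay for \<open>p\<close> such powers, so all bounds hold once \<open>\<rho>\<close> is small. The function \<open>x\<^sup>T P(\<epsilon>(x)) x\<close> is a Lyapunov
  function with linear gain for small disturbances, and linear gains pass through the cascade from block \<open>q\<close> down to
  block \<open>0\<close>.\<close>

section \<open>Exponential polynomials and Turan inequalities\<close>

text \<open>A block is driven by states that may be arbitrarily large, while the derivatives of the
  input must be bounded at every state. Differentiating \<open>b^T P x\<close> along the loop
  produces \<open>P A x\<close>, which has no such bound by itself. The Riccati equation and its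
  derivatives in \<open>\<epsilon>\<close> move \<open>A\<close> from the state onto a fixed vector,
  at the price of products of quantities already known to be bounded; this closes the induction over
  the order of the derivative. The scheduling rule sets the scale: it forces
  \<open>\<epsilon> x^T P x \<le> \<rho>\<close>, and with \<open>P \<le> C \<epsilon>\<close> the
  Cauchy-Schwarz inequality for \<open>P\<close> bounds \<open>w^T P x\<close> by a multiple of
  \<open>sqrt \<rho>\<close>, uniformly in \<open>x\<close>. How fast \<open>P(\<epsilon>)\<close>
  tends to 0 in a given direction depends on the Jordan structure. The Turan inequalities avoid that
  structure: their constants depend only on the number of factors, not on the step, so they can be
  integrated over the step against an exponential weight. The denominators leave room to spare: in
  terms of the size of the driving state they contribute the exponent \<open>- 2 * (p + 1)\<close>,
  and \<open>p\<close> derivatives give back at most \<open>p\<close>.\<close>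

primrec annihil :: "complex list \<Rightarrow> (real \<Rightarrow> complex) \<Rightarrow> bool" where
  "annihil [] f = (\<forall>t\<ge>0. f t = 0)"
| "annihil (l # ls) f = (\<exists>g. (\<forall>t\<ge>0. (f has_vector_derivative (l * f t + g t)) (at t within {0..}))
      \<and> annihil ls g)"

text \<open>The list stands for the product of the operators \<open>d/dt - l\<close>, head applied
  first, recorded through the successive images of \<open>f\<close>. No higher derivative of
  \<open>f\<close> has to be named, and repeated eigenvalues need no separate treatment.\<close>

lemma annihil_ConsI:
  "(\<And>t. t \<ge> 0 \<Longrightarrow> (f has_vector_derivative (l * f t + g t)) (at t within {0..})) \<Longrightarrow> annihil ls g
    \<Longrightarrow> annihil (l # ls) f"
  by auto

lemma annihil_lincomb:
  "annihil ls f \<Longrightarrow> annihil ls g \<Longrightarrow> annihil ls (\<lambda>t. a * f t + b * g t)"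
proof (induction ls arbitrary: f g)
  case (Cons l ls)
  obtain f1 where f1: "\<And>t. t \<ge> 0 \<Longrightarrow> (f has_vector_derivative (l * f t + f1 t)) (at t within {0..})" "annihil ls f1"
    using Cons.prems by auto
  obtain g1 where g1: "\<And>t. t \<ge> 0 \<Longrightarrow> (g has_vector_derivative (l * g t + g1 t)) (at t within {0..})" "annihil ls g1"
    using Cons.prems by auto
  have "((\<lambda>t. a * f t + b * g t) has_vector_derivative
      (l * (a * f t + b * g t) + (a * f1 t + b * g1 t))) (at t within {0..})" if "t \<ge> 0" for t
    by (rule derivative_eq_intros f1 g1 that refl | simp add: algebra_simps)+
  then show ?case by (rule annihil_ConsI[OF _ Cons.IH[OF f1(2) g1(2)]])
qed simp

lemma has_vector_derivative_shift:
  assumes "(f has_vector_derivative f') (at (t + h) within {0..})" "h \<ge> (0::real)"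
  shows "((\<lambda>t. f (t + h)) has_vector_derivative f') (at t within {0..})"
proof -
  have "((\<lambda>t. t + h) has_vector_derivative 1) (at t within {0..})"
    by (auto intro!: derivative_eq_intros)
  moreover have "(f has_vector_derivative f') (at (t + h) within ((\<lambda>t. t + h) ` {0..}))"
    by (rule has_vector_derivative_within_subset[OF assms(1)]) (use assms(2) in auto)
  ultimately have "(f \<circ> (\<lambda>t. t + h) has_vector_derivative 1 *\<^sub>R f') (at t within {0..})"
    by (rule vector_diff_chain_within)
  then show ?thesis by (simp add: o_def)
qed

lemma linear_scalar_ode:
  assumes "\<And>t. t \<ge> 0 \<Longrightarrow> (f has_vector_derivative (l * f t)) (at t within {0..})" "t \<ge> 0"
  shows "f t = exp (l * of_real t) * (f 0 :: complex)"
proof -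
  have "((\<lambda>t. exp (- l * of_real t) * f t) has_vector_derivative 0) (at t within {0..})" if "t \<ge> 0" for t
  proof -
    have "((\<lambda>t. exp (- l * of_real t)) has_vector_derivative (- l * exp (- l * of_real t))) (at t within {0..})"
      by (rule has_vector_derivative_real_field[THEN has_vector_derivative_at_within]) 
         (auto intro!: derivative_eq_intros)
    from has_vector_derivative_mult[OF this assms(1)[OF that]] show ?thesis by (simp add: algebra_simps)
  qed
  note d = this
  obtain c where "\<And>t. t \<in> {0..} \<Longrightarrow> exp (- l * of_real t) * f t = c"
    by (rule has_vector_derivative_zero_constant[of "{0..}" "\<lambda>t. exp (- l * of_real t) * f t"]) (use d in auto)
  then have c: "exp (- l * of_real t) * f t = c" if "t \<ge> 0" for t using that by simp
  have "exp (- l * of_real t) * f t = f 0"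
    using c[of 0] c[OF assms(2)] by simp
  then show ?thesis by (simp add: exp_minus field_simps)
qed

text \<open>The shift-difference factors act like the corresponding differential factors.\<close>

lemma annihil_shift_diff:
  "annihil (ls @ [l]) f \<Longrightarrow> h \<ge> 0 \<Longrightarrow> annihil ls (\<lambda>t. f (t + h) - exp (l * of_real h) * f t)"
proof (induction ls arbitrary: f)
  case Nil
  have d: "\<And>t. t \<ge> 0 \<Longrightarrow> (f has_vector_derivative (l * f t)) (at t within {0..})"
  proof -
    fix t :: real assume "t \<ge> 0"
    obtain g where g: "\<And>t. t \<ge> 0 \<Longrightarrow> (f has_vector_derivative (l * f t + g t)) (at t within {0..})"
      "\<And>t. t \<ge> 0 \<Longrightarrow> g t = 0"
      using Nil by auto
    show "(f has_vector_derivative (l * f t)) (at t within {0..})"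
      using g(1)[OF \<open>t \<ge> 0\<close>] g(2)[OF \<open>t \<ge> 0\<close>] by simp
  qed
  have "f (t + h) = exp (l * of_real h) * f t" if "t \<ge> 0" for t
  proof -
    have "f (t + h) = exp (l * of_real (t + h)) * f 0"
      by (rule linear_scalar_ode[OF d]) (use Nil(2) that in auto)
    moreover have "f t = exp (l * of_real t) * f 0"
      by (rule linear_scalar_ode[OF d that])
    ultimately show ?thesis by (simp only: distrib_left exp_add of_real_add mult_ac)
  qed
  then show ?case by simp
next
  case (Cons m ls)
  obtain g where g: "\<And>t. t \<ge> 0 \<Longrightarrow> (f has_vector_derivative (m * f t + g t)) (at t within {0..})" "annihil (ls @ [l]) g"
    using Cons.prems by auto
  let ?e = "exp (l * of_real h)"
  have "((\<lambda>t. f (t + h) - ?e * f t) has_vector_derivative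
      (m * (f (t + h) - ?e * f t) + (g (t + h) - ?e * g t))) (at t within {0..})" if "t \<ge> 0" for t
  proof -
    have "((\<lambda>t. f (t + h)) has_vector_derivative (m * f (t + h) + g (t + h))) (at t within {0..})"
      using has_vector_derivative_shift g(1)[of "t + h"] Cons.prems(2) that by auto
    moreover have "((\<lambda>t. ?e * f t) has_vector_derivative ?e * (m * f t + g t)) (at t within {0..})"
      by (rule has_vector_derivative_mult_right[OF g(1)[OF that]])
    ultimately have "((\<lambda>t. f (t + h) - ?e * f t) has_vector_derivative
      (m * f (t + h) + g (t + h) - ?e * (m * f t + g t))) (at t within {0..})"
      by (rule has_vector_derivative_diff)
    then show ?thesis by (simp add: algebra_simps)
  qed
  then show ?case unfolding append_Cons by (rule annihil_ConsI[OF _ Cons.IH[OF g(2) Cons.prems(2)]])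
qed

text \<open>The difference \<open>g\<close> has one factor fewer, and the multiplier
  \<open>exp (l * h)\<close> has modulus one because \<open>Re l = 0\<close>, so \<open>f t\<close>
  is recovered from \<open>f (t + h)\<close> and \<open>g t\<close> without loss. The two shifted
  copies of \<open>f\<close> in \<open>g\<close> double the sum at every stage, and
  \<open>1 + 2 * 3 ^ n \<le> 3 ^ (n + 1)\<close>. The step \<open>h\<close> never enters the
  constant.\<close>

lemma turan_backward:
  assumes "annihil ls f" "\<forall>l\<in>set ls. Re l = 0" "t \<ge> 0" "h \<ge> 0"
  shows "norm (f t) \<le> 3 ^ length ls * (\<Sum>k=1..length ls. norm (f (t + real k * h)))"
  using assms
proof (induction ls arbitrary: f t rule: rev_induct)
  case (snoc l ls)
  define g where "g = (\<lambda>t. f (t + h) - exp (l * of_real h) * f t)"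
  let ?n = "length ls"
  have e: "norm (exp (l * of_real h) * z) = norm z" for z :: complex
    using snoc.prems by (simp add: norm_mult)
  have "annihil ls g" unfolding g_def by (rule annihil_shift_diff) (use snoc.prems in auto)
  from snoc.IH[OF this] snoc.prems
  have IH: "norm (g t) \<le> 3 ^ ?n * (\<Sum>k=1..?n. norm (g (t + real k * h)))" by auto
  let ?S = "\<Sum>k=1..Suc ?n. norm (f (t + real k * h))"
  have "(\<Sum>k=1..?n. norm (g (t + real k * h)))
      \<le> (\<Sum>k=1..?n. norm (f (t + real (Suc k) * h)) + norm (f (t + real k * h)))"
  proof (rule sum_mono)
    fix k
    have "norm (g (t + real k * h)) \<le> norm (f (t + real k * h + h)) + norm (exp (l * of_real h) * f (t + real k * h))"
      unfolding g_def by (rule norm_triangle_ineq4)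
    then show "norm (g (t + real k * h)) \<le> norm (f (t + real (Suc k) * h)) + norm (f (t + real k * h))"
      unfolding e by (simp add: algebra_simps)
  qed
  also have "\<dots> = (\<Sum>k=2..Suc ?n. norm (f (t + real k * h))) + (\<Sum>k=1..?n. norm (f (t + real k * h)))"
    unfolding sum.distrib by (subst sum.shift_bounds_cl_Suc_ivl[symmetric]) (simp add: eval_nat_numeral)
  also have "\<dots> \<le> ?S + ?S"
    by (intro add_mono sum_mono2) auto
  finally have 1: "norm (g t) \<le> 3 ^ ?n * (2 * ?S)"
    using IH by (smt (verit) mult_left_mono zero_le_power)
  have fS: "norm (f (t + h)) \<le> ?S"
    using member_le_sum[of 1 "{1..Suc ?n}" "\<lambda>k. norm (f (t + real k * h))"] by auto
  have "norm (f t) = norm (exp (l * of_real h) * f t)" by (simp only: e)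
  also have "\<dots> = norm (f (t + h) - g t)" by (simp add: g_def)
  also have "\<dots> \<le> norm (f (t + h)) + norm (g t)" by (rule norm_triangle_ineq4)
  also have "\<dots> \<le> 1 * ?S + 3 ^ ?n * (2 * ?S)" using fS 1 by simp
  also have "\<dots> \<le> 3 ^ ?n * ?S + 3 ^ ?n * (2 * ?S)"
    by (intro add_mono mult_right_mono sum_nonneg order_refl) auto
  also have "\<dots> = 3 ^ Suc ?n * ?S" by simp
  finally show ?case by (simp del: sum.cl_ivl_Suc)
qed auto

text \<open>The same recursion read at the far end: the value of \<open>f\<close> after
  \<open>n + 1\<close> steps is the value of \<open>g\<close> after \<open>n\<close> steps plus a
  modulus-one multiple of \<open>f\<close> after \<open>n\<close> steps.\<close>

lemma turan_forward:
  assumes "annihil ls f" "\<forall>l\<in>set ls. Re l = 0" "t \<ge> 0" "h \<ge> 0"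
  shows "norm (f (t + real (length ls) * h)) \<le> 3 ^ length ls * (\<Sum>k<length ls. norm (f (t + real k * h)))"
  using assms
proof (induction ls arbitrary: f t rule: rev_induct)
  case (snoc l ls)
  define g where "g = (\<lambda>t. f (t + h) - exp (l * of_real h) * f t)"
  let ?n = "length ls"
  have e: "norm (exp (l * of_real h) * z) = norm z" for z :: complex
    using snoc.prems by (simp add: norm_mult)
  have "annihil ls g" unfolding g_def by (rule annihil_shift_diff) (use snoc.prems in auto)
  from snoc.IH[OF this] snoc.prems
  have IH: "norm (g (t + real ?n * h)) \<le> 3 ^ ?n * (\<Sum>k<?n. norm (g (t + real k * h)))" by auto
  let ?S = "\<Sum>k<Suc ?n. norm (f (t + real k * h))"
  have "(\<Sum>k<?n. norm (g (t + real k * h)))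
      \<le> (\<Sum>k<?n. norm (f (t + real (Suc k) * h)) + norm (f (t + real k * h)))"
  proof (rule sum_mono)
    fix k
    have "norm (g (t + real k * h)) \<le> norm (f (t + real k * h + h)) + norm (exp (l * of_real h) * f (t + real k * h))"
      unfolding g_def by (rule norm_triangle_ineq4)
    then show "norm (g (t + real k * h)) \<le> norm (f (t + real (Suc k) * h)) + norm (f (t + real k * h))"
      unfolding e by (simp add: algebra_simps)
  qed
  also have "\<dots> = (\<Sum>k<?n. norm (f (t + real (Suc k) * h))) + (\<Sum>k<?n. norm (f (t + real k * h)))"
    unfolding sum.distrib ..
  also have "\<dots> \<le> ?S + ?S"
  proof (rule add_mono)
    show "(\<Sum>k<?n. norm (f (t + real (Suc k) * h))) \<le> ?S"
      unfolding sum.lessThan_Suc_shift by simp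
  qed simp
  finally have 1: "norm (g (t + real ?n * h)) \<le> 3 ^ ?n * (2 * ?S)"
    using IH by (smt (verit) mult_left_mono zero_le_power)
  have fS: "norm (f (t + real ?n * h)) \<le> ?S"
    using member_le_sum[of ?n "{..<Suc ?n}" "\<lambda>k. norm (f (t + real k * h))"] by auto
  have "norm (f (t + real (Suc ?n) * h)) = norm (g (t + real ?n * h) + exp (l * of_real h) * f (t + real ?n * h))"
    by (simp add: g_def algebra_simps)
  also have "\<dots> \<le> norm (g (t + real ?n * h)) + norm (f (t + real ?n * h))"
    using norm_triangle_ineq[of "g (t + real ?n * h)" "exp (l * of_real h) * f (t + real ?n * h)"]
    by (simp only: e)
  also have "\<dots> \<le> 3 ^ ?n * (2 * ?S) + 1 * ?S" using fS 1 by simp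
  also have "\<dots> \<le> 3 ^ ?n * (2 * ?S) + 3 ^ ?n * ?S"
    by (intro add_mono mult_right_mono sum_nonneg order_refl) auto
  also have "\<dots> = 3 ^ Suc ?n * ?S" by simp
  finally show ?case by (simp del: sum.lessThan_Suc)
qed auto

text \<open>Variation of constants, one factor at a time. The strict inequality
  \<open>Re l < \<gamma>\<close> absorbs the polynomial factors that repeated eigenvalues
  produce.\<close>

lemma annihil_growth:
  assumes "annihil ls f" "\<forall>l\<in>set ls. Re l < \<gamma>"
  shows "\<exists>K\<ge>0. \<forall>t\<ge>0. norm (f t) \<le> K * exp (\<gamma> * t)"
  using assms
proof (induction ls arbitrary: f)
  case Nil
  then show ?case by (auto intro!: exI[of _ 0])
next
  case (Cons l ls)
  obtain g where g: "\<And>t. t \<ge> 0 \<Longrightarrow> (f has_vector_derivative (l * f t + g t)) (at t within {0..})" "annihil ls g"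
    using Cons.prems by auto
  obtain K where K: "K \<ge> 0" "\<And>t. t \<ge> 0 \<Longrightarrow> norm (g t) \<le> K * exp (\<gamma> * t)"
    using Cons.IH[OF g(2)] Cons.prems by auto
  \<comment> \<open>After the substitution that removes \<open>l\<close>, the forcing term grows at
    the rate \<open>r\<close>; its positivity makes the integral of the bound again a multiple of
    \<open>exp (r * t)\<close>.\<close>
  define r where "r = \<gamma> - Re l"
  have r: "r > 0" using Cons.prems by (simp add: r_def)
  define u where "u = (\<lambda>t::real. exp (- l * of_real t) * f t)"
  have du: "(u has_vector_derivative exp (- l * of_real t) * g t) (at t within {0..})" if "t \<ge> 0" for t
  proof -
    have "((\<lambda>t. exp (- l * of_real t)) has_vector_derivative (- l * exp (- l * of_real t))) (at t within {0..})"
      by (rule has_vector_derivative_real_field[THEN has_vector_derivative_at_within]) 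
         (auto intro!: derivative_eq_intros)
    from has_vector_derivative_mult[OF this g(1)[OF that]] show ?thesis by (simp add: algebra_simps u_def)
  qed
  have bnd: "norm (u t - u 0) \<le> (K / r) * exp (r * t) - (K / r) * exp (r * 0)" if "t \<ge> 0" for t
  proof (cases "t = 0")
    case False
    then have "0 < t" using that by simp
    then show ?thesis
    proof (rule differentiable_bound_general)
      show "continuous_on {0..t} u"
        using continuous_on_subset[OF continuous_on_vector_derivative[of "{0..}" u]] du by fastforce
      show "continuous_on {0..t} (\<lambda>t. (K / r) * exp (r * t))"
        by (intro continuous_intros)
      show "(u has_vector_derivative exp (- l * of_real s) * g s) (at s)" if "0 < s" "s < t" for s
        using du[of s] that by (simp add: at_within_interior[of s "{0..}"])
      show "((\<lambda>t. (K / r) * exp (r * t)) has_vector_derivative (K * exp (r * s))) (at s)" if "0 < s" "s < t" for s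
        using r by (auto intro!: derivative_eq_intros simp flip: has_real_derivative_iff_has_vector_derivative)
      show "norm (exp (- l * of_real s) * g s) \<le> K * exp (r * s)" if "0 < s" "s < t" for s
      proof -
        have "norm (exp (- l * of_real s) * g s) = exp (- Re l * s) * norm (g s)"
          by (simp add: norm_mult)
        also have "\<dots> \<le> exp (- Re l * s) * (K * exp (\<gamma> * s))"
          using K that by (intro mult_left_mono) auto
        also have "\<dots> = K * exp (r * s)" by (simp add: r_def exp_diff exp_minus left_diff_distrib field_simps)
        finally show ?thesis .
      qed
    qed
  qed simp
  have "norm (f t) \<le> (norm (u 0) + K / r) * exp (\<gamma> * t)" if "t \<ge> 0" for t
  proof -
    have "norm (u t) \<le> norm (u 0) + K / r * exp (r * t)"
      using bnd[OF that] norm_triangle_sub[of "u t" "u 0"] K r by (smt (verit) divide_nonneg_pos exp_gt_zero mult_nonneg_nonneg)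
    also have "\<dots> \<le> norm (u 0) * exp (r * t) + K / r * exp (r * t)"
    proof -
      have "norm (u 0) * 1 \<le> norm (u 0) * exp (r * t)"
        using r that by (intro mult_left_mono) auto
      then show ?thesis by simp
    qed
    finally have "norm (u t) \<le> (norm (u 0) + K / r) * exp (r * t)" by (simp add: algebra_simps)
    moreover have "norm (u t) = exp (- Re l * t) * norm (f t)" by (simp add: u_def norm_mult)
    ultimately have "norm (f t) \<le> exp (Re l * t) * ((norm (u 0) + K / r) * exp (r * t))"
      by (simp add: exp_minus field_simps)
    also have "\<dots> = (norm (u 0) + K / r) * exp (\<gamma> * t)"
      by (simp add: r_def left_diff_distrib exp_diff)
    finally show ?thesis .
  qed
  then show ?case using K r by (intro exI[of _ "norm (u 0) + K / r"]) (auto intro!: add_nonneg_nonneg divide_nonneg_pos)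
qed

lemma annihil_zero: "annihil ls (\<lambda>t. 0)"
  by (induction ls) (auto intro!: exI[of _ "\<lambda>t. 0"])

lemma annihil_sum:
  "finite I \<Longrightarrow> (\<And>i. i \<in> I \<Longrightarrow> annihil ls (f i)) \<Longrightarrow> annihil ls (\<lambda>t. \<Sum>i\<in>I. c i * f i t)"
proof (induction I rule: finite_induct)
  case (insert i I)
  have "annihil ls (\<lambda>t. c i * f i t + 1 * (\<Sum>i\<in>I. c i * f i t))"
    using insert by (intro annihil_lincomb) auto
  then show ?case using insert by simp
qed (simp add: annihil_zero)

section \<open>Lists of eigenvalues that annihilate a block\<close>

definition cmat :: "real^'n^'n \<Rightarrow> complex^'n \<Rightarrow> complex^'n" where
  "cmat M v = (\<chi> r. \<Sum>c\<in>UNIV. of_real (M $ r $ c) * v $ c)"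

lemma cmat_add: "cmat M (v + w) = cmat M v + cmat M w"
  and cmat_scale: "cmat M (c *s v) = c *s cmat M v"
  and cmat_diff: "cmat M (v - w) = cmat M v - cmat M w"
  and cmat_zero [simp]: "cmat M 0 = 0"
  by (auto simp: cmat_def vec_eq_iff sum.distrib sum_subtractf sum_distrib_left algebra_simps)

lemma scaleR_eq_smult: "r *\<^sub>R v = of_real r *s (v :: complex^'n)"
  by (simp only: vec_eq_iff vector_scaleR_component vector_smult_component) (simp add: scaleR_conv_of_real)

text \<open>A polynomial in \<open>M\<close> kept in factored form, because later only its roots
  matter.\<close>

primrec opprod :: "real^'n^'n \<Rightarrow> complex list \<Rightarrow> complex^'n \<Rightarrow> complex^'n" where
  "opprod M [] v = v"
| "opprod M (l # ls) v = opprod M ls (cmat M v - l *s v)"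

lemma opprod_add: "opprod M ls (v + w) = opprod M ls v + opprod M ls w"
  and opprod_scale: "opprod M ls (c *s v) = c *s opprod M ls v"
  and opprod_zero [simp]: "opprod M ls 0 = 0"
proof -
  show "opprod M ls (v + w) = opprod M ls v + opprod M ls w"
    by (induction ls arbitrary: v w) (auto simp: cmat_add vec.scale_right_distrib add_diff_add)
  show s: "opprod M ls (c *s v) = c *s opprod M ls v" for c v
    
  proof (induction ls arbitrary: v)
    case (Cons l ls)
    have "cmat M (c *s v) - l *s (c *s v) = c *s (cmat M v - l *s v)"
      by (simp add: cmat_scale vec.scale_right_diff_distrib mult.commute)
    then show ?case by (simp only: opprod.simps Cons)
  qed simp
  show "opprod M ls 0 = 0" using s[of 0 0] by simp
qed

lemma opprod_sum: "opprod M ls (sum f I) = (\<Sum>i\<in>I. opprod M ls (f i))"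
  by (induction I rule: infinite_finite_induct) (auto simp: opprod_add)

lemma opprod_factor: "opprod M ls (cmat M v - l *s v) = cmat M (opprod M ls v) - l *s opprod M ls v"
proof (induction ls arbitrary: v)
  case (Cons m ls)
  have "cmat M (cmat M v - l *s v) - m *s (cmat M v - l *s v) = cmat M (cmat M v - m *s v) - l *s (cmat M v - m *s v)"
    by (simp add: cmat_diff cmat_scale vec.scale_right_diff_distrib mult.commute algebra_simps)
  then show ?case by (simp only: opprod.simps Cons)
qed simp

lemma opprod_append: "opprod M (ls @ ms) v = opprod M ms (opprod M ls v)"
  by (induction ls arbitrary: v) auto

lemma opprod_commute: "opprod M ls (opprod M ms v) = opprod M ms (opprod M ls v)"
  by (induction ms arbitrary: v) (auto simp: opprod_factor)

text \<open>Complex subspaces stable under \<open>M\<close>. Differences replace sums because the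
  factors \<open>M - l\<close> are what has to stay inside.\<close>

definition cinv :: "real^'n^'n \<Rightarrow> (complex^'n) set \<Rightarrow> bool" where
  "cinv M S \<longleftrightarrow> 0 \<in> S \<and> (\<forall>v\<in>S. cmat M v \<in> S) \<and> (\<forall>v\<in>S. \<forall>w\<in>S. v - w \<in> S) \<and> (\<forall>c. \<forall>v\<in>S. c *s v \<in> S)"

lemma opprod_in: "cinv M S \<Longrightarrow> v \<in> S \<Longrightarrow> opprod M ls v \<in> S"
  by (induction ls arbitrary: v) (auto simp: cinv_def)

definition ceig :: "real^'n^'n \<Rightarrow> (complex^'n) set \<Rightarrow> complex \<Rightarrow> bool" where
  "ceig M S l \<longleftrightarrow> (\<exists>w\<in>S. w \<noteq> 0 \<and> cmat M w = l *s w)"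

text \<open>The fundamental theorem of algebra splits off one root at a time. A root
  \<open>a\<close> that is not an eigenvalue on \<open>S\<close> is dropped: what the other factors
  leave of \<open>v\<close> lies in \<open>S\<close> and in the kernel of \<open>M - a\<close>,
  hence is zero. Thus the list consists of eigenvalues only, which is what the spectral hypotheses
  speak about.\<close>

lemma annihilating_list_poly:
  assumes "cinv M S" "p \<noteq> 0" "degree p \<le> n" "v \<in> S" "(\<Sum>i\<le>n. coeff p i *s (cmat M ^^ i) v) = 0"
  shows "\<exists>ls. (\<forall>l\<in>set ls. ceig M S l) \<and> opprod M ls v = 0"
  using assms(2-)
proof (induction n arbitrary: p v)
  case 0
  then have "coeff p 0 \<noteq> 0" by (metis le_zero_eq leading_coeff_0_iff)
  then have "v = 0" using 0 by auto
  then show ?case by (intro exI[of _ "[]"]) simp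
next
  case (Suc n)
  show ?case
  proof (cases "degree p = 0")
    case True
    then have "coeff p i = 0" if "i > 0" for i using that by (simp add: coeff_eq_0)
    then have "(\<Sum>i\<le>Suc n. coeff p i *s (cmat M ^^ i) v) = coeff p 0 *s v"
      by (subst sum.remove[of _ 0]) (auto intro!: sum.neutral)
    moreover have "coeff p 0 \<noteq> 0" using True Suc.prems by (metis leading_coeff_0_iff)
    ultimately have "v = 0" using Suc.prems by auto
    then show ?thesis by (intro exI[of _ "[]"]) simp
  next
    case False
    then have "\<not> constant (poly p)" by (simp add: constant_degree)
    then obtain a where "poly p a = 0" using fundamental_theorem_of_algebra by blast
    then obtain q where q: "p = [:-a, 1:] * q" by (meson dvdE poly_eq_0_iff_dvd)
    have q0: "q \<noteq> 0" using q Suc.prems by auto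
    have dq: "degree q \<le> n"
    proof -
      have "degree p = degree [:-a, 1:] + degree q"
        unfolding q using q0 by (intro degree_mult_eq) auto
      then show ?thesis using Suc.prems by simp
    qed
    let ?w = "cmat M v - a *s v"
    have wS: "?w \<in> S" using assms(1) Suc.prems by (auto simp: cinv_def)
    \<comment> \<open>Synthetic division by \<open>X - a\<close>: a relation for \<open>v\<close>
      with the coefficients of \<open>p\<close> becomes a relation for \<open>(M - a) v\<close> with
      the coefficients of the quotient \<open>q\<close>.\<close>
    have cp: "coeff p (Suc i) = coeff q i - a * coeff q (Suc i)" "coeff p 0 = - a * coeff q 0" for i
      by (auto simp: q coeff_pCons)
    have pw: "(cmat M ^^ i) ?w = (cmat M ^^ Suc i) v - a *s (cmat M ^^ i) v" for i
      by (induction i) (auto simp: cmat_diff cmat_scale)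
    have "(\<Sum>i\<le>n. coeff q i *s (cmat M ^^ i) ?w)
        = (\<Sum>i\<le>n. coeff q i *s (cmat M ^^ Suc i) v) - (\<Sum>i\<le>n. (a * coeff q i) *s (cmat M ^^ i) v)"
      unfolding pw by (simp add: vec.scale_right_diff_distrib sum_subtractf mult.commute)
    also have "(\<Sum>i\<le>n. (a * coeff q i) *s (cmat M ^^ i) v) = (\<Sum>i\<le>Suc n. (a * coeff q i) *s (cmat M ^^ i) v)"
      using dq by (simp add: coeff_eq_0)
    also have "\<dots> = (a * coeff q 0) *s v + (\<Sum>i\<le>n. (a * coeff q (Suc i)) *s (cmat M ^^ Suc i) v)"
      by (simp only: sum.atMost_Suc_shift funpow.simps id_apply)
    also have "(\<Sum>i\<le>n. coeff q i *s (cmat M ^^ Suc i) v)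
         - ((a * coeff q 0) *s v + (\<Sum>i\<le>n. (a * coeff q (Suc i)) *s (cmat M ^^ Suc i) v))
        = coeff p 0 *s v + (\<Sum>i\<le>n. coeff p (Suc i) *s (cmat M ^^ Suc i) v)"
      by (simp only: cp vec.scale_left_diff_distrib sum_subtractf vec.scale_minus_left mult_minus_left) (simp add: algebra_simps)
    also have "\<dots> = (\<Sum>i\<le>Suc n. coeff p i *s (cmat M ^^ i) v)"
      by (simp only: sum.atMost_Suc_shift funpow.simps id_apply)
    finally have "(\<Sum>i\<le>n. coeff q i *s (cmat M ^^ i) ?w) = 0" using Suc.prems by simp
    from Suc.IH[OF q0 dq wS this] obtain ls where ls: "\<forall>l\<in>set ls. ceig M S l" "opprod M ls ?w = 0" by auto
    show ?thesis
    proof (cases "ceig M S a")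
      case True
      then show ?thesis using ls by (intro exI[of _ "a # ls"]) auto
    next
      case False
      have "cmat M (opprod M ls v) = a *s opprod M ls v"
        using ls(2) by (simp add: opprod_factor)
      moreover have "opprod M ls v \<in> S" using assms(1) Suc.prems by (intro opprod_in) auto
      ultimately have "opprod M ls v = 0" using False by (auto simp: ceig_def)
      then show ?thesis using ls by auto
    qed
  qed
qed

text \<open>The first \<open>DIM + 1\<close> iterates of \<open>v\<close> under \<open>M\<close>
  satisfy a nontrivial linear relation, which is read as a nonzero polynomial. Real coefficients are
  enough, so the real dimension is used.\<close>

lemma annihilating_list_vector:
  fixes v :: "complex^'n"
  assumes "cinv M S" "v \<in> S"
  shows "\<exists>ls. (\<forall>l\<in>set ls. ceig M S l) \<and> opprod M ls v = 0"
proof -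
  define g where "g = (\<lambda>k. (cmat M ^^ k) v)"
  let ?n = "DIM(complex^'n)"
  have "\<exists>c :: nat \<Rightarrow> real. (\<exists>i\<le>?n. c i \<noteq> 0) \<and> (\<Sum>i\<le>?n. c i *\<^sub>R g i) = 0"
  \<comment> \<open>Linear dependence is a notion for sets, so repeated iterates are treated apart;
    a repetition is itself a relation, with coefficients 1 and -1.\<close>
  proof (cases "inj_on g {..?n}")
    case True
    then have "card (g ` {..?n}) = Suc ?n" by (simp add: card_image)
    then have "dependent (g ` {..?n})" using independent_bound[of "g ` {..?n}"] by auto
    then obtain u where u: "(\<Sum>v\<in>g ` {..?n}. u v *\<^sub>R v) = 0" "\<exists>v\<in>g ` {..?n}. u v \<noteq> 0"
      by (auto simp: dependent_finite)
    have "(\<Sum>i\<le>?n. u (g i) *\<^sub>R g i) = 0"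
      using u(1) unfolding sum.reindex[OF True] o_def .
    then show ?thesis using u(2) by (intro exI[of _ "\<lambda>i. u (g i)"]) auto
  next
    case False
    then obtain i j where ij: "i \<le> ?n" "j \<le> ?n" "i \<noteq> j" "g i = g j" by (auto simp: inj_on_def)
    define c where "c = (\<lambda>k. if k = i then 1 else if k = j then -1 else 0 :: real)"
    have "(\<Sum>k\<le>?n. c k *\<^sub>R g k) = (\<Sum>k\<in>{i, j}. c k *\<^sub>R g k)"
      using ij by (intro sum.mono_neutral_right) (auto simp: c_def)
    also have "\<dots> = 0" using ij by (simp add: c_def)
    finally show ?thesis using ij by (intro exI[of _ c]) (auto simp: c_def)
  qed
  then obtain c :: "nat \<Rightarrow> real" and i where c: "i \<le> ?n" "c i \<noteq> 0" "(\<Sum>i\<le>?n. c i *\<^sub>R g i) = 0" by blast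
  define p :: "complex poly" where "p = (\<Sum>i\<le>?n. monom (of_real (c i)) i)"
  have cf: "coeff p k = (if k \<le> ?n then of_real (c k) else 0)" for k
    by (simp add: p_def coeff_sum coeff_monom if_distrib sum.delta cong: if_cong)
  show ?thesis
  proof (rule annihilating_list_poly[OF assms(1) _ _ assms(2), where p = p and n = ?n])
    show "p \<noteq> 0" using c(1,2) cf[of i] by auto
    show "degree p \<le> ?n" by (rule degree_le) (auto simp: cf)
    show "(\<Sum>i\<le>?n. coeff p i *s (cmat M ^^ i) v) = 0"
      using c(3) by (simp add: cf g_def scaleR_eq_smult)
  qed
qed

lemma annihilating_list_finite:
  assumes "cinv M S" "finite T" "T \<subseteq> S"
  shows "\<exists>ls. (\<forall>l\<in>set ls. ceig M S l) \<and> (\<forall>v\<in>T. opprod M ls v = 0)"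
  using assms(2,3)
proof (induction T rule: finite_induct)
  case empty
  then show ?case by (intro exI[of _ "[]"]) auto
next
  case (insert v T)
  then obtain ls where ls: "\<forall>l\<in>set ls. ceig M S l" "\<forall>v\<in>T. opprod M ls v = 0" by auto
  obtain ms where ms: "\<forall>l\<in>set ms. ceig M S l" "opprod M ms v = 0"
    using annihilating_list_vector[OF assms(1), of v] insert by auto
  have "opprod M ms v = 0 \<Longrightarrow> opprod M ms (opprod M ls v) = 0" for v
    by (subst opprod_commute) simp
  then show ?case using ls ms
    by (intro exI[of _ "ls @ ms"]) (auto simp: opprod_append)
qed

definition cblk :: "('n \<Rightarrow> nat) \<Rightarrow> nat \<Rightarrow> (complex^'n) set" where
  "cblk blk i = {v. \<forall>r. blk r \<noteq> i \<longrightarrow> v $ r = 0}"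

lemma cinv_blk: "cinv (blk_mat blk i A) (cblk blk i)"
  by (auto simp: cinv_def cblk_def cmat_def blk_mat_def intro!: sum.neutral)

lemma ceig_blk: "ceig (blk_mat blk i A) (cblk blk i) l \<Longrightarrow> blk_eigenvalue blk i A l"
proof -
  assume "ceig (blk_mat blk i A) (cblk blk i) l"
  then obtain w where w: "w \<in> cblk blk i" "w \<noteq> 0" "cmat (blk_mat blk i A) w = l *s w"
    by (auto simp: ceig_def)
  have "(\<Sum>c\<in>{c. blk c = i}. of_real (A $ r $ c) * w $ c) = l * w $ r" if "blk r = i" for r
  proof -
    have "(\<Sum>c\<in>{c. blk c = i}. of_real (A $ r $ c) * w $ c)
        = (\<Sum>c\<in>UNIV. of_real (blk_mat blk i A $ r $ c) * w $ c)"
      using that by (intro sum.mono_neutral_cong_left) (auto simp: blk_mat_def)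
    also have "\<dots> = (cmat (blk_mat blk i A) w) $ r" by (simp add: cmat_def)
    finally show ?thesis using w by simp
  qed
  then show ?thesis using w by (auto simp: blk_eigenvalue_def cblk_def)
qed

lemma blk_annihilating_list:
  fixes A :: "real^'n^'n"
  shows "\<exists>ls. (\<forall>l\<in>set ls. blk_eigenvalue blk i A l) \<and> (\<forall>v\<in>cblk blk i. opprod (blk_mat blk i A) ls v = 0)"
proof -
  let ?T = "(\<lambda>r. axis r (1::complex)) ` {r. blk r = i}"
  have "?T \<subseteq> cblk blk i" by (auto simp: cblk_def axis_def)
  from annihilating_list_finite[OF cinv_blk _ this, of A]
  obtain ls where ls: "\<forall>l\<in>set ls. ceig (blk_mat blk i A) (cblk blk i) l"
    "\<forall>v\<in>?T. opprod (blk_mat blk i A) ls v = 0" by auto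
  have "opprod (blk_mat blk i A) ls v = 0" if "v \<in> cblk blk i" for v
  proof -
    have "v = (\<Sum>r\<in>{r. blk r = i}. v $ r *s axis r 1)"
      using that by (auto simp: vec_eq_iff cblk_def axis_def if_distrib sum.delta cong: if_cong)
    then have "opprod (blk_mat blk i A) ls v = (\<Sum>r\<in>{r. blk r = i}. v $ r *s opprod (blk_mat blk i A) ls (axis r 1))"
      by (metis (no_types, lifting) opprod_scale opprod_sum sum.cong)
    also have "\<dots> = 0" using ls(2) by (auto intro!: sum.neutral)
    finally show ?thesis .
  qed
  then show ?thesis using ls(1) ceig_blk by blast
qed

text \<open>Needed because \<open>exp (- t A) b\<close> is a flow of \<open>- A\<close>, so the list
  has to be negated.\<close>

lemma opprod_uminus: "opprod (- M) (map uminus ls) v = (-1) ^ length ls *s opprod M ls v"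
proof (induction ls arbitrary: v)
  case (Cons l ls)
  have "cmat (- M) v - (- l) *s v = (-1) *s (cmat M v - l *s v)"
    by (simp add: vec_eq_iff cmat_def sum_negf)
  then show ?case by (simp only: opprod.simps list.map Cons opprod_scale) simp
qed simp

definition cdot :: "complex^'n \<Rightarrow> complex^'n \<Rightarrow> complex" where
  "cdot v w = (\<Sum>r\<in>UNIV. v $ r * w $ r)"

lemma cdot_opprod: "cdot (opprod M ls v) w = cdot v (opprod (transpose M) ls w)"
proof (induction ls arbitrary: v w)
  case (Cons l ls)
  have "cdot (cmat M v) w = cdot v (cmat (transpose M) w)" for v w
    unfolding cdot_def cmat_def transpose_def
    by (simp add: sum_distrib_left sum_distrib_right, subst sum.swap) (simp add: mult_ac)
  then have "cdot (cmat M v - l *s v) w = cdot v (cmat (transpose M) w - l *s w)" for v w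
    by (simp add: cdot_def algebra_simps sum_subtractf sum_distrib_left)
  then show ?case using Cons by (simp add: opprod_factor)
qed simp

text \<open>The eigenvalue hypotheses concern \<open>A\<close>, but the Hurwitz block is studied
  through flows of the transpose. Moving the whole product across the pairing \<open>cdot\<close>
  avoids any comparison of spectra; the pairing has no conjugation, so the same list serves.\<close>

lemma blk_annihilating_transpose:
  assumes "\<forall>v\<in>cblk blk i. opprod (blk_mat blk i A) ls v = 0" "w \<in> cblk blk i"
  shows "opprod (transpose (blk_mat blk i A)) ls w = 0"
proof -
  have tr: "transpose (blk_mat blk i A) = blk_mat blk i (transpose A)"
    by (auto simp: vec_eq_iff transpose_def blk_mat_def)
  have in_blk: "opprod (transpose (blk_mat blk i A)) ls w \<in> cblk blk i"
    unfolding tr by (rule opprod_in[OF cinv_blk assms(2)])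
  have "opprod (transpose (blk_mat blk i A)) ls w $ r = 0" for r
  proof (cases "blk r = i")
    case True
    have "cdot (axis r 1) (opprod (transpose (blk_mat blk i A)) ls w) = cdot (opprod (blk_mat blk i A) ls (axis r 1)) w"
      by (rule cdot_opprod[symmetric])
    also have "\<dots> = 0" using assms(1) True by (auto simp: cblk_def axis_def cdot_def)
    finally show ?thesis by (simp add: cdot_def axis_def if_distrib if_distribR sum.delta cong: if_cong)
  qed (use in_blk in \<open>auto simp: cblk_def\<close>)
  then show ?thesis by (simp add: vec_eq_iff)
qed

text \<open>Along a flow of \<open>M\<close>, time differentiation acts as \<open>M\<close>, so the
  vector \<open>(M - l) \<psi>\<close> supplies the witness that \<open>annihil\<close> asks for,
  and it is again a flow of \<open>M\<close>.\<close>

lemma opprod_flow_annihil: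
  assumes "\<And>t. t \<ge> 0 \<Longrightarrow> (\<psi> has_vector_derivative cmat M (\<psi> t)) (at t within {0..})"
    and "\<And>t. t \<ge> 0 \<Longrightarrow> opprod M ls (\<psi> t) = 0"
  shows "annihil ls (\<lambda>t. \<psi> t $ r)"
  using assms
proof (induction ls arbitrary: \<psi>)
  case (Cons l ls)
  have bl: "bounded_linear (\<lambda>v. cmat M v - l *s v)"
    by (rule linear_conv_bounded_linear[THEN iffD1], rule linearI)
       (simp_all add: cmat_add cmat_scale vec.scale_right_distrib scaleR_eq_smult vec.scale_right_diff_distrib mult.commute)
  let ?g = "\<lambda>t. cmat M (\<psi> t) - l *s \<psi> t"
  have "(?g has_vector_derivative cmat M (?g t)) (at t within {0..})" if "t \<ge> 0" for t
    using bounded_linear.has_vector_derivative[OF bl Cons.prems(1)[OF that]]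
    by (simp add: cmat_diff cmat_scale)
  then have "annihil ls (\<lambda>t. ?g t $ r)"
    using Cons.prems(2) by (intro Cons.IH) auto
  moreover have "((\<lambda>t. \<psi> t $ r) has_vector_derivative (l * (\<psi> t $ r) + ?g t $ r)) (at t within {0..})"
    if "t \<ge> 0" for t
    using bounded_linear.has_vector_derivative[OF bounded_linear_vec_nth Cons.prems(1)[OF that]] by simp
  ultimately show ?case by (intro annihil_ConsI)
qed simp

definition cvec :: "real^'n \<Rightarrow> complex^'n" where
  "cvec x = (\<chi> r. of_real (x $ r))"

lemma flow_annihil:
  assumes "\<And>t. t \<ge> 0 \<Longrightarrow> (\<phi> has_vector_derivative M *v \<phi> t) (at t within {0..})"
    and "\<And>t. t \<ge> 0 \<Longrightarrow> opprod M ls (cvec (\<phi> t)) = 0"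
  shows "annihil ls (\<lambda>t. of_real (y \<bullet> \<phi> t))"
proof -
  have bl: "bounded_linear (cvec :: real^'n \<Rightarrow> complex^'n)"
    by (rule linear_conv_bounded_linear[THEN iffD1], rule linearI)
       (simp_all add: vec_eq_iff cvec_def scaleR_eq_smult)
  have cm: "cmat M (cvec x) = cvec (M *v x)" for x
    by (simp add: vec_eq_iff cmat_def cvec_def matrix_vector_mult_def)
  have "annihil ls (\<lambda>t. cvec (\<phi> t) $ r)" for r
    using bounded_linear.has_vector_derivative[OF bl assms(1)] assms(2)
    by (intro opprod_flow_annihil) (auto simp: cm)
  then have "annihil ls (\<lambda>t. \<Sum>r\<in>UNIV. of_real (y $ r) * (cvec (\<phi> t) $ r))"
    by (intro annihil_sum) auto
  then show ?thesis by (simp add: inner_vec_def cvec_def)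
qed

section \<open>Solutions and linear gain\<close>

lemma exp_weight_bound:
  assumes "a > (0::real)"
  shows "t * exp (- a * t) \<le> 1 / a"
proof -
  have "a * t \<le> exp (a * t)" using exp_ge_add_one_self[of "a * t"] by linarith
  then have "a * t * exp (- a * t) \<le> exp (a * t) * exp (- a * t)" by (rule mult_right_mono) simp
  also have "\<dots> = 1" by (simp flip: exp_add)
  finally show ?thesis using assms by (simp add: field_simps)
qed

lemma has_integral_exp_weight:
  assumes "a > (0::real)" "t \<ge> 0"
  shows "((\<lambda>s. c * exp (a * s)) has_integral c * (exp (a * t) - 1) / a) {0..t}"
proof -
  have "((\<lambda>s. c * exp (a * s)) has_integral (c * exp (a * t) / a - c * exp (a * 0) / a)) {0..t}"
    using assms by (intro fundamental_theorem_of_calculus)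
      (auto intro!: derivative_eq_intros simp flip: has_real_derivative_iff_has_vector_derivative)
  then show ?thesis by (simp add: right_diff_distrib diff_divide_distrib)
qed

text \<open>Fixed point in the variable \<open>z t = exp (- 2 * L * t) *\<^sub>R x t\<close>. The
  weight makes the integral operator contract by 1/2 on the whole half-line, so local solutions need
  not be continued; the linear growth of \<open>E\<close> keeps the operator inside the bounded
  continuous functions.\<close>

lemma global_picard:
  fixes F :: "'a::euclidean_space \<Rightarrow> 'a"
  assumes L: "L > 0" "\<And>x y. norm (F x - F y) \<le> L * norm (x - y)"
    and E: "continuous_on {0..} E" "\<And>t. t \<ge> 0 \<Longrightarrow> norm (E t) \<le> M * (1 + t)"
  obtains x where "continuous_on {0..} x" "\<And>t. t \<ge> 0 \<Longrightarrow> x t = E t + integral {0..t} (\<lambda>s. F (x s))"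
proof -
  have contF: "continuous_on UNIV F"
    by (rule lipschitz_on_continuous_on[where L = L], rule lipschitz_onI) (use L in \<open>auto simp: dist_norm\<close>)
  \<comment> \<open>The space of bounded continuous functions lives on the whole line;
    \<open>max 0 t\<close> extends the operator to negative times by a constant.\<close>
  define T where "T = (\<lambda>(z :: real \<Rightarrow>\<^sub>C 'a) t. exp (- 2 * L * max 0 t) *\<^sub>R
      (E (max 0 t) + integral {0..max 0 t} (\<lambda>s. F (exp (2 * L * s) *\<^sub>R apply_bcontfun z s))))"
  have cont_in: "continuous_on S (\<lambda>s. F (exp (2 * L * s) *\<^sub>R apply_bcontfun z s))" for z :: "real \<Rightarrow>\<^sub>C 'a" and S
    by (rule continuous_on_compose2[OF contF]) (auto intro!: continuous_intros)
  have M0: "M \<ge> 0" using order_trans[OF norm_ge_zero E(2)[of 0]] by simp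
  have Tbd: "norm (T z t) \<le> M * (1 + 1 / (2 * L)) + (norm (F 0) / (2 * L) + norm z / 2)" for z t
  proof -
    define m where "m = max 0 t"
    have m: "m \<ge> 0" by (simp add: m_def)
    let ?w = "exp (- 2 * L * m)"
    have w: "?w \<le> 1" "m * ?w \<le> 1 / (2 * L)" "?w > 0"
      using exp_weight_bound[of "2 * L" m] L m by auto
    have "norm (integral {0..m} (\<lambda>s. F (exp (2 * L * s) *\<^sub>R apply_bcontfun z s)))
        \<le> integral {0..m} (\<lambda>s. norm (F 0) + L * norm z * exp (2 * L * s))"
    proof (rule integral_norm_bound_integral)
      fix s assume "s \<in> {0..m}"
      have "norm (F (exp (2 * L * s) *\<^sub>R apply_bcontfun z s)) \<le> norm (F 0) + L * norm (exp (2 * L * s) *\<^sub>R apply_bcontfun z s)"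
        using L(2)[of "exp (2 * L * s) *\<^sub>R apply_bcontfun z s" 0] norm_triangle_sub by (smt (verit) diff_zero)
      also have "\<dots> \<le> norm (F 0) + L * (exp (2 * L * s) * norm z)"
        using L norm_bounded[of z s] by (intro add_mono mult_left_mono) auto
      finally show "norm (F (exp (2 * L * s) *\<^sub>R apply_bcontfun z s)) \<le> norm (F 0) + L * norm z * exp (2 * L * s)"
        by (simp add: mult_ac)
    qed (auto intro!: integrable_continuous_interval cont_in continuous_intros)
    also have "\<dots> = norm (F 0) * m + L * norm z * (exp (2 * L * m) - 1) / (2 * L)"
    proof (rule integral_unique, rule has_integral_add)
      show "((\<lambda>s. norm (F 0)) has_integral norm (F 0) * m) {0..m}"
        using has_integral_const_real[of "norm (F 0)" 0 m] m by (simp add: mult.commute)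
    qed (use has_integral_exp_weight[of "2 * L" m "L * norm z"] L m in auto)
    also have "\<dots> \<le> norm (F 0) * m + norm z / 2 * exp (2 * L * m)"
      using L by (simp add: field_simps)
    finally have I: "norm (integral {0..m} (\<lambda>s. F (exp (2 * L * s) *\<^sub>R apply_bcontfun z s)))
      \<le> norm (F 0) * m + norm z / 2 * exp (2 * L * m)" .
    have "norm (T z t) = ?w * norm (E m + integral {0..m} (\<lambda>s. F (exp (2 * L * s) *\<^sub>R apply_bcontfun z s)))"
      by (simp add: T_def m_def)
    also have "\<dots> \<le> ?w * (M * (1 + m) + (norm (F 0) * m + norm z / 2 * exp (2 * L * m)))"
      using I E(2)[OF m] by (intro mult_left_mono norm_triangle_le add_mono) auto
    also have "\<dots> = M * (?w + m * ?w) + (norm (F 0) * (m * ?w) + norm z / 2 * (exp (2 * L * m) * ?w))"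
      by (simp add: algebra_simps)
    also have "exp (2 * L * m) * ?w = 1" by (simp flip: exp_add)
    also have "M * (?w + m * ?w) + (norm (F 0) * (m * ?w) + norm z / 2 * 1)
        \<le> M * (1 + 1 / (2 * L)) + (norm (F 0) * (1 / (2 * L)) + norm z / 2 * 1)"
      using w M0 by (intro add_mono mult_left_mono) auto
    finally show ?thesis by simp
  qed
  have Tcont: "continuous_on UNIV (T z)" for z
  proof -
    have "continuous_on UNIV (\<lambda>t. integral {0..max 0 t} (\<lambda>s. F (exp (2 * L * s) *\<^sub>R apply_bcontfun z s)))"
    proof (rule continuous_on_compose2[of "{0..}" "\<lambda>t. integral {0..t} (\<lambda>s. F (exp (2 * L * s) *\<^sub>R apply_bcontfun z s))"])
      show "continuous_on {0..} (\<lambda>t. integral {0..t} (\<lambda>s. F (exp (2 * L * s) *\<^sub>R apply_bcontfun z s)))"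
      proof (rule continuous_on_vector_derivative)
        fix t :: real assume t: "t \<in> {0..}"
        have "((\<lambda>u. integral {0..u} (\<lambda>s. F (exp (2 * L * s) *\<^sub>R apply_bcontfun z s))) has_vector_derivative
          F (exp (2 * L * t) *\<^sub>R apply_bcontfun z t)) (at t within {0..t+1})"
          using t by (intro integral_has_vector_derivative cont_in) auto
        moreover have "at t within {0..t+1} = at t within {0..}"
          by (rule at_within_nhd[of t "{t-1<..<t+1}"]) auto
        ultimately show "((\<lambda>u. integral {0..u} (\<lambda>s. F (exp (2 * L * s) *\<^sub>R apply_bcontfun z s))) has_vector_derivative
          F (exp (2 * L * t) *\<^sub>R apply_bcontfun z t)) (at t within {0..})" by simp
      qed
      show "continuous_on UNIV (\<lambda>t::real. max 0 t)" by (intro continuous_intros)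
      show "range (\<lambda>t::real. max 0 t) \<subseteq> {0..}" by (auto simp: max_def)
    qed
    moreover have "continuous_on UNIV (\<lambda>t. E (max 0 t))"
    proof (rule continuous_on_compose2[OF E(1)])
      show "continuous_on UNIV (\<lambda>t::real. max 0 t)" by (intro continuous_intros)
      show "range (\<lambda>t::real. max 0 t) \<subseteq> {0..}" by (auto simp: max_def)
    qed
    ultimately show ?thesis unfolding T_def by (intro continuous_intros)
  qed
  have TB: "T z \<in> bcontfun" for z by (rule bcontfun_normI[OF Tcont Tbd])
  have "\<forall>z1 z2. dist (Bcontfun (T z1)) (Bcontfun (T z2)) \<le> 1/2 * dist z1 z2"
  proof (intro allI dist_bound)
    fix z1 z2 :: "real \<Rightarrow>\<^sub>C 'a" and t :: real
    define m where "m = max 0 t"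
    have m: "m \<ge> 0" by (simp add: m_def)
    let ?G = "\<lambda>z s. F (exp (2 * L * s) *\<^sub>R apply_bcontfun z s)"
    have int: "?G z integrable_on {0..m}" for z by (intro integrable_continuous_interval cont_in)
    have "norm (integral {0..m} (\<lambda>s. ?G z1 s - ?G z2 s)) \<le> integral {0..m} (\<lambda>s. L * norm (z1 - z2) * exp (2 * L * s))"
    proof (rule integral_norm_bound_integral)
      fix s assume "s \<in> {0..m}"
      have "norm (?G z1 s - ?G z2 s) \<le> L * norm (exp (2 * L * s) *\<^sub>R (apply_bcontfun z1 s - apply_bcontfun z2 s))"
        using L(2) by (simp only: scaleR_right_diff_distrib)
      also have "\<dots> = L * (exp (2 * L * s) * norm (apply_bcontfun (z1 - z2) s))" by simp
      also have "\<dots> \<le> L * (exp (2 * L * s) * norm (z1 - z2))"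
        using L norm_bounded[of "z1 - z2" s] by (intro mult_left_mono) auto
      finally show "norm (?G z1 s - ?G z2 s) \<le> L * norm (z1 - z2) * exp (2 * L * s)" by (simp add: mult_ac)
    qed (auto intro!: integrable_continuous_interval cont_in continuous_intros)
    also have "\<dots> = L * norm (z1 - z2) * (exp (2 * L * m) - 1) / (2 * L)"
      using L m by (intro integral_unique has_integral_exp_weight) auto
    also have "\<dots> \<le> norm (z1 - z2) / 2 * exp (2 * L * m)" using L by (simp add: field_simps)
    finally have I: "norm (integral {0..m} (?G z1) - integral {0..m} (?G z2)) \<le> norm (z1 - z2) / 2 * exp (2 * L * m)"
      by (subst integral_diff[OF int int, symmetric])
    have "dist (T z1 t) (T z2 t) = norm (exp (- 2 * L * m) *\<^sub>R (integral {0..m} (?G z1) - integral {0..m} (?G z2)))"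
      by (simp add: T_def dist_norm m_def algebra_simps)
    also have "\<dots> \<le> exp (- 2 * L * m) * (norm (z1 - z2) / 2 * exp (2 * L * m))"
      using I by (auto intro!: mult_left_mono)
    also have "\<dots> = norm (z1 - z2) / 2 * (exp (- 2 * L * m) * exp (2 * L * m))" by simp
    also have "exp (- 2 * L * m) * exp (2 * L * m) = 1" by (simp flip: exp_add)
    finally show "dist (apply_bcontfun (Bcontfun (T z1)) t) (apply_bcontfun (Bcontfun (T z2)) t) \<le> 1/2 * dist z1 z2"
      using TB by (simp add: Bcontfun_inverse dist_norm)
  qed
  then obtain z where z: "Bcontfun (T z) = z"
    using banach_fix_type[of "1/2" "\<lambda>z. Bcontfun (T z)"] by auto
  then have Tz: "T z t = apply_bcontfun z t" for t using TB[of z] by (metis Bcontfun_inverse)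
  show ?thesis
  proof (rule that)
    show "continuous_on {0..} (\<lambda>t. exp (2 * L * t) *\<^sub>R apply_bcontfun z t)" by (intro continuous_intros) auto
    fix t :: real assume t: "t \<ge> 0"
    have "exp (2 * L * t) *\<^sub>R apply_bcontfun z t = exp (2 * L * t) *\<^sub>R T z t" by (simp add: Tz)
    also have "\<dots> = (exp (2 * L * t) * exp (- 2 * L * t)) *\<^sub>R
      (E t + integral {0..t} (\<lambda>s. F (exp (2 * L * s) *\<^sub>R apply_bcontfun z s)))" using t by (simp add: T_def)
    also have "exp (2 * L * t) * exp (- 2 * L * t) = 1" by (simp flip: exp_add)
    finally show "exp (2 * L * t) *\<^sub>R apply_bcontfun z t
       = E t + integral {0..t} (\<lambda>s. F (exp (2 * L * s) *\<^sub>R apply_bcontfun z s))" by simp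
  qed
qed

lemma linear_flow_exists:
  fixes M :: "'a::euclidean_space \<Rightarrow> 'a"
  assumes "linear M"
  obtains \<phi> where "\<phi> 0 = b" "\<And>t. t \<ge> 0 \<Longrightarrow> (\<phi> has_vector_derivative M (\<phi> t)) (at t within {0..})"
proof -
  obtain K where K: "K > 0" "\<And>x. norm (M x) \<le> K * norm x"
    using linear_bounded_pos[OF assms] by blast
  have lip: "norm (M x - M y) \<le> K * norm (x - y)" for x y
    using K(2)[of "x - y"] by (simp add: linear_diff[OF assms])
  have nb: "norm b \<le> norm b * (1 + t)" if "t \<ge> 0" for t :: real
    using mult_left_mono[of 1 "1 + t" "norm b"] that by simp
  have "\<exists>x. continuous_on {0..} x \<and> (\<forall>t\<ge>0::real. x t = b + integral {0..t} (\<lambda>s. M (x s)))"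
    by (rule global_picard[OF K(1) lip continuous_on_const[of "{0..}" b] nb]) blast+
  then obtain x :: "real \<Rightarrow> 'a" where x: "continuous_on {0..} x" "\<And>t. t \<ge> 0 \<Longrightarrow> x t = b + integral {0..t} (\<lambda>s. M (x s))"
    by blast
  have cM: "continuous_on S (\<lambda>s. M (x s))" if "S \<subseteq> {0..}" for S
    using linear_continuous_on_compose[OF continuous_on_subset[OF x(1) that] assms] .
  show ?thesis
  proof (rule that)
    show "x 0 = b" using x(2)[of 0] by simp
    fix t :: real assume t: "t \<ge> 0"
    have "((\<lambda>u. b + integral {0..u} (\<lambda>s. M (x s))) has_vector_derivative 0 + M (x t)) (at t within {0..t+1})"
      using t by (intro has_vector_derivative_add has_vector_derivative_const integral_has_vector_derivative cM) auto
    moreover have "at t within {0..t+1} = at t within {0..}"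
      by (rule at_within_nhd[of t "{t-1<..<t+1}"]) auto
    ultimately have "((\<lambda>u. b + integral {0..u} (\<lambda>s. M (x s))) has_vector_derivative M (x t)) (at t within {0..})"
      by simp
    then show "(x has_vector_derivative M (x t)) (at t within {0..})"
      by (rule has_vector_derivative_transform[rotated 2]) (use t x(2) in auto)
  qed
qed

lemma admissible_integrable:
  fixes e :: "real \<Rightarrow> 'a::euclidean_space"
  assumes "admissible X e"
  shows "e integrable_on {0..t}"
proof -
  obtain K where K: "\<And>t. t \<ge> 0 \<Longrightarrow> norm (e t) \<le> K"
    using assms unfolding admissible_def bounded_iff by auto
  let ?f = "\<lambda>x. indicator {0..} x *\<^sub>R e x"
  have "?f \<in> borel_measurable lborel" using assms by (simp add: admissible_def set_borel_measurable_def)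
  then have "?f \<in> borel_measurable (lebesgue_on {0..t})"
    by (simp add: measurable_completion measurable_restrict_space1)
  then have "?f integrable_on {0..t}"
    by (rule measurable_bounded_by_integrable_imp_integrable[where g = "\<lambda>_. K"]) (auto simp: K)
  then show ?thesis by (rule integrable_eq) auto
qed

text \<open>The disturbance is merely measurable, so it enters only through its integral, which is
  continuous and, by boundedness, grows at most linearly: an admissible forcing \<open>E\<close> for
  \<open>global_picard\<close>.\<close>

lemma csol_exists:
  fixes F :: "'a::euclidean_space \<Rightarrow> 'a"
  assumes L: "L > 0" "\<And>x y. norm (F x - F y) \<le> L * norm (x - y)"
    and e: "admissible X e" and x0: "x0 \<in> X"
  shows "\<exists>x. csol X F e x \<and> x 0 = x0"
proof -
  obtain K where K: "\<And>t. t \<ge> 0 \<Longrightarrow> norm (e t) \<le> K"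
    using e unfolding admissible_def bounded_iff by auto
  have K0: "K \<ge> 0" using K[of 0] norm_ge_zero[of "e 0"] by linarith
  note int = admissible_integrable[OF e]
  define E where "E = (\<lambda>t. x0 + integral {0..t} e)"
  have "continuous_on {0..} E"
    unfolding continuous_on_eq_continuous_within
  proof
    fix t :: real assume t: "t \<in> {0..}"
    have "continuous_on {0..t+1} E"
      unfolding E_def by (intro continuous_intros indefinite_integral_continuous_1 int)
    then have "continuous (at t within {0..t+1}) E"
      using t by (simp add: continuous_on_eq_continuous_within)
    moreover have "at t within {0..t+1} = at t within {0..}"
      by (rule at_within_nhd[of t "{t-1<..<t+1}"]) auto
    ultimately show "continuous (at t within {0..}) E" by simp
  qed
  moreover have "norm (E t) \<le> (norm x0 + K) * (1 + t)" if "t \<ge> 0" for t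
  proof -
    have "norm (integral {0..t} e) \<le> integral {0..t} (\<lambda>_. K)"
      by (rule integral_norm_bound_integral) (auto intro: int K)
    then have "norm (integral {0..t} e) \<le> K * t" using that by (simp add: mult.commute)
    then have "norm (E t) \<le> norm x0 + K * t" unfolding E_def by (intro norm_triangle_le) simp
    also have "\<dots> \<le> (norm x0 + K) * (1 + t)" using K0 that by (simp add: algebra_simps)
    finally show ?thesis .
  qed
  ultimately obtain x where x: "continuous_on {0..} x" "\<And>t. t \<ge> 0 \<Longrightarrow> x t = E t + integral {0..t} (\<lambda>s. F (x s))"
    by (rule global_picard[OF L]) auto
  have contF: "continuous_on UNIV F"
    by (rule lipschitz_on_continuous_on[where L = L], rule lipschitz_onI) (use L in \<open>auto simp: dist_norm\<close>)
  have x00: "x 0 = x0" using x(2)[of 0] by (simp add: E_def)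
  have "((\<lambda>s. F (x s) + e s) has_integral (x t - x 0)) {0..t}" if "t \<ge> 0" for t
  proof -
    have "continuous_on {0..t} (\<lambda>s. F (x s))"
      by (rule continuous_on_compose2[OF contF]) (auto intro: continuous_on_subset[OF x(1)])
    then have "((\<lambda>s. F (x s)) has_integral integral {0..t} (\<lambda>s. F (x s))) {0..t}"
      by (intro integrable_integral integrable_continuous_interval)
    moreover have "(e has_integral integral {0..t} e) {0..t}" by (intro integrable_integral int)
    ultimately have "((\<lambda>s. F (x s) + e s) has_integral (integral {0..t} (\<lambda>s. F (x s)) + integral {0..t} e)) {0..t}"
      by (rule has_integral_add)
    then show ?thesis using x(2)[OF that] x00 by (simp add: E_def add.commute)
  qed
  then show ?thesis using x0 x00 by (auto simp: csol_def)
qed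

lemma traj_imp_csol:
  assumes "traj X F x"
  shows "csol X F (\<lambda>_. 0) x"
  unfolding csol_def
proof (intro conjI allI impI)
  have d: "(x has_vector_derivative F (x s)) (at s within {0..})" if "s \<ge> 0" for s
    using assms that unfolding traj_def by blast
  fix t :: real assume "t \<ge> 0"
  have "((\<lambda>s. F (x s)) has_integral (x t - x 0)) {0..t}"
  proof (rule fundamental_theorem_of_calculus[OF \<open>t \<ge> 0\<close>])
    fix s assume "s \<in> {0..t}"
    then show "(x has_vector_derivative F (x s)) (at s within {0..t})"
      by (intro has_vector_derivative_within_subset[OF d]) auto
  qed
  then show "((\<lambda>s. F (x s) + 0) has_integral (x t - x 0)) {0..t}" by simp
qed (use assms in \<open>simp add: traj_def\<close>)

lemma csol_has_integral:
  assumes "csol X F e x" "0 \<le> s" "s \<le> t"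
  shows "((\<lambda>u. F (x u) + e u) has_integral (x t - x s)) {s..t}"
proof -
  let ?g = "\<lambda>u. F (x u) + e u"
  have i: "(?g has_integral (x t - x 0)) {0..t}" "(?g has_integral (x s - x 0)) {0..s}"
    using assms by (auto simp: csol_def)
  have "?g integrable_on {s..t}"
    by (rule integrable_on_subinterval[OF has_integral_integrable[OF i(1)]]) (use assms in auto)
  then have "(?g has_integral (x s - x 0 + integral {s..t} ?g)) {0..t}"
    by (intro has_integral_combine[OF assms(2,3) i(2)] integrable_integral)
  then have "x t - x 0 = x s - x 0 + integral {s..t} ?g" by (rule has_integral_unique[OF i(1)])
  then show ?thesis using \<open>?g integrable_on {s..t}\<close> integrable_integral by fastforce
qed

lemma csol_continuous:
  assumes "csol X F e x"
  shows "continuous_on {0..} x"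
  unfolding continuous_on_eq_continuous_within
proof
  fix t :: real assume t: "t \<in> {0..}"
  have i: "((\<lambda>u. F (x u) + e u) has_integral (x s - x 0)) {0..s}" if "s \<ge> 0" for s
    using assms that by (auto simp: csol_def)
  have "continuous_on {0..t+1} (\<lambda>s. x 0 + integral {0..s} (\<lambda>u. F (x u) + e u))"
    using t by (intro continuous_intros indefinite_integral_continuous_1 has_integral_integrable[OF i]) auto
  moreover have "x 0 + integral {0..s} (\<lambda>u. F (x u) + e u) = x s" if "s \<in> {0..t+1}" for s
    using integral_unique[OF i[of s]] that by auto
  ultimately have "continuous_on {0..t+1} x"
    using continuous_on_eq by blast
  then have "continuous (at t within {0..t+1}) x"
    using t by (simp add: continuous_on_eq_continuous_within)
  moreover have "at t within {0..t+1} = at t within {0..}"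
    by (rule at_within_nhd[of t "{t-1<..<t+1}"]) auto
  ultimately show "continuous (at t within {0..}) x" by simp
qed

text \<open>Any mismatch between the image of the dynamics and \<open>G\<close> is declared to be a
  disturbance. This is how a block of the cascade becomes a perturbed copy of its isolated
  loop.\<close>

lemma csol_linear_image:
  assumes "csol X F e x" "bounded_linear h" "h (x 0) \<in> Y"
  shows "csol Y G (\<lambda>t. h (F (x t) + e t) - G (h (x t))) (\<lambda>t. h (x t))"
  unfolding csol_def
proof (intro conjI allI impI)
  fix t :: real assume "t \<ge> 0"
  then have "((\<lambda>u. F (x u) + e u) has_integral (x t - x 0)) {0..t}" using assms(1) by (auto simp: csol_def)
  from has_integral_linear[OF this assms(2)]
  show "((\<lambda>s. G (h (x s)) + (h (F (x s) + e s) - G (h (x s)))) has_integral h (x t) - h (x 0)) {0..t}"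
    by (simp add: o_def linear_diff[OF bounded_linear.linear[OF assms(2)]])
qed (rule assms(3))

lemma csol_in_subspace:
  fixes pr :: "'a::euclidean_space \<Rightarrow> 'a"
  assumes "csol X F e x" "bounded_linear pr" "\<And>y. pr y = y \<longleftrightarrow> y \<in> X" "\<And>y. F y \<in> X" "\<And>t. t \<ge> 0 \<Longrightarrow> e t \<in> X" "t \<ge> 0"
  shows "x t \<in> X"
proof -
  have i: "((\<lambda>u. F (x u) + e u) has_integral (x t - x 0)) {0..t}" using assms by (auto simp: csol_def)
  note l = bounded_linear.linear[OF assms(2)]
  have "((\<lambda>u. F (x u) + e u) has_integral pr (x t - x 0)) {0..t}"
  proof (rule has_integral_eq[OF _ has_integral_linear[OF i assms(2)]])
    fix u assume "u \<in> {0..t}"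
    then have "pr (F (x u)) = F (x u)" "pr (e u) = e u" using assms(3-5) by auto
    then show "(pr \<circ> (\<lambda>u. F (x u) + e u)) u = F (x u) + e u" by (simp add: linear_add[OF l])
  qed
  then have "pr (x t - x 0) = x t - x 0" using i by (rule has_integral_unique)
  moreover have "pr (x 0) = x 0" using assms(1,3) by (auto simp: csol_def)
  ultimately have "pr (x t) = x t" by (simp add: linear_diff[OF l])
  then show ?thesis using assms(3) by simp
qed

text \<open>A comparison argument without differentiability. By compactness there is a last time
  \<open>s\<close> at which \<open>f\<close> is below the barrier; from there either the hypothesis
  on short steps (above \<open>\<theta>\<close>) or continuity (below \<open>\<theta>\<close>)
  carries the inequality a little further, so \<open>s\<close> is the end of the interval.\<close>

lemma dini_decay:
  fixes f :: "real \<Rightarrow> real"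
  assumes cont: "continuous_on {T..} f" and g: "\<gamma> \<ge> 0"
    and dini: "\<And>t. t \<ge> T \<Longrightarrow> f t \<ge> \<theta> \<Longrightarrow> \<exists>\<eta>>0. \<forall>h. 0 < h \<and> h < \<eta> \<longrightarrow> f (t + h) \<le> f t - \<gamma> * h"
    and t: "t \<ge> T"
  shows "f t \<le> max \<theta> (f T - \<gamma> * (t - T))"
proof -
  define m where "m = (\<lambda>t. max \<theta> (f T - \<gamma> * (t - T)))"
  define S where "S = {s \<in> {T..t}. f s \<le> m s}"
  have "continuous_on {T..t} f" by (rule continuous_on_subset[OF cont]) auto
  then have "closed S" unfolding S_def m_def
    by (intro continuous_on_closed_Collect_le continuous_intros) auto
  moreover have "bounded S" by (rule bounded_subset[of "{T..t}"]) (auto simp: S_def)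
  ultimately have "compact S" by (simp add: compact_eq_bounded_closed)
  moreover have "T \<in> S" using t by (auto simp: S_def m_def)
  ultimately obtain s where s: "s \<in> S" "\<And>u. u \<in> S \<Longrightarrow> u \<le> s"
    using compact_attains_sup[of S] by auto
  have "s = t"
  proof (rule ccontr)
    assume "s \<noteq> t"
    then have st: "T \<le> s" "s < t" "f s \<le> m s" using s by (auto simp: S_def)
    have "\<exists>\<eta>>0. \<forall>h. 0 < h \<and> h < \<eta> \<longrightarrow> f (s + h) \<le> m (s + h)"
    proof (cases "f s \<ge> \<theta>")
      case True
      from dini[OF st(1) this] obtain \<eta> where \<eta>: "\<eta> > 0" "\<And>h. 0 < h \<Longrightarrow> h < \<eta> \<Longrightarrow> f (s + h) \<le> f s - \<gamma> * h" by auto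
      have "f (s + h) \<le> m (s + h)" if "0 < h" "h < \<eta>" for h
      proof -
        have "f (s + h) \<le> m s - \<gamma> * h" using \<eta>(2)[OF that] st(3) by simp
        also have "\<dots> \<le> m (s + h)" using mult_nonneg_nonneg[OF g, of h] that by (simp add: m_def max_def algebra_simps)
        finally show ?thesis .
      qed
      then show ?thesis using \<eta>(1) by blast
    next
      case False
      have "continuous (at s within {T..}) f" using cont st by (simp add: continuous_on_eq_continuous_within)
      then obtain d where d: "d > 0" "\<And>u. u \<in> {T..} \<Longrightarrow> dist u s < d \<Longrightarrow> dist (f u) (f s) < \<theta> - f s"
        using False unfolding continuous_within_eps_delta by (metis diff_gt_0_iff_gt not_le)
      have "f (s + h) \<le> m (s + h)" if "0 < h" "h < d" for h
        using d(2)[of "s + h"] that st by (auto simp: dist_real_def m_def)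
      then show ?thesis using d(1) by blast
    qed
    then obtain \<eta> where \<eta>: "\<eta> > 0" "\<And>h. 0 < h \<Longrightarrow> h < \<eta> \<Longrightarrow> f (s + h) \<le> m (s + h)" by auto
    define h where "h = min (\<eta> / 2) (t - s)"
    have "0 < h" "h < \<eta>" "s + h \<le> t" using \<eta>(1) st by (auto simp: h_def)
    then have "s + h \<in> S" using \<eta>(2) st by (auto simp: S_def)
    then show False using s(2) \<open>0 < h\<close> by fastforce
  qed
  then show ?thesis using s(1) by (auto simp: S_def m_def)
qed

text \<open>With a measurable disturbance, \<open>V\<close> along the solution need not be
  differentiable at a given time, so decrease is stated for all short steps to the right. Of the
  slack \<open>\<sigma>\<close>, one half pays for the linearization of \<open>V\<close>, the other
  for the variation of \<open>F\<close> along the solution.\<close>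

lemma dini_csol:
  fixes F :: "'a::euclidean_space \<Rightarrow> 'a" and V :: "'a \<Rightarrow> real"
  assumes sol: "csol X F e x" and t: "t \<ge> 0" and F: "continuous_on UNIV F"
    and V: "(V has_derivative V') (at (x t))"
    and e: "\<And>s. s \<ge> t \<Longrightarrow> V' (e s) \<le> \<alpha>" "\<And>s. s \<ge> t \<Longrightarrow> norm (e s) \<le> \<delta>"
    and c: "V' (F (x t)) + \<alpha> < - \<gamma>"
  shows "\<exists>\<eta>>0. \<forall>h. 0 < h \<and> h < \<eta> \<longrightarrow> V (x (t + h)) \<le> V (x t) - \<gamma> * h"
proof -
  define \<sigma> where "\<sigma> = - \<gamma> - (V' (F (x t)) + \<alpha>)"
  have \<sigma>: "\<sigma> > 0" using c by (simp add: \<sigma>_def)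
  have blV: "bounded_linear V'" using V by (rule has_derivative_bounded_linear)
  then obtain K where K: "K > 0" "\<And>v. norm (V' v) \<le> norm v * K" using bounded_linear.pos_bounded by blast
  have \<delta>0: "\<delta> \<ge> 0" using e(2)[of t] norm_ge_zero[of "e t"] by linarith
  \<comment> \<open>A bound for the speed on the short interval, where \<open>F (x u)\<close> stays
    within distance 1 of \<open>F (x t)\<close>.\<close>
  define M where "M = norm (F (x t)) + 1 + \<delta>"
  have M: "M > 0" using \<delta>0 by (simp add: M_def add_pos_nonneg add_nonneg_pos)
  have "continuous_on {0..} (\<lambda>s. F (x s))"
    by (rule continuous_on_compose2[OF F csol_continuous[OF sol]]) auto
  then have "continuous (at t within {0..}) (\<lambda>s. F (x s))"
    using t by (simp add: continuous_on_eq_continuous_within)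
  moreover have "min 1 (\<sigma> / (2 * K)) > 0" using \<sigma> K by auto
  ultimately obtain d1 where d1: "d1 > 0" "\<And>s. s \<in> {0..} \<Longrightarrow> dist s t < d1 \<Longrightarrow> dist (F (x s)) (F (x t)) < min 1 (\<sigma> / (2 * K))"
    unfolding continuous_within_eps_delta by blast
  obtain d2 where d2: "d2 > 0" "\<And>y. norm (y - x t) < d2 \<Longrightarrow> norm (V y - V (x t) - V' (y - x t)) \<le> \<sigma> / (2 * M) * norm (y - x t)"
  proof -
    have "\<sigma> / (2 * M) > 0" using \<sigma> M by simp
    then show ?thesis using V that unfolding has_derivative_at_alt by blast
  qed
  define \<eta> where "\<eta> = min d1 (d2 / M)"
  have "V (x (t + h)) \<le> V (x t) - \<gamma> * h" if h: "0 < h" "h < \<eta>" for h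
  proof -
    have i: "((\<lambda>u. F (x u) + e u) has_integral (x (t + h) - x t)) {t..t + h}"
      using csol_has_integral[OF sol t, of "t + h"] h by simp
    have close: "norm (F (x u) - F (x t)) < min 1 (\<sigma> / (2 * K))" if "u \<in> {t..t + h}" for u
      using d1(2)[of u] that t h by (auto simp: dist_norm \<eta>_def)
    have "norm (x (t + h) - x t) \<le> M * measure lborel (cbox t (t + h))"
    proof (rule has_integral_bound[OF _ i[folded cbox_interval]])
      fix u assume u: "u \<in> cbox t (t + h)"
      have "norm (F (x u)) \<le> norm (F (x t)) + norm (F (x u) - F (x t))" by (rule norm_triangle_sub)
      then have "norm (F (x u)) \<le> norm (F (x t)) + 1" using close[of u] u by auto
      then show "norm (F (x u) + e u) \<le> M"
        using e(2)[of u] u unfolding M_def by (intro norm_triangle_le) auto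
    qed (use M in simp)
    then have xh: "norm (x (t + h) - x t) \<le> M * h" using h by simp
    moreover have "M * h < d2" using h M by (simp add: \<eta>_def pos_less_divide_eq mult.commute)
    ultimately have "norm (V (x (t + h)) - V (x t) - V' (x (t + h) - x t)) \<le> \<sigma> / (2 * M) * norm (x (t + h) - x t)"
      by (intro d2(2)) simp
    also have "\<dots> \<le> \<sigma> / (2 * M) * (M * h)"
      using xh \<sigma> M by (intro mult_left_mono) auto
    also have "\<dots> = \<sigma> / 2 * h" using M by simp
    finally have 1: "V (x (t + h)) \<le> V (x t) + V' (x (t + h) - x t) + \<sigma> / 2 * h"
      unfolding real_norm_def by linarith
    have "V' (x (t + h) - x t) \<le> (V' (F (x t)) + \<alpha> + \<sigma> / 2) * h"
    proof (rule has_integral_le[OF has_integral_linear[OF i blV]])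
      show "((\<lambda>_. V' (F (x t)) + \<alpha> + \<sigma> / 2) has_integral (V' (F (x t)) + \<alpha> + \<sigma> / 2) * h) {t..t + h}"
        using has_integral_const_real[of "V' (F (x t)) + \<alpha> + \<sigma> / 2" t "t + h"] h by (simp add: mult.commute)
      fix u assume u: "u \<in> {t..t + h}"
      have "V' (F (x u) + e u) = V' (F (x t)) + V' (F (x u) - F (x t)) + V' (e u)"
        by (simp add: linear_add[OF bounded_linear.linear[OF blV]] linear_diff[OF bounded_linear.linear[OF blV]])
      moreover have "V' (F (x u) - F (x t)) \<le> \<sigma> / 2"
      proof -
        have "V' (F (x u) - F (x t)) \<le> norm (F (x u) - F (x t)) * K"
          using K(2)[of "F (x u) - F (x t)"] by auto
        also have "\<dots> \<le> \<sigma> / (2 * K) * K" using close[OF u] K by (intro mult_right_mono) auto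
        finally show ?thesis using K by simp
      qed
      moreover have "V' (e u) \<le> \<alpha>" using e(1) u by auto
      ultimately show "(V' \<circ> (\<lambda>u. F (x u) + e u)) u \<le> V' (F (x t)) + \<alpha> + \<sigma> / 2" by simp
    qed
    then have "V (x (t + h)) \<le> V (x t) + (V' (F (x t)) + \<alpha> + \<sigma> / 2) * h + \<sigma> / 2 * h" using 1 by linarith
    also have "\<dots> = V (x t) - \<gamma> * h" by (simp add: \<sigma>_def algebra_simps)
    finally show ?thesis .
  qed
  moreover have "\<eta> > 0" using d1 d2 M by (simp add: \<eta>_def)
  ultimately show ?thesis by blast
qed

text \<open>The second conclusion makes Lyapunov stability, like the asymptotic gain, pass through cascades.\<close>

definition lin_gain_param :: "'a::euclidean_space set \<Rightarrow> ('a \<Rightarrow> 'a) \<Rightarrow> real \<Rightarrow> real \<Rightarrow> bool" where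
  "lin_gain_param X F \<Delta> N \<longleftrightarrow> (\<forall>\<delta> e x. 0 < \<delta> \<and> \<delta> \<le> \<Delta> \<and> csol X F e x \<and> (\<forall>t\<ge>0. e t \<in> X) \<longrightarrow>
     (ev_bdd e \<delta> \<longrightarrow> ev_bdd x (N * \<delta>)) \<and>
     ((\<forall>t\<ge>0. norm (e t) \<le> \<delta>) \<and> norm (x 0) \<le> \<delta> \<longrightarrow> (\<forall>t\<ge>0. norm (x t) \<le> N * \<delta>)))"

definition lin_gain :: "'a::euclidean_space set \<Rightarrow> ('a \<Rightarrow> 'a) \<Rightarrow> bool" where
  "lin_gain X F \<longleftrightarrow> (\<exists>\<Delta>>0. \<exists>N>0. lin_gain_param X F \<Delta> N)"

lemma lin_gain_param_ev:
  assumes "lin_gain_param X F \<Delta> N" "0 < \<delta>" "\<delta> \<le> \<Delta>" "csol X F e x" "\<And>t. t \<ge> 0 \<Longrightarrow> e t \<in> X" "ev_bdd e \<delta>"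
  shows "ev_bdd x (N * \<delta>)"
proof -
  have "ev_bdd e \<delta> \<longrightarrow> ev_bdd x (N * \<delta>)"
    by (rule assms(1)[unfolded lin_gain_param_def, rule_format, THEN conjunct1]) (use assms in auto)
  then show ?thesis using assms(6) by (rule mp)
qed

lemma lin_gain_param_un:
  assumes "lin_gain_param X F \<Delta> N" "0 < \<delta>" "\<delta> \<le> \<Delta>" "csol X F e x" "\<And>t. t \<ge> 0 \<Longrightarrow> e t \<in> X"
    "\<And>t. t \<ge> 0 \<Longrightarrow> norm (e t) \<le> \<delta>" "norm (x 0) \<le> \<delta>" "t \<ge> 0"
  shows "norm (x t) \<le> N * \<delta>"
proof -
  have "(\<forall>t\<ge>0. norm (e t) \<le> \<delta>) \<and> norm (x 0) \<le> \<delta> \<longrightarrow> (\<forall>t\<ge>0. norm (x t) \<le> N * \<delta>)"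
    by (rule assms(1)[unfolded lin_gain_param_def, rule_format, THEN conjunct2]) (use assms in auto)
  moreover have "(\<forall>t\<ge>0. norm (e t) \<le> \<delta>) \<and> norm (x 0) \<le> \<delta>" using assms(6,7) by blast
  ultimately have "\<forall>t\<ge>0. norm (x t) \<le> N * \<delta>" by (rule mp)
  then show ?thesis using assms(8) by blast
qed

text \<open>For each \<open>\<delta>\<close> a single level \<open>\<theta>\<close> of
  \<open>V\<close> serves three purposes: above it \<open>V\<close> decreases at a fixed rate, below
  it states have size \<open>N * \<delta>\<close>, and it contains the ball of radius
  \<open>\<delta>\<close>. The first two give the asymptotic gain; with the third they give the
  uniform bound. The gradient bound \<open>\<alpha>\<close> may depend on the state, since in the
  scheduled loop the decrease is compared with the gradient and not with
  \<open>norm x\<close>.\<close>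

lemma lyapunov_lin_gain:
  fixes F :: "'a::euclidean_space \<Rightarrow> 'a" and V :: "'a \<Rightarrow> real"
  assumes pr: "bounded_linear pr" "\<And>y. pr y = y \<longleftrightarrow> y \<in> X" and F: "continuous_on UNIV F" "\<And>y. F y \<in> X"
    and V: "\<And>x. (V has_derivative V' x) (at x)"
    and \<alpha>: "\<And>x h. V' x h \<le> \<alpha> x * norm h" "\<And>x. \<alpha> x \<ge> 0"
    and N: "N > 0" "\<Delta> > 0"
    and main: "\<And>\<delta>. 0 < \<delta> \<Longrightarrow> \<delta> \<le> \<Delta> \<Longrightarrow> \<exists>\<theta> \<gamma>. \<gamma> > 0 \<and>
      (\<forall>x\<in>X. V x \<ge> \<theta> \<longrightarrow> V' x (F x) + \<alpha> x * \<delta> < - \<gamma>) \<and>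
      (\<forall>x\<in>X. V x \<le> \<theta> \<longrightarrow> norm x \<le> N * \<delta>) \<and> (\<forall>x\<in>X. norm x \<le> \<delta> \<longrightarrow> V x \<le> \<theta>)"
  shows "lin_gain X F"
proof -
  have "lin_gain_param X F \<Delta> N"
    unfolding lin_gain_param_def
  proof (intro allI impI, elim conjE)
    fix \<delta> e x assume \<delta>: "0 < \<delta>" "\<delta> \<le> \<Delta>" and sol: "csol X F e x" and eX: "\<forall>t\<ge>0. e t \<in> X"
    obtain \<theta> \<gamma> where \<gamma>: "\<gamma> > 0"
      and dec: "\<And>x. x \<in> X \<Longrightarrow> V x \<ge> \<theta> \<Longrightarrow> V' x (F x) + \<alpha> x * \<delta> < - \<gamma>"
      and out: "\<And>x. x \<in> X \<Longrightarrow> V x \<le> \<theta> \<Longrightarrow> norm x \<le> N * \<delta>"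
      and start: "\<And>x. x \<in> X \<Longrightarrow> norm x \<le> \<delta> \<Longrightarrow> V x \<le> \<theta>"
      using main[OF \<delta>] by blast
    have xX: "x t \<in> X" if "t \<ge> 0" for t
      by (rule csol_in_subspace[OF sol pr F(2)]) (use eX that in auto)
    have V_cont: "continuous_on UNIV V"
      using V by (meson continuous_at_imp_continuous_on has_derivative_continuous)
    have key: "V (x t) \<le> max \<theta> (V (x T) - \<gamma> * (t - T))"
      if T: "T \<ge> 0" "\<And>s. s \<ge> T \<Longrightarrow> norm (e s) \<le> \<delta>" and t: "t \<ge> T" for T t
    proof (rule dini_decay[where f = "\<lambda>t. V (x t)"])
      show "continuous_on {T..} (\<lambda>t. V (x t))"
        by (rule continuous_on_compose2[OF V_cont]) (use T in \<open>auto intro: continuous_on_subset[OF csol_continuous[OF sol]]\<close>)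
      fix u assume u: "u \<ge> T" "V (x u) \<ge> \<theta>"
      show "\<exists>\<eta>>0. \<forall>h. 0 < h \<and> h < \<eta> \<longrightarrow> V (x (u + h)) \<le> V (x u) - \<gamma> * h"
      proof (rule dini_csol[OF sol _ F(1) V])
        show "V' (x u) (F (x u)) + \<alpha> (x u) * \<delta> < - \<gamma>"
          using dec xX u T by auto
        fix s assume s: "s \<ge> u"
        show "norm (e s) \<le> \<delta>" using T u s by auto
        have "V' (x u) (e s) \<le> \<alpha> (x u) * norm (e s)" by (rule \<alpha>)
        also have "\<dots> \<le> \<alpha> (x u) * \<delta>" using \<alpha>(2) T(2)[of s] u s by (intro mult_left_mono) auto
        finally show "V' (x u) (e s) \<le> \<alpha> (x u) * \<delta>" .
      qed (use T u in auto)
    qed (use \<gamma> t in auto)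
    have "ev_bdd x (N * \<delta>)" if "ev_bdd e \<delta>"
    proof -
      obtain T where T: "T > 0" "\<And>t. t \<ge> T \<Longrightarrow> norm (e t) \<le> \<delta>" using \<open>ev_bdd e \<delta>\<close> unfolding ev_bdd_def by auto
      \<comment> \<open>By this time the decrease at rate \<open>\<gamma>\<close> has used up the
        excess of \<open>V\<close> over \<open>\<theta>\<close>.\<close>
      define T' where "T' = T + \<bar>V (x T) - \<theta>\<bar> / \<gamma>"
      have "T' \<ge> T" using \<gamma> by (simp add: T'_def)
      have "norm (x t) \<le> N * \<delta>" if "t \<ge> T'" for t
      proof -
        have "t \<ge> T" using that \<open>T' \<ge> T\<close> by simp
        then have "V (x t) \<le> max \<theta> (V (x T) - \<gamma> * (t - T))" using key[of T t] T by auto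
        moreover have "\<gamma> * (\<bar>V (x T) - \<theta>\<bar> / \<gamma>) \<le> \<gamma> * (t - T)"
          using that \<gamma> by (intro mult_left_mono) (auto simp: T'_def)
        then have "V (x T) - \<gamma> * (t - T) \<le> \<theta>" using \<gamma> by auto
        ultimately have "V (x t) \<le> \<theta>" by simp
        then show ?thesis using out xX \<open>t \<ge> T\<close> T(1) by auto
      qed
      then show ?thesis using \<open>T' \<ge> T\<close> T(1) unfolding ev_bdd_def by (intro exI[of _ T']) auto
    qed
    moreover have "norm (x t) \<le> N * \<delta>" if "\<forall>t\<ge>0. norm (e t) \<le> \<delta>" "norm (x 0) \<le> \<delta>" "t \<ge> 0" for t
    proof -
      have "V (x t) \<le> max \<theta> (V (x 0) - \<gamma> * (t - 0))" using key[of 0 t] that by auto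
      moreover have "V (x 0) \<le> \<theta>" using start xX that by auto
      moreover have "\<gamma> * t \<ge> 0" using \<gamma> that by simp
      ultimately have "V (x t) \<le> \<theta>" by auto
      then show ?thesis using out xX that by auto
    qed
    ultimately show "(ev_bdd e \<delta> \<longrightarrow> ev_bdd x (N * \<delta>)) \<and>
     ((\<forall>t\<ge>0. norm (e t) \<le> \<delta>) \<and> norm (x 0) \<le> \<delta> \<longrightarrow> (\<forall>t\<ge>0. norm (x t) \<le> N * \<delta>))" by blast
  qed
  then show ?thesis using N unfolding lin_gain_def by blast
qed

text \<open>The zero disturbance is below every \<open>\<delta>\<close>, so both conclusions of the
  gain property may be used with \<open>\<delta>\<close> as small as desired: the uniform one gives
  stability, the eventual one attraction.\<close>

lemma lin_gain_GAS:
  assumes "lin_gain X F" "0 \<in> X"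
  shows "GAS X F"
proof -
  from assms(1) obtain \<Delta> N where \<Delta>N: "\<Delta> > 0" "N > 0" and lg: "lin_gain_param X F \<Delta> N"
    unfolding lin_gain_def by blast
  define d where "d = (\<lambda>\<epsilon>. min \<Delta> (\<epsilon> / (2 * N)))"
  have d: "0 < d \<epsilon>" "d \<epsilon> \<le> \<Delta>" "N * d \<epsilon> < \<epsilon>" if "\<epsilon> > 0" for \<epsilon>
  proof -
    show "0 < d \<epsilon>" "d \<epsilon> \<le> \<Delta>" using \<Delta>N that by (auto simp: d_def)
    have "N * d \<epsilon> \<le> N * (\<epsilon> / (2 * N))" using \<Delta>N by (intro mult_left_mono) (auto simp: d_def)
    also have "\<dots> < \<epsilon>" using \<Delta>N that by simp
    finally show "N * d \<epsilon> < \<epsilon>" .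
  qed
  have st: "norm (x t) < \<epsilon>" if "\<epsilon> > 0" "traj X F x" "norm (x 0) < d \<epsilon>" "t \<ge> 0" for \<epsilon> x t
  proof -
    have "norm (x t) \<le> N * d \<epsilon>"
      by (rule lin_gain_param_un[OF lg d(1,2)[OF that(1)] traj_imp_csol[OF that(2)]]) (use assms(2) that d(1)[OF that(1)] in auto)
    then show ?thesis using d(3)[OF that(1)] by linarith
  qed
  have "(x \<longlongrightarrow> 0) at_top" if "traj X F x" for x
  proof (rule tendstoI)
    fix \<epsilon> :: real assume \<epsilon>: "\<epsilon> > 0"
    have "ev_bdd (\<lambda>_. 0 :: 'a) (d \<epsilon>)" using d(1)[OF \<epsilon>] unfolding ev_bdd_def by (intro exI[of _ 1]) auto
    then have "ev_bdd x (N * d \<epsilon>)"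
      by (intro lin_gain_param_ev[OF lg d(1,2)[OF \<epsilon>] traj_imp_csol[OF that]] assms(2))
    then obtain T where T: "\<And>t. t \<ge> T \<Longrightarrow> norm (x t) \<le> N * d \<epsilon>" unfolding ev_bdd_def by blast
    have "dist (x t) 0 < \<epsilon>" if "t \<ge> T" for t using T[OF that] d(3)[OF \<epsilon>] by simp
    then show "\<forall>\<^sub>F t in at_top. dist (x t) 0 < \<epsilon>" unfolding eventually_at_top_linorder by blast
  qed
  then show ?thesis unfolding GAS_def
    using st d(1) by (intro conjI allI impI) (blast, blast)
qed

text \<open>The Lipschitz constant supplies global existence, which \<open>SISS_L_param\<close>
  demands besides the eventual bound.\<close>

lemma lin_gain_SISS_L:
  fixes F :: "'a::euclidean_space \<Rightarrow> 'a"
  assumes "lin_gain X F" "L > 0" "\<And>x y. norm (F x - F y) \<le> L * norm (x - y)"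
  shows "SISS_L X F"
proof -
  from assms(1) obtain \<Delta> N where \<Delta>N: "\<Delta> > 0" "N > 0" and lg: "lin_gain_param X F \<Delta> N"
    unfolding lin_gain_def by blast
  have "SISS_L_param X F \<Delta> N"
    unfolding SISS_L_param_def
  proof (intro allI impI conjI ballI)
    fix \<delta> e x0 assume "0 < \<delta> \<and> \<delta> \<le> \<Delta>" "admissible X e \<and> ev_bdd e \<delta>" "x0 \<in> X"
    then show "\<exists>x. csol X F e x \<and> x 0 = x0" by (intro csol_exists[OF assms(2,3)]) auto
  next
    fix \<delta> e x assume a: "0 < \<delta> \<and> \<delta> \<le> \<Delta>" "admissible X e \<and> ev_bdd e \<delta>" "csol X F e x"
    then have "e t \<in> X" if "t \<ge> 0" for t using that unfolding admissible_def by blast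
    with a show "ev_bdd x (N * \<delta>)" by (intro lin_gain_param_ev[OF lg, of \<delta> e x]) auto
  qed
  then show ?thesis using \<Delta>N unfolding SISS_L_def by blast
qed

section \<open>Laplace transforms\<close>

definition exp_growth :: "real \<Rightarrow> (real \<Rightarrow> real) \<Rightarrow> bool" where
  "exp_growth \<gamma> h \<longleftrightarrow> continuous_on {0..} h \<and> (\<exists>K. \<forall>t\<ge>0. \<bar>h t\<bar> \<le> K * exp (\<gamma> * t))"

definition Lap :: "(real \<Rightarrow> real) \<Rightarrow> real \<Rightarrow> real" where
  "Lap h \<epsilon> = (\<integral>t. indicator {0..} t * (exp (- \<epsilon> * t) * h t) \<partial>lborel)"

lemma integrable_exp_weight:
  assumes "a > (0::real)"
  shows "integrable lborel (\<lambda>t. indicator {0..} t * exp (- a * t))"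
    and "(\<integral>t. indicator {0..} t * exp (- a * t) \<partial>lborel) = 1 / a"
proof -
  have "(\<integral>\<^sup>+t. ennreal (exp (- a * t)) * indicator {0..} t \<partial>lborel) = 0 - (- exp (- a * 0) / a)"
  proof (rule nn_integral_FTC_atLeast)
    show "((\<lambda>t. - exp (- a * t) / a) has_real_derivative exp (- a * t)) (at t)" for t
      using assms by (auto intro!: derivative_eq_intros)
    have "filterlim (\<lambda>t. - a * t) at_bot at_top"
      using assms by (simp add: filterlim_tendsto_pos_mult_at_top[OF tendsto_const _ filterlim_ident] filterlim_uminus_at_bot)
    then have "((\<lambda>t. exp (- a * t)) \<longlongrightarrow> 0) at_top" by (rule filterlim_compose[OF exp_at_bot])
    then show "((\<lambda>t. - exp (- a * t) / a) \<longlongrightarrow> 0) at_top"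
      using tendsto_divide[OF tendsto_minus tendsto_const] assms by fastforce
  qed auto
  moreover have "(\<integral>\<^sup>+t. ennreal (indicator {0..} t * exp (- a * t)) \<partial>lborel)
      = (\<integral>\<^sup>+t. ennreal (exp (- a * t)) * indicator {0..} t \<partial>lborel)"
    by (intro nn_integral_cong) (auto split: split_indicator)
  ultimately have "(\<integral>\<^sup>+t. ennreal (indicator {0..} t * exp (- a * t)) \<partial>lborel) = ennreal (1 / a)" by simp
  then have "has_bochner_integral lborel (\<lambda>t. indicator {0..} t * exp (- a * t)) (1 / a)"
    by (intro has_bochner_integral_nn_integral) (use assms in auto)
  then show "integrable lborel (\<lambda>t. indicator {0..} t * exp (- a * t))"
    "(\<integral>t. indicator {0..} t * exp (- a * t) \<partial>lborel) = 1 / a"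
    by (auto simp: has_bochner_integral_iff)
qed

lemma Lap_integrable:
  assumes "exp_growth \<gamma> h" "\<gamma> < \<epsilon>"
  shows "integrable lborel (\<lambda>t. indicator {0..} t * (exp (- \<epsilon> * t) * h t))"
proof -
  obtain K where K: "\<And>t. t \<ge> 0 \<Longrightarrow> \<bar>h t\<bar> \<le> K * exp (\<gamma> * t)" and c: "continuous_on {0..} h"
    using assms(1) unfolding exp_growth_def by blast
  show ?thesis
  proof (rule Bochner_Integration.integrable_bound)
    show "integrable lborel (\<lambda>t. K * (indicator {0..} t * exp (- (\<epsilon> - \<gamma>) * t)))"
      using assms(2) by (intro integrable_mult_right integrable_exp_weight) auto
    have "continuous_on {0..} (\<lambda>t. exp (- \<epsilon> * t) * h t)" by (intro continuous_intros c)
    from borel_measurable_continuous_on_indicator[OF _ this]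
    show "(\<lambda>t. indicator {0..} t * (exp (- \<epsilon> * t) * h t)) \<in> borel_measurable lborel" by simp
    have "\<bar>exp (- \<epsilon> * t) * h t\<bar> \<le> \<bar>K * exp (- (\<epsilon> - \<gamma>) * t)\<bar>" if "t \<ge> 0" for t
    proof -
      have "\<bar>exp (- \<epsilon> * t) * h t\<bar> \<le> exp (- \<epsilon> * t) * (K * exp (\<gamma> * t))"
        using K[OF that] by (simp add: abs_mult)
      also have "\<dots> = K * exp (- (\<epsilon> - \<gamma>) * t)" by (simp add: algebra_simps flip: exp_add)
      finally show ?thesis by linarith
    qed
    then show "AE t in lborel. norm (indicator {0..} t * (exp (- \<epsilon> * t) * h t))
        \<le> norm (K * (indicator {0..} t * exp (- (\<epsilon> - \<gamma>) * t)))"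
      by (auto split: split_indicator)
  qed
qed

lemma exp_growth_lincomb:
  assumes "exp_growth \<gamma> h" "exp_growth \<gamma> g"
  shows "exp_growth \<gamma> (\<lambda>t. a * h t + b * g t)"
proof -
  obtain K where K: "\<And>t. t \<ge> 0 \<Longrightarrow> \<bar>h t\<bar> \<le> K * exp (\<gamma> * t)" and c: "continuous_on {0..} h"
    using assms(1) unfolding exp_growth_def by blast
  obtain L where L: "\<And>t. t \<ge> 0 \<Longrightarrow> \<bar>g t\<bar> \<le> L * exp (\<gamma> * t)" and d: "continuous_on {0..} g"
    using assms(2) unfolding exp_growth_def by blast
  have "\<bar>a * h t + b * g t\<bar> \<le> (\<bar>a\<bar> * K + \<bar>b\<bar> * L) * exp (\<gamma> * t)" if "t \<ge> 0" for t
  proof -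
    have "\<bar>a * h t + b * g t\<bar> \<le> \<bar>a\<bar> * \<bar>h t\<bar> + \<bar>b\<bar> * \<bar>g t\<bar>"
      by (metis abs_mult abs_triangle_ineq)
    also have "\<dots> \<le> \<bar>a\<bar> * (K * exp (\<gamma> * t)) + \<bar>b\<bar> * (L * exp (\<gamma> * t))"
      using K[OF that] L[OF that] by (intro add_mono mult_left_mono) auto
    finally show ?thesis by (simp add: algebra_simps)
  qed
  moreover have "continuous_on {0..} (\<lambda>t. a * h t + b * g t)" by (intro continuous_intros c d)
  ultimately show ?thesis unfolding exp_growth_def by blast
qed

lemma exp_growth_mult:
  assumes "exp_growth \<gamma> h" "exp_growth \<gamma>' g"
  shows "exp_growth (\<gamma> + \<gamma>') (\<lambda>t. h t * g t)"
proof -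
  obtain K where K: "\<And>t. t \<ge> 0 \<Longrightarrow> \<bar>h t\<bar> \<le> K * exp (\<gamma> * t)" and c: "continuous_on {0..} h"
    using assms(1) unfolding exp_growth_def by blast
  obtain L where L: "\<And>t. t \<ge> 0 \<Longrightarrow> \<bar>g t\<bar> \<le> L * exp (\<gamma>' * t)" and d: "continuous_on {0..} g"
    using assms(2) unfolding exp_growth_def by blast
  have "\<bar>h t * g t\<bar> \<le> (K * L) * exp ((\<gamma> + \<gamma>') * t)" if "t \<ge> 0" for t
  proof -
    have "\<bar>h t * g t\<bar> \<le> (K * exp (\<gamma> * t)) * (L * exp (\<gamma>' * t))"
      unfolding abs_mult using K[OF that] L[OF that] by (intro mult_mono) (auto intro: order_trans[OF abs_ge_zero])
    also have "\<dots> = (K * L) * exp ((\<gamma> + \<gamma>') * t)" by (simp add: algebra_simps exp_add)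
    finally show ?thesis .
  qed
  moreover have "continuous_on {0..} (\<lambda>t. h t * g t)" by (intro continuous_intros c d)
  ultimately show ?thesis unfolding exp_growth_def by blast
qed

lemma exp_growth_const: "\<gamma> \<ge> 0 \<Longrightarrow> exp_growth \<gamma> (\<lambda>_. c)"
proof -
  assume g: "\<gamma> \<ge> 0"
  have "\<bar>c\<bar> \<le> \<bar>c\<bar> * exp (\<gamma> * t)" if "t \<ge> 0" for t
    using mult_left_mono[of 1 "exp (\<gamma> * t)" "\<bar>c\<bar>"] g that by simp
  then show ?thesis unfolding exp_growth_def by (auto intro!: exI[of _ "\<bar>c\<bar>"])
qed

text \<open>Distributing the exponential evenly over the \<open>k\<close> factors \<open>t\<close>
  reduces this to the bound for a single factor.\<close>

lemma power_exp_weight_bound: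
  assumes "a > (0::real)" "t \<ge> 0"
  shows "t ^ k * exp (- a * t) \<le> (real k / a) ^ k"
proof (cases "k = 0")
  case True
  then show ?thesis using assms by simp
next
  case False
  have "t ^ k * exp (- a * t) = (t * exp (- (a / real k) * t)) ^ k"
    using False by (simp add: power_mult_distrib flip: exp_of_nat_mult)
  also have "\<dots> \<le> (1 / (a / real k)) ^ k"
    using exp_weight_bound[of "a / real k" t] assms False by (intro power_mono) auto
  finally show ?thesis by simp
qed

lemma exp_growth_power: "\<gamma> > 0 \<Longrightarrow> exp_growth \<gamma> (\<lambda>t. t ^ k)"
proof -
  assume g: "\<gamma> > 0"
  have "\<bar>t ^ k\<bar> \<le> (real k / \<gamma>) ^ k * exp (\<gamma> * t)" if "t \<ge> 0" for t
    using power_exp_weight_bound[OF g that, of k] that by (simp add: exp_minus field_simps)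
  then show ?thesis unfolding exp_growth_def by (auto intro!: continuous_intros)
qed

lemma exp_growth_power_mult:
  assumes "exp_growth \<gamma> h" "\<gamma> < \<gamma>'"
  shows "exp_growth \<gamma>' (\<lambda>t. t ^ k * h t)"
  using exp_growth_mult[OF exp_growth_power[of "\<gamma>' - \<gamma>"] assms(1)] assms(2) by simp

lemma Lap_lincomb:
  assumes "exp_growth \<gamma> h" "exp_growth \<gamma> g" "\<gamma> < \<epsilon>"
  shows "Lap (\<lambda>t. a * h t + b * g t) \<epsilon> = a * Lap h \<epsilon> + b * Lap g \<epsilon>"
proof -
  have "Lap (\<lambda>t. a * h t + b * g t) \<epsilon>
      = (\<integral>t. a * (indicator {0..} t * (exp (- \<epsilon> * t) * h t)) + b * (indicator {0..} t * (exp (- \<epsilon> * t) * g t)) \<partial>lborel)"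
    unfolding Lap_def by (intro Bochner_Integration.integral_cong) (auto simp: algebra_simps)
  also have "\<dots> = a * Lap h \<epsilon> + b * Lap g \<epsilon>"
    unfolding Lap_def using Lap_integrable[OF assms(1,3)] Lap_integrable[OF assms(2,3)] by simp
  finally show ?thesis .
qed

lemma Lap_mono:
  assumes "exp_growth \<gamma> h" "exp_growth \<gamma>' g" "\<gamma> < \<epsilon>" "\<gamma>' < \<epsilon>'"
    and "\<And>t. t \<ge> 0 \<Longrightarrow> exp (- \<epsilon> * t) * h t \<le> exp (- \<epsilon>' * t) * g t"
  shows "Lap h \<epsilon> \<le> Lap g \<epsilon>'"
  unfolding Lap_def
  by (intro integral_mono Lap_integrable[OF assms(1,3)] Lap_integrable[OF assms(2,4)])
     (use assms(5) in \<open>auto split: split_indicator\<close>)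

lemma Lap_nonneg: "(\<And>t. t \<ge> 0 \<Longrightarrow> h t \<ge> 0) \<Longrightarrow> Lap h \<epsilon> \<ge> 0"
  unfolding Lap_def by (intro Bochner_Integration.integral_nonneg) (auto split: split_indicator)

lemma Lap_cong: "(\<And>t. t \<ge> 0 \<Longrightarrow> h t = g t) \<Longrightarrow> Lap h \<epsilon> = Lap g \<epsilon>"
  unfolding Lap_def by (intro Bochner_Integration.integral_cong) (auto split: split_indicator)

lemma Lap_const: "\<epsilon> > 0 \<Longrightarrow> Lap (\<lambda>_. c) \<epsilon> = c / \<epsilon>"
  using integrable_exp_weight(2)[of \<epsilon>] unfolding Lap_def
  by (subst mult.assoc[symmetric], subst Bochner_Integration.integral_mult_left_zero) (simp add: field_simps)

lemma Lap_sum: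
  assumes "finite I" "\<And>i. i \<in> I \<Longrightarrow> exp_growth \<gamma> (h i)" "\<gamma> < \<epsilon>"
  shows "Lap (\<lambda>t. \<Sum>i\<in>I. h i t) \<epsilon> = (\<Sum>i\<in>I. Lap (h i) \<epsilon>)"
proof -
  have "Lap (\<lambda>t. \<Sum>i\<in>I. h i t) \<epsilon> = (\<integral>t. (\<Sum>i\<in>I. indicator {0..} t * (exp (- \<epsilon> * t) * h i t)) \<partial>lborel)"
    unfolding Lap_def by (intro Bochner_Integration.integral_cong) (auto simp: sum_distrib_left)
  also have "\<dots> = (\<Sum>i\<in>I. Lap (h i) \<epsilon>)"
    unfolding Lap_def using assms by (intro Bochner_Integration.integral_sum Lap_integrable)
  finally show ?thesis .
qed

lemma Lap_scale:
  assumes "c > 0"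
  shows "Lap (\<lambda>t. h (c * t)) \<epsilon> = Lap h (\<epsilon> / c) / c"
proof -
  have "Lap h (\<epsilon> / c) = \<bar>c\<bar> *\<^sub>R (\<integral>t. indicator {0..} (0 + c * t) * (exp (- (\<epsilon> / c) * (0 + c * t)) * h (0 + c * t)) \<partial>lborel)"
    unfolding Lap_def using assms by (intro lborel_integral_real_affine) auto
  also have "(\<integral>t. indicator {0..} (0 + c * t) * (exp (- (\<epsilon> / c) * (0 + c * t)) * h (0 + c * t)) \<partial>lborel) = Lap (\<lambda>t. h (c * t)) \<epsilon>"
    unfolding Lap_def using assms
    by (intro Bochner_Integration.integral_cong) (auto split: split_indicator simp: zero_le_mult_iff)
  finally show ?thesis using assms by (simp add: field_simps)
qed

lemma exp_growth_scale:
  assumes "exp_growth \<gamma> h" "c > 0"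
  shows "exp_growth (\<gamma> * c) (\<lambda>t. h (c * t))"
proof -
  obtain K where K: "\<And>t. t \<ge> 0 \<Longrightarrow> \<bar>h t\<bar> \<le> K * exp (\<gamma> * t)" and c: "continuous_on {0..} h"
    using assms(1) unfolding exp_growth_def by blast
  have "continuous_on {0..} (\<lambda>t. h (c * t))"
    by (rule continuous_on_compose2[OF c]) (use assms(2) in \<open>auto intro!: continuous_intros\<close>)
  moreover have "\<bar>h (c * t)\<bar> \<le> K * exp (\<gamma> * c * t)" if "t \<ge> 0" for t
    using K[of "c * t"] that assms(2) by (simp add: mult_ac)
  ultimately show ?thesis unfolding exp_growth_def by blast
qed

lemma exp_growth_shift:
  assumes "exp_growth \<gamma> h" "c \<ge> 0"
  shows "exp_growth \<gamma> (\<lambda>t. h (c + t))"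
proof -
  obtain K where K: "\<And>t. t \<ge> 0 \<Longrightarrow> \<bar>h t\<bar> \<le> K * exp (\<gamma> * t)" and c: "continuous_on {0..} h"
    using assms(1) unfolding exp_growth_def by blast
  have "continuous_on {0..} (\<lambda>t. h (c + t))"
    by (rule continuous_on_compose2[OF c]) (use assms(2) in \<open>auto intro!: continuous_intros\<close>)
  moreover have "\<bar>h (c + t)\<bar> \<le> (K * exp (\<gamma> * c)) * exp (\<gamma> * t)" if "t \<ge> 0" for t
    using K[of "c + t"] that assms(2) by (simp add: distrib_left exp_add mult_ac)
  ultimately show ?thesis unfolding exp_growth_def by blast
qed

text \<open>A translation turns the integral into one over \<open>[c, \<infinity>)\<close> with the
  factor \<open>exp (\<epsilon> * c)\<close>; for nonnegative \<open>h\<close> the domain may then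
  be enlarged.\<close>

lemma Lap_shift_le:
  assumes "exp_growth \<gamma> h" "\<gamma> < \<epsilon>" "c \<ge> 0" "\<And>t. t \<ge> 0 \<Longrightarrow> h t \<ge> 0"
  shows "Lap (\<lambda>t. h (c + t)) \<epsilon> \<le> exp (\<epsilon> * c) * Lap h \<epsilon>"
proof -
  let ?f = "\<lambda>u. exp (\<epsilon> * c) * (indicator {0..} (u - c) * (exp (- \<epsilon> * u) * h u))"
  have int: "integrable lborel (\<lambda>t. indicator {0..} t * (exp (- \<epsilon> * t) * h t))"
    by (rule Lap_integrable[OF assms(1,2)])
  have "Lap (\<lambda>t. h (c + t)) \<epsilon> = (\<integral>t. ?f (c + 1 * t) \<partial>lborel)"
    unfolding Lap_def by (intro Bochner_Integration.integral_cong)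
      (auto split: split_indicator simp: distrib_left exp_diff exp_minus field_simps exp_add)
  also have "\<dots> = (\<integral>u. ?f u \<partial>lborel)"
    using lborel_integral_real_affine[of 1 ?f c] by simp
  also have "\<dots> \<le> (\<integral>u. exp (\<epsilon> * c) * (indicator {0..} u * (exp (- \<epsilon> * u) * h u)) \<partial>lborel)"
  proof (rule integral_mono)
    show "integrable lborel (\<lambda>u. exp (\<epsilon> * c) * (indicator {0..} u * (exp (- \<epsilon> * u) * h u)))"
      by (intro integrable_mult_right int)
    have "integrable lborel (\<lambda>u. indicator {c..} u *\<^sub>R (exp (\<epsilon> * c) * (indicator {0..} u * (exp (- \<epsilon> * u) * h u))))"
      by (intro integrable_mult_indicator integrable_mult_right int) auto
    moreover have "(\<lambda>u. indicator {c..} u *\<^sub>R (exp (\<epsilon> * c) * (indicator {0..} u * (exp (- \<epsilon> * u) * h u)))) = ?f"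
      using assms(3) by (intro ext) (auto split: split_indicator)
    ultimately show "integrable lborel ?f" by (simp only:)
    show "?f u \<le> exp (\<epsilon> * c) * (indicator {0..} u * (exp (- \<epsilon> * u) * h u))" for u
      using assms(3,4) by (auto split: split_indicator)
  qed
  also have "\<dots> = exp (\<epsilon> * c) * Lap h \<epsilon>"
    unfolding Lap_def by (rule Bochner_Integration.integral_mult_right_zero)
  finally show ?thesis .
qed

text \<open>The source of the Lyapunov equations for both kinds of block: with
  \<open>\<epsilon> > 0\<close> for the critical ones and, since the rate \<open>\<gamma>\<close>
  may be negative, with \<open>\<epsilon> = 0\<close> for the Hurwitz one.\<close>

lemma Lap_parts:
  assumes H: "exp_growth \<gamma> H" and h: "exp_growth \<gamma> h" and \<gamma>: "\<gamma> < \<epsilon>"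
    and d: "\<And>t. t \<ge> 0 \<Longrightarrow> (H has_vector_derivative h t) (at t within {0..})"
  shows "Lap h \<epsilon> = \<epsilon> * Lap H \<epsilon> - H 0"
proof -
  have gr: "exp_growth \<gamma> (\<lambda>t. 1 * h t + (- \<epsilon>) * H t)" by (intro exp_growth_lincomb H h)
  let ?g = "\<lambda>t. exp (- \<epsilon> * t) * (1 * h t + (- \<epsilon>) * H t)"
  let ?f = "\<lambda>t. indicator {0..} t * ?g t"
  have "integrable lborel ?f" by (rule Lap_integrable[OF gr \<gamma>])
  then have lim: "((\<lambda>y. \<integral>t. indicator {..y} t *\<^sub>R ?f t \<partial>lborel) \<longlongrightarrow> (\<integral>t. ?f t \<partial>lborel)) at_top"
    by (intro tendsto_integral_at_top) auto
  have val: "(\<integral>t. indicator {..y} t *\<^sub>R ?f t \<partial>lborel) = exp (- \<epsilon> * y) * H y - H 0" if "y \<ge> 0" for y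
  proof -
    have "(\<integral>t. indicator {0..y} t *\<^sub>R ?g t \<partial>lborel) = exp (- \<epsilon> * y) * H y - exp (- \<epsilon> * 0) * H 0"
    proof (rule integral_FTC_Icc[OF that])
      fix t assume t: "0 \<le> t" "t \<le> y"
      have dH: "(H has_vector_derivative h t) (at t within {0..y})"
        by (rule has_vector_derivative_within_subset[OF d]) (use t in auto)
      have dE: "((\<lambda>t. exp (- \<epsilon> * t)) has_vector_derivative (- \<epsilon> * exp (- \<epsilon> * t))) (at t within {0..y})"
        by (auto intro!: derivative_eq_intros simp flip: has_real_derivative_iff_has_vector_derivative)
      from has_vector_derivative_mult[OF dE dH]
      show "((\<lambda>t. exp (- \<epsilon> * t) * H t) has_vector_derivative ?g t) (at t within {0..y})"
        by (simp add: algebra_simps)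
    next
      have "continuous_on {0..y} (\<lambda>t. 1 * h t + (- \<epsilon>) * H t)"
        using gr unfolding exp_growth_def by (auto elim!: continuous_on_subset)
      from continuous_on_mult[OF _ this, of "\<lambda>t. exp (- \<epsilon> * t)"] show "continuous_on {0..y} ?g"
        by (simp add: continuous_intros)
    qed
    moreover have "(\<integral>t. indicator {..y} t *\<^sub>R ?f t \<partial>lborel) = (\<integral>t. indicator {0..y} t *\<^sub>R ?g t \<partial>lborel)"
      by (intro Bochner_Integration.integral_cong) (auto split: split_indicator)
    ultimately show ?thesis by simp
  qed
  have "((\<lambda>y. exp (- \<epsilon> * y) * H y - H 0) \<longlongrightarrow> 0 - H 0) at_top"
  proof (intro tendsto_diff tendsto_const)
    obtain K where K: "\<And>t. t \<ge> 0 \<Longrightarrow> \<bar>H t\<bar> \<le> K * exp (\<gamma> * t)"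
      using H unfolding exp_growth_def by blast
    have "filterlim (\<lambda>t. - (\<epsilon> - \<gamma>) * t) at_bot at_top"
      using \<gamma> by (simp only: mult_minus_left filterlim_uminus_at_bot minus_minus)
         (intro filterlim_tendsto_pos_mult_at_top[OF tendsto_const _ filterlim_ident], simp)
    then have "((\<lambda>t. exp (- (\<epsilon> - \<gamma>) * t)) \<longlongrightarrow> 0) at_top" by (rule filterlim_compose[OF exp_at_bot])
    then have l0: "((\<lambda>t. K * exp (- (\<epsilon> - \<gamma>) * t)) \<longlongrightarrow> 0) at_top" by (rule tendsto_mult_right_zero)
    show "((\<lambda>y. exp (- \<epsilon> * y) * H y) \<longlongrightarrow> 0) at_top"
    proof (rule Lim_null_comparison[OF _ l0])
      have "norm (exp (- \<epsilon> * t) * H t) \<le> K * exp (- (\<epsilon> - \<gamma>) * t)" if "t \<ge> 0" for t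
      proof -
        have "norm (exp (- \<epsilon> * t) * H t) \<le> exp (- \<epsilon> * t) * (K * exp (\<gamma> * t))"
          using K[OF that] by (simp add: abs_mult)
        also have "\<dots> = K * exp (- (\<epsilon> - \<gamma>) * t)" by (simp add: algebra_simps flip: exp_add)
        finally show ?thesis .
      qed
      then show "\<forall>\<^sub>F t in at_top. norm (exp (- \<epsilon> * t) * H t) \<le> K * exp (- (\<epsilon> - \<gamma>) * t)"
        unfolding eventually_at_top_linorder by blast
    qed
  qed
  moreover have "\<forall>\<^sub>F y in at_top. (\<integral>t. indicator {..y} t *\<^sub>R ?f t \<partial>lborel) = exp (- \<epsilon> * y) * H y - H 0"
    unfolding eventually_at_top_linorder using val by blast
  then have "\<forall>\<^sub>F y in at_top. exp (- \<epsilon> * y) * H y - H 0 = (\<integral>t. indicator {..y} t *\<^sub>R ?f t \<partial>lborel)"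
    by (rule eventually_mono) (rule sym)
  ultimately have "((\<lambda>y. \<integral>t. indicator {..y} t *\<^sub>R ?f t \<partial>lborel) \<longlongrightarrow> 0 - H 0) at_top"
    by (rule Lim_transform_eventually)
  then have "(\<integral>t. ?f t \<partial>lborel) = - H 0"
    using lim tendsto_unique[OF trivial_limit_at_top_linorder] by fastforce
  then have "Lap (\<lambda>t. 1 * h t + (- \<epsilon>) * H t) \<epsilon> = - H 0" by (simp only: Lap_def)
  then show ?thesis using Lap_lincomb[OF h H \<gamma>, of 1 "- \<epsilon>"] by simp
qed

lemma exp_quadratic_remainder:
  fixes u :: real
  shows "\<bar>exp u - 1 - u\<bar> \<le> u\<^sup>2 * exp \<bar>u\<bar>"
proof -
  have "\<bar>exp u - 1 - u\<bar> = exp u - 1 - u" using exp_ge_add_one_self[of u] by (intro abs_of_nonneg) linarith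
  also have "\<dots> \<le> u\<^sup>2 * exp \<bar>u\<bar>"
  proof -
    obtain t where t: "\<bar>t\<bar> \<le> \<bar>u\<bar>" "exp u = (\<Sum>m<2. (u ^ m) / fact m) + (exp t / fact 2) * u ^ 2"
      using Maclaurin_exp_le[of u 2] by blast
    have "exp u - 1 - u = exp t / 2 * u\<^sup>2" using t(2) by (simp add: numeral_2_eq_2)
    also have "\<dots> \<le> exp \<bar>u\<bar> * u\<^sup>2"
    proof (rule mult_right_mono)
      have "exp t \<le> exp \<bar>u\<bar>" using t(1) by simp
      moreover have "exp t > 0" by simp
      ultimately show "exp t / 2 \<le> exp \<bar>u\<bar>" by linarith
    qed simp
    finally show ?thesis by (simp add: mult.commute)
  qed
  finally show ?thesis .
qed

text \<open>Differentiation under the integral with an explicit quadratic remainder, whose constant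
  is a Laplace transform at the slightly smaller parameter \<open>\<epsilon> - r\<close>.\<close>

lemma Lap_has_derivative:
  assumes h: "exp_growth \<gamma> h" and \<gamma>: "\<gamma> < \<epsilon>"
  shows "((\<lambda>\<epsilon>. Lap h \<epsilon>) has_real_derivative - Lap (\<lambda>t. t * h t) \<epsilon>) (at \<epsilon>)"
proof -
  \<comment> \<open>One third of the gap absorbs the factors \<open>t\<close> and
    \<open>t ^ 2\<close>, one third the perturbation of \<open>\<epsilon>\<close>, and the last
    third keeps the integrals convergent.\<close>
  define r where "r = (\<epsilon> - \<gamma>) / 3"
  have r: "r > 0" using \<gamma> by (simp add: r_def)
  have habs: "exp_growth \<gamma> (\<lambda>t. \<bar>h t\<bar>)"
    using h unfolding exp_growth_def by (auto intro: continuous_on_rabs)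
  have g1: "exp_growth (\<gamma> + r) (\<lambda>t. t * h t)"
    using exp_growth_power_mult[OF h, of "\<gamma> + r" 1] r by simp
  have g2: "exp_growth (\<gamma> + r) (\<lambda>t. t ^ 2 * \<bar>h t\<bar>)"
    using exp_growth_power_mult[OF habs, of "\<gamma> + r" 2] r by simp
  define C where "C = Lap (\<lambda>t. t ^ 2 * \<bar>h t\<bar>) (\<epsilon> - r)"
  have lt: "\<gamma> + r < \<epsilon> - r" "\<gamma> < \<epsilon> - r" using r by (auto simp: r_def field_simps)
  have i1: "integrable lborel (\<lambda>t. indicator {0..} t * (exp (- \<epsilon> * t) * (t * h t)))"
    by (rule Lap_integrable[OF g1]) (use lt r in auto)
  have i2: "integrable lborel (\<lambda>t. indicator {0..} t * (exp (- \<epsilon> * t) * h t))"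
    by (rule Lap_integrable[OF h \<gamma>])
  have i3: "integrable lborel (\<lambda>t. indicator {0..} t * (exp (- (\<epsilon> - r) * t) * (t ^ 2 * \<bar>h t\<bar>)))"
    by (rule Lap_integrable[OF g2 lt(1)])
  have main: "\<bar>Lap h (\<epsilon> + d) - Lap h \<epsilon> + d * Lap (\<lambda>t. t * h t) \<epsilon>\<bar> \<le> C * d\<^sup>2" if d: "\<bar>d\<bar> \<le> r" for d
  proof -
    have i4: "integrable lborel (\<lambda>t. indicator {0..} t * (exp (- (\<epsilon> + d) * t) * h t))"
      by (rule Lap_integrable[OF h]) (use d lt in auto)
    let ?R = "\<lambda>t. indicator {0..} t * (exp (- (\<epsilon> + d) * t) * h t) - indicator {0..} t * (exp (- \<epsilon> * t) * h t)
        + d * (indicator {0..} t * (exp (- \<epsilon> * t) * (t * h t)))"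
    have "\<bar>Lap h (\<epsilon> + d) - Lap h \<epsilon> + d * Lap (\<lambda>t. t * h t) \<epsilon>\<bar> = norm (\<integral>t. ?R t \<partial>lborel)"
      unfolding Lap_def real_norm_def using i1 i2 i4 by simp
    also have "\<dots> \<le> (\<integral>t. d\<^sup>2 * (indicator {0..} t * (exp (- (\<epsilon> - r) * t) * (t ^ 2 * \<bar>h t\<bar>))) \<partial>lborel)"
    proof (rule Bochner_Integration.integral_norm_bound_integral)
      fix t :: real
      show "norm (?R t) \<le> d\<^sup>2 * (indicator {0..} t * (exp (- (\<epsilon> - r) * t) * (t ^ 2 * \<bar>h t\<bar>)))"
      proof (cases "t \<ge> 0")
        case True
        have "?R t = exp (- \<epsilon> * t) * (exp (- d * t) - 1 - (- d * t)) * h t"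
          using True by (simp add: algebra_simps flip: exp_add)
        then have "norm (?R t) = exp (- \<epsilon> * t) * \<bar>exp (- d * t) - 1 - (- d * t)\<bar> * \<bar>h t\<bar>"
          by (simp add: abs_mult)
        also have "\<dots> \<le> exp (- \<epsilon> * t) * ((- d * t)\<^sup>2 * exp \<bar>- d * t\<bar>) * \<bar>h t\<bar>"
          by (intro mult_right_mono mult_left_mono exp_quadratic_remainder) auto
        also have "\<dots> \<le> exp (- \<epsilon> * t) * ((- d * t)\<^sup>2 * exp (r * t)) * \<bar>h t\<bar>"
          using d True by (intro mult_right_mono mult_left_mono) (auto simp: abs_mult intro: mult_right_mono)
        also have "\<dots> = d\<^sup>2 * (exp (- (\<epsilon> - r) * t) * (t ^ 2 * \<bar>h t\<bar>))"
        proof -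
          have "exp (- (\<epsilon> - r) * t) = exp (- \<epsilon> * t) * exp (r * t)" by (simp add: algebra_simps flip: exp_add)
          then show ?thesis by (simp only: power_mult_distrib power2_minus mult_ac)
        qed
        finally show ?thesis using True by simp
      qed simp
    qed (use i1 i2 i3 i4 in auto)
    also have "\<dots> = C * d\<^sup>2" unfolding C_def Lap_def by (subst Bochner_Integration.integral_mult_right_zero) simp
    finally show ?thesis .
  qed
  have "C \<ge> 0" unfolding C_def by (rule Lap_nonneg) simp
  show ?thesis
    unfolding has_field_derivative_def has_derivative_at_alt
  proof (intro conjI allI impI)
    show "bounded_linear ((*) (- Lap (\<lambda>t. t * h t) \<epsilon>))" by (rule bounded_linear_mult_right)
    fix e :: real assume e: "e > 0"
    define \<eta> where "\<eta> = min r (e / (C + 1))"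
    have "\<eta> > 0" using r e \<open>C \<ge> 0\<close> by (simp add: \<eta>_def)
    moreover have "norm (Lap h y - Lap h \<epsilon> - (- Lap (\<lambda>t. t * h t) \<epsilon>) * (y - \<epsilon>)) \<le> e * norm (y - \<epsilon>)"
      if "norm (y - \<epsilon>) < \<eta>" for y
    proof -
      define d where "d = y - \<epsilon>"
      have d: "\<bar>d\<bar> \<le> r" "\<bar>d\<bar> \<le> e / (C + 1)" using that by (auto simp: \<eta>_def d_def)
      have "norm (Lap h y - Lap h \<epsilon> - (- Lap (\<lambda>t. t * h t) \<epsilon>) * (y - \<epsilon>)) \<le> C * d\<^sup>2"
        using main[OF d(1)] by (simp add: d_def algebra_simps)
      also have "\<dots> = (C * \<bar>d\<bar>) * \<bar>d\<bar>" by (simp add: power2_eq_square abs_mult_self_eq mult.assoc)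
      also have "\<dots> \<le> e * \<bar>d\<bar>"
      proof (rule mult_right_mono)
        have "C * \<bar>d\<bar> \<le> (C + 1) * (e / (C + 1))" using d(2) \<open>C \<ge> 0\<close> by (intro mult_mono) auto
        then show "C * \<bar>d\<bar> \<le> e" using \<open>C \<ge> 0\<close> by simp
      qed simp
      finally show ?thesis by (simp add: d_def)
    qed
    ultimately show "\<exists>\<eta>>0. \<forall>y. norm (y - \<epsilon>) < \<eta> \<longrightarrow>
      norm (Lap h y - Lap h \<epsilon> - (- Lap (\<lambda>t. t * h t) \<epsilon>) * (y - \<epsilon>)) \<le> e * norm (y - \<epsilon>)" by blast
  qed
qed

section \<open>Turan inequalities integrated over the step\<close>

lemma sum_power2_le:
  fixes a :: "'i \<Rightarrow> real"
  assumes "finite I"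
  shows "(\<Sum>i\<in>I. a i)\<^sup>2 \<le> real (card I) * (\<Sum>i\<in>I. (a i)\<^sup>2)"
  using Cauchy_Schwarz_ineq_sum[of "\<lambda>_. 1" a I] by simp

text \<open>The Turan inequality is integrated over the step \<open>h\<close> with weight
  \<open>exp (- \<epsilon> * m * h)\<close>. The left side does not depend on \<open>h\<close> and
  so gains the factor \<open>\<epsilon> * m\<close>. On the right, the substitution
  \<open>s = k * h\<close> turns the weight into \<open>exp (- \<epsilon> * m * s / k)\<close>,
  which is at most \<open>exp (- \<epsilon> * s)\<close> because \<open>k \<le> m\<close>. The
  factor \<open>\<epsilon>\<close> gained here is what makes \<open>P(\<epsilon>)\<close> of order
  \<open>\<epsilon>\<close>.\<close>

lemma turan_pointwise:
  fixes f :: "real \<Rightarrow> real"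
  assumes gr: "\<And>\<gamma>. \<gamma> > 0 \<Longrightarrow> exp_growth \<gamma> (\<lambda>t. (f t)\<^sup>2)"
    and turan: "\<And>t h. t \<ge> 0 \<Longrightarrow> h \<ge> 0 \<Longrightarrow> \<bar>f t\<bar> \<le> C * (\<Sum>k=1..m. \<bar>f (t + real k * h)\<bar>)"
    and \<epsilon>: "0 < \<epsilon>" "\<epsilon> \<le> 1" and t: "0 \<le> t" "t \<le> 1"
  shows "(f t)\<^sup>2 \<le> 3 * C\<^sup>2 * real m ^ 3 * \<epsilon> * Lap (\<lambda>t. (f t)\<^sup>2) \<epsilon>"
proof (cases "m = 0")
  case True
  then show ?thesis using turan[OF t(1), of 0] by simp
next
  case False
  then have m: "real m > 0" by simp
  let ?L = "Lap (\<lambda>s. (f (t + s))\<^sup>2) \<epsilon>"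
  have gt: "exp_growth \<gamma> (\<lambda>s. (f (t + s))\<^sup>2)" if "\<gamma> > 0" for \<gamma>
    using exp_growth_shift[OF gr[OF that] t(1)] .
  have gk: "exp_growth (\<epsilon> / 2) (\<lambda>h. (f (t + real k * h))\<^sup>2)" if "k \<in> {1..m}" for k
    using exp_growth_scale[OF gt[of "\<epsilon> / 2 / real k"], of "real k"] that \<epsilon> by simp
  have Lk: "Lap (\<lambda>h. (f (t + real k * h))\<^sup>2) (\<epsilon> * real m) \<le> ?L" if k: "k \<in> {1..m}" for k
  proof -
    have "Lap (\<lambda>h. (f (t + real k * h))\<^sup>2) (\<epsilon> * real m) = Lap (\<lambda>s. (f (t + s))\<^sup>2) (\<epsilon> * real m / real k) / real k"
      using Lap_scale[of "real k" "\<lambda>s. (f (t + s))\<^sup>2"] k by simp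
    also have "\<dots> \<le> Lap (\<lambda>s. (f (t + s))\<^sup>2) (\<epsilon> * real m / real k) / 1"
      using k by (intro divide_left_mono Lap_nonneg) auto
    also have "\<dots> \<le> ?L / 1"
    proof (intro divide_right_mono Lap_mono[OF gt[of "\<epsilon> / 2"] gt[of "\<epsilon> / 2"]])
      have le: "\<epsilon> \<le> \<epsilon> * real m / real k" using k \<epsilon> by (simp add: field_simps)
      then show "\<epsilon> / 2 < \<epsilon> * real m / real k" using \<epsilon> by linarith
      show "exp (- (\<epsilon> * real m / real k) * s) * (f (t + s))\<^sup>2 \<le> exp (- \<epsilon> * s) * (f (t + s))\<^sup>2" if "s \<ge> 0" for s
        using mult_right_mono[OF le that] by (intro mult_right_mono) auto
    qed (use \<epsilon> in auto)
    finally show ?thesis by simp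
  qed
  have sq: "(f t)\<^sup>2 \<le> (\<Sum>k=1..m. C\<^sup>2 * real m * (f (t + real k * h))\<^sup>2)" if "h \<ge> 0" for h
  proof -
    have "(f t)\<^sup>2 = \<bar>f t\<bar>\<^sup>2" by simp
    also have "\<dots> \<le> (C * (\<Sum>k=1..m. \<bar>f (t + real k * h)\<bar>))\<^sup>2"
      using turan[OF t(1) that] by (intro power_mono) auto
    also have "\<dots> = C\<^sup>2 * (\<Sum>k=1..m. \<bar>f (t + real k * h)\<bar>)\<^sup>2" by (simp add: power_mult_distrib)
    also have "\<dots> \<le> C\<^sup>2 * (real m * (\<Sum>k=1..m. \<bar>f (t + real k * h)\<bar>\<^sup>2))"
      using sum_power2_le[of "{1..m}" "\<lambda>k. \<bar>f (t + real k * h)\<bar>"] by (intro mult_left_mono) auto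
    finally show ?thesis by (simp add: sum_distrib_left mult.assoc)
  qed
  have "(f t)\<^sup>2 / (\<epsilon> * real m) = Lap (\<lambda>_. (f t)\<^sup>2) (\<epsilon> * real m)"
    using \<epsilon> m by (simp add: Lap_const)
  also have "\<dots> \<le> Lap (\<lambda>h. \<Sum>k=1..m. C\<^sup>2 * real m * (f (t + real k * h))\<^sup>2) (\<epsilon> * real m)"
  proof (rule Lap_mono)
    show "exp_growth 0 (\<lambda>_. (f t)\<^sup>2)" by (rule exp_growth_const) simp
    show "exp_growth (\<epsilon> / 2) (\<lambda>h. \<Sum>k=1..m. C\<^sup>2 * real m * (f (t + real k * h))\<^sup>2)"
    proof -
      have "exp_growth (\<epsilon> / 2) (\<lambda>h. \<Sum>k\<in>S. C\<^sup>2 * real m * (f (t + real k * h))\<^sup>2)" if "finite S" "S \<subseteq> {1..m}" for S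
        using that
      proof (induction S rule: finite_induct)
        case empty
        then show ?case using exp_growth_const[of "\<epsilon> / 2" 0] \<epsilon> by simp
      next
        case (insert k S)
        then show ?case
          using exp_growth_lincomb[OF gk[of k], of "\<lambda>h. \<Sum>k\<in>S. C\<^sup>2 * real m * (f (t + real k * h))\<^sup>2" "C\<^sup>2 * real m" 1] by simp
      qed
      then show ?thesis by simp
    qed
    show "\<epsilon> / 2 < \<epsilon> * real m" using \<epsilon> False by (cases m) (auto simp: field_simps add_pos_nonneg)
    show "exp (- (\<epsilon> * real m) * h) * (f t)\<^sup>2
        \<le> exp (- (\<epsilon> * real m) * h) * (\<Sum>k=1..m. C\<^sup>2 * real m * (f (t + real k * h))\<^sup>2)" if "h \<ge> 0" for h
      using sq[OF that] by (intro mult_left_mono) auto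
  qed (use \<epsilon> m in auto)
  also have "\<dots> = (\<Sum>k=1..m. Lap (\<lambda>h. C\<^sup>2 * real m * (f (t + real k * h))\<^sup>2) (\<epsilon> * real m))"
  proof (rule Lap_sum)
    show "exp_growth (\<epsilon> / 2) (\<lambda>h. C\<^sup>2 * real m * (f (t + real k * h))\<^sup>2)" if "k \<in> {1..m}" for k
      using exp_growth_lincomb[OF gk[OF that] gk[OF that], of "C\<^sup>2 * real m" 0] by simp
    show "\<epsilon> / 2 < \<epsilon> * real m" using \<epsilon> False by (cases m) (auto simp: field_simps add_pos_nonneg)
  qed simp
  also have "\<dots> = (\<Sum>k=1..m. C\<^sup>2 * real m * Lap (\<lambda>h. (f (t + real k * h))\<^sup>2) (\<epsilon> * real m))"
  proof (rule sum.cong[OF refl])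
    fix k assume k: "k \<in> {1..m}"
    have "\<epsilon> / 2 < \<epsilon> * real m" using \<epsilon> False by (cases m) (auto simp: field_simps add_pos_nonneg)
    then show "Lap (\<lambda>h. C\<^sup>2 * real m * (f (t + real k * h))\<^sup>2) (\<epsilon> * real m)
        = C\<^sup>2 * real m * Lap (\<lambda>h. (f (t + real k * h))\<^sup>2) (\<epsilon> * real m)"
      using Lap_lincomb[OF gk[OF k] gk[OF k], of "\<epsilon> * real m" "C\<^sup>2 * real m" 0] by simp
  qed
  also have "\<dots> \<le> (\<Sum>k=1..m. C\<^sup>2 * real m * ?L)"
    by (intro sum_mono mult_left_mono Lk) auto
  also have "\<dots> = C\<^sup>2 * real m ^ 2 * ?L" by (simp add: power2_eq_square)
  finally have 1: "(f t)\<^sup>2 \<le> C\<^sup>2 * real m ^ 3 * \<epsilon> * ?L"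
    using \<epsilon> m by (simp add: pos_divide_le_eq power2_eq_square power3_eq_cube mult_ac)
  have L0: "Lap (\<lambda>t. (f t)\<^sup>2) \<epsilon> \<ge> 0" by (rule Lap_nonneg) simp
  \<comment> \<open>Returning from the shifted transform to the one at the origin costs
    \<open>exp (\<epsilon> * t)\<close>, at most \<open>exp 1\<close> and hence at most 3.\<close>
  have "?L \<le> exp (\<epsilon> * t) * Lap (\<lambda>t. (f t)\<^sup>2) \<epsilon>"
    by (rule Lap_shift_le[OF gr[of "\<epsilon> / 2"]]) (use \<epsilon> t in auto)
  also have "\<dots> \<le> 3 * Lap (\<lambda>t. (f t)\<^sup>2) \<epsilon>"
  proof (rule mult_right_mono[OF _ L0])
    have "\<epsilon> * t \<le> 1" using mult_mono[of \<epsilon> 1 t 1] \<epsilon> t by simp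
    then have "exp (\<epsilon> * t) \<le> exp 1" by simp
    then show "exp (\<epsilon> * t) \<le> 3" using exp_le by linarith
  qed
  finally have "C\<^sup>2 * real m ^ 3 * \<epsilon> * ?L \<le> C\<^sup>2 * real m ^ 3 * \<epsilon> * (3 * Lap (\<lambda>t. (f t)\<^sup>2) \<epsilon>)"
    using \<epsilon> by (intro mult_left_mono) auto
  then show ?thesis using 1 by (simp add: mult_ac)
qed

text \<open>Samples between \<open>s / 2\<close> and \<open>s\<close> bound \<open>f s\<close> by
  values at \<open>c k * s\<close> with \<open>c k \<le> \<theta> < 1\<close>. After rescaling, this
  says that lowering the parameter from \<open>\<epsilon>\<close> to
  \<open>\<theta> * \<epsilon>\<close> enlarges the transform by a constant factor only. The weight
  \<open>exp (- \<epsilon> * (1 - \<theta>) * t)\<close> so released pays for \<open>t ^ k\<close>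
  at the price \<open>1 / \<epsilon> ^ k\<close>.\<close>

lemma turan_moment:
  fixes f :: "real \<Rightarrow> real"
  assumes gr: "\<And>\<gamma>. \<gamma> > 0 \<Longrightarrow> exp_growth \<gamma> (\<lambda>t. (f t)\<^sup>2)" and m: "m \<ge> 1"
    and turan: "\<And>t h. t \<ge> 0 \<Longrightarrow> h \<ge> 0 \<Longrightarrow> \<bar>f (t + real m * h)\<bar> \<le> C * (\<Sum>k<m. \<bar>f (t + real k * h)\<bar>)"
    and \<epsilon>: "0 < \<epsilon>"
  shows "Lap (\<lambda>t. t ^ k * (f t)\<^sup>2) \<epsilon> \<le> (2 * real m * real k) ^ k * (2 * C\<^sup>2 * (real m)\<^sup>2) / \<epsilon> ^ k * Lap (\<lambda>t. (f t)\<^sup>2) \<epsilon>"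
proof -
  \<comment> \<open>The largest sampled fraction: with \<open>m\<close> steps of length
    \<open>s / (2 * m)\<close> starting at \<open>s / 2\<close>, the last sample before
    \<open>s\<close> is \<open>\<theta> * s\<close>.\<close>
  define \<theta> where "\<theta> = 1 - 1 / (2 * real m)"
  have mr: "real m \<ge> 1" using m by simp
  have \<theta>: "1 / 2 \<le> \<theta>" "\<theta> < 1" "1 - \<theta> = 1 / (2 * real m)" using mr by (auto simp: \<theta>_def field_simps)
  define c where "c = (\<lambda>k. 1 / 2 + real k / (2 * real m))"
  have c: "1 / 2 \<le> c k" "c k \<le> \<theta>" if "k < m" for k
  proof -
    have "real k + 1 \<le> real m" using that by linarith
    then have "(real k + 1) / (2 * real m) \<le> real m / (2 * real m)" using mr by (intro divide_right_mono) auto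
    then show "1 / 2 \<le> c k" "c k \<le> \<theta>" using mr by (auto simp: c_def \<theta>_def add_divide_distrib)
  qed
  have sq: "(f s)\<^sup>2 \<le> (\<Sum>k<m. C\<^sup>2 * real m * (f (c k * s))\<^sup>2)" if "s \<ge> 0" for s
  proof -
    have e: "s / 2 + real m * (s / (2 * real m)) = s" using mr by (simp add: field_simps)
    have e2: "s / 2 + real k * (s / (2 * real m)) = c k * s" for k using mr by (simp add: c_def field_simps)
    have "\<bar>f s\<bar> \<le> C * (\<Sum>k<m. \<bar>f (c k * s)\<bar>)"
      using turan[of "s / 2" "s / (2 * real m)", unfolded e, unfolded e2] that by simp
    then have "\<bar>f s\<bar>\<^sup>2 \<le> (C * (\<Sum>k<m. \<bar>f (c k * s)\<bar>))\<^sup>2" by (intro power_mono) auto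
    also have "\<dots> = C\<^sup>2 * (\<Sum>k<m. \<bar>f (c k * s)\<bar>)\<^sup>2" by (simp add: power_mult_distrib)
    also have "\<dots> \<le> C\<^sup>2 * (real m * (\<Sum>k<m. \<bar>f (c k * s)\<bar>\<^sup>2))"
      using sum_power2_le[of "{..<m}" "\<lambda>k. \<bar>f (c k * s)\<bar>"] by (intro mult_left_mono) auto
    finally show ?thesis by (simp add: sum_distrib_left mult.assoc)
  qed
  let ?L = "Lap (\<lambda>t. (f t)\<^sup>2) \<epsilon>"
  have L0: "?L \<ge> 0" by (rule Lap_nonneg) simp
  have te: "\<theta> * \<epsilon> > 0" "\<epsilon> * \<theta> > 0" using \<theta> \<epsilon> by auto
  have gk: "exp_growth (\<theta> * \<epsilon> / 2) (\<lambda>s. (f (c k * s))\<^sup>2)" if "k < m" for k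
  proof -
    have ck: "c k > 0" using c[OF that] by linarith
    have "exp_growth (\<theta> * \<epsilon> / 2 / c k * c k) (\<lambda>s. (f (c k * s))\<^sup>2)"
      using te ck by (intro exp_growth_scale gr divide_pos_pos) auto
    then show ?thesis using ck by simp
  qed
  have gk': "exp_growth (\<theta> * \<epsilon> / 2) (\<lambda>s. C\<^sup>2 * real m * (f (c k * s))\<^sup>2)" if "k < m" for k
    using exp_growth_lincomb[OF gk[OF that] gk[OF that], of "C\<^sup>2 * real m" 0] by simp
  have lt: "\<theta> * \<epsilon> / 2 < \<theta> * \<epsilon>" using te by simp
  have Lk: "Lap (\<lambda>s. (f (c k * s))\<^sup>2) (\<theta> * \<epsilon>) \<le> 2 * ?L" if k: "k < m" for k
  proof -
    have ck: "c k > 0" using c[OF k] by linarith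
    have le: "\<epsilon> \<le> \<theta> * \<epsilon> / c k" using c[OF k] ck \<epsilon> by (simp add: field_simps)
    have "Lap (\<lambda>s. (f (c k * s))\<^sup>2) (\<theta> * \<epsilon>) = Lap (\<lambda>t. (f t)\<^sup>2) (\<theta> * \<epsilon> / c k) / c k"
      using Lap_scale[of "c k" "\<lambda>s. (f s)\<^sup>2"] ck by simp
    also have "\<dots> \<le> ?L / c k"
    proof (intro divide_right_mono Lap_mono[OF gr[of "\<epsilon> / 2"] gr[of "\<epsilon> / 2"]])
      show "\<epsilon> / 2 < \<theta> * \<epsilon> / c k" using \<epsilon> le by linarith
      show "exp (- (\<theta> * \<epsilon> / c k) * s) * (f s)\<^sup>2 \<le> exp (- \<epsilon> * s) * (f s)\<^sup>2" if "s \<ge> 0" for s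
        using mult_right_mono[OF le that] by (intro mult_right_mono) auto
    qed (use \<epsilon> ck in auto)
    also have "\<dots> \<le> ?L / (1 / 2)"
      using c[OF k] ck L0 by (intro divide_left_mono) auto
    finally show ?thesis by simp
  qed
  have "Lap (\<lambda>t. (f t)\<^sup>2) (\<theta> * \<epsilon>) \<le> Lap (\<lambda>s. \<Sum>k<m. C\<^sup>2 * real m * (f (c k * s))\<^sup>2) (\<theta> * \<epsilon>)"
  proof (rule Lap_mono[OF gr[of "\<theta> * \<epsilon> / 2"]])
    have "exp_growth (\<theta> * \<epsilon> / 2) (\<lambda>s. \<Sum>k\<in>S. C\<^sup>2 * real m * (f (c k * s))\<^sup>2)" if "finite S" "S \<subseteq> {..<m}" for S
      using that
    proof (induction S rule: finite_induct)
      case empty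
      then show ?case using exp_growth_const[of "\<theta> * \<epsilon> / 2" 0] te by simp
    next
      case (insert k S)
      then show ?case
        using exp_growth_lincomb[OF gk'[of k], of "\<lambda>s. \<Sum>k\<in>S. C\<^sup>2 * real m * (f (c k * s))\<^sup>2" 1 1] by simp
    qed
    then show "exp_growth (\<theta> * \<epsilon> / 2) (\<lambda>s. \<Sum>k<m. C\<^sup>2 * real m * (f (c k * s))\<^sup>2)" by simp
    show "exp (- (\<theta> * \<epsilon>) * s) * (f s)\<^sup>2 \<le> exp (- (\<theta> * \<epsilon>) * s) * (\<Sum>k<m. C\<^sup>2 * real m * (f (c k * s))\<^sup>2)" if "s \<ge> 0" for s
      using sq[OF that] by (intro mult_left_mono) auto
  qed (use lt te in auto)
  also have "\<dots> = (\<Sum>k<m. Lap (\<lambda>s. C\<^sup>2 * real m * (f (c k * s))\<^sup>2) (\<theta> * \<epsilon>))"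
    by (rule Lap_sum[OF _ gk' lt]) auto
  also have "\<dots> = (\<Sum>k<m. C\<^sup>2 * real m * Lap (\<lambda>s. (f (c k * s))\<^sup>2) (\<theta> * \<epsilon>))"
  proof (rule sum.cong[OF refl])
    fix k assume "k \<in> {..<m}"
    then show "Lap (\<lambda>s. C\<^sup>2 * real m * (f (c k * s))\<^sup>2) (\<theta> * \<epsilon>) = C\<^sup>2 * real m * Lap (\<lambda>s. (f (c k * s))\<^sup>2) (\<theta> * \<epsilon>)"
      using Lap_lincomb[OF gk gk lt, of k k "C\<^sup>2 * real m" 0] by simp
  qed
  also have "\<dots> \<le> (\<Sum>k<m. C\<^sup>2 * real m * (2 * ?L))"
    by (intro sum_mono mult_left_mono Lk) auto
  also have "\<dots> = 2 * C\<^sup>2 * (real m)\<^sup>2 * ?L" by (simp add: power2_eq_square)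
  finally have dbl: "Lap (\<lambda>t. (f t)\<^sup>2) (\<theta> * \<epsilon>) \<le> 2 * C\<^sup>2 * (real m)\<^sup>2 * ?L" .
  define P where "P = (real k / (\<epsilon> * (1 - \<theta>))) ^ k"
  have P0: "P \<ge> 0" using \<epsilon> \<theta> by (simp add: P_def)
  have "Lap (\<lambda>t. t ^ k * (f t)\<^sup>2) \<epsilon> \<le> Lap (\<lambda>t. P * (f t)\<^sup>2 + 0 * (f t)\<^sup>2) (\<theta> * \<epsilon>)"
  proof (rule Lap_mono)
    show "exp_growth (\<epsilon> / 2) (\<lambda>t. t ^ k * (f t)\<^sup>2)"
      by (rule exp_growth_power_mult[OF gr[of "\<epsilon> / 4"]]) (use \<epsilon> in auto)
    show "exp_growth (\<theta> * \<epsilon> / 2) (\<lambda>t. P * (f t)\<^sup>2 + 0 * (f t)\<^sup>2)"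
      by (intro exp_growth_lincomb gr) (use te in auto)
    show "exp (- \<epsilon> * t) * (t ^ k * (f t)\<^sup>2) \<le> exp (- (\<theta> * \<epsilon>) * t) * (P * (f t)\<^sup>2 + 0 * (f t)\<^sup>2)" if "t \<ge> 0" for t
    proof -
      have "t ^ k * exp (- (\<epsilon> * (1 - \<theta>)) * t) \<le> P"
        unfolding P_def by (rule power_exp_weight_bound) (use \<epsilon> \<theta> mr that in auto)
      then have "(t ^ k * exp (- (\<epsilon> * (1 - \<theta>)) * t)) * (exp (- (\<theta> * \<epsilon>) * t) * (f t)\<^sup>2) \<le> P * (exp (- (\<theta> * \<epsilon>) * t) * (f t)\<^sup>2)"
        by (intro mult_right_mono) auto
      moreover have "exp (- (\<epsilon> * (1 - \<theta>)) * t) * exp (- (\<theta> * \<epsilon>) * t) = exp (- \<epsilon> * t)"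
        by (simp add: algebra_simps flip: exp_add)
      then have "(t ^ k * exp (- (\<epsilon> * (1 - \<theta>)) * t)) * (exp (- (\<theta> * \<epsilon>) * t) * (f t)\<^sup>2) = exp (- \<epsilon> * t) * (t ^ k * (f t)\<^sup>2)"
        by (metis (no_types, opaque_lifting) mult.assoc mult.left_commute)
      ultimately have "exp (- \<epsilon> * t) * (t ^ k * (f t)\<^sup>2) \<le> P * (exp (- (\<theta> * \<epsilon>) * t) * (f t)\<^sup>2)"
        by (simp only:)
      then show ?thesis by (simp add: mult_ac)
    qed
  qed (use \<epsilon> te in auto)
  also have "\<dots> = P * Lap (\<lambda>t. (f t)\<^sup>2) (\<theta> * \<epsilon>)"
    using Lap_lincomb[OF gr[of "\<theta> * \<epsilon> / 2"] gr[of "\<theta> * \<epsilon> / 2"] lt, of P 0] te by simp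
  also have "\<dots> \<le> P * (2 * C\<^sup>2 * (real m)\<^sup>2 * ?L)" by (rule mult_left_mono[OF dbl P0])
  also have "P = (2 * real m * real k) ^ k / \<epsilon> ^ k"
    unfolding P_def \<theta>(3) by (simp add: power_divide[symmetric] mult_ac)
  finally show ?thesis by (simp add: mult_ac)
qed

section \<open>The low-gain Riccati solution\<close>

lemma psd_Cauchy_Schwarz:
  fixes a b c :: real
  assumes "\<And>s. a + 2 * s * b + s\<^sup>2 * c \<ge> 0"
  shows "\<bar>b\<bar> \<le> sqrt a * sqrt c"
proof -
  have a: "a \<ge> 0" using assms[of 0] by simp
  have c: "c \<ge> 0"
  proof (rule ccontr)
    assume "\<not> c \<ge> 0"
    then have c: "c < 0" by simp
    define s where "s = (2 * \<bar>b\<bar> + a + 1) / (- c) + 1"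
    have "(2 * \<bar>b\<bar> + a + 1) / (- c) \<ge> 0" using c a by (intro divide_nonneg_pos) auto
    then have s1: "s \<ge> 1" by (simp add: s_def)
    have "- c * (s - 1) = 2 * \<bar>b\<bar> + a + 1" using c by (simp add: s_def)
    then have "- c * s \<ge> 2 * \<bar>b\<bar> + a + 1" using c by (simp add: algebra_simps)
    then have "s * (- c * s) \<ge> s * (2 * \<bar>b\<bar> + a + 1)" using s1 by (intro mult_left_mono) auto
    moreover have "s * (a + 1) \<ge> 1 * (a + 1)" using s1 a by (intro mult_right_mono) auto
    moreover have "2 * s * b \<le> 2 * s * \<bar>b\<bar>" using s1 by (intro mult_left_mono) auto
    ultimately have "a + 2 * s * b + s\<^sup>2 * c \<le> -1" by (simp add: algebra_simps power2_eq_square)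
    then show False using assms[of s] by simp
  qed
  have "b\<^sup>2 \<le> a * c"
  proof (cases "c = 0")
    case True
    have "b = 0"
    proof (rule ccontr)
      assume "b \<noteq> 0"
      then have "2 * (- (a + 1) / (2 * b)) * b = - (a + 1)" by simp
      then show False using assms[of "- (a + 1) / (2 * b)"] True by simp
    qed
    then show ?thesis using True by simp
  next
    case False
    have "a + 2 * (- b / c) * b + (- b / c)\<^sup>2 * c \<ge> 0" by (rule assms)
    then have "a - b\<^sup>2 / c \<ge> 0" using False by (simp add: power2_eq_square field_simps)
    then show ?thesis using False c by (simp add: field_simps)
  qed
  then have "sqrt (b\<^sup>2) \<le> sqrt (a * c)" by (rule real_sqrt_le_mono)
  then show ?thesis by (simp add: real_sqrt_mult)
qed

text \<open>The component of the derivative orthogonal to \<open>Z\<close> is the derivative of a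
  function that vanishes identically. Used to reach the controllability vectors from the curve
  \<open>\<phi>\<close>.\<close>

lemma derivative_in_subspace:
  fixes g :: "real \<Rightarrow> 'a::euclidean_space"
  assumes "subspace Z" "\<And>t. t \<in> {0..1} \<Longrightarrow> g t \<in> Z" "t \<in> {0..1}" "(g has_vector_derivative D) (at t within {0..1})"
  shows "D \<in> Z"
proof -
  obtain y z where yz: "z \<in> span Z" "\<And>w. w \<in> span Z \<Longrightarrow> orthogonal y w" "D = z + y"
    using orthogonal_subspace_decomp_exists[of Z D] by blast
  have Z: "span Z = Z" using assms(1) by (simp add: span_eq_iff)
  have yg: "y \<bullet> g t = 0" if "t \<in> {0..1}" for t
    using yz(2) assms(2)[OF that] Z by (auto simp: orthogonal_def)
  have "((\<lambda>t. y \<bullet> g t) has_vector_derivative y \<bullet> D) (at t within {0..1})"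
    by (rule bounded_linear.has_vector_derivative[OF bounded_linear_inner_right assms(4)])
  moreover have "((\<lambda>t. y \<bullet> g t) has_vector_derivative 0) (at t within {0..1})"
    by (rule has_vector_derivative_transform[of t "{0..1}" _ "\<lambda>_. 0"]) (use assms(3) yg in auto)
  ultimately have "y \<bullet> D = 0"
    using vector_derivative_unique_within_closed_interval[of 0 1 t] assms(3) by fastforce
  moreover have "y \<bullet> z = 0" using yz(1,2) by (auto simp: orthogonal_def)
  ultimately have "y = 0" using yz(3) by (simp add: inner_add_right)
  then show ?thesis using yz Z by simp
qed

lemma inner_blinfun_derivative:
  fixes v :: "'b::real_inner"
  assumes "(M has_vector_derivative D) (at \<epsilon>)"
  shows "((\<lambda>\<epsilon>. v \<bullet> blinfun_apply (M \<epsilon>) w) has_real_derivative v \<bullet> blinfun_apply D w) (at \<epsilon>)"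
  unfolding has_real_derivative_iff_has_vector_derivative
  by (rule bounded_linear.has_vector_derivative[OF bounded_linear_inner_right],
      rule bounded_linear.has_vector_derivative[OF blinfun.bounded_linear_left assms])

text \<open>A block is kept inside the ambient space, as a subspace \<open>X\<close> with its
  orthogonal projection \<open>pr\<close>, so that blocks of different dimensions share one type.
  The condition \<open>A_pr\<close> makes \<open>A\<close> vanish on the orthogonal complement of
  \<open>X\<close>.\<close>

locale orth_block =
  fixes A pr :: "'a::euclidean_space \<Rightarrow> 'a" and b :: 'a and X :: "'a set"
  assumes linA: "linear A" and linpr: "linear pr"
    and pr_sym: "\<And>v w. pr v \<bullet> w = v \<bullet> pr w"
    and pr_mem: "\<And>v. pr v \<in> X" and pr_id: "\<And>v. v \<in> X \<Longrightarrow> pr v = v"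
    and A_pr: "\<And>v. A (pr v) = A v" and A_mem: "\<And>v. A v \<in> X"
    and b_mem: "b \<in> X"
begin

lemma pr_pr [simp]: "pr (pr v) = pr v" by (rule pr_id[OF pr_mem])

lemma pr_iff: "pr v = v \<longleftrightarrow> v \<in> X" using pr_id pr_mem[of v] by auto

lemma bl_pr: "bounded_linear pr" using linpr by (simp add: linear_conv_bounded_linear)

end

text \<open>\<open>Pd k\<close> stands for the \<open>k\<close>-th derivative of the Riccati solution \<open>P(\<epsilon>)\<close>, extended by zero to the orthogonal
  complement of \<open>X\<close>.\<close>

locale low_gain = orth_block A pr b X
  for A pr :: "'a::euclidean_space \<Rightarrow> 'a" and b :: 'a and X :: "'a set" +
  fixes Pd :: "nat \<Rightarrow> real \<Rightarrow> 'a \<Rightarrow>\<^sub>L 'a"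
  assumes Pd_deriv: "\<And>k \<epsilon>. 0 < \<epsilon> \<Longrightarrow> \<epsilon> < 1 \<Longrightarrow> (Pd k has_vector_derivative Pd (Suc k) \<epsilon>) (at \<epsilon>)"
    and Pd_sym: "\<And>k \<epsilon> v w. 0 < \<epsilon> \<Longrightarrow> \<epsilon> < 1 \<Longrightarrow> v \<bullet> Pd k \<epsilon> w = w \<bullet> Pd k \<epsilon> v"
    and Pd_bound: "\<And>k. \<exists>C\<ge>0. \<forall>\<epsilon> v w. 0 < \<epsilon> \<longrightarrow> \<epsilon> < 1 \<longrightarrow>
        \<bar>v \<bullet> Pd k \<epsilon> w\<bar> \<le> C / \<epsilon> ^ k * (sqrt (v \<bullet> Pd 0 \<epsilon> v) * sqrt (w \<bullet> Pd 0 \<epsilon> w))"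
    and P_up: "\<exists>C>0. \<forall>\<epsilon> v. 0 < \<epsilon> \<longrightarrow> \<epsilon> < 1 \<longrightarrow> v \<bullet> Pd 0 \<epsilon> v \<le> C * \<epsilon> * (norm v)\<^sup>2"
    and P_pos: "\<And>\<epsilon> v. 0 < \<epsilon> \<Longrightarrow> \<epsilon> < 1 \<Longrightarrow> v \<bullet> Pd 0 \<epsilon> v \<ge> 0"
    and P1_pos: "\<And>\<epsilon> v. 0 < \<epsilon> \<Longrightarrow> \<epsilon> < 1 \<Longrightarrow> v \<bullet> Pd 1 \<epsilon> v \<ge> 0"
    and P_low: "\<And>\<epsilon>0. 0 < \<epsilon>0 \<Longrightarrow> \<exists>K>0. \<forall>\<epsilon> v. \<epsilon>0 \<le> \<epsilon> \<longrightarrow> \<epsilon> < 1 \<longrightarrow> v \<in> X \<longrightarrow> (norm v)\<^sup>2 \<le> K * (v \<bullet> Pd 0 \<epsilon> v)"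
    and P_pr: "\<And>\<epsilon> v. 0 < \<epsilon> \<Longrightarrow> \<epsilon> < 1 \<Longrightarrow> Pd 0 \<epsilon> (pr v) = Pd 0 \<epsilon> v"
    and riccati: "\<And>\<epsilon> v w. 0 < \<epsilon> \<Longrightarrow> \<epsilon> < 1 \<Longrightarrow>
        v \<bullet> Pd 0 \<epsilon> (A w) + A v \<bullet> Pd 0 \<epsilon> w + \<epsilon> * (v \<bullet> Pd 0 \<epsilon> w) = (v \<bullet> Pd 0 \<epsilon> b) * (b \<bullet> Pd 0 \<epsilon> w)"

text \<open>The curve \<open>\<phi>\<close> is \<open>exp (- t A) b\<close> and \<open>At\<close> is
  the adjoint of \<open>A\<close>. The Turan inequalities hold with the same \<open>C\<close> and
  \<open>m\<close> for all test vectors \<open>v\<close>; together with \<open>growth\<close> they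
  are all that is retained of the imaginary spectrum.\<close>

locale gram = orth_block A pr b X
  for A pr :: "'a::euclidean_space \<Rightarrow> 'a" and b :: 'a and X :: "'a set" +
  fixes At :: "'a \<Rightarrow> 'a" and \<phi> :: "real \<Rightarrow> 'a" and C :: real and m :: nat
  assumes linAt: "linear At" and adj: "\<And>v w. A v \<bullet> w = v \<bullet> At w" and At_mem: "\<And>v. At v \<in> X"
    and ctr: "X \<subseteq> span (range (\<lambda>k. (A ^^ k) b))"
    and phi0: "\<phi> 0 = b" and phi_d: "\<And>t. t \<ge> 0 \<Longrightarrow> (\<phi> has_vector_derivative - A (\<phi> t)) (at t within {0..})"
    and phi_mem: "\<And>t. t \<ge> 0 \<Longrightarrow> \<phi> t \<in> X"
    and growth: "\<And>\<gamma> v. \<gamma> > 0 \<Longrightarrow> exp_growth \<gamma> (\<lambda>t. v \<bullet> \<phi> t)"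
    and m: "m \<ge> 1"
    and T1: "\<And>v t h. t \<ge> 0 \<Longrightarrow> h \<ge> 0 \<Longrightarrow> \<bar>v \<bullet> \<phi> t\<bar> \<le> C * (\<Sum>k=1..m. \<bar>v \<bullet> \<phi> (t + real k * h)\<bar>)"
    and T2: "\<And>v t h. t \<ge> 0 \<Longrightarrow> h \<ge> 0 \<Longrightarrow> \<bar>v \<bullet> \<phi> (t + real m * h)\<bar> \<le> C * (\<Sum>k<m. \<bar>v \<bullet> \<phi> (t + real k * h)\<bar>)"
begin

text \<open>The bilinear form of the Gramian with the extra weight \<open>t ^ k\<close>: up to the
  sign \<open>(-1) ^ k\<close>, its \<open>k\<close>-th derivative in
  \<open>\<epsilon>\<close>.\<close>

definition Bf :: "nat \<Rightarrow> 'a \<Rightarrow> 'a \<Rightarrow> real \<Rightarrow> real" where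
  "Bf k v w \<epsilon> = Lap (\<lambda>t. t ^ k * ((v \<bullet> \<phi> t) * (w \<bullet> \<phi> t))) \<epsilon>"

lemma growth2: "\<gamma> > 0 \<Longrightarrow> exp_growth \<gamma> (\<lambda>t. t ^ k * ((v \<bullet> \<phi> t) * (w \<bullet> \<phi> t)))"
  using exp_growth_power_mult[OF exp_growth_mult[OF growth[of "\<gamma> / 4" v] growth[of "\<gamma> / 4" w]], of \<gamma> k] by simp

lemma growth_sq: "\<gamma> > 0 \<Longrightarrow> exp_growth \<gamma> (\<lambda>t. (v \<bullet> \<phi> t)\<^sup>2)"
  using growth2[of \<gamma> 0 v v] by (simp add: power2_eq_square)

lemma Bf_sym: "Bf k v w \<epsilon> = Bf k w v \<epsilon>" by (simp add: Bf_def mult.commute)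

lemma Bf_sq: "Bf 0 v v \<epsilon> = Lap (\<lambda>t. (v \<bullet> \<phi> t)\<^sup>2) \<epsilon>" by (simp add: Bf_def power2_eq_square)

lemma Bf_sqk: "Bf k v v \<epsilon> = Lap (\<lambda>t. t ^ k * (v \<bullet> \<phi> t)\<^sup>2) \<epsilon>" by (simp add: Bf_def power2_eq_square)

lemma Bf_nonneg: "Bf k v v \<epsilon> \<ge> 0" unfolding Bf_sqk by (rule Lap_nonneg) simp

lemma Bf_lincomb: "\<epsilon> > 0 \<Longrightarrow> Bf k (c *\<^sub>R v + d *\<^sub>R v') w \<epsilon> = c * Bf k v w \<epsilon> + d * Bf k v' w \<epsilon>"
  unfolding Bf_def
  by (subst Lap_lincomb[OF growth2[of "\<epsilon> / 2"] growth2[of "\<epsilon> / 2"], symmetric])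
     (auto simp: inner_add_left algebra_simps)

lemma Bf_linear: "\<epsilon> > 0 \<Longrightarrow> linear (\<lambda>v. Bf k v w \<epsilon>)"
  using Bf_lincomb[of \<epsilon> k 1 _ 1] Bf_lincomb[of \<epsilon> k _ _ 0] by (intro linearI) auto

lemma Bf_expand:
  assumes "\<epsilon> > 0"
  shows "Bf k v w \<epsilon> = (\<Sum>i\<in>Basis. (v \<bullet> i) * Bf k i w \<epsilon>)"
proof -
  have "Bf k v w \<epsilon> = Bf k (\<Sum>i\<in>Basis. (v \<bullet> i) *\<^sub>R i) w \<epsilon>" by (simp add: euclidean_representation)
  also have "\<dots> = (\<Sum>i\<in>Basis. (v \<bullet> i) * Bf k i w \<epsilon>)"
    by (simp only: linear_sum[OF Bf_linear[OF assms, of k w]] linear_scale[OF Bf_linear[OF assms, of k w]] real_scaleR_def)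
  finally show ?thesis .
qed

lemma Bf_Cauchy: 
  assumes "\<epsilon> > 0"
  shows "\<bar>Bf k v w \<epsilon>\<bar> \<le> sqrt (Bf k v v \<epsilon>) * sqrt (Bf k w w \<epsilon>)"
proof (rule psd_Cauchy_Schwarz)
  fix s
  have "0 \<le> Bf k (1 *\<^sub>R v + s *\<^sub>R w) (1 *\<^sub>R v + s *\<^sub>R w) \<epsilon>" by (rule Bf_nonneg)
  also have "\<dots> = Bf k v (1 *\<^sub>R v + s *\<^sub>R w) \<epsilon> + s * Bf k w (1 *\<^sub>R v + s *\<^sub>R w) \<epsilon>"
    by (subst Bf_lincomb[OF assms]) simp
  also have "Bf k v (1 *\<^sub>R v + s *\<^sub>R w) \<epsilon> = Bf k v v \<epsilon> + s * Bf k v w \<epsilon>"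
    by (subst Bf_sym, subst Bf_lincomb[OF assms]) (simp add: Bf_sym)
  also have "Bf k w (1 *\<^sub>R v + s *\<^sub>R w) \<epsilon> = Bf k v w \<epsilon> + s * Bf k w w \<epsilon>"
    by (subst Bf_sym, subst Bf_lincomb[OF assms]) (simp add: Bf_sym)
  finally show "0 \<le> Bf k v v \<epsilon> + 2 * s * Bf k v w \<epsilon> + s\<^sup>2 * Bf k w w \<epsilon>"
    by (simp add: algebra_simps power2_eq_square)
qed

definition El :: "'a \<Rightarrow> 'a \<Rightarrow> 'a \<Rightarrow>\<^sub>L 'a" where
  "El i j = Blinfun (\<lambda>v. (v \<bullet> j) *\<^sub>R i)"

lemma El_apply: "El i j v = (v \<bullet> j) *\<^sub>R i"
  unfolding El_def by (subst bounded_linear_Blinfun_apply) (auto intro!: bounded_linear_intros)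

text \<open>The operator of the form \<open>Bf k\<close>, written over the matrix units
  \<open>El i j\<close> so that differentiability in operator norm reduces to that of scalar
  entries.\<close>

definition S :: "nat \<Rightarrow> real \<Rightarrow> 'a \<Rightarrow>\<^sub>L 'a" where
  "S k \<epsilon> = (\<Sum>i\<in>Basis. \<Sum>j\<in>Basis. Bf k i j \<epsilon> *\<^sub>R El i j)"

lemma S_inner:
  assumes "\<epsilon> > 0"
  shows "v \<bullet> S k \<epsilon> w = Bf k v w \<epsilon>"
proof -
  have "v \<bullet> S k \<epsilon> w = (\<Sum>i\<in>Basis. \<Sum>j\<in>Basis. Bf k i j \<epsilon> * ((w \<bullet> j) * (v \<bullet> i)))"
    by (simp add: S_def blinfun.sum_left blinfun.scaleR_left El_apply inner_sum_right mult.assoc)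
  also have "\<dots> = (\<Sum>i\<in>Basis. (v \<bullet> i) * (\<Sum>j\<in>Basis. (w \<bullet> j) * Bf k j i \<epsilon>))"
    by (intro sum.cong refl, simp add: sum_distrib_left, intro sum.cong refl) (subst Bf_sym, simp)
  also have "\<dots> = (\<Sum>i\<in>Basis. (v \<bullet> i) * Bf k w i \<epsilon>)"
    by (subst Bf_expand[OF assms, of k w]) simp
  also have "\<dots> = (\<Sum>i\<in>Basis. (v \<bullet> i) * Bf k i w \<epsilon>)" by (simp add: Bf_sym[of k w])
  also have "\<dots> = Bf k v w \<epsilon>" by (rule Bf_expand[OF assms, symmetric])
  finally show ?thesis .
qed

lemma S_deriv:
  assumes "\<epsilon> > 0"
  shows "(S k has_vector_derivative - S (Suc k) \<epsilon>) (at \<epsilon>)"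
proof -
  have "((\<lambda>\<epsilon>. Bf k i j \<epsilon>) has_vector_derivative - Bf (Suc k) i j \<epsilon>) (at \<epsilon>)" for i j
    using Lap_has_derivative[OF growth2[of "\<epsilon> / 2" k i j]] assms
    by (simp add: Bf_def mult.assoc flip: has_real_derivative_iff_has_vector_derivative)
  then have "((\<lambda>\<epsilon>. Bf k i j \<epsilon> *\<^sub>R El i j) has_vector_derivative - Bf (Suc k) i j \<epsilon> *\<^sub>R El i j) (at \<epsilon>)" for i j
    by (rule bounded_linear.has_vector_derivative[OF bounded_linear_scaleR_left])
  then have "(S k has_vector_derivative (\<Sum>i\<in>Basis. \<Sum>j\<in>Basis. - Bf (Suc k) i j \<epsilon> *\<^sub>R El i j)) (at \<epsilon>)"
    unfolding S_def[abs_def] by (intro has_vector_derivative_sum)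
  then show ?thesis by (simp add: S_def sum_negf)
qed

lemma pr_phi: "t \<ge> 0 \<Longrightarrow> pr v \<bullet> \<phi> t = v \<bullet> \<phi> t"
  by (simp add: pr_sym pr_id[OF phi_mem])

lemma Bf_pr: "Bf k (pr v) w \<epsilon> = Bf k v w \<epsilon>"
  unfolding Bf_def by (rule Lap_cong) (simp add: pr_phi)

lemma S_mem: 
  assumes "\<epsilon> > 0"
  shows "S k \<epsilon> w \<in> X"
proof -
  have "v \<bullet> pr (S k \<epsilon> w) = v \<bullet> S k \<epsilon> w" for v
    using pr_sym[of v "S k \<epsilon> w"] assms by (simp add: S_inner Bf_pr)
  then have "pr (S k \<epsilon> w) = S k \<epsilon> w" by (metis vector_eq_ldot)
  then show ?thesis by (simp add: pr_iff)
qed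

lemma moment:
  obtains Ck where "Ck \<ge> 0" "\<And>v \<epsilon>. \<epsilon> > 0 \<Longrightarrow> Bf k v v \<epsilon> \<le> Ck / \<epsilon> ^ k * Bf 0 v v \<epsilon>"
proof
  show "(2 * real m * real k) ^ k * (2 * C\<^sup>2 * (real m)\<^sup>2) \<ge> 0" by simp
  fix v and \<epsilon> :: real assume "\<epsilon> > 0"
  then show "Bf k v v \<epsilon> \<le> (2 * real m * real k) ^ k * (2 * C\<^sup>2 * (real m)\<^sup>2) / \<epsilon> ^ k * Bf 0 v v \<epsilon>"
    unfolding Bf_sqk[of k] Bf_sq using turan_moment[OF growth_sq m T2] by simp
qed

text \<open>Each differentiation of the curve produces one more factor \<open>- A\<close>, and a
  subspace contains the derivatives of the curves inside it. At \<open>t = 0\<close> this yields the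
  controllability vectors.\<close>

lemma A_phi_span: "t \<in> {0..1} \<Longrightarrow> (A ^^ k) (\<phi> t) \<in> span (\<phi> ` {0..1})"
proof (induction k arbitrary: t)
  case 0
  then show ?case by (auto intro: span_base)
next
  case (Suc k)
  have lin: "linear (A ^^ k)" for k
  proof (induction k)
    case 0
    show ?case unfolding funpow.simps by (rule linear_id)
  next
    case (Suc k)
    then show ?case unfolding funpow.simps by (rule linear_compose[OF _ linA])
  qed
  have "(\<phi> has_vector_derivative - A (\<phi> t)) (at t within {0..1})"
    by (rule has_vector_derivative_within_subset[OF phi_d]) (use Suc.prems in auto)
  from bounded_linear.has_vector_derivative[OF lin[unfolded linear_conv_bounded_linear] this]
  have "((\<lambda>t. (A ^^ k) (\<phi> t)) has_vector_derivative (A ^^ k) (- A (\<phi> t))) (at t within {0..1})" .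
  from derivative_in_subspace[OF subspace_span Suc.IH Suc.prems this]
  have "(A ^^ k) (- A (\<phi> t)) \<in> span (\<phi> ` {0..1})" by simp
  then have "- (A ^^ Suc k) (\<phi> t) \<in> span (\<phi> ` {0..1})"
    by (simp add: linear_neg[OF lin] funpow_swap1)
  then show ?case using span_neg by fastforce
qed

text \<open>The vectors \<open>w\<close> whose products with \<open>v\<close> are controlled by the
  Gramian form in this way make up a subspace \<open>Y\<close>. It contains the curve on
  \<open>[0, 1]\<close> by \<open>turan_pointwise\<close>, hence the span of that curve, hence
  \<open>X\<close> by controllability. So on \<open>X\<close> the Gramian is at least of order
  \<open>1 / \<epsilon>\<close>.\<close>

lemma lower:
  obtains C2 where "C2 > 0" "\<And>v \<epsilon>. v \<in> X \<Longrightarrow> 0 < \<epsilon> \<Longrightarrow> \<epsilon> \<le> 1 \<Longrightarrow> (norm v)\<^sup>2 \<le> C2 * \<epsilon> * Bf 0 v v \<epsilon>"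
proof -
  define Y where "Y = {w. \<exists>K\<ge>0. \<forall>v \<epsilon>. 0 < \<epsilon> \<longrightarrow> \<epsilon> \<le> 1 \<longrightarrow> (v \<bullet> w)\<^sup>2 \<le> K * \<epsilon> * Bf 0 v v \<epsilon>}"
  have "subspace Y"
    unfolding subspace_def
  proof (intro conjI ballI allI)
    show "0 \<in> Y" by (auto simp: Y_def intro!: exI[of _ 0])
    fix x y assume "x \<in> Y" "y \<in> Y"
    then obtain K L where KL: "K \<ge> 0" "L \<ge> 0" "\<And>v \<epsilon>. 0 < \<epsilon> \<Longrightarrow> \<epsilon> \<le> 1 \<Longrightarrow> (v \<bullet> x)\<^sup>2 \<le> K * \<epsilon> * Bf 0 v v \<epsilon>"
       "\<And>v \<epsilon>. 0 < \<epsilon> \<Longrightarrow> \<epsilon> \<le> 1 \<Longrightarrow> (v \<bullet> y)\<^sup>2 \<le> L * \<epsilon> * Bf 0 v v \<epsilon>"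
      unfolding Y_def by blast
    have "(v \<bullet> (x + y))\<^sup>2 \<le> (2 * K + 2 * L) * \<epsilon> * Bf 0 v v \<epsilon>" if "0 < \<epsilon>" "\<epsilon> \<le> 1" for v \<epsilon>
    proof -
      have "(v \<bullet> (x + y))\<^sup>2 \<le> 2 * (v \<bullet> x)\<^sup>2 + 2 * (v \<bullet> y)\<^sup>2"
        using zero_le_power2[of "v \<bullet> x - v \<bullet> y"] by (simp add: inner_add_right power2_eq_square algebra_simps)
      also have "\<dots> \<le> 2 * (K * \<epsilon> * Bf 0 v v \<epsilon>) + 2 * (L * \<epsilon> * Bf 0 v v \<epsilon>)"
        using KL that by (intro add_mono mult_left_mono) auto
      finally show ?thesis by (simp add: algebra_simps)
    qed
    then show "x + y \<in> Y" unfolding Y_def using KL by (auto intro!: exI[of _ "2 * K + 2 * L"])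
  next
    fix c :: real and x assume "x \<in> Y"
    then obtain K where K: "K \<ge> 0" "\<And>v \<epsilon>. 0 < \<epsilon> \<Longrightarrow> \<epsilon> \<le> 1 \<Longrightarrow> (v \<bullet> x)\<^sup>2 \<le> K * \<epsilon> * Bf 0 v v \<epsilon>"
      unfolding Y_def by blast
    have "(v \<bullet> (c *\<^sub>R x))\<^sup>2 \<le> (c\<^sup>2 * K) * \<epsilon> * Bf 0 v v \<epsilon>" if "0 < \<epsilon>" "\<epsilon> \<le> 1" for v \<epsilon>
      using mult_left_mono[OF K(2)[OF that, of v], of "c\<^sup>2"] by (simp add: power_mult_distrib mult_ac)
    then show "c *\<^sub>R x \<in> Y" unfolding Y_def using K by (auto intro!: exI[of _ "c\<^sup>2 * K"])
  qed
  moreover have "\<phi> ` {0..1} \<subseteq> Y"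
  proof
    fix w assume "w \<in> \<phi> ` {0..1}"
    then obtain t where t: "t \<in> {0..1}" "w = \<phi> t" by auto
    have "(v \<bullet> w)\<^sup>2 \<le> (3 * C\<^sup>2 * real m ^ 3) * \<epsilon> * Bf 0 v v \<epsilon>" if "0 < \<epsilon>" "\<epsilon> \<le> 1" for v \<epsilon>
      unfolding Bf_sq t(2) by (rule turan_pointwise[OF growth_sq T1]) (use that t in auto)
    then show "w \<in> Y" unfolding Y_def by (auto intro!: exI[of _ "3 * C\<^sup>2 * real m ^ 3"])
  qed
  ultimately have sub: "span (\<phi> ` {0..1}) \<subseteq> Y" by (simp add: span_minimal)
  have "range (\<lambda>k. (A ^^ k) b) \<subseteq> span (\<phi> ` {0..1})"
    using A_phi_span[of 0] phi0 by auto
  then have "X \<subseteq> Y" using ctr sub span_mono[of "range (\<lambda>k. (A ^^ k) b)"] span_span by (metis order_trans)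
  then have "\<forall>i\<in>Basis. \<exists>K\<ge>0. \<forall>v \<epsilon>. 0 < \<epsilon> \<longrightarrow> \<epsilon> \<le> 1 \<longrightarrow> (v \<bullet> pr i)\<^sup>2 \<le> K * \<epsilon> * Bf 0 v v \<epsilon>"
    using pr_mem by (auto simp: Y_def subset_iff)
  then obtain K where K: "\<And>i. i \<in> Basis \<Longrightarrow> K i \<ge> 0"
    "\<And>i v \<epsilon>. i \<in> Basis \<Longrightarrow> 0 < \<epsilon> \<Longrightarrow> \<epsilon> \<le> 1 \<Longrightarrow> (v \<bullet> pr i)\<^sup>2 \<le> K i * \<epsilon> * Bf 0 v v \<epsilon>"
    by metis
  show ?thesis
  proof
    show "(\<Sum>i\<in>Basis. K i) + 1 > 0" using K by (simp add: sum_nonneg add_nonneg_pos)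
    fix v and \<epsilon> :: real assume v: "v \<in> X" and \<epsilon>: "0 < \<epsilon>" "\<epsilon> \<le> 1"
    have "(norm v)\<^sup>2 = (\<Sum>i\<in>Basis. (v \<bullet> i)\<^sup>2)" by (rule norm_eq_sqrt_inner[THEN arg_cong[of _ _ "\<lambda>x. x\<^sup>2"], THEN trans])
       (simp add: euclidean_inner[of v v] power2_eq_square sum_nonneg)
    also have "\<dots> = (\<Sum>i\<in>Basis. (v \<bullet> pr i)\<^sup>2)" using v by (simp flip: pr_sym add: pr_id)
    also have "\<dots> \<le> (\<Sum>i\<in>Basis. K i * \<epsilon> * Bf 0 v v \<epsilon>)" by (intro sum_mono K \<epsilon>)
    also have "\<dots> = (\<Sum>i\<in>Basis. K i) * \<epsilon> * Bf 0 v v \<epsilon>" by (simp add: sum_distrib_right)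
    also have "\<dots> \<le> ((\<Sum>i\<in>Basis. K i) + 1) * \<epsilon> * Bf 0 v v \<epsilon>"
      using \<epsilon> Bf_nonneg by (intro mult_right_mono) auto
    finally show "(norm v)\<^sup>2 \<le> ((\<Sum>i\<in>Basis. K i) + 1) * \<epsilon> * Bf 0 v v \<epsilon>" .
  qed
qed

text \<open>The Gramian vanishes on the orthogonal complement of \<open>X\<close>. Adding the
  projection onto that complement makes it invertible on the whole space, and the inverse restricted
  to \<open>X\<close> stays in \<open>X\<close>.\<close>

lemma P_exists:
  assumes \<epsilon>: "0 < \<epsilon>" "\<epsilon> < 1"
  shows "\<exists>Q :: 'a \<Rightarrow>\<^sub>L 'a. \<forall>v. S 0 \<epsilon> (Q v) = pr v \<and> Q v \<in> X"
proof -
  obtain C2 where C2: "C2 > 0" "\<And>v \<epsilon>. v \<in> X \<Longrightarrow> 0 < \<epsilon> \<Longrightarrow> \<epsilon> \<le> 1 \<Longrightarrow> (norm v)\<^sup>2 \<le> C2 * \<epsilon> * Bf 0 v v \<epsilon>"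
    using lower by blast
  define W where "W = (\<lambda>v. S 0 \<epsilon> v + (v - pr v))"
  have linW: "linear W" unfolding W_def
    by (intro linear_compose_add linear_compose_sub linpr linear_id[unfolded id_def] bounded_linear.linear[OF blinfun.bounded_linear_right])
  have "inj W"
    unfolding linear_injective_0[OF linW]
  proof (intro allI impI)
    fix v assume "W v = 0"
    then have "v \<bullet> W v = 0" by simp
    moreover have "v \<bullet> (v - pr v) = (norm (v - pr v))\<^sup>2"
      by (simp add: power2_norm_eq_inner inner_diff_left inner_diff_right pr_sym)
    ultimately have "Bf 0 v v \<epsilon> + (norm (v - pr v))\<^sup>2 = 0" using \<epsilon> by (simp add: W_def inner_add_right S_inner)
    then have z: "Bf 0 v v \<epsilon> = 0" "(norm (v - pr v))\<^sup>2 = 0" using Bf_nonneg[of 0 v \<epsilon>] by (smt (verit) zero_le_power2)+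
    then have "v \<in> X" using pr_iff[of v] by simp
    then show "v = 0" using C2(2)[of v \<epsilon>] z \<epsilon> by simp
  qed
  then obtain g where g: "linear g" "\<And>x. W (g x) = x"
    using linear_injective_isomorphism[OF linW] by auto
  have bl: "bounded_linear (\<lambda>v. g (pr v))"
    using linear_compose[OF linpr g(1)] by (simp add: linear_conv_bounded_linear o_def)
  have "S 0 \<epsilon> (g (pr v)) = pr v \<and> g (pr v) \<in> X" for v
  proof -
    let ?y = "g (pr v)"
    have "pr (W ?y) = S 0 \<epsilon> ?y"
      using S_mem[of \<epsilon> 0 ?y] \<epsilon> by (simp add: W_def linear_add[OF linpr] linear_diff[OF linpr] pr_id)
    then have 1: "S 0 \<epsilon> ?y = pr v" using g(2) by simp
    then have "?y - pr ?y = 0" using g(2)[of "pr v"] by (simp add: W_def)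
    then show ?thesis using 1 pr_iff[of ?y] by simp
  qed
  then show ?thesis using bounded_linear_Blinfun_apply[OF bl] by metis
qed

definition P :: "real \<Rightarrow> 'a \<Rightarrow>\<^sub>L 'a" where
  "P \<epsilon> = (SOME Q :: 'a \<Rightarrow>\<^sub>L 'a. \<forall>v. S 0 \<epsilon> (Q v) = pr v \<and> Q v \<in> X)"

context
  fixes \<epsilon> :: real
  assumes \<epsilon>: "0 < \<epsilon>" "\<epsilon> < 1"
begin

lemma WP: "S 0 \<epsilon> (P \<epsilon> v) = pr v" and P_mem: "P \<epsilon> v \<in> X"
  using someI_ex[OF P_exists[OF \<epsilon>]] unfolding P_def by auto

lemma P_inner: "v \<bullet> P \<epsilon> w = Bf 0 (P \<epsilon> v) (P \<epsilon> w) \<epsilon>"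
proof -
  have "v \<bullet> P \<epsilon> w = pr v \<bullet> P \<epsilon> w" by (simp add: pr_sym pr_id[OF P_mem])
  also have "\<dots> = S 0 \<epsilon> (P \<epsilon> v) \<bullet> P \<epsilon> w" by (simp add: WP)
  also have "\<dots> = Bf 0 (P \<epsilon> v) (P \<epsilon> w) \<epsilon>" using \<epsilon> by (simp add: inner_commute S_inner Bf_sym)
  finally show ?thesis .
qed

lemma P_sym: "v \<bullet> P \<epsilon> w = w \<bullet> P \<epsilon> v"
  unfolding P_inner by (rule Bf_sym)

lemma P_nonneg: "v \<bullet> P \<epsilon> v \<ge> 0"
  unfolding P_inner by (rule Bf_nonneg)

lemma PW: "P \<epsilon> (S 0 \<epsilon> v) = pr v"
proof (rule vector_eq_ldot[THEN iffD1], rule allI)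
  fix u
  have "u \<bullet> P \<epsilon> (S 0 \<epsilon> v) = S 0 \<epsilon> v \<bullet> P \<epsilon> u" by (rule P_sym)
  also have "\<dots> = v \<bullet> S 0 \<epsilon> (P \<epsilon> u)" using \<epsilon> by (simp add: S_inner inner_commute[of "S 0 \<epsilon> v"] Bf_sym)
  also have "\<dots> = u \<bullet> pr v" unfolding WP by (metis inner_commute pr_sym)
  finally show "u \<bullet> P \<epsilon> (S 0 \<epsilon> v) = u \<bullet> pr v" .
qed

lemma P_pr': "P \<epsilon> (pr v) = P \<epsilon> v"
  by (rule vector_eq_ldot[THEN iffD1], rule allI)
     (metis P_mem P_sym pr_id pr_sym)

lemma P_Cauchy: "\<bar>v \<bullet> P \<epsilon> w\<bar> \<le> sqrt (v \<bullet> P \<epsilon> v) * sqrt (w \<bullet> P \<epsilon> w)"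
  unfolding P_inner using \<epsilon> by (intro Bf_Cauchy)

text \<open>The Lyapunov equation of the Gramian, evaluated at \<open>P v\<close> and
  \<open>P w\<close>, becomes the Riccati equation, because \<open>S 0\<close> cancels against
  \<open>P\<close>.\<close>

lemma riccati_P:
  "v \<bullet> P \<epsilon> (A w) + A v \<bullet> P \<epsilon> w + \<epsilon> * (v \<bullet> P \<epsilon> w) = (v \<bullet> P \<epsilon> b) * (b \<bullet> P \<epsilon> w)"
proof -
  \<comment> \<open>Integration by parts; the right side is the boundary term at time 0, where
    \<open>\<phi>\<close> equals \<open>b\<close>.\<close>
  have lyap: "Bf 0 (At x) y \<epsilon> + Bf 0 x (At y) \<epsilon> + \<epsilon> * Bf 0 x y \<epsilon> = (x \<bullet> b) * (y \<bullet> b)" for x y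
  proof -
    let ?H = "\<lambda>t. (x \<bullet> \<phi> t) * (y \<bullet> \<phi> t)"
    let ?f = "\<lambda>t. (At x \<bullet> \<phi> t) * (y \<bullet> \<phi> t)" and ?g = "\<lambda>t. (x \<bullet> \<phi> t) * (At y \<bullet> \<phi> t)"
    have gr: "exp_growth (\<epsilon> / 2) ?f" "exp_growth (\<epsilon> / 2) ?g" "exp_growth (\<epsilon> / 2) ?H"
      using growth2[of "\<epsilon> / 2" 0] \<epsilon> by auto
    have lt: "\<epsilon> / 2 < \<epsilon>" using \<epsilon> by simp
    have "Lap (\<lambda>t. (-1) * ?f t + (-1) * ?g t) \<epsilon> = \<epsilon> * Lap ?H \<epsilon> - ?H 0"
    proof (rule Lap_parts[OF gr(3) exp_growth_lincomb[OF gr(1,2)] lt])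
      fix t :: real assume t: "t \<ge> 0"
      have d: "((\<lambda>t. z \<bullet> \<phi> t) has_vector_derivative - (At z \<bullet> \<phi> t)) (at t within {0..})" for z
        using bounded_linear.has_vector_derivative[OF bounded_linear_inner_right phi_d[OF t], of z]
        by (simp add: inner_commute[of z] adj inner_commute[of "At z"])
      from has_vector_derivative_mult[OF d[of x] d[of y]]
      show "(?H has_vector_derivative - 1 * ?f t + - 1 * ?g t) (at t within {0..})"
        by (simp add: algebra_simps)
    qed
    moreover have "Lap (\<lambda>t. (-1) * ?f t + (-1) * ?g t) \<epsilon> = (-1) * Lap ?f \<epsilon> + (-1) * Lap ?g \<epsilon>"
      by (rule Lap_lincomb[OF gr(1,2) lt])
    ultimately show ?thesis by (simp add: Bf_def phi0)
  qed
  have "Bf 0 (At (P \<epsilon> v)) (P \<epsilon> w) \<epsilon> = At (P \<epsilon> v) \<bullet> S 0 \<epsilon> (P \<epsilon> w)" using \<epsilon> by (simp add: S_inner)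
  also have "\<dots> = P \<epsilon> v \<bullet> A (pr w)" by (metis WP adj inner_commute)
  also have "\<dots> = v \<bullet> P \<epsilon> (A w)" by (metis A_pr P_sym inner_commute)
  finally have 1: "Bf 0 (At (P \<epsilon> v)) (P \<epsilon> w) \<epsilon> = v \<bullet> P \<epsilon> (A w)" .
  have "Bf 0 (P \<epsilon> v) (At (P \<epsilon> w)) \<epsilon> = At (P \<epsilon> w) \<bullet> S 0 \<epsilon> (P \<epsilon> v)" using \<epsilon> by (simp add: S_inner Bf_sym)
  also have "\<dots> = A v \<bullet> P \<epsilon> w" by (metis WP adj inner_commute A_pr)
  finally have 2: "Bf 0 (P \<epsilon> v) (At (P \<epsilon> w)) \<epsilon> = A v \<bullet> P \<epsilon> w" .
  show ?thesis
    using lyap[of "P \<epsilon> v" "P \<epsilon> w"] unfolding 1 2 P_inner[of v w, symmetric]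
    by (metis P_sym inner_commute)
qed

end

text \<open>The lower bound on the Gramian form, used at \<open>P v\<close>, bounds the square of
  the norm of \<open>P v\<close> by \<open>C2 * \<epsilon> * (v \<bullet> P v)\<close>;
  Cauchy-Schwarz then cancels one factor.\<close>

lemma P_upper:
  obtains C2 where "C2 > 0" "\<And>v \<epsilon>. 0 < \<epsilon> \<Longrightarrow> \<epsilon> < 1 \<Longrightarrow> norm (P \<epsilon> v) \<le> C2 * \<epsilon> * norm v"
proof -
  obtain C2 where C2: "C2 > 0" "\<And>v \<epsilon>. v \<in> X \<Longrightarrow> 0 < \<epsilon> \<Longrightarrow> \<epsilon> \<le> 1 \<Longrightarrow> (norm v)\<^sup>2 \<le> C2 * \<epsilon> * Bf 0 v v \<epsilon>"
    using lower by blast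
  show ?thesis
  proof (rule that[OF C2(1)])
    fix v \<epsilon> assume \<epsilon>: "0 < \<epsilon>" "\<epsilon> < (1::real)"
    have "(norm (P \<epsilon> v))\<^sup>2 \<le> C2 * \<epsilon> * (v \<bullet> P \<epsilon> v)"
      unfolding P_inner[OF \<epsilon>] using C2(2)[OF P_mem[OF \<epsilon>]] \<epsilon> by simp
    also have "\<dots> \<le> C2 * \<epsilon> * (norm v * norm (P \<epsilon> v))"
      using C2 \<epsilon> norm_cauchy_schwarz[of v "P \<epsilon> v"] by (intro mult_left_mono) auto
    finally have "norm (P \<epsilon> v) * norm (P \<epsilon> v) \<le> (C2 * \<epsilon> * norm v) * norm (P \<epsilon> v)"
      by (simp add: power2_eq_square mult_ac)
    then show "norm (P \<epsilon> v) \<le> C2 * \<epsilon> * norm v"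
      using C2 \<epsilon> by (cases "norm (P \<epsilon> v) = 0") (auto dest: mult_right_le_imp_le simp: mult_nonneg_nonneg)
  qed
qed

text \<open>The resolvent identity \<open>P \<delta> - P \<epsilon> = P \<delta> o (S 0 \<epsilon> -
  S 0 \<delta>) o P \<epsilon>\<close> together with the uniform norm bound \<open>C2\<close> gives
  first continuity of \<open>P\<close> and then, inserted a second time, the derivative.\<close>

lemma P_deriv:
  assumes \<epsilon>: "0 < \<epsilon>" "\<epsilon> < 1"
  shows "(P has_vector_derivative (P \<epsilon> o\<^sub>L S 1 \<epsilon> o\<^sub>L P \<epsilon>)) (at \<epsilon>)"
proof -
  obtain C2 where C2: "C2 > 0" "\<And>v \<epsilon>. 0 < \<epsilon> \<Longrightarrow> \<epsilon> < 1 \<Longrightarrow> norm (P \<epsilon> v) \<le> C2 * \<epsilon> * norm v"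
    using P_upper by blast
  have Pn: "norm (P \<delta>) \<le> C2" if "0 < \<delta>" "\<delta> < 1" for \<delta>
  proof (rule norm_blinfun_bound)
    fix v
    have "norm (P \<delta> v) \<le> C2 * \<delta> * norm v" by (rule C2(2)[OF that])
    also have "\<dots> \<le> C2 * norm v" using C2 that by (intro mult_right_mono) auto
    finally show "norm (P \<delta> v) \<le> C2 * norm v" .
  qed (use C2 in auto)
  have diff: "P \<delta> - P \<epsilon> = P \<delta> o\<^sub>L (S 0 \<epsilon> - S 0 \<delta>) o\<^sub>L P \<epsilon>" if "0 < \<delta>" "\<delta> < 1" for \<delta>
    by (rule blinfun_eqI)
       (simp add: blinfun.diff_left blinfun.diff_right WP[OF \<epsilon>] PW[OF that] P_pr'[OF that] pr_id[OF P_mem[OF \<epsilon>]])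
  have Sd: "(S 0 has_derivative (\<lambda>h. h *\<^sub>R (- S 1 \<epsilon>))) (at \<epsilon>)"
    using S_deriv[of \<epsilon> 0] \<epsilon> by (simp add: has_vector_derivative_def)
  have Sc: "(S 0 \<longlongrightarrow> S 0 \<epsilon>) (at \<epsilon>)"
    using has_derivative_continuous[OF Sd] by (simp add: continuous_within)
  have ev: "\<forall>\<^sub>F \<delta> in at \<epsilon>. 0 < \<delta> \<and> \<delta> < 1"
    using eventually_at_in_open'[of "{0<..<1}" \<epsilon>] \<epsilon> by auto
  define R where "R = (\<lambda>\<delta>. S 0 \<epsilon> - S 0 \<delta> - (\<delta> - \<epsilon>) *\<^sub>R S 1 \<epsilon>)"
  have Rl: "((\<lambda>\<delta>. norm (R \<delta>) / norm (\<delta> - \<epsilon>)) \<longlongrightarrow> 0) (at \<epsilon>)"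
  proof -
    have "((\<lambda>\<delta>. norm (S 0 \<delta> - S 0 \<epsilon> - (\<delta> - \<epsilon>) *\<^sub>R (- S 1 \<epsilon>)) / norm (\<delta> - \<epsilon>)) \<longlongrightarrow> 0) (at \<epsilon>)"
      using Sd unfolding has_derivative_iff_norm by blast
    moreover have "norm (S 0 \<delta> - S 0 \<epsilon> - (\<delta> - \<epsilon>) *\<^sub>R (- S 1 \<epsilon>)) = norm (R \<delta>)" for \<delta>
      unfolding R_def by (subst norm_minus_cancel[symmetric]) simp
    ultimately show ?thesis by simp
  qed
  define K where "K = norm (S 1 \<epsilon>) * C2"
  have "((\<lambda>\<delta>. C2 * (norm (R \<delta>) / norm (\<delta> - \<epsilon>)) * C2 + (C2 * norm (S 0 \<epsilon> - S 0 \<delta>) * C2) * K) \<longlongrightarrow> C2 * 0 * C2 + (C2 * norm (S 0 \<epsilon> - S 0 \<epsilon>) * C2) * K) (at \<epsilon>)"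
    by (intro tendsto_intros Rl Sc)
  then have lim: "((\<lambda>\<delta>. C2 * (norm (R \<delta>) / norm (\<delta> - \<epsilon>)) * C2 + (C2 * norm (S 0 \<epsilon> - S 0 \<delta>) * C2) * K) \<longlongrightarrow> 0) (at \<epsilon>)" by simp
  let ?D = "P \<epsilon> o\<^sub>L S 1 \<epsilon> o\<^sub>L P \<epsilon>"
  have est: "norm (norm (P \<delta> - P \<epsilon> - (\<delta> - \<epsilon>) *\<^sub>R ?D) / norm (\<delta> - \<epsilon>))
      \<le> C2 * (norm (R \<delta>) / norm (\<delta> - \<epsilon>)) * C2 + (C2 * norm (S 0 \<epsilon> - S 0 \<delta>) * C2) * K"
    if \<delta>: "0 < \<delta>" "\<delta> < 1" "\<delta> \<noteq> \<epsilon>" for \<delta>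
  proof -
    have comp: "norm (a o\<^sub>L c o\<^sub>L d) \<le> norm a * norm c * norm d" for a c d :: "'a \<Rightarrow>\<^sub>L 'a"
      by (rule order_trans[OF norm_blinfun_compose], intro mult_right_mono norm_blinfun_compose) simp
    have nd: "norm (P \<delta> - P \<epsilon>) \<le> C2 * norm (S 0 \<epsilon> - S 0 \<delta>) * C2"
      unfolding diff[OF \<delta>(1,2)] 
      by (rule order_trans[OF comp]) (intro mult_mono Pn \<epsilon> \<delta> order_refl mult_nonneg_nonneg norm_ge_zero; use C2 in simp)
    have "P \<delta> - P \<epsilon> - (\<delta> - \<epsilon>) *\<^sub>R ?D = (P \<delta> o\<^sub>L R \<delta> o\<^sub>L P \<epsilon>) + (\<delta> - \<epsilon>) *\<^sub>R ((P \<delta> - P \<epsilon>) o\<^sub>L S 1 \<epsilon> o\<^sub>L P \<epsilon>)"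
    proof (rule blinfun_eqI)
      fix i
      have "(P \<delta> - P \<epsilon>) i = (P \<delta> o\<^sub>L (S 0 \<epsilon> - S 0 \<delta>) o\<^sub>L P \<epsilon>) i"
        unfolding diff[OF \<delta>(1,2)] ..
      then have "P \<delta> i - P \<epsilon> i = P \<delta> (S 0 \<epsilon> (P \<epsilon> i)) - P \<delta> (S 0 \<delta> (P \<epsilon> i))"
        by (simp add: blinfun.diff_left blinfun.diff_right)
      then show "(P \<delta> - P \<epsilon> - (\<delta> - \<epsilon>) *\<^sub>R ?D) i
          = ((P \<delta> o\<^sub>L R \<delta> o\<^sub>L P \<epsilon>) + (\<delta> - \<epsilon>) *\<^sub>R ((P \<delta> - P \<epsilon>) o\<^sub>L S 1 \<epsilon> o\<^sub>L P \<epsilon>)) i"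
        by (simp add: R_def blinfun.diff_left blinfun.diff_right blinfun.add_left blinfun.scaleR_left blinfun.scaleR_right scaleR_right_diff_distrib)
    qed
    then have "norm (P \<delta> - P \<epsilon> - (\<delta> - \<epsilon>) *\<^sub>R ?D)
        \<le> norm (P \<delta> o\<^sub>L R \<delta> o\<^sub>L P \<epsilon>) + norm ((\<delta> - \<epsilon>) *\<^sub>R ((P \<delta> - P \<epsilon>) o\<^sub>L S 1 \<epsilon> o\<^sub>L P \<epsilon>))"
      by (simp only: norm_triangle_ineq)
    also have "\<dots> \<le> norm (P \<delta>) * norm (R \<delta>) * norm (P \<epsilon>) + \<bar>\<delta> - \<epsilon>\<bar> * (norm (P \<delta> - P \<epsilon>) * norm (S 1 \<epsilon>) * norm (P \<epsilon>))"
      unfolding norm_scaleR by (intro add_mono mult_left_mono comp) auto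
    also have "\<dots> \<le> C2 * norm (R \<delta>) * C2 + \<bar>\<delta> - \<epsilon>\<bar> * ((C2 * norm (S 0 \<epsilon> - S 0 \<delta>) * C2) * norm (S 1 \<epsilon>) * C2)"
      by (intro add_mono mult_mono Pn \<epsilon> \<delta> nd order_refl mult_nonneg_nonneg norm_ge_zero abs_ge_zero; use C2 in simp)
    finally have "norm (P \<delta> - P \<epsilon> - (\<delta> - \<epsilon>) *\<^sub>R ?D) / \<bar>\<delta> - \<epsilon>\<bar>
      \<le> (C2 * norm (R \<delta>) * C2 + \<bar>\<delta> - \<epsilon>\<bar> * ((C2 * norm (S 0 \<epsilon> - S 0 \<delta>) * C2) * norm (S 1 \<epsilon>) * C2)) / \<bar>\<delta> - \<epsilon>\<bar>"
      by (rule divide_right_mono) simp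
    also have "\<dots> = C2 * (norm (R \<delta>) / norm (\<delta> - \<epsilon>)) * C2 + (C2 * norm (S 0 \<epsilon> - S 0 \<delta>) * C2) * K"
      using \<delta>(3) by (simp add: K_def add_divide_distrib mult.assoc)
    finally show ?thesis by simp
  qed
  have "((\<lambda>\<delta>. norm (P \<delta> - P \<epsilon> - (\<delta> - \<epsilon>) *\<^sub>R ?D) / norm (\<delta> - \<epsilon>)) \<longlongrightarrow> 0) (at \<epsilon>)"
    by (rule Lim_null_comparison[OF _ lim]) (use ev est in \<open>auto simp: eventually_at_filter elim!: eventually_mono\<close>)
  then show ?thesis
    unfolding has_vector_derivative_def has_derivative_iff_norm by (simp add: bounded_linear_scaleR_left)
qed

text \<open>\<open>M\<close> is dominated by \<open>P / \<epsilon> ^ k\<close> as a form. The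
  comparison is with \<open>P\<close> and not with the norm, because \<open>P(\<epsilon>)\<close>
  may tend to 0 at different rates in different directions.\<close>

definition sP :: "nat \<Rightarrow> (real \<Rightarrow> 'a \<Rightarrow>\<^sub>L 'a) \<Rightarrow> bool" where
  "sP k M \<longleftrightarrow> (\<exists>K\<ge>0. \<forall>\<epsilon> v w. 0 < \<epsilon> \<longrightarrow> \<epsilon> < 1 \<longrightarrow>
     \<bar>v \<bullet> M \<epsilon> w\<bar> \<le> K / \<epsilon> ^ k * (sqrt (v \<bullet> P \<epsilon> v) * sqrt (w \<bullet> P \<epsilon> w)))"

lemma sP_P: "sP 0 P"
  unfolding sP_def using P_Cauchy by (intro exI[of _ 1]) auto

lemma sP_add:
  assumes "sP k M" "sP k N"
  shows "sP k (\<lambda>\<epsilon>. M \<epsilon> + N \<epsilon>)"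
proof -
  obtain K where K: "K \<ge> 0" "\<And>\<epsilon> v w. 0 < \<epsilon> \<Longrightarrow> \<epsilon> < 1 \<Longrightarrow>
     \<bar>v \<bullet> M \<epsilon> w\<bar> \<le> K / \<epsilon> ^ k * (sqrt (v \<bullet> P \<epsilon> v) * sqrt (w \<bullet> P \<epsilon> w))"
    using assms(1) unfolding sP_def by blast
  obtain L where L: "L \<ge> 0" "\<And>\<epsilon> v w. 0 < \<epsilon> \<Longrightarrow> \<epsilon> < 1 \<Longrightarrow>
     \<bar>v \<bullet> N \<epsilon> w\<bar> \<le> L / \<epsilon> ^ k * (sqrt (v \<bullet> P \<epsilon> v) * sqrt (w \<bullet> P \<epsilon> w))"
    using assms(2) unfolding sP_def by blast
  have "\<bar>v \<bullet> (M \<epsilon> + N \<epsilon>) w\<bar> \<le> (K + L) / \<epsilon> ^ k * (sqrt (v \<bullet> P \<epsilon> v) * sqrt (w \<bullet> P \<epsilon> w))"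
    if "0 < \<epsilon>" "\<epsilon> < 1" for \<epsilon> v w
  proof -
    have "\<bar>v \<bullet> (M \<epsilon> + N \<epsilon>) w\<bar> \<le> \<bar>v \<bullet> M \<epsilon> w\<bar> + \<bar>v \<bullet> N \<epsilon> w\<bar>"
      by (simp add: blinfun.add_left inner_add_right)
    also have "\<dots> \<le> K / \<epsilon> ^ k * (sqrt (v \<bullet> P \<epsilon> v) * sqrt (w \<bullet> P \<epsilon> w)) + L / \<epsilon> ^ k * (sqrt (v \<bullet> P \<epsilon> v) * sqrt (w \<bullet> P \<epsilon> w))"
      by (intro add_mono K(2) L(2) that)
    also have "\<dots> = (K + L) / \<epsilon> ^ k * (sqrt (v \<bullet> P \<epsilon> v) * sqrt (w \<bullet> P \<epsilon> w))"
      by (simp add: add_divide_distrib distrib_right)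
    finally show ?thesis .
  qed
  then show ?thesis unfolding sP_def using K L by (intro exI[of _ "K + L"]) auto
qed

lemma sP_minus: "sP k M \<Longrightarrow> sP k (\<lambda>\<epsilon>. - M \<epsilon>)"
  unfolding sP_def by (simp add: blinfun.minus_left)

text \<open>Duality between \<open>P\<close> and the Gramian: the hypothesis is tested with
  \<open>v = S 0 (M w)\<close>, whose size measured by \<open>P\<close> equals the size of
  \<open>M w\<close> measured by the Gramian, and one such factor cancels.\<close>

lemma sP_W_bound:
  assumes \<epsilon>: "0 < \<epsilon>" "\<epsilon> < 1" and K: "K \<ge> 0"
    and M: "\<And>v w. \<bar>v \<bullet> M w\<bar> \<le> K * (sqrt (v \<bullet> P \<epsilon> v) * sqrt (w \<bullet> P \<epsilon> w))"
  shows "sqrt (Bf 0 (M w) (M w) \<epsilon>) \<le> K * sqrt (w \<bullet> P \<epsilon> w)"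
proof -
  let ?x = "S 0 \<epsilon> (M w)" and ?n = "sqrt (Bf 0 (M w) (M w) \<epsilon>)"
  have n: "?n * ?n = Bf 0 (M w) (M w) \<epsilon>" by (simp add: Bf_nonneg)
  have x: "?x \<bullet> P \<epsilon> ?x = Bf 0 (M w) (M w) \<epsilon>"
  proof -
    have "?x \<bullet> P \<epsilon> ?x = pr ?x \<bullet> M w" using \<epsilon> by (simp add: PW pr_sym)
    also have "\<dots> = M w \<bullet> ?x" using \<epsilon> by (simp add: pr_id[OF S_mem] inner_commute)
    finally show ?thesis using \<epsilon> by (simp add: S_inner)
  qed
  have "?n * ?n = ?x \<bullet> M w" using \<epsilon> by (simp only: n) (simp add: S_inner inner_commute[of "S 0 \<epsilon> (M w)"])
  also have "\<dots> \<le> K * (?n * sqrt (w \<bullet> P \<epsilon> w))" using M[of ?x w] unfolding x by linarith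
  finally have "?n * ?n \<le> (K * sqrt (w \<bullet> P \<epsilon> w)) * ?n" by (simp only: mult_ac)
  note le = this
  have K0: "K * sqrt (w \<bullet> P \<epsilon> w) \<ge> 0" using K P_nonneg[OF \<epsilon>] by simp
  show ?thesis
  proof (cases "?n > 0")
    case True
    with le show ?thesis by (rule mult_right_le_imp_le)
  next
    case False
    then show ?thesis using K0 by linarith
  qed
qed

text \<open>The adjoint moves \<open>M\<close> to the left argument. Both outer arguments are then
  measured by the Gramian, where the moment inequality bounds the form of \<open>S k\<close> by
  \<open>1 / \<epsilon> ^ k\<close> times that of \<open>S 0\<close>.\<close>

lemma sP_comp:
  assumes "sP j M" "sP l N"
  shows "sP (j + k + l) (\<lambda>\<epsilon>. M \<epsilon> o\<^sub>L S k \<epsilon> o\<^sub>L N \<epsilon>)"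
proof -
  obtain K where K: "K \<ge> 0" "\<And>\<epsilon> v w. 0 < \<epsilon> \<Longrightarrow> \<epsilon> < 1 \<Longrightarrow>
     \<bar>v \<bullet> M \<epsilon> w\<bar> \<le> K / \<epsilon> ^ j * (sqrt (v \<bullet> P \<epsilon> v) * sqrt (w \<bullet> P \<epsilon> w))"
    using assms(1) unfolding sP_def by blast
  obtain L where L: "L \<ge> 0" "\<And>\<epsilon> v w. 0 < \<epsilon> \<Longrightarrow> \<epsilon> < 1 \<Longrightarrow>
     \<bar>v \<bullet> N \<epsilon> w\<bar> \<le> L / \<epsilon> ^ l * (sqrt (v \<bullet> P \<epsilon> v) * sqrt (w \<bullet> P \<epsilon> w))"
    using assms(2) unfolding sP_def by blast
  obtain Ck where Ck: "Ck \<ge> 0" "\<And>v \<epsilon>. \<epsilon> > 0 \<Longrightarrow> Bf k v v \<epsilon> \<le> Ck / \<epsilon> ^ k * Bf 0 v v \<epsilon>"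
    using moment by blast
  have "\<bar>v \<bullet> (M \<epsilon> o\<^sub>L S k \<epsilon> o\<^sub>L N \<epsilon>) w\<bar> \<le> (K * Ck * L) / \<epsilon> ^ (j + k + l) * (sqrt (v \<bullet> P \<epsilon> v) * sqrt (w \<bullet> P \<epsilon> w))"
    if \<epsilon>: "0 < \<epsilon>" "\<epsilon> < 1" for \<epsilon> v w
  proof -
    let ?a = "adjoint (M \<epsilon>) v"
    have adj: "x \<bullet> adjoint (M \<epsilon>) y = M \<epsilon> x \<bullet> y" for x y
      by (rule adjoint_works[OF bounded_linear.linear[OF blinfun.bounded_linear_right]])
    have "\<bar>x \<bullet> adjoint (M \<epsilon>) y\<bar> \<le> K / \<epsilon> ^ j * (sqrt (x \<bullet> P \<epsilon> x) * sqrt (y \<bullet> P \<epsilon> y))" for x y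
      using K(2)[OF \<epsilon>, of y x] unfolding adj by (simp add: inner_commute mult_ac)
    then have a: "sqrt (Bf 0 ?a ?a \<epsilon>) \<le> K / \<epsilon> ^ j * sqrt (v \<bullet> P \<epsilon> v)"
      using K(1) \<epsilon> by (intro sP_W_bound) auto
    have b: "sqrt (Bf 0 (N \<epsilon> w) (N \<epsilon> w) \<epsilon>) \<le> L / \<epsilon> ^ l * sqrt (w \<bullet> P \<epsilon> w)"
      using L \<epsilon> by (intro sP_W_bound) auto
    have "v \<bullet> (M \<epsilon> o\<^sub>L S k \<epsilon> o\<^sub>L N \<epsilon>) w = ?a \<bullet> S k \<epsilon> (N \<epsilon> w)"
      by (simp add: inner_commute[of ?a] adj inner_commute[of v])
    also have "\<dots> = Bf k ?a (N \<epsilon> w) \<epsilon>" using \<epsilon> by (simp add: S_inner)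
    finally have "\<bar>v \<bullet> (M \<epsilon> o\<^sub>L S k \<epsilon> o\<^sub>L N \<epsilon>) w\<bar> \<le> sqrt (Bf k ?a ?a \<epsilon>) * sqrt (Bf k (N \<epsilon> w) (N \<epsilon> w) \<epsilon>)"
      using Bf_Cauchy[OF \<epsilon>(1)] by simp
    also have "\<dots> \<le> sqrt (Ck / \<epsilon> ^ k * Bf 0 ?a ?a \<epsilon>) * sqrt (Ck / \<epsilon> ^ k * Bf 0 (N \<epsilon> w) (N \<epsilon> w) \<epsilon>)"
      using Ck \<epsilon> by (intro mult_mono real_sqrt_le_mono) (auto intro!: Bf_nonneg mult_nonneg_nonneg divide_nonneg_nonneg)
    also have "\<dots> = (Ck / \<epsilon> ^ k) * (sqrt (Bf 0 ?a ?a \<epsilon>) * sqrt (Bf 0 (N \<epsilon> w) (N \<epsilon> w) \<epsilon>))"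
    proof -
      define s where "s = sqrt (Ck / \<epsilon> ^ k)"
      have "s * s = Ck / \<epsilon> ^ k" using Ck(1) \<epsilon> by (simp add: s_def)
      then have "(s * x) * (s * y) = (Ck / \<epsilon> ^ k) * (x * y)" for x y by (metis mult.assoc mult.left_commute)
      then show ?thesis by (simp only: real_sqrt_mult s_def[symmetric])
    qed
    also have "\<dots> \<le> (Ck / \<epsilon> ^ k) * ((K / \<epsilon> ^ j * sqrt (v \<bullet> P \<epsilon> v)) * (L / \<epsilon> ^ l * sqrt (w \<bullet> P \<epsilon> w)))"
      using Ck K L \<epsilon> P_nonneg[OF \<epsilon>] by (intro mult_left_mono mult_mono a b) (auto intro!: mult_nonneg_nonneg Bf_nonneg)
    also have "\<dots> = (K * Ck * L) / \<epsilon> ^ (j + k + l) * (sqrt (v \<bullet> P \<epsilon> v) * sqrt (w \<bullet> P \<epsilon> w))"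
      by (simp add: power_add mult_ac)
    finally show ?thesis .
  qed
  then show ?thesis unfolding sP_def using K L Ck by (intro exI[of _ "K * Ck * L"]) auto
qed

text \<open>Since \<open>P' = P o S 1 o P\<close> and \<open>(S k)' = - S (k + 1)\<close>, differentiating stays within alternating words in \<open>P\<close> and \<open>S k\<close>.\<close>

inductive Wd :: "nat \<Rightarrow> (real \<Rightarrow> 'a \<Rightarrow>\<^sub>L 'a) \<Rightarrow> bool" where
  Wd_P: "Wd 0 P"
| Wd_comp: "Wd j M \<Longrightarrow> Wd l N \<Longrightarrow> n = j + Suc k + l \<Longrightarrow> Wd n (\<lambda>\<epsilon>. M \<epsilon> o\<^sub>L S (Suc k) \<epsilon> o\<^sub>L N \<epsilon>)"
| Wd_add: "Wd n M \<Longrightarrow> Wd n N \<Longrightarrow> Wd n (\<lambda>\<epsilon>. M \<epsilon> + N \<epsilon>)"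
| Wd_minus: "Wd n M \<Longrightarrow> Wd n (\<lambda>\<epsilon>. - M \<epsilon>)"

lemma Wd_bound: "Wd k M \<Longrightarrow> sP k M"
  by (induction rule: Wd.induct) (auto intro: sP_P sP_comp sP_add sP_minus simp del: add_Suc_right add_Suc)

lemma Wd_deriv: "Wd k M \<Longrightarrow> \<exists>D. Wd (Suc k) D \<and> (\<forall>\<epsilon>. 0 < \<epsilon> \<longrightarrow> \<epsilon> < 1 \<longrightarrow> (M has_vector_derivative D \<epsilon>) (at \<epsilon>))"
proof (induction rule: Wd.induct)
  case Wd_P
  have "Wd (Suc 0) (\<lambda>\<epsilon>. P \<epsilon> o\<^sub>L S (Suc 0) \<epsilon> o\<^sub>L P \<epsilon>)" by (rule Wd.Wd_comp[OF Wd.Wd_P Wd.Wd_P]) simp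
  then show ?case using P_deriv by auto
next
  case (Wd_comp j M l N n k)
  obtain M' where M': "Wd (Suc j) M'" "\<And>\<epsilon>. 0 < \<epsilon> \<Longrightarrow> \<epsilon> < 1 \<Longrightarrow> (M has_vector_derivative M' \<epsilon>) (at \<epsilon>)" using Wd_comp by blast
  obtain N' where N': "Wd (Suc l) N'" "\<And>\<epsilon>. 0 < \<epsilon> \<Longrightarrow> \<epsilon> < 1 \<Longrightarrow> (N has_vector_derivative N' \<epsilon>) (at \<epsilon>)" using Wd_comp by blast
  let ?D = "\<lambda>\<epsilon>. (M \<epsilon> o\<^sub>L S (Suc k) \<epsilon> o\<^sub>L N' \<epsilon>) + (- (M \<epsilon> o\<^sub>L S (Suc (Suc k)) \<epsilon> o\<^sub>L N \<epsilon>) + (M' \<epsilon> o\<^sub>L S (Suc k) \<epsilon> o\<^sub>L N \<epsilon>))"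
  have "Wd (Suc n) ?D"
  proof (intro Wd.Wd_add Wd.Wd_minus)
    show "Wd (Suc n) (\<lambda>\<epsilon>. M \<epsilon> o\<^sub>L S (Suc k) \<epsilon> o\<^sub>L N' \<epsilon>)"
      by (rule Wd.Wd_comp[OF Wd_comp.hyps(1) N'(1)]) (use Wd_comp in simp)
    show "Wd (Suc n) (\<lambda>\<epsilon>. M \<epsilon> o\<^sub>L S (Suc (Suc k)) \<epsilon> o\<^sub>L N \<epsilon>)"
      by (rule Wd.Wd_comp[OF Wd_comp.hyps(1,2)]) (use Wd_comp in simp)
    show "Wd (Suc n) (\<lambda>\<epsilon>. M' \<epsilon> o\<^sub>L S (Suc k) \<epsilon> o\<^sub>L N \<epsilon>)"
      by (rule Wd.Wd_comp[OF M'(1) Wd_comp.hyps(2)]) (use Wd_comp in simp)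
  qed
  moreover have "((\<lambda>\<epsilon>. M \<epsilon> o\<^sub>L S (Suc k) \<epsilon> o\<^sub>L N \<epsilon>) has_vector_derivative ?D \<epsilon>) (at \<epsilon>)" if \<epsilon>: "0 < \<epsilon>" "\<epsilon> < 1" for \<epsilon>
  proof -
    note bb = bounded_bilinear.has_vector_derivative[OF bounded_bilinear_blinfun_compose]
    have "((\<lambda>\<epsilon>. M \<epsilon> o\<^sub>L S (Suc k) \<epsilon> o\<^sub>L N \<epsilon>) has_vector_derivative
        ((M \<epsilon> o\<^sub>L S (Suc k) \<epsilon>) o\<^sub>L N' \<epsilon>) + (((M \<epsilon> o\<^sub>L (- S (Suc (Suc k)) \<epsilon>)) + (M' \<epsilon> o\<^sub>L S (Suc k) \<epsilon>)) o\<^sub>L N \<epsilon>)) (at \<epsilon>)"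
      by (rule bb[OF bb[OF M'(2)[OF \<epsilon>] S_deriv[OF \<epsilon>(1)]] N'(2)[OF \<epsilon>]])
    moreover have "((M \<epsilon> o\<^sub>L S (Suc k) \<epsilon>) o\<^sub>L N' \<epsilon>) + (((M \<epsilon> o\<^sub>L (- S (Suc (Suc k)) \<epsilon>)) + (M' \<epsilon> o\<^sub>L S (Suc k) \<epsilon>)) o\<^sub>L N \<epsilon>) = ?D \<epsilon>"
      by (rule blinfun_eqI) (simp add: blinfun.add_left blinfun.minus_left blinfun.minus_right blinfun.diff_left)
    ultimately show ?thesis by simp
  qed
  ultimately show ?case by blast
next
  case (Wd_add n M N)
  obtain M' where M': "Wd (Suc n) M'" "\<And>\<epsilon>. 0 < \<epsilon> \<Longrightarrow> \<epsilon> < 1 \<Longrightarrow> (M has_vector_derivative M' \<epsilon>) (at \<epsilon>)" using Wd_add by blast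
  obtain N' where N': "Wd (Suc n) N'" "\<And>\<epsilon>. 0 < \<epsilon> \<Longrightarrow> \<epsilon> < 1 \<Longrightarrow> (N has_vector_derivative N' \<epsilon>) (at \<epsilon>)" using Wd_add by blast
  show ?case
    by (intro exI[of _ "\<lambda>\<epsilon>. M' \<epsilon> + N' \<epsilon>"] conjI allI impI Wd.Wd_add M' N' has_vector_derivative_add)
next
  case (Wd_minus n M)
  obtain M' where M': "Wd (Suc n) M'" "\<And>\<epsilon>. 0 < \<epsilon> \<Longrightarrow> \<epsilon> < 1 \<Longrightarrow> (M has_vector_derivative M' \<epsilon>) (at \<epsilon>)" using Wd_minus by blast
  show ?case
    by (intro exI[of _ "\<lambda>\<epsilon>. - M' \<epsilon>"] conjI allI impI Wd.Wd_minus M' has_vector_derivative_minus)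
qed

theorem low_gain_exists: "\<exists>Pd. low_gain A pr b X Pd"
proof -
  define dop where "dop = (\<lambda>k M. SOME D. Wd (Suc k) D \<and> (\<forall>\<epsilon>. 0 < \<epsilon> \<longrightarrow> \<epsilon> < 1 \<longrightarrow> (M has_vector_derivative D \<epsilon>) (at \<epsilon>)))"
  define Pd where "Pd = rec_nat P dop"
  have Pd0: "Pd 0 = P" and PdS: "Pd (Suc k) = dop k (Pd k)" for k by (auto simp: Pd_def)
  have dop: "Wd (Suc k) (dop k M) \<and> (\<forall>\<epsilon>. 0 < \<epsilon> \<longrightarrow> \<epsilon> < 1 \<longrightarrow> (M has_vector_derivative dop k M \<epsilon>) (at \<epsilon>))" if "Wd k M" for k M
    unfolding dop_def by (rule someI_ex[OF Wd_deriv[OF that]])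
  have W: "Wd k (Pd k)" for k by (induction k) (auto simp: Pd0 PdS Wd_P dop)
  have deriv: "(Pd k has_vector_derivative Pd (Suc k) \<epsilon>) (at \<epsilon>)" if "0 < \<epsilon>" "\<epsilon> < 1" for k \<epsilon>
    using dop[OF W[of k]] that by (simp add: PdS)
  \<comment> \<open>The individual words need not be symmetric, so symmetry is inherited from
    \<open>P\<close> by uniqueness of derivatives.\<close>
  have sym: "\<forall>\<epsilon>. 0 < \<epsilon> \<longrightarrow> \<epsilon> < 1 \<longrightarrow> v \<bullet> Pd k \<epsilon> w = w \<bullet> Pd k \<epsilon> v" for k v w
  proof (induction k)
    case 0
    show ?case using P_sym by (simp add: Pd0)
  next
    case (Suc k)
    show ?case
    proof (intro allI impI)
      fix \<epsilon> :: real assume \<epsilon>: "0 < \<epsilon>" "\<epsilon> < 1"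
      have "((\<lambda>\<epsilon>. v \<bullet> Pd k \<epsilon> w) has_real_derivative v \<bullet> Pd (Suc k) \<epsilon> w) (at \<epsilon>)"
        by (rule inner_blinfun_derivative[OF deriv[OF \<epsilon>]])
      moreover have "((\<lambda>\<epsilon>. v \<bullet> Pd k \<epsilon> w) has_real_derivative w \<bullet> Pd (Suc k) \<epsilon> v) (at \<epsilon>)"
        by (rule has_field_derivative_transform_within_open[OF inner_blinfun_derivative[OF deriv[OF \<epsilon>], of w k v], of "{0<..<1}"])
           (use Suc \<epsilon> in auto)
      ultimately show "v \<bullet> Pd (Suc k) \<epsilon> w = w \<bullet> Pd (Suc k) \<epsilon> v" by (rule DERIV_unique)
    qed
  qed
  have P1: "Pd 1 \<epsilon> = P \<epsilon> o\<^sub>L S 1 \<epsilon> o\<^sub>L P \<epsilon>" if "0 < \<epsilon>" "\<epsilon> < 1" for \<epsilon>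
    using deriv[OF that, of 0] P_deriv[OF that] by (auto simp: Pd0 dest: vector_derivative_unique_at)
  show ?thesis
  proof (intro exI[of _ Pd] low_gain.intro low_gain_axioms.intro)
    show "orth_block A pr b X" by (rule orth_block_axioms)
    fix k :: nat and v w :: 'a
    show "\<exists>C\<ge>0. \<forall>\<epsilon> v w. 0 < \<epsilon> \<longrightarrow> \<epsilon> < 1 \<longrightarrow>
        \<bar>v \<bullet> Pd k \<epsilon> w\<bar> \<le> C / \<epsilon> ^ k * (sqrt (v \<bullet> Pd 0 \<epsilon> v) * sqrt (w \<bullet> Pd 0 \<epsilon> w))"
      using Wd_bound[OF W[of k]] unfolding sP_def Pd0 .
    show "\<exists>C>0. \<forall>\<epsilon> v. 0 < \<epsilon> \<longrightarrow> \<epsilon> < 1 \<longrightarrow> v \<bullet> Pd 0 \<epsilon> v \<le> C * \<epsilon> * (norm v)\<^sup>2"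
    proof -
      obtain C2 where C2: "C2 > 0" "\<And>v \<epsilon>. 0 < \<epsilon> \<Longrightarrow> \<epsilon> < 1 \<Longrightarrow> norm (P \<epsilon> v) \<le> C2 * \<epsilon> * norm v"
        using P_upper by blast
      have "v \<bullet> P \<epsilon> v \<le> C2 * \<epsilon> * (norm v)\<^sup>2" if "0 < \<epsilon>" "\<epsilon> < 1" for \<epsilon> v
      proof -
        have "v \<bullet> P \<epsilon> v \<le> norm v * norm (P \<epsilon> v)" by (rule norm_cauchy_schwarz)
        also have "\<dots> \<le> norm v * (C2 * \<epsilon> * norm v)" by (intro mult_left_mono C2(2) that) simp
        finally show ?thesis by (simp add: power2_eq_square mult_ac)
      qed
      then show ?thesis using C2(1) by (auto simp: Pd0)
    qed
    show "\<exists>K>0. \<forall>\<epsilon> v. \<epsilon>0 \<le> \<epsilon> \<longrightarrow> \<epsilon> < 1 \<longrightarrow> v \<in> X \<longrightarrow> (norm v)\<^sup>2 \<le> K * (v \<bullet> Pd 0 \<epsilon> v)" if "0 < \<epsilon>0" for \<epsilon>0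
    proof -
      \<comment> \<open>The Gramian form decreases in \<open>\<epsilon>\<close>, so its norm at
        \<open>\<epsilon>0\<close> serves for all larger parameters. Cauchy-Schwarz converts this
        upper bound for the Gramian into a lower bound for its inverse.\<close>
      define K where "K = norm (S 0 \<epsilon>0) + 1"
      have K: "K > 0" by (simp add: K_def add_nonneg_pos)
      have "(norm v)\<^sup>2 \<le> K * (v \<bullet> P \<epsilon> v)" if \<epsilon>: "\<epsilon>0 \<le> \<epsilon>" "\<epsilon> < 1" and v: "v \<in> X" for \<epsilon> v
      proof -
        have \<epsilon>': "0 < \<epsilon>" using \<epsilon> \<open>0 < \<epsilon>0\<close> by simp
        have "Bf 0 v v \<epsilon> \<le> Bf 0 v v \<epsilon>0"
          unfolding Bf_sq
        proof (rule Lap_mono[OF growth_sq[of "\<epsilon>0 / 2"] growth_sq[of "\<epsilon>0 / 2"]])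
          fix t :: real assume "t \<ge> 0"
          then show "exp (- \<epsilon> * t) * (v \<bullet> \<phi> t)\<^sup>2 \<le> exp (- \<epsilon>0 * t) * (v \<bullet> \<phi> t)\<^sup>2"
            using \<epsilon> mult_right_mono[of \<epsilon>0 \<epsilon> t] by (intro mult_right_mono) auto
        qed (use \<open>0 < \<epsilon>0\<close> \<epsilon> in auto)
        also have "\<dots> = v \<bullet> S 0 \<epsilon>0 v" using \<open>0 < \<epsilon>0\<close> by (simp add: S_inner)
        also have "\<dots> \<le> norm v * norm (S 0 \<epsilon>0 v)" by (rule norm_cauchy_schwarz)
        also have "\<dots> \<le> norm v * (K * norm v)"
        proof (rule mult_left_mono)
          show "norm (S 0 \<epsilon>0 v) \<le> K * norm v"
            using norm_blinfun[of "S 0 \<epsilon>0" v] norm_ge_zero[of v] unfolding K_def distrib_right by linarith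
        qed simp
        finally have B: "Bf 0 v v \<epsilon> \<le> K * (norm v)\<^sup>2" by (simp add: power2_eq_square mult_ac)
        have "(norm v)\<^sup>2 = v \<bullet> S 0 \<epsilon> (P \<epsilon> v)" using \<epsilon> \<epsilon>' v by (simp add: WP pr_id power2_norm_eq_inner)
        also have "\<dots> = Bf 0 v (P \<epsilon> v) \<epsilon>" using \<epsilon>' by (simp add: S_inner)
        also have "\<dots> \<le> sqrt (Bf 0 v v \<epsilon>) * sqrt (Bf 0 (P \<epsilon> v) (P \<epsilon> v) \<epsilon>)"
          using Bf_Cauchy[OF \<epsilon>', of 0 v "P \<epsilon> v"] by linarith
        also have "\<dots> \<le> sqrt (K * (norm v)\<^sup>2) * sqrt (v \<bullet> P \<epsilon> v)"
          unfolding P_inner[OF \<epsilon>' \<epsilon>(2), of v v] using B by (intro mult_right_mono real_sqrt_le_mono) (auto intro: Bf_nonneg)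
        finally have "((norm v)\<^sup>2)\<^sup>2 \<le> (sqrt (K * (norm v)\<^sup>2) * sqrt (v \<bullet> P \<epsilon> v))\<^sup>2"
          by (rule power_mono) simp
        also have "\<dots> = (K * (v \<bullet> P \<epsilon> v)) * (norm v)\<^sup>2"
          using K P_nonneg[OF \<epsilon>' \<epsilon>(2), of v] by (simp add: power_mult_distrib)
        finally have "(norm v)\<^sup>2 * (norm v)\<^sup>2 \<le> (K * (v \<bullet> P \<epsilon> v)) * (norm v)\<^sup>2" by (simp add: power2_eq_square)
        note le = this
        show ?thesis
        proof (cases "v = 0")
          case False
          then have "(norm v)\<^sup>2 > 0" by simp
          with le show ?thesis by (rule mult_right_le_imp_le)
        qed simp
      qed
      then show ?thesis using K by (auto simp: Pd0)
    qed
    fix \<epsilon> :: real assume \<epsilon>: "0 < \<epsilon>" "\<epsilon> < 1"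
    show "(Pd k has_vector_derivative Pd (Suc k) \<epsilon>) (at \<epsilon>)" by (rule deriv[OF \<epsilon>])
    show "v \<bullet> Pd k \<epsilon> w = w \<bullet> Pd k \<epsilon> v" using sym \<epsilon> by blast
    show "v \<bullet> Pd 0 \<epsilon> v \<ge> 0" using P_nonneg[OF \<epsilon>] by (simp add: Pd0)
    \<comment> \<open>The first derivative is \<open>P o S 1 o P\<close>, and \<open>S 1\<close> is
      the Gramian with the nonnegative weight \<open>t\<close>.\<close>
    show "v \<bullet> Pd 1 \<epsilon> v \<ge> 0"
      unfolding P1[OF \<epsilon>] using P_sym[OF \<epsilon>, of v "S 1 \<epsilon> (P \<epsilon> v)"] \<epsilon>
      by (simp add: inner_commute[of "blinfun_apply (S (Suc 0) \<epsilon>) _"] S_inner Bf_nonneg)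
    show "Pd 0 \<epsilon> (pr v) = Pd 0 \<epsilon> v" using P_pr'[OF \<epsilon>] by (simp add: Pd0)
    show "v \<bullet> Pd 0 \<epsilon> (A w) + A v \<bullet> Pd 0 \<epsilon> w + \<epsilon> * (v \<bullet> Pd 0 \<epsilon> w) = (v \<bullet> Pd 0 \<epsilon> b) * (b \<bullet> Pd 0 \<epsilon> w)"
      using riccati_P[OF \<epsilon>] by (simp add: Pd0)
  qed
qed

end

section \<open>Smoothness classes and Lie derivatives\<close>

lemma Cp_SucI:
  assumes "\<And>x. (g has_derivative g' x) (at x)" "\<And>v. v \<in> Basis \<Longrightarrow> Cp k (\<lambda>x. g' x v)"
  shows "Cp (Suc k) g"
proof -
  have "frechet_derivative g (at x) = g' x" for x using frechet_derivative_at[OF assms(1)] by simp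
  then show ?thesis using assms by (auto simp: differentiable_def)
qed

lemma Cp_SucE:
  assumes "Cp (Suc k) g"
  obtains g' where "\<And>x. (g has_derivative g' x) (at x)" "\<And>v. v \<in> Basis \<Longrightarrow> Cp k (\<lambda>x. g' x v)"
  using assms frechet_derivative_works[of g] that[of "\<lambda>x. frechet_derivative g (at x)"] by auto

lemma Cp_Suc_imp: "Cp (Suc k) g \<Longrightarrow> Cp k g"
proof (induction k arbitrary: g)
  case 0
  then show ?case by (auto intro!: differentiable_imp_continuous_on simp: differentiable_on_def differentiable_at_withinI)
next
  case (Suc k)
  show ?case
    by (rule Cp_SucE[OF Suc.prems]) (rule Cp_SucI, auto intro: Suc.IH)
qed

lemma Cp_const: "Cp k (\<lambda>x. c)"
proof (induction k arbitrary: c)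
  case (Suc k)
  show ?case by (rule Cp_SucI[where g' = "\<lambda>x h. 0"]) (auto intro: Suc)
qed simp

lemma Cp_add: "Cp k g \<Longrightarrow> Cp k h \<Longrightarrow> Cp k (\<lambda>x. g x + h x)"
proof (induction k arbitrary: g h)
  case (Suc k)
  obtain g' where g': "\<And>x. (g has_derivative g' x) (at x)" "\<And>v. v \<in> Basis \<Longrightarrow> Cp k (\<lambda>x. g' x v)"
    using Cp_SucE[OF Suc.prems(1)] by blast
  obtain h' where h': "\<And>x. (h has_derivative h' x) (at x)" "\<And>v. v \<in> Basis \<Longrightarrow> Cp k (\<lambda>x. h' x v)"
    using Cp_SucE[OF Suc.prems(2)] by blast
  show ?case
    by (rule Cp_SucI[OF has_derivative_add[OF g'(1) h'(1)]]) (intro Suc.IH g' h')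
qed (auto intro: continuous_on_add)

lemma Cp_mult:
  fixes g h :: "'a::euclidean_space \<Rightarrow> real"
  shows "Cp k g \<Longrightarrow> Cp k h \<Longrightarrow> Cp k (\<lambda>x. g x * h x)"
proof (induction k arbitrary: g h)
  case (Suc k)
  obtain g' where g': "\<And>x. (g has_derivative g' x) (at x)" "\<And>v. v \<in> Basis \<Longrightarrow> Cp k (\<lambda>x. g' x v)"
    using Cp_SucE[OF Suc.prems(1)] by blast
  obtain h' where h': "\<And>x. (h has_derivative h' x) (at x)" "\<And>v. v \<in> Basis \<Longrightarrow> Cp k (\<lambda>x. h' x v)"
    using Cp_SucE[OF Suc.prems(2)] by blast
  show ?case
    by (rule Cp_SucI[OF has_derivative_mult[OF g'(1) h'(1)]])
       (intro Cp_add Suc.IH g' h' Cp_Suc_imp[OF Suc.prems(1)] Cp_Suc_imp[OF Suc.prems(2)])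
qed (auto intro: continuous_on_mult)

lemma Cp_cmult: "Cp k g \<Longrightarrow> Cp k (\<lambda>x. c * g x :: real)"
  by (intro Cp_mult Cp_const)

lemma Cp_sum: "(\<And>i. i \<in> I \<Longrightarrow> Cp k (f i)) \<Longrightarrow> Cp k (\<lambda>x. \<Sum>i\<in>I. f i x)"
  by (induction I rule: infinite_finite_induct) (auto intro: Cp_const Cp_add)

lemma Cp_power: "Cp k g \<Longrightarrow> Cp k (\<lambda>x. g x ^ n :: real)"
  by (induction n) (auto intro: Cp_const Cp_mult)

lemma Cp_inverse:
  fixes g :: "'a::euclidean_space \<Rightarrow> real"
  assumes "\<And>x. g x \<noteq> 0"
  shows "Cp k g \<Longrightarrow> Cp k (\<lambda>x. inverse (g x))"
proof (induction k)
  case 0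
  then show ?case using assms by (auto intro!: continuous_on_inverse)
next
  case (Suc k)
  obtain g' where g': "\<And>x. (g has_derivative g' x) (at x)" "\<And>v. v \<in> Basis \<Longrightarrow> Cp k (\<lambda>x. g' x v)"
    using Cp_SucE[OF Suc.prems] by blast
  have d: "((\<lambda>x. inverse (g x)) has_derivative (\<lambda>h. - 1 * (inverse (g x) * (g' x h * inverse (g x))))) (at x)" for x
    using Deriv.has_derivative_inverse[OF assms g'(1)[of x]] by (simp add: mult.assoc)
  show ?case
    by (rule Cp_SucI[OF d]) (intro Cp_cmult Cp_mult Suc.IH g' Cp_Suc_imp[OF Suc.prems])
qed

lemma Cp_inner: "Cp k (\<lambda>x. w \<bullet> x)"
proof (cases k)
  case 0
  then show ?thesis by (auto intro!: continuous_intros)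
next
  case (Suc k)
  show ?thesis unfolding Suc
    by (rule Cp_SucI[where g' = "\<lambda>x h. w \<bullet> h"]) (auto intro!: derivative_eq_intros Cp_const)
qed

lemma Cp_vec:
  fixes g :: "'a::euclidean_space \<Rightarrow> real^'m"
  shows "(\<And>i. Cp k (\<lambda>x. g x $ i)) \<Longrightarrow> Cp k g"
proof (induction k arbitrary: g)
  case 0
  then show ?case by (auto simp: continuous_on_componentwise[of UNIV g] Basis_vec_def inner_axis)
next
  case (Suc k)
  have "\<forall>i. \<exists>g'. (\<forall>x. ((\<lambda>x. g x $ i) has_derivative g' x) (at x)) \<and> (\<forall>v\<in>Basis. Cp k (\<lambda>x. g' x v))"
  proof
    fix i
    show "\<exists>g'. (\<forall>x. ((\<lambda>x. g x $ i) has_derivative g' x) (at x)) \<and> (\<forall>v\<in>Basis. Cp k (\<lambda>x. g' x v))"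
      using Cp_SucE[OF Suc.prems[of i]] by metis
  qed
  then obtain g' where g': "\<And>i x. ((\<lambda>x. g x $ i) has_derivative g' i x) (at x)"
    "\<And>i v. v \<in> Basis \<Longrightarrow> Cp k (\<lambda>x. g' i x v)" by metis
  have "(g has_derivative (\<lambda>h. \<chi> i. g' i x h)) (at x)" for x
    unfolding has_derivative_componentwise_within[of g]
    using g'(1) by (auto simp: Basis_vec_def inner_axis)
  then show ?case
  proof (rule Cp_SucI)
    fix v :: 'a assume "v \<in> Basis"
    then show "Cp k (\<lambda>x. \<chi> i. g' i x v)" by (intro Suc.IH) (simp add: g'(2))
  qed
qed

text \<open>In \<open>lie_bd F \<omega> j s k g\<close> the parameter of the family \<open>g\<close> is the design parameter of the
  feedback: the exponent \<open>s\<close> records smallness in that parameter, and \<open>k\<close> the growth in the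
  weight \<open>\<omega>\<close>, which goes up by one with every Lie derivative along \<open>F\<close>.\<close>

definition wt_bd :: "('a \<Rightarrow> real) \<Rightarrow> nat \<Rightarrow> int \<Rightarrow> (real \<Rightarrow> 'a \<Rightarrow> real) \<Rightarrow> bool" where
  "wt_bd \<omega> s k g \<longleftrightarrow> (\<exists>C\<ge>0. \<forall>\<rho> x. 0 < \<rho> \<longrightarrow> \<rho> < 1/2 \<longrightarrow> \<bar>g \<rho> x\<bar> \<le> C * sqrt \<rho> ^ s * \<omega> x powi k)"

primrec lie_bd :: "(real \<Rightarrow> 'a \<Rightarrow> 'a) \<Rightarrow> ('a \<Rightarrow> real) \<Rightarrow> nat \<Rightarrow> nat \<Rightarrow> int \<Rightarrow> (real \<Rightarrow> 'a::euclidean_space \<Rightarrow> real) \<Rightarrow> bool" where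
  "lie_bd F \<omega> 0 s k g = wt_bd \<omega> s k g"
| "lie_bd F \<omega> (Suc j) s k g = (wt_bd \<omega> s k g \<and> (\<exists>g'. (\<forall>\<rho> x. 0 < \<rho> \<longrightarrow> \<rho> < 1/2 \<longrightarrow> (g \<rho> has_derivative g' \<rho> x) (at x))
      \<and> lie_bd F \<omega> j s (k + 1) (\<lambda>\<rho> x. g' \<rho> x (F \<rho> x))))"

text \<open>With \<open>\<omega> \<ge> 1\<close> a larger exponent is a weaker bound, so exponents
  can be aligned before adding.\<close>

locale weight =
  fixes F :: "real \<Rightarrow> 'a \<Rightarrow> 'a::euclidean_space" and \<omega> :: "'a \<Rightarrow> real"
  assumes \<omega>: "\<And>x. \<omega> x \<ge> 1"
begin

lemma \<omega>_pos: "\<omega> x > 0" using \<omega>[of x] by linarith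

lemma wt_bd_mult:
  assumes "wt_bd \<omega> s k g" "wt_bd \<omega> s' k' h"
  shows "wt_bd \<omega> (s + s') (k + k') (\<lambda>\<rho> x. g \<rho> x * h \<rho> x)"
proof -
  obtain C where C: "C \<ge> 0" "\<And>\<rho> x. 0 < \<rho> \<Longrightarrow> \<rho> < 1/2 \<Longrightarrow> \<bar>g \<rho> x\<bar> \<le> C * sqrt \<rho> ^ s * \<omega> x powi k"
    using assms(1) unfolding wt_bd_def by blast
  obtain D where D: "D \<ge> 0" "\<And>\<rho> x. 0 < \<rho> \<Longrightarrow> \<rho> < 1/2 \<Longrightarrow> \<bar>h \<rho> x\<bar> \<le> D * sqrt \<rho> ^ s' * \<omega> x powi k'"
    using assms(2) unfolding wt_bd_def by blast
  have "\<bar>g \<rho> x * h \<rho> x\<bar> \<le> (C * D) * sqrt \<rho> ^ (s + s') * \<omega> x powi (k + k')" if "0 < \<rho>" "\<rho> < 1/2" for \<rho> x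
  proof -
    have "\<bar>g \<rho> x * h \<rho> x\<bar> \<le> (C * sqrt \<rho> ^ s * \<omega> x powi k) * (D * sqrt \<rho> ^ s' * \<omega> x powi k')"
      unfolding abs_mult using C(2)[OF that, of x] D(2)[OF that, of x] by (intro mult_mono) (auto intro: order_trans[OF abs_ge_zero])
    also have "\<dots> = (C * D) * sqrt \<rho> ^ (s + s') * \<omega> x powi (k + k')"
      using \<omega>_pos[of x] by (simp add: power_add power_int_add)
    finally show ?thesis .
  qed
  then show ?thesis unfolding wt_bd_def using C(1) D(1) by (intro exI[of _ "C * D"]) auto
qed

lemma wt_bd_weaken:
  assumes "wt_bd \<omega> s k g" "s' \<le> s" "k \<le> k'"
  shows "wt_bd \<omega> s' k' g"
proof -
  obtain C where C: "C \<ge> 0" "\<And>\<rho> x. 0 < \<rho> \<Longrightarrow> \<rho> < 1/2 \<Longrightarrow> \<bar>g \<rho> x\<bar> \<le> C * sqrt \<rho> ^ s * \<omega> x powi k"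
    using assms(1) unfolding wt_bd_def by blast
  have "\<bar>g \<rho> x\<bar> \<le> C * sqrt \<rho> ^ s' * \<omega> x powi k'" if "0 < \<rho>" "\<rho> < 1/2" for \<rho> x
  proof -
    have "\<bar>g \<rho> x\<bar> \<le> C * sqrt \<rho> ^ s * \<omega> x powi k" by (rule C(2)[OF that])
    also have "\<dots> \<le> C * sqrt \<rho> ^ s' * \<omega> x powi k'"
      using C(1) that \<omega>[of x] assms(2,3)
      by (intro mult_mono mult_left_mono power_decreasing power_int_increasing) (auto intro!: mult_nonneg_nonneg)
    finally show ?thesis .
  qed
  then show ?thesis unfolding wt_bd_def using C(1) by blast
qed

lemma wt_bd_add:
  assumes "wt_bd \<omega> s k g" "wt_bd \<omega> s k h"
  shows "wt_bd \<omega> s k (\<lambda>\<rho> x. g \<rho> x + h \<rho> x)"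
proof -
  obtain C where C: "C \<ge> 0" "\<And>\<rho> x. 0 < \<rho> \<Longrightarrow> \<rho> < 1/2 \<Longrightarrow> \<bar>g \<rho> x\<bar> \<le> C * sqrt \<rho> ^ s * \<omega> x powi k"
    using assms(1) unfolding wt_bd_def by blast
  obtain D where D: "D \<ge> 0" "\<And>\<rho> x. 0 < \<rho> \<Longrightarrow> \<rho> < 1/2 \<Longrightarrow> \<bar>h \<rho> x\<bar> \<le> D * sqrt \<rho> ^ s * \<omega> x powi k"
    using assms(2) unfolding wt_bd_def by blast
  have "\<bar>g \<rho> x + h \<rho> x\<bar> \<le> (C + D) * sqrt \<rho> ^ s * \<omega> x powi k" if "0 < \<rho>" "\<rho> < 1/2" for \<rho> x
    using C(2)[OF that, of x] D(2)[OF that, of x] unfolding distrib_right by linarith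
  then show ?thesis unfolding wt_bd_def using C(1) D(1) by (intro exI[of _ "C + D"]) auto
qed

abbreviation "LB \<equiv> lie_bd F \<omega>"

lemma LB_wt: "LB j s k g \<Longrightarrow> wt_bd \<omega> s k g" by (cases j) auto

text \<open>The Lie derivative may be replaced by any expression \<open>h\<close> that agrees with
  it for parameters in the admissible range. This lets identities such as the Riccati equation,
  valid only there, rewrite it before it is estimated.\<close>

lemma LB_SucI:
  assumes "wt_bd \<omega> s k g" "\<And>\<rho> x. 0 < \<rho> \<Longrightarrow> \<rho> < 1/2 \<Longrightarrow> (g \<rho> has_derivative g' \<rho> x) (at x)"
    "LB j s (k + 1) h" "\<And>\<rho> x. 0 < \<rho> \<Longrightarrow> \<rho> < 1/2 \<Longrightarrow> g' \<rho> x (F \<rho> x) = h \<rho> x"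
  shows "LB (Suc j) s k g"
proof -
  have cong: "LB j s k h \<Longrightarrow> (\<And>\<rho> x. 0 < \<rho> \<Longrightarrow> \<rho> < 1/2 \<Longrightarrow> f \<rho> x = h \<rho> x) \<Longrightarrow> LB j s k f" for j s k f h
  proof (cases j)
    case 0
    assume "LB j s k h" "\<And>\<rho> x. 0 < \<rho> \<Longrightarrow> \<rho> < 1/2 \<Longrightarrow> f \<rho> x = h \<rho> x"
    then show "LB j s k f" using 0 by (simp add: wt_bd_def)
  next
    case (Suc i)
    assume a: "LB j s k h" and e: "\<And>\<rho> x. 0 < \<rho> \<Longrightarrow> \<rho> < 1/2 \<Longrightarrow> f \<rho> x = h \<rho> x"
    have "f \<rho> = h \<rho>" if "0 < \<rho>" "\<rho> < 1/2" for \<rho> using e[OF that] by auto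
    with a Suc show "LB j s k f" by (simp add: wt_bd_def)
  qed
  have "LB j s (k + 1) (\<lambda>\<rho> x. g' \<rho> x (F \<rho> x))" by (rule cong[OF assms(3)]) (rule assms(4))
  then show ?thesis using assms(1,2) by auto
qed

lemma LB_SucE:
  assumes "LB (Suc j) s k g"
  obtains g' where "\<And>\<rho> x. 0 < \<rho> \<Longrightarrow> \<rho> < 1/2 \<Longrightarrow> (g \<rho> has_derivative g' \<rho> x) (at x)"
    "LB j s (k + 1) (\<lambda>\<rho> x. g' \<rho> x (F \<rho> x))"
  using assms by auto

lemma LB_Suc: "LB (Suc j) s k g \<Longrightarrow> LB j s k g"
proof (induction j arbitrary: k g)
  case (Suc j)
  obtain g' where g': "\<And>\<rho> x. 0 < \<rho> \<Longrightarrow> \<rho> < 1/2 \<Longrightarrow> (g \<rho> has_derivative g' \<rho> x) (at x)"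
    "LB (Suc j) s (k + 1) (\<lambda>\<rho> x. g' \<rho> x (F \<rho> x))" using LB_SucE[OF Suc.prems] by blast
  show ?case by (rule LB_SucI[OF LB_wt[OF Suc.prems] g'(1) Suc.IH[OF g'(2)]]) auto
qed simp

lemma LB_weaken: "LB j s k g \<Longrightarrow> s' \<le> s \<Longrightarrow> k \<le> k' \<Longrightarrow> LB j s' k' g"
proof (induction j arbitrary: k k' g)
  case 0
  then show ?case using wt_bd_weaken by simp
next
  case (Suc j)
  obtain g' where g': "\<And>\<rho> x. 0 < \<rho> \<Longrightarrow> \<rho> < 1/2 \<Longrightarrow> (g \<rho> has_derivative g' \<rho> x) (at x)"
    "LB j s (k + 1) (\<lambda>\<rho> x. g' \<rho> x (F \<rho> x))" using LB_SucE[OF Suc.prems(1)] by blast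
  show ?case
    by (rule LB_SucI[OF wt_bd_weaken[OF LB_wt[OF Suc.prems(1)] Suc.prems(2,3)] g'(1) Suc.IH[OF g'(2) Suc.prems(2)]])
       (use Suc.prems in auto)
qed

lemma LB_add: "LB j s k g \<Longrightarrow> LB j s k h \<Longrightarrow> LB j s k (\<lambda>\<rho> x. g \<rho> x + h \<rho> x)"
proof (induction j arbitrary: k g h)
  case 0
  then show ?case using wt_bd_add by simp
next
  case (Suc j)
  obtain g' where g': "\<And>\<rho> x. 0 < \<rho> \<Longrightarrow> \<rho> < 1/2 \<Longrightarrow> (g \<rho> has_derivative g' \<rho> x) (at x)"
    "LB j s (k + 1) (\<lambda>\<rho> x. g' \<rho> x (F \<rho> x))" using LB_SucE[OF Suc.prems(1)] by blast
  obtain h' where h': "\<And>\<rho> x. 0 < \<rho> \<Longrightarrow> \<rho> < 1/2 \<Longrightarrow> (h \<rho> has_derivative h' \<rho> x) (at x)"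
    "LB j s (k + 1) (\<lambda>\<rho> x. h' \<rho> x (F \<rho> x))" using LB_SucE[OF Suc.prems(2)] by blast
  show ?case
    by (rule LB_SucI[OF wt_bd_add[OF LB_wt[OF Suc.prems(1)] LB_wt[OF Suc.prems(2)]]
        has_derivative_add[OF g'(1) h'(1)] Suc.IH[OF g'(2) h'(2)]]) auto
qed

lemma LB_mult: "LB j s k g \<Longrightarrow> LB j s' k' h \<Longrightarrow> LB j (s + s') (k + k') (\<lambda>\<rho> x. g \<rho> x * h \<rho> x)"
proof (induction j arbitrary: k k' g h)
  case 0
  then show ?case using wt_bd_mult by simp
next
  case (Suc j)
  obtain g' where g': "\<And>\<rho> x. 0 < \<rho> \<Longrightarrow> \<rho> < 1/2 \<Longrightarrow> (g \<rho> has_derivative g' \<rho> x) (at x)"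
    "LB j s (k + 1) (\<lambda>\<rho> x. g' \<rho> x (F \<rho> x))" using LB_SucE[OF Suc.prems(1)] by blast
  obtain h' where h': "\<And>\<rho> x. 0 < \<rho> \<Longrightarrow> \<rho> < 1/2 \<Longrightarrow> (h \<rho> has_derivative h' \<rho> x) (at x)"
    "LB j s' (k' + 1) (\<lambda>\<rho> x. h' \<rho> x (F \<rho> x))" using LB_SucE[OF Suc.prems(2)] by blast
  have 1: "LB j (s + s') (k + k' + 1) (\<lambda>\<rho> x. g \<rho> x * h' \<rho> x (F \<rho> x))"
    using Suc.IH[OF LB_Suc[OF Suc.prems(1)] h'(2)] by (simp add: algebra_simps)
  have 2: "LB j (s + s') (k + k' + 1) (\<lambda>\<rho> x. g' \<rho> x (F \<rho> x) * h \<rho> x)"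
    using Suc.IH[OF g'(2) LB_Suc[OF Suc.prems(2)]] by (simp add: algebra_simps)
  show ?case
    by (rule LB_SucI[OF wt_bd_mult[OF LB_wt[OF Suc.prems(1)] LB_wt[OF Suc.prems(2)]]
        has_derivative_mult[OF g'(1) h'(1)] LB_add[OF 1 2]]) auto
qed

lemma LB_zero: "LB j s k (\<lambda>\<rho> x. 0)"
proof (induction j arbitrary: k)
  case 0
  then show ?case by (auto simp: wt_bd_def intro!: exI[of _ 0])
next
  case (Suc j)
  show ?case by (rule LB_SucI[where g' = "\<lambda>\<rho> x h. 0", OF _ _ Suc]) (auto simp: wt_bd_def intro!: exI[of _ 0])
qed

lemma LB_param:
  assumes "wt_bd \<omega> s 0 (\<lambda>\<rho> x. c \<rho>)"
  shows "LB j s 0 (\<lambda>\<rho> x. c \<rho>)"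
proof (cases j)
  case 0
  then show ?thesis using assms by simp
next
  case (Suc i)
  show ?thesis unfolding Suc
    by (rule LB_SucI[where g' = "\<lambda>\<rho> x h. 0", OF assms _ LB_zero]) auto
qed

lemma LB_const: "LB j 0 0 (\<lambda>\<rho> x. c)"
  by (rule LB_param) (auto simp: wt_bd_def intro!: exI[of _ "\<bar>c\<bar>"])

lemma LB_rho: "LB j 1 0 (\<lambda>\<rho> x. \<rho>)"
proof (rule LB_param)
  have "\<rho> \<le> sqrt \<rho>" if "0 < \<rho>" "\<rho> < 1/2" for \<rho> :: real
    using that by (intro real_le_rsqrt) (simp add: power2_eq_square)
  then show "wt_bd \<omega> 1 0 (\<lambda>\<rho> x. \<rho>)" by (auto simp: wt_bd_def intro!: exI[of _ 1])
qed

lemma LB_cmult: "LB j s k g \<Longrightarrow> LB j s k (\<lambda>\<rho> x. c * g \<rho> x)"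
  using LB_mult[OF LB_const[of j c], of s k g] by simp

lemma LB_sum: "(\<And>i. i \<in> I \<Longrightarrow> LB j s k (f i)) \<Longrightarrow> LB j s k (\<lambda>\<rho> x. \<Sum>i\<in>I. f i \<rho> x)"
  by (induction I rule: infinite_finite_induct) (auto intro: LB_zero LB_add)

lemma LB_mult_weaken:
  "LB j s k g \<Longrightarrow> LB j s' k' h \<Longrightarrow> s'' \<le> s + s' \<Longrightarrow> k + k' \<le> k'' \<Longrightarrow> LB j s'' k'' (\<lambda>\<rho> x. g \<rho> x * h \<rho> x)"
  using LB_weaken[OF LB_mult] by blast

text \<open>The derivative of \<open>1 / h\<close> carries the exponent
  \<open>- k + (k + 1) - k = - k + 1\<close>, exactly what one Lie derivative may cost; only the
  bound of order zero on the inverse has to be supplied.\<close>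

lemma LB_inverse:
  assumes "wt_bd \<omega> 0 (- k) (\<lambda>\<rho> x. inverse (h \<rho> x))" "\<And>\<rho> x. 0 < \<rho> \<Longrightarrow> \<rho> < 1/2 \<Longrightarrow> h \<rho> x \<noteq> 0"
  shows "LB j 0 k h \<Longrightarrow> LB j 0 (- k) (\<lambda>\<rho> x. inverse (h \<rho> x))"
proof (induction j)
  case 0
  then show ?case using assms by simp
next
  case (Suc j)
  obtain h' where h': "\<And>\<rho> x. 0 < \<rho> \<Longrightarrow> \<rho> < 1/2 \<Longrightarrow> (h \<rho> has_derivative h' \<rho> x) (at x)"
    "LB j 0 (k + 1) (\<lambda>\<rho> x. h' \<rho> x (F \<rho> x))" using LB_SucE[OF Suc.prems] by blast
  note I = Suc.IH[OF LB_Suc[OF Suc.prems]]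
  have L: "LB j 0 (- k + 1) (\<lambda>\<rho> x. - 1 * (inverse (h \<rho> x) * (h' \<rho> x (F \<rho> x) * inverse (h \<rho> x))))"
    by (rule LB_cmult, rule LB_mult_weaken[OF I LB_mult[OF h'(2) I]]) auto
  have d: "((\<lambda>x. inverse (h \<rho> x)) has_derivative (\<lambda>v. - (inverse (h \<rho> x) * h' \<rho> x v * inverse (h \<rho> x)))) (at x)"
    if "0 < \<rho>" "\<rho> < 1/2" for \<rho> x
    by (rule Deriv.has_derivative_inverse[OF assms(2)[OF that] h'(1)[OF that]])
  show ?case by (rule LB_SucI[OF assms(1) d L]) auto
qed

lemma LB_power: "LB j s k g \<Longrightarrow> LB j 0 (int n * k) (\<lambda>\<rho> x. g \<rho> x ^ n)"
proof (induction n)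
  case 0
  then show ?case using LB_const[of j 1] by simp
next
  case (Suc n)
  have "LB j 0 (int (Suc n) * k) (\<lambda>\<rho> x. g \<rho> x * g \<rho> x ^ n)"
    by (rule LB_mult_weaken[OF Suc.prems Suc.IH[OF Suc.prems]]) (auto simp: algebra_simps)
  then show ?case by simp
qed

text \<open>Unfolds the nested existentials into one sequence of iterated Lie derivatives, to be
  matched later with the time derivatives along a trajectory.\<close>

lemma LB_sequence:
  "LB j s k g \<Longrightarrow> \<exists>G. G 0 = g \<and> (\<forall>i\<le>j. wt_bd \<omega> s (k + int i) (G i)) \<and>
     (\<forall>i<j. \<exists>g'. (\<forall>\<rho> x. 0 < \<rho> \<longrightarrow> \<rho> < 1/2 \<longrightarrow> (G i \<rho> has_derivative g' \<rho> x) (at x)) \<and> G (Suc i) = (\<lambda>\<rho> x. g' \<rho> x (F \<rho> x)))"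
proof (induction j arbitrary: k g)
  case 0
  then show ?case by (intro exI[of _ "\<lambda>_. g"]) auto
next
  case (Suc j)
  obtain g' where g': "\<And>\<rho> x. 0 < \<rho> \<Longrightarrow> \<rho> < 1/2 \<Longrightarrow> (g \<rho> has_derivative g' \<rho> x) (at x)"
    "LB j s (k + 1) (\<lambda>\<rho> x. g' \<rho> x (F \<rho> x))" using LB_SucE[OF Suc.prems(1)] by blast
  from Suc.IH[OF g'(2)] obtain G where G: "G 0 = (\<lambda>\<rho> x. g' \<rho> x (F \<rho> x))" "\<And>i. i \<le> j \<Longrightarrow> wt_bd \<omega> s (k + 1 + int i) (G i)"
    "\<And>i. i < j \<Longrightarrow> \<exists>g'. (\<forall>\<rho> x. 0 < \<rho> \<longrightarrow> \<rho> < 1/2 \<longrightarrow> (G i \<rho> has_derivative g' \<rho> x) (at x)) \<and> G (Suc i) = (\<lambda>\<rho> x. g' \<rho> x (F \<rho> x))"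
    by blast
  define H where "H = case_nat g G"
  have "wt_bd \<omega> s (k + int i) (H i)" if "i \<le> Suc j" for i
    using that G(2)[of "i - 1"] LB_wt[OF Suc.prems] by (cases i) (auto simp: H_def add.assoc)
  moreover have "\<exists>g'. (\<forall>\<rho> x. 0 < \<rho> \<longrightarrow> \<rho> < 1/2 \<longrightarrow> (H i \<rho> has_derivative g' \<rho> x) (at x)) \<and> H (Suc i) = (\<lambda>\<rho> x. g' \<rho> x (F \<rho> x))"
    if "i < Suc j" for i
  proof (cases i)
    case 0
    then show ?thesis using g'(1) G(1) by (auto simp: H_def)
  next
    case (Suc l)
    then show ?thesis using that G(3)[of l] by (simp add: H_def)
  qed
  ultimately show ?case by (intro exI[of _ H]) (auto simp: H_def)
qed

end

section \<open>The gain schedule\<close>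

context low_gain
begin

lemma Pd_pr: "0 < \<epsilon> \<Longrightarrow> \<epsilon> < 1 \<Longrightarrow> Pd k \<epsilon> (pr v) = Pd k \<epsilon> v"
proof (induction k arbitrary: \<epsilon>)
  case 0
  then show ?case by (rule P_pr)
next
  case (Suc k)
  have "u \<bullet> Pd (Suc k) \<epsilon> (pr v) = u \<bullet> Pd (Suc k) \<epsilon> v" for u
  proof (rule DERIV_unique)
    show "((\<lambda>\<epsilon>. u \<bullet> Pd k \<epsilon> v) has_real_derivative u \<bullet> Pd (Suc k) \<epsilon> v) (at \<epsilon>)"
      by (rule inner_blinfun_derivative[OF Pd_deriv[OF Suc.prems]])
    show "((\<lambda>\<epsilon>. u \<bullet> Pd k \<epsilon> v) has_real_derivative u \<bullet> Pd (Suc k) \<epsilon> (pr v)) (at \<epsilon>)"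
      by (rule has_field_derivative_transform_within_open[OF inner_blinfun_derivative[OF Pd_deriv[OF Suc.prems]], of "{0<..<1}"])
         (use Suc in auto)
  qed
  then show ?case by (metis vector_eq_ldot)
qed

text \<open>Repeated differentiation of the Riccati equation in \<open>\<epsilon>\<close>. The term
  with \<open>Pd (k - 1)\<close> comes from the factor \<open>\<epsilon>\<close> in
  \<open>\<epsilon> P\<close>; for \<open>k = 0\<close> its coefficient vanishes, so the truncated
  subtraction is harmless. What matters about the coefficients \<open>c\<close> is that they depend
  neither on \<open>\<epsilon>\<close> nor on the vectors.\<close>

lemma riccati_k:
  "\<exists>c :: nat \<Rightarrow> real. \<forall>\<epsilon> v w. 0 < \<epsilon> \<longrightarrow> \<epsilon> < 1 \<longrightarrow>
     v \<bullet> Pd k \<epsilon> (A w) + A v \<bullet> Pd k \<epsilon> w + \<epsilon> * (v \<bullet> Pd k \<epsilon> w) + real k * (v \<bullet> Pd (k - 1) \<epsilon> w)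
     = (\<Sum>i\<le>k. c i * ((v \<bullet> Pd i \<epsilon> b) * (b \<bullet> Pd (k - i) \<epsilon> w)))"
proof (induction k)
  case 0
  then show ?case using riccati by (intro exI[of _ "\<lambda>_. 1"]) auto
next
  case (Suc k)
  then obtain c :: "nat \<Rightarrow> real" where c: "\<And>\<epsilon> v w. 0 < \<epsilon> \<Longrightarrow> \<epsilon> < 1 \<Longrightarrow>
     v \<bullet> Pd k \<epsilon> (A w) + A v \<bullet> Pd k \<epsilon> w + \<epsilon> * (v \<bullet> Pd k \<epsilon> w) + real k * (v \<bullet> Pd (k - 1) \<epsilon> w)
     = (\<Sum>i\<le>k. c i * ((v \<bullet> Pd i \<epsilon> b) * (b \<bullet> Pd (k - i) \<epsilon> w)))" by blast
  \<comment> \<open>Pascal's rule: the product rule raises the order of either the left or the right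
    factor.\<close>
  define d where "d = (\<lambda>i. (if i \<le> k then c i else 0) + (if i = 0 then 0 else c (i - 1)))"
  have "v \<bullet> Pd (Suc k) \<epsilon> (A w) + A v \<bullet> Pd (Suc k) \<epsilon> w + \<epsilon> * (v \<bullet> Pd (Suc k) \<epsilon> w) + real (Suc k) * (v \<bullet> Pd (Suc k - 1) \<epsilon> w)
     = (\<Sum>i\<le>Suc k. d i * ((v \<bullet> Pd i \<epsilon> b) * (b \<bullet> Pd (Suc k - i) \<epsilon> w)))" if \<epsilon>: "0 < \<epsilon>" "\<epsilon> < 1" for \<epsilon> v w
  proof -
    note D = inner_blinfun_derivative[OF Pd_deriv[OF \<epsilon>]]
    have k1: "((\<lambda>\<epsilon>. real k * (v \<bullet> Pd (k - 1) \<epsilon> w)) has_real_derivative real k * (v \<bullet> Pd k \<epsilon> w)) (at \<epsilon>)"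
    proof (cases k)
      case (Suc l)
      show ?thesis using DERIV_cmult[OF D[of v l w], of "real k"] Suc by simp
    qed simp
    have "((\<lambda>\<epsilon>. v \<bullet> Pd k \<epsilon> (A w) + A v \<bullet> Pd k \<epsilon> w + \<epsilon> * (v \<bullet> Pd k \<epsilon> w) + real k * (v \<bullet> Pd (k - 1) \<epsilon> w))
      has_real_derivative (v \<bullet> Pd (Suc k) \<epsilon> (A w) + A v \<bullet> Pd (Suc k) \<epsilon> w + (1 * (v \<bullet> Pd k \<epsilon> w) + (v \<bullet> Pd (Suc k) \<epsilon> w) * \<epsilon>) + real k * (v \<bullet> Pd k \<epsilon> w))) (at \<epsilon>)"
      by (intro DERIV_add DERIV_mult D k1 DERIV_ident)
    moreover have "((\<lambda>\<epsilon>. v \<bullet> Pd k \<epsilon> (A w) + A v \<bullet> Pd k \<epsilon> w + \<epsilon> * (v \<bullet> Pd k \<epsilon> w) + real k * (v \<bullet> Pd (k - 1) \<epsilon> w))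
      has_real_derivative (\<Sum>i\<le>k. c i * ((v \<bullet> Pd (Suc i) \<epsilon> b) * (b \<bullet> Pd (k - i) \<epsilon> w) + (b \<bullet> Pd (Suc (k - i)) \<epsilon> w) * (v \<bullet> Pd i \<epsilon> b)))) (at \<epsilon>)"
    proof (rule has_field_derivative_transform_within_open[where S = "{0<..<1}"])
      show "((\<lambda>\<epsilon>. \<Sum>i\<le>k. c i * ((v \<bullet> Pd i \<epsilon> b) * (b \<bullet> Pd (k - i) \<epsilon> w)))
        has_real_derivative (\<Sum>i\<le>k. c i * ((v \<bullet> Pd (Suc i) \<epsilon> b) * (b \<bullet> Pd (k - i) \<epsilon> w) + (b \<bullet> Pd (Suc (k - i)) \<epsilon> w) * (v \<bullet> Pd i \<epsilon> b)))) (at \<epsilon>)"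
        by (intro DERIV_sum DERIV_cmult DERIV_mult D)
    qed (use c \<epsilon> in auto)
    ultimately have "v \<bullet> Pd (Suc k) \<epsilon> (A w) + A v \<bullet> Pd (Suc k) \<epsilon> w + (1 * (v \<bullet> Pd k \<epsilon> w) + (v \<bullet> Pd (Suc k) \<epsilon> w) * \<epsilon>) + real k * (v \<bullet> Pd k \<epsilon> w)
      = (\<Sum>i\<le>k. c i * ((v \<bullet> Pd (Suc i) \<epsilon> b) * (b \<bullet> Pd (k - i) \<epsilon> w) + (b \<bullet> Pd (Suc (k - i)) \<epsilon> w) * (v \<bullet> Pd i \<epsilon> b)))"
      by (rule DERIV_unique)
    also have "\<dots> = (\<Sum>i\<le>k. c i * ((v \<bullet> Pd (Suc i) \<epsilon> b) * (b \<bullet> Pd (Suc k - Suc i) \<epsilon> w)))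
      + (\<Sum>i\<le>k. c i * ((v \<bullet> Pd i \<epsilon> b) * (b \<bullet> Pd (Suc k - i) \<epsilon> w)))"
      by (simp add: sum.distrib distrib_left Suc_diff_le mult_ac)
    also have "(\<Sum>i\<le>k. c i * ((v \<bullet> Pd (Suc i) \<epsilon> b) * (b \<bullet> Pd (Suc k - Suc i) \<epsilon> w)))
      = (\<Sum>i\<le>Suc k. (if i = 0 then 0 else c (i - 1)) * ((v \<bullet> Pd i \<epsilon> b) * (b \<bullet> Pd (Suc k - i) \<epsilon> w)))"
      unfolding sum.atMost_Suc_shift by simp
    also have "(\<Sum>i\<le>k. c i * ((v \<bullet> Pd i \<epsilon> b) * (b \<bullet> Pd (Suc k - i) \<epsilon> w)))
      = (\<Sum>i\<le>Suc k. (if i \<le> k then c i else 0) * ((v \<bullet> Pd i \<epsilon> b) * (b \<bullet> Pd (Suc k - i) \<epsilon> w)))"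
      by simp
    finally show ?thesis by (simp add: d_def sum.distrib[symmetric] distrib_right algebra_simps)
  qed
  then show ?case by (intro exI[of _ d]) blast
qed

definition Hs :: "real \<Rightarrow> 'a \<Rightarrow> real" where "Hs \<epsilon> x = \<epsilon> * (1 + x \<bullet> Pd 0 \<epsilon> x)"

lemma Hs_deriv:
  assumes "0 < \<epsilon>" "\<epsilon> < 1"
  shows "((\<lambda>\<epsilon>. Hs \<epsilon> x) has_real_derivative (1 + x \<bullet> Pd 0 \<epsilon> x + \<epsilon> * (x \<bullet> Pd 1 \<epsilon> x))) (at \<epsilon>)"
proof -
  have "((\<lambda>\<epsilon>. \<epsilon> * (1 + x \<bullet> Pd 0 \<epsilon> x)) has_real_derivative (1 * (1 + x \<bullet> Pd 0 \<epsilon> x) + (0 + x \<bullet> Pd (Suc 0) \<epsilon> x) * \<epsilon>)) (at \<epsilon>)"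
    by (intro DERIV_mult DERIV_add DERIV_ident DERIV_const inner_blinfun_derivative[OF Pd_deriv[OF assms]])
  then show ?thesis by (simp add: Hs_def[abs_def] algebra_simps)
qed

text \<open>The derivative in \<open>\<epsilon>\<close> is at least 1 because both \<open>P\<close>
  and its derivative are nonnegative. This yields uniqueness of the schedule and its continuity in
  the state and the parameter.\<close>

lemma Hs_mono:
  assumes "0 < a" "a \<le> c" "c < 1"
  shows "Hs c x - Hs a x \<ge> c - a"
proof (cases "a = c")
  case False
  then have "a < c" using assms by simp
  then obtain z where z: "a < z" "z < c" "Hs c x - Hs a x = (c - a) * (1 + x \<bullet> Pd 0 z x + z * (x \<bullet> Pd 1 z x))"
    using MVT2[of a c "\<lambda>\<epsilon>. Hs \<epsilon> x" "\<lambda>z. 1 + x \<bullet> Pd 0 z x + z * (x \<bullet> Pd 1 z x)"] Hs_deriv assms by auto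
  have "1 + x \<bullet> Pd 0 z x + z * (x \<bullet> Pd 1 z x) \<ge> 1"
    using P_pos[of z x] mult_nonneg_nonneg[of z "x \<bullet> Pd 1 z x"] P1_pos[of z x] z assms by simp
  then have "(c - a) * (1 + x \<bullet> Pd 0 z x + z * (x \<bullet> Pd 1 z x)) \<ge> (c - a) * 1"
    using \<open>a < c\<close> by (intro mult_left_mono) auto
  then show ?thesis using z by simp
qed simp

lemma Hs_mono_abs:
  assumes "0 < a" "a < 1" "0 < c" "c < 1"
  shows "\<bar>c - a\<bar> \<le> \<bar>Hs c x - Hs a x\<bar>"
  using Hs_mono[of a c x] Hs_mono[of c a x] assms by (cases "a \<le> c") auto

text \<open>Intermediate value theorem on \<open>[\<rho> / c, \<rho>]\<close>, with \<open>c\<close>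
  taken from the upper bound on \<open>P\<close> so that the scheduling function is at most
  \<open>\<rho>\<close> at the left end. The restriction on \<open>\<rho>\<close> keeps the interval
  where \<open>P\<close> is differentiable.\<close>

lemma eps_exists:
  assumes \<rho>: "0 < \<rho>" "\<rho> < 1/2"
  shows "\<exists>\<epsilon>. 0 < \<epsilon> \<and> \<epsilon> \<le> \<rho> \<and> Hs \<epsilon> x = \<rho>"
proof -
  obtain C where C: "C > 0" "\<And>\<epsilon> v. 0 < \<epsilon> \<Longrightarrow> \<epsilon> < 1 \<Longrightarrow> v \<bullet> Pd 0 \<epsilon> v \<le> C * \<epsilon> * (norm v)\<^sup>2"
    using P_up by blast
  define c where "c = 1 + C * (norm x)\<^sup>2"
  have c: "c \<ge> 1" using C by (simp add: c_def)
  define a where "a = \<rho> / c"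
  have a: "0 < a" "a \<le> \<rho>" using c \<rho> by (auto simp: a_def divide_le_eq mult_left_mono)
  have "Hs a x \<le> a * c"
  proof -
    have "x \<bullet> Pd 0 a x \<le> C * a * (norm x)\<^sup>2" using C(2) a \<rho> by auto
    also have "\<dots> \<le> C * 1 * (norm x)\<^sup>2" using C(1) a \<rho> by (intro mult_right_mono mult_left_mono) auto
    finally show ?thesis using a by (auto simp: Hs_def c_def intro!: mult_left_mono)
  qed
  also have "\<dots> = \<rho>" using c by (simp add: a_def)
  finally have 1: "Hs a x \<le> \<rho>" .
  have 2: "\<rho> \<le> Hs \<rho> x"
    using P_pos[of \<rho> x] \<rho> mult_left_mono[of 1 "1 + x \<bullet> Pd 0 \<rho> x" \<rho>] by (simp add: Hs_def)
  have "\<exists>\<epsilon>. a \<le> \<epsilon> \<and> \<epsilon> \<le> \<rho> \<and> Hs \<epsilon> x = \<rho>"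
    by (rule IVT[OF 1 2 a(2)]) (use DERIV_isCont[OF Hs_deriv] a \<rho> in auto)
  then obtain \<epsilon> where "a \<le> \<epsilon>" "\<epsilon> \<le> \<rho>" "Hs \<epsilon> x = \<rho>" by blast
  then show ?thesis using a(1) by (intro exI[of _ \<epsilon>]) auto
qed

definition eps :: "real \<Rightarrow> 'a \<Rightarrow> real" where
  "eps \<rho> x = (SOME \<epsilon>. 0 < \<epsilon> \<and> \<epsilon> \<le> \<rho> \<and> Hs \<epsilon> x = \<rho>)"

text \<open>By the scheduling equation this is \<open>1 / (1 + Vl \<rho> x)\<close>, the factor that
  makes quadratic expressions in the state bounded.\<close>

definition tau :: "real \<Rightarrow> 'a \<Rightarrow> real" where "tau \<rho> x = eps \<rho> x / \<rho>"

text \<open>With these powers of \<open>\<epsilon>\<close> the families \<open>ak\<close>, \<open>bk\<close>, \<open>qk\<close> are bounded uniformly in the state; together with \<open>tau\<close> they are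
  closed under Lie derivatives along the loop, by the differentiated Riccati equation.\<close>

definition ak :: "nat \<Rightarrow> 'a \<Rightarrow> real \<Rightarrow> 'a \<Rightarrow> real" where
  "ak k w \<rho> x = eps \<rho> x ^ k * (w \<bullet> Pd k (eps \<rho> x) x)"

definition bk :: "nat \<Rightarrow> 'a \<Rightarrow> 'a \<Rightarrow> real \<Rightarrow> 'a \<Rightarrow> real" where
  "bk k w w' \<rho> x = eps \<rho> x ^ k * (w \<bullet> Pd k (eps \<rho> x) w')"

definition qk :: "nat \<Rightarrow> real \<Rightarrow> 'a \<Rightarrow> real" where
  "qk k \<rho> x = tau \<rho> x * (eps \<rho> x ^ k * (x \<bullet> Pd k (eps \<rho> x) x))"

text \<open>The reciprocal of the logarithmic derivative of \<open>Hs\<close> with respect to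
  \<open>\<epsilon>\<close> at the scheduled value, that is, the factor produced by implicit
  differentiation. It lies between 0 and 1.\<close>

definition eta :: "real \<Rightarrow> 'a \<Rightarrow> real" where "eta \<rho> x = inverse (1 + qk 1 \<rho> x)"

text \<open>The logarithmic differential of \<open>eps\<close>. Every derivative of
  \<open>eps\<close> thus brings a factor \<open>eps\<close>, which compensates for the extra
  \<open>1 / \<epsilon>\<close> in the bound on \<open>Pd (Suc k)\<close>.\<close>

definition ell :: "real \<Rightarrow> 'a \<Rightarrow> 'a \<Rightarrow> real" where
  "ell \<rho> x h = - 2 * (tau \<rho> x * (eta \<rho> x * (x \<bullet> Pd 0 (eps \<rho> x) h)))"

definition kappa :: "real \<Rightarrow> 'a \<Rightarrow> real" where "kappa \<rho> x = - ak 0 b \<rho> x"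

definition Vl :: "real \<Rightarrow> 'a \<Rightarrow> real" where "Vl \<rho> x = x \<bullet> Pd 0 (eps \<rho> x) x"

context
  fixes \<rho> :: real
  assumes \<rho>: "0 < \<rho>" "\<rho> < 1/2"
begin

lemma eps_pos: "0 < eps \<rho> x" and eps_le: "eps \<rho> x \<le> \<rho>" and eps_eq: "Hs (eps \<rho> x) x = \<rho>"
  using someI_ex[OF eps_exists[OF \<rho>, of x]] unfolding eps_def by auto

lemma eps_lt: "eps \<rho> x < 1" using eps_le[of x] \<rho> by linarith

lemma eps_unique: "0 < \<epsilon> \<Longrightarrow> \<epsilon> < 1 \<Longrightarrow> Hs \<epsilon> x = \<rho> \<Longrightarrow> eps \<rho> x = \<epsilon>"
  using Hs_mono_abs[of \<epsilon> "eps \<rho> x" x] eps_pos[of x] eps_lt[of x] eps_eq[of x] by simp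

lemma eps_pr: "eps \<rho> (pr x) = eps \<rho> x"
proof (rule eps_unique)
  show "Hs (eps \<rho> x) (pr x) = \<rho>"
    using eps_eq[of x] eps_pos[of x] eps_lt[of x] P_pr[of "eps \<rho> x" x] Pd_sym[of "eps \<rho> x" "pr x" 0 x]
    by (simp add: Hs_def)
qed (use eps_pos eps_lt in auto)

lemma kappa_pr: "kappa \<rho> (pr x) = kappa \<rho> x"
  by (simp add: kappa_def ak_def eps_pr P_pr eps_pos eps_lt)

lemma Vl_nonneg: "Vl \<rho> x \<ge> 0"
  unfolding Vl_def by (rule P_pos[OF eps_pos eps_lt])

lemma eps_Vl: "eps \<rho> x * (1 + Vl \<rho> x) = \<rho>"
  using eps_eq[of x] by (simp add: Hs_def Vl_def)

lemma tau_pos: "0 < tau \<rho> x" and tau_le: "tau \<rho> x \<le> 1" and tau_Vl: "tau \<rho> x * Vl \<rho> x \<le> 1"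
  and tau_eq: "tau \<rho> x * (1 + Vl \<rho> x) = 1" and eps_tau: "eps \<rho> x = \<rho> * tau \<rho> x"
proof -
  show "0 < tau \<rho> x" using eps_pos \<rho> by (simp add: tau_def)
  show "tau \<rho> x \<le> 1" using eps_le \<rho> by (simp add: tau_def)
  show e: "tau \<rho> x * (1 + Vl \<rho> x) = 1" using eps_Vl[of x] \<rho> by (simp add: tau_def)
  then show "tau \<rho> x * Vl \<rho> x \<le> 1" using \<open>0 < tau \<rho> x\<close> by (simp add: algebra_simps)
  show "eps \<rho> x = \<rho> * tau \<rho> x" using \<rho> by (simp add: tau_def)
qed

lemma q1_nonneg: "qk 1 \<rho> x \<ge> 0"
  unfolding qk_def using tau_pos[of x] eps_pos[of x] P1_pos[OF eps_pos eps_lt] by simp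

lemma eta_pos: "0 < eta \<rho> x" and eta_le: "eta \<rho> x \<le> 1"
  using q1_nonneg[of x] by (auto simp: eta_def inverse_eq_divide)

text \<open>The map \<open>(\<epsilon>, x) \<mapsto> (Hs \<epsilon> x, x)\<close> has the known
  right inverse \<open>g\<close>; it is differentiable with invertible derivative at the point in
  question, and \<open>g\<close> is continuous there by \<open>Hs_mono_abs\<close>. This already
  gives the derivative of \<open>g\<close>, of which the schedule is a section.\<close>

lemma eps_has_derivative: "(eps \<rho> has_derivative (\<lambda>h. eps \<rho> x * ell \<rho> x h)) (at x)"
proof -
  let ?e = "eps \<rho> x"
  note e = eps_pos[of x] eps_lt[of x]
  define f where "f = (\<lambda>z :: real \<times> 'a. (fst z * (1 + snd z \<bullet> Pd 0 (fst z) (snd z)), snd z))"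
  \<comment> \<open>Here the parameter \<open>\<rho>\<close> is a variable as well; the value 0
    outside the admissible strip is a placeholder, since only a neighbourhood matters.\<close>
  define g where "g = (\<lambda>z :: real \<times> 'a. (if 0 < fst z \<and> fst z < 1/2 then eps (fst z) (snd z) else 0, snd z))"
  define f' where "f' = (\<lambda>d :: real \<times> 'a. (fst d * (1 + x \<bullet> Pd 0 ?e x + ?e * (x \<bullet> Pd 1 ?e x)) + 2 * ?e * (x \<bullet> Pd 0 ?e (snd d)), snd d))"
  define s where "s = 1 + x \<bullet> Pd 0 ?e x + ?e * (x \<bullet> Pd 1 ?e x)"
  have s: "s \<ge> 1" using P_pos[OF e, of x] mult_nonneg_nonneg[of ?e "x \<bullet> Pd 1 ?e x"] P1_pos[OF e, of x] e by (simp add: s_def)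
  define g' where "g' = (\<lambda>d :: real \<times> 'a. ((fst d - 2 * ?e * (x \<bullet> Pd 0 ?e (snd d))) / s, snd d))"
  have gx: "g (\<rho>, x) = (?e, x)" using \<rho> by (simp add: g_def)
  have P': "((\<lambda>z :: real \<times> 'a. Pd 0 (fst z)) has_derivative (\<lambda>d. fst d *\<^sub>R Pd 1 ?e)) (at (?e, x))"
  proof -
    have "(Pd 0 has_derivative (\<lambda>h. h *\<^sub>R Pd 1 ?e)) (at (fst (?e, x)))"
      using Pd_deriv[OF e, of 0] by (simp add: has_vector_derivative_def)
    from has_derivative_compose[OF has_derivative_fst[OF has_derivative_ident] this]
    show ?thesis by simp
  qed
  have f1: "((\<lambda>z :: real \<times> 'a. fst z * (1 + snd z \<bullet> Pd 0 (fst z) (snd z))) has_derivative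
     (\<lambda>d. ?e * (0 + (x \<bullet> (Pd 0 ?e (snd d) + (fst d *\<^sub>R Pd 1 ?e) x) + snd d \<bullet> Pd 0 ?e x)) + fst d * (1 + x \<bullet> Pd 0 ?e x))) (at (?e, x))"
    using has_derivative_mult[OF has_derivative_fst[OF has_derivative_ident[of "at (?e, x)"]]
       has_derivative_add[OF has_derivative_const[of 1] has_derivative_inner[OF has_derivative_snd[OF has_derivative_ident]
         bounded_bilinear.FDERIV[OF bounded_bilinear_blinfun_apply P' has_derivative_snd[OF has_derivative_ident]]]]]
    by simp
  have "(f has_derivative f') (at (?e, x))"
    unfolding f_def
  proof (rule has_derivative_Pair[OF f1 has_derivative_snd[OF has_derivative_ident], THEN has_derivative_eq_rhs], rule ext)
    fix d :: "real \<times> 'a"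
    show "(?e * (0 + (x \<bullet> (Pd 0 ?e (snd d) + (fst d *\<^sub>R Pd 1 ?e) x) + snd d \<bullet> Pd 0 ?e x)) + fst d * (1 + x \<bullet> Pd 0 ?e x), snd d) = f' d"
      using Pd_sym[OF e, of "snd d" 0 x]
      by (simp add: f'_def blinfun.scaleR_left inner_add_right algebra_simps)
  qed
  then have df: "(f has_derivative f') (at (g (\<rho>, x)))" by (simp add: gx)
  have bg: "bounded_linear g'"
    unfolding g'_def
    by (intro bounded_linear_Pair bounded_linear_snd bounded_linear_divide[THEN bounded_linear_compose] bounded_linear_sub bounded_linear_fst
       bounded_linear_const_mult bounded_linear_inner_right[THEN bounded_linear_compose] blinfun.bounded_linear_right[THEN bounded_linear_compose])
  have gf: "g' \<circ> f' = id"
  proof (rule ext)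
    fix d :: "real \<times> 'a"
    have "f' d = (fst d * s + 2 * ?e * (x \<bullet> Pd 0 ?e (snd d)), snd d)" by (simp only: f'_def s_def)
    then show "(g' \<circ> f') d = id d" using s by (simp add: g'_def)
  qed
  have cg: "continuous (at (\<rho>, x)) g"
  proof -
    have contH: "((\<lambda>z :: real \<times> 'a. \<bar>fst z - Hs ?e (snd z)\<bar>) \<longlongrightarrow> \<bar>\<rho> - Hs ?e x\<bar>) (at (\<rho>, x))"
      unfolding Hs_def by (auto intro!: tendsto_eq_intros bounded_linear.tendsto[OF blinfun.bounded_linear_right])
    then have z: "((\<lambda>z :: real \<times> 'a. \<bar>fst z - Hs ?e (snd z)\<bar>) \<longlongrightarrow> 0) (at (\<rho>, x))"
      using eps_eq by simp
    have op: "open ({0<..<1/2::real} \<times> (UNIV :: 'a set))" by (intro open_Times) auto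
    have ev: "\<forall>\<^sub>F z in at (\<rho>, x). z \<in> {0<..<1/2::real} \<times> (UNIV :: 'a set)"
      using eventually_at_in_open'[OF op, of "(\<rho>, x)"] \<rho> by simp
    have "\<forall>\<^sub>F z in at (\<rho>, x). norm (fst (g z) - ?e) \<le> \<bar>fst z - Hs ?e (snd z)\<bar>"
      using ev
    proof (rule eventually_mono)
      fix z :: "real \<times> 'a" assume "z \<in> {0<..<1/2::real} \<times> UNIV"
      then have r: "0 < fst z" "fst z < 1/2" by auto
      obtain \<epsilon>' where e': "eps (fst z) (snd z) = \<epsilon>'" "0 < \<epsilon>'" "\<epsilon>' \<le> fst z" "Hs \<epsilon>' (snd z) = fst z"
        using someI_ex[OF eps_exists[OF r, of "snd z"]] unfolding eps_def by auto
      have "\<bar>\<epsilon>' - ?e\<bar> \<le> \<bar>Hs \<epsilon>' (snd z) - Hs ?e (snd z)\<bar>"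
        by (rule Hs_mono_abs) (use e e' r in auto)
      then show "norm (fst (g z) - ?e) \<le> \<bar>fst z - Hs ?e (snd z)\<bar>"
        using e' r by (simp add: g_def)
    qed
    from Lim_null_comparison[OF this z] have "((\<lambda>z. fst (g z)) \<longlongrightarrow> ?e) (at (\<rho>, x))"
      by (rule LIM_zero_cancel)
    moreover have "((\<lambda>z. snd (g z)) \<longlongrightarrow> x) (at (\<rho>, x))"
      unfolding g_def by (auto intro!: tendsto_eq_intros)
    ultimately have "((\<lambda>z. (fst (g z), snd (g z))) \<longlongrightarrow> (?e, x)) (at (\<rho>, x))" by (rule tendsto_Pair)
    then show ?thesis by (simp add: continuous_within gx)
  qed
  have "(g has_derivative g') (at (\<rho>, x))"
  proof (rule has_derivative_inverse_basic[OF df bg gf cg])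
    show "open ({0<..<1/2::real} \<times> (UNIV :: 'a set))" by (intro open_Times) auto
    show "(\<rho>, x) \<in> {0<..<1/2::real} \<times> UNIV" using \<rho> by simp
    fix z :: "real \<times> 'a" assume "z \<in> {0<..<1/2::real} \<times> UNIV"
    then have r: "0 < fst z" "fst z < 1/2" by auto
    have "Hs (eps (fst z) (snd z)) (snd z) = fst z"
      using someI_ex[OF eps_exists[OF r, of "snd z"]] unfolding eps_def by auto
    then show "f (g z) = z" using r by (simp add: f_def g_def Hs_def)
  qed
  then have "((\<lambda>y. fst (g (\<rho>, y))) has_derivative (\<lambda>h. fst (g' (0, h)))) (at x)"
    by (intro has_derivative_fst has_derivative_compose[where g = g and f = "\<lambda>y. (\<rho>, y)"] has_derivative_Pair has_derivative_const has_derivative_ident)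
  moreover have "(\<lambda>y. fst (g (\<rho>, y))) = eps \<rho>" using \<rho> by (auto simp: g_def)
  moreover have "fst (g' (0, h)) = ?e * ell \<rho> x h" for h
  proof -
    have "tau \<rho> x * s = 1 + qk 1 \<rho> x"
      using tau_eq[of x] by (simp add: s_def qk_def Vl_def algebra_simps)
    then have "tau \<rho> x * eta \<rho> x = 1 / s"
      using q1_nonneg[of x] s unfolding eta_def by (simp add: field_simps)
    then have "ell \<rho> x h = - 2 * ((1 / s) * (x \<bullet> Pd 0 ?e h))" by (simp add: ell_def mult.assoc[symmetric])
    then show ?thesis by (simp add: g'_def)
  qed
  ultimately show ?thesis by simp
qed

lemma tau_has_derivative: "(tau \<rho> has_derivative (\<lambda>h. tau \<rho> x * ell \<rho> x h)) (at x)"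
  using has_derivative_mult_right[OF eps_has_derivative, of "1 / \<rho>" x] by (simp add: tau_def[abs_def])

lemma Pd_eps_has_derivative:
  "((\<lambda>x. Pd k (eps \<rho> x)) has_derivative (\<lambda>h. (eps \<rho> x * ell \<rho> x h) *\<^sub>R Pd (Suc k) (eps \<rho> x))) (at x)"
proof -
  have "(Pd k has_derivative (\<lambda>h. h *\<^sub>R Pd (Suc k) (eps \<rho> x))) (at (eps \<rho> x))"
    using Pd_deriv[OF eps_pos eps_lt, of k] by (simp add: has_vector_derivative_def)
  from has_derivative_compose[OF eps_has_derivative this] show ?thesis .
qed

lemma eps_power_has_derivative:
  "((\<lambda>x. eps \<rho> x ^ k) has_derivative (\<lambda>h. real k * ell \<rho> x h * eps \<rho> x ^ k)) (at x)"
proof (rule has_derivative_eq_rhs[OF has_derivative_power[OF eps_has_derivative]], rule ext)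
  fix h
  show "of_nat k * (eps \<rho> x * ell \<rho> x h) * eps \<rho> x ^ (k - 1) = real k * ell \<rho> x h * eps \<rho> x ^ k"
    by (cases k) auto
qed

lemma bk_has_derivative:
  "(bk k w w' \<rho> has_derivative (\<lambda>h. real k * ell \<rho> x h * bk k w w' \<rho> x + ell \<rho> x h * bk (Suc k) w w' \<rho> x)) (at x)"
  unfolding bk_def[abs_def]
proof (rule has_derivative_eq_rhs[OF has_derivative_mult[OF eps_power_has_derivative
    has_derivative_inner_right[OF bounded_bilinear.FDERIV[OF bounded_bilinear_blinfun_apply Pd_eps_has_derivative has_derivative_const]]]], rule ext)
  fix h
  show "eps \<rho> x ^ k * (w \<bullet> (Pd k (eps \<rho> x) 0 + ((eps \<rho> x * ell \<rho> x h) *\<^sub>R Pd (Suc k) (eps \<rho> x)) w'))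
      + real k * ell \<rho> x h * eps \<rho> x ^ k * (w \<bullet> Pd k (eps \<rho> x) w')
      = real k * ell \<rho> x h * (eps \<rho> x ^ k * (w \<bullet> Pd k (eps \<rho> x) w')) + ell \<rho> x h * (eps \<rho> x ^ Suc k * (w \<bullet> Pd (Suc k) (eps \<rho> x) w'))"
    by (simp add: blinfun.scaleR_left)
qed

lemma ak_has_derivative:
  "(ak k w \<rho> has_derivative (\<lambda>h. real k * ell \<rho> x h * ak k w \<rho> x + ell \<rho> x h * ak (Suc k) w \<rho> x + bk k w h \<rho> x)) (at x)"
  unfolding ak_def[abs_def]
proof (rule has_derivative_eq_rhs[OF has_derivative_mult[OF eps_power_has_derivative
    has_derivative_inner_right[OF bounded_bilinear.FDERIV[OF bounded_bilinear_blinfun_apply Pd_eps_has_derivative has_derivative_ident]]]], rule ext)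
  fix h
  show "eps \<rho> x ^ k * (w \<bullet> (Pd k (eps \<rho> x) h + ((eps \<rho> x * ell \<rho> x h) *\<^sub>R Pd (Suc k) (eps \<rho> x)) x))
      + real k * ell \<rho> x h * eps \<rho> x ^ k * (w \<bullet> Pd k (eps \<rho> x) x)
      = real k * ell \<rho> x h * (eps \<rho> x ^ k * (w \<bullet> Pd k (eps \<rho> x) x)) + ell \<rho> x h * (eps \<rho> x ^ Suc k * (w \<bullet> Pd (Suc k) (eps \<rho> x) x)) + bk k w h \<rho> x"
    by (simp add: blinfun.scaleR_left bk_def inner_add_right algebra_simps)
qed

lemma qk_has_derivative:
  "(qk k \<rho> has_derivative (\<lambda>h. (1 + real k) * ell \<rho> x h * qk k \<rho> x + ell \<rho> x h * qk (Suc k) \<rho> x + 2 * tau \<rho> x * ak k h \<rho> x)) (at x)"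
  unfolding qk_def[abs_def]
proof (rule has_derivative_eq_rhs[OF has_derivative_mult[OF tau_has_derivative has_derivative_mult[OF eps_power_has_derivative
    has_derivative_inner[OF has_derivative_ident bounded_bilinear.FDERIV[OF bounded_bilinear_blinfun_apply Pd_eps_has_derivative has_derivative_ident]]]]], rule ext)
  fix h
  show "tau \<rho> x * (eps \<rho> x ^ k * (x \<bullet> (Pd k (eps \<rho> x) h + ((eps \<rho> x * ell \<rho> x h) *\<^sub>R Pd (Suc k) (eps \<rho> x)) x) + h \<bullet> Pd k (eps \<rho> x) x)
      + real k * ell \<rho> x h * eps \<rho> x ^ k * (x \<bullet> Pd k (eps \<rho> x) x))
      + tau \<rho> x * ell \<rho> x h * (eps \<rho> x ^ k * (x \<bullet> Pd k (eps \<rho> x) x))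
      = (1 + real k) * ell \<rho> x h * (tau \<rho> x * (eps \<rho> x ^ k * (x \<bullet> Pd k (eps \<rho> x) x)))
      + ell \<rho> x h * (tau \<rho> x * (eps \<rho> x ^ Suc k * (x \<bullet> Pd (Suc k) (eps \<rho> x) x))) + 2 * tau \<rho> x * ak k h \<rho> x"
    using Pd_sym[OF eps_pos eps_lt, of x k x h] by (simp add: blinfun.scaleR_left ak_def inner_add_right algebra_simps)
qed

lemma ell_ak: "ell \<rho> x h = - 2 * (tau \<rho> x * (eta \<rho> x * ak 0 h \<rho> x))"
  using Pd_sym[OF eps_pos eps_lt, of x 0 x h] by (simp add: ell_def ak_def)

text \<open>The differentials are polynomials in the same functions and \<open>eta\<close>, so
  smoothness of every order follows by one induction over all families simultaneously.\<close>

lemma Cp_generators: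
  "(\<forall>k w. Cp j (ak k w \<rho>)) \<and> (\<forall>k w w'. Cp j (bk k w w' \<rho>)) \<and> (\<forall>k. Cp j (qk k \<rho>)) \<and> Cp j (tau \<rho>)"
proof (induction j)
  case 0
  have "continuous_on UNIV f" if "\<And>x. \<exists>f'. (f has_derivative f') (at x)" for f :: "'a \<Rightarrow> real"
    using that by (meson continuous_at_imp_continuous_on has_derivative_continuous)
  then show ?case using ak_has_derivative bk_has_derivative qk_has_derivative tau_has_derivative
    unfolding Cp.simps by (intro conjI allI) blast+
next
  case (Suc j)
  then have a: "\<And>k w. Cp j (ak k w \<rho>)" and bb: "\<And>k w w'. Cp j (bk k w w' \<rho>)" and q: "\<And>k. Cp j (qk k \<rho>)" and t: "Cp j (tau \<rho>)"
    by auto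
  have "1 + qk 1 \<rho> x \<noteq> 0" for x using q1_nonneg[of x] by linarith
  then have e: "Cp j (eta \<rho>)" unfolding eta_def[abs_def] by (intro Cp_inverse Cp_add Cp_const q)
  have l: "Cp j (\<lambda>x. ell \<rho> x h)" for h
    unfolding ell_ak by (intro Cp_cmult Cp_mult t e a)
  show ?case
  proof (intro conjI allI)
    show "Cp (Suc j) (ak k w \<rho>)" for k w
      by (rule Cp_SucI[OF ak_has_derivative]) (intro Cp_add Cp_mult Cp_const l a bb)
    show "Cp (Suc j) (bk k w w' \<rho>)" for k w w'
      by (rule Cp_SucI[OF bk_has_derivative]) (intro Cp_add Cp_mult Cp_const l a bb)
    show "Cp (Suc j) (qk k \<rho>)" for k
      by (rule Cp_SucI[OF qk_has_derivative]) (intro Cp_add Cp_mult Cp_const l a q t)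
    show "Cp (Suc j) (tau \<rho>)"
      by (rule Cp_SucI[OF tau_has_derivative]) (intro Cp_mult l t)
  qed
qed

lemma Cp_kappa: "Cp j (kappa \<rho>)"
  using Cp_cmult[of j "ak 0 b \<rho>" "-1"] Cp_generators[of j] by (simp add: kappa_def[abs_def])

end

end

section \<open>Uniform bounds, Lie derivatives and the Lyapunov function of a scheduled
  block\<close>

context low_gain
begin

text \<open>Cauchy-Schwarz in the form \<open>P\<close>: the fixed vector contributes at most
  \<open>sqrt (C * \<epsilon>) * norm w\<close>, the state contributes
  \<open>sqrt (Vl \<rho> x)\<close>, and \<open>\<epsilon> * Vl \<rho> x \<le> \<rho>\<close> by the
  schedule.\<close>

lemma ak_bound: "\<exists>C\<ge>0. \<forall>\<rho> x w. 0 < \<rho> \<longrightarrow> \<rho> < 1/2 \<longrightarrow> \<bar>ak k w \<rho> x\<bar> \<le> C * norm w * sqrt \<rho>"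
proof -
  obtain C where C: "C > 0" "\<And>\<epsilon> v. 0 < \<epsilon> \<Longrightarrow> \<epsilon> < 1 \<Longrightarrow> v \<bullet> Pd 0 \<epsilon> v \<le> C * \<epsilon> * (norm v)\<^sup>2"
    using P_up by blast
  obtain K where K: "K \<ge> 0" "\<And>\<epsilon> v w. 0 < \<epsilon> \<Longrightarrow> \<epsilon> < 1 \<Longrightarrow>
        \<bar>v \<bullet> Pd k \<epsilon> w\<bar> \<le> K / \<epsilon> ^ k * (sqrt (v \<bullet> Pd 0 \<epsilon> v) * sqrt (w \<bullet> Pd 0 \<epsilon> w))"
    using Pd_bound[of k] by blast
  have "\<bar>ak k w \<rho> x\<bar> \<le> (K * sqrt C) * norm w * sqrt \<rho>" if \<rho>: "0 < \<rho>" "\<rho> < 1/2" for \<rho> x w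
  proof -
    let ?e = "eps \<rho> x"
    note e = eps_pos[OF \<rho>, of x] eps_lt[OF \<rho>, of x]
    have "\<bar>ak k w \<rho> x\<bar> = ?e ^ k * \<bar>w \<bullet> Pd k ?e x\<bar>" using e by (simp add: ak_def abs_mult)
    also have "\<dots> \<le> ?e ^ k * (K / ?e ^ k * (sqrt (w \<bullet> Pd 0 ?e w) * sqrt (x \<bullet> Pd 0 ?e x)))"
      using e K(2)[OF e] by (intro mult_left_mono) auto
    also have "\<dots> = K * (sqrt (w \<bullet> Pd 0 ?e w) * sqrt (Vl \<rho> x))" using e by (simp add: Vl_def)
    also have "\<dots> \<le> K * (sqrt (C * ?e * (norm w)\<^sup>2) * sqrt (Vl \<rho> x))"
      using K(1) C(2)[OF e, of w] Vl_nonneg[OF \<rho>] by (intro mult_left_mono mult_right_mono real_sqrt_le_mono) auto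
    also have "\<dots> = (K * sqrt C) * norm w * sqrt (?e * Vl \<rho> x)"
      by (simp add: real_sqrt_mult)
    also have "\<dots> \<le> (K * sqrt C) * norm w * sqrt \<rho>"
      using K(1) C(1) e eps_Vl[OF \<rho>, of x] by (intro mult_left_mono real_sqrt_le_mono) (auto simp: algebra_simps)
    finally show ?thesis .
  qed
  then show ?thesis using K(1) C(1) by (intro exI[of _ "K * sqrt C"]) auto
qed

text \<open>Two fixed vectors give a full factor \<open>\<epsilon>\<close>, which is at most
  \<open>\<rho>\<close> and hence at most \<open>sqrt \<rho>\<close>.\<close>

lemma bk_bound: "\<exists>C\<ge>0. \<forall>\<rho> x w w'. 0 < \<rho> \<longrightarrow> \<rho> < 1/2 \<longrightarrow> \<bar>bk k w w' \<rho> x\<bar> \<le> C * norm w * norm w' * sqrt \<rho>"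
proof -
  obtain C where C: "C > 0" "\<And>\<epsilon> v. 0 < \<epsilon> \<Longrightarrow> \<epsilon> < 1 \<Longrightarrow> v \<bullet> Pd 0 \<epsilon> v \<le> C * \<epsilon> * (norm v)\<^sup>2"
    using P_up by blast
  obtain K where K: "K \<ge> 0" "\<And>\<epsilon> v w. 0 < \<epsilon> \<Longrightarrow> \<epsilon> < 1 \<Longrightarrow>
        \<bar>v \<bullet> Pd k \<epsilon> w\<bar> \<le> K / \<epsilon> ^ k * (sqrt (v \<bullet> Pd 0 \<epsilon> v) * sqrt (w \<bullet> Pd 0 \<epsilon> w))"
    using Pd_bound[of k] by blast
  have "\<bar>bk k w w' \<rho> x\<bar> \<le> (K * C) * norm w * norm w' * sqrt \<rho>" if \<rho>: "0 < \<rho>" "\<rho> < 1/2" for \<rho> x w w'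
  proof -
    let ?e = "eps \<rho> x"
    note e = eps_pos[OF \<rho>, of x] eps_lt[OF \<rho>, of x]
    have "\<bar>bk k w w' \<rho> x\<bar> = ?e ^ k * \<bar>w \<bullet> Pd k ?e w'\<bar>" using e by (simp add: bk_def abs_mult)
    also have "\<dots> \<le> ?e ^ k * (K / ?e ^ k * (sqrt (w \<bullet> Pd 0 ?e w) * sqrt (w' \<bullet> Pd 0 ?e w')))"
      using e K(2)[OF e] by (intro mult_left_mono) auto
    also have "\<dots> = K * (sqrt (w \<bullet> Pd 0 ?e w) * sqrt (w' \<bullet> Pd 0 ?e w'))" using e by simp
    also have "\<dots> \<le> K * (sqrt (C * ?e * (norm w)\<^sup>2) * sqrt (C * ?e * (norm w')\<^sup>2))"
      using K(1) C(2)[OF e] C(1) e by (intro mult_left_mono mult_mono real_sqrt_le_mono) (auto intro: P_pos)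
    also have "\<dots> = (K * C) * norm w * norm w' * ?e"
    proof -
      have "sqrt (C * ?e) * sqrt (C * ?e) = C * ?e" using C(1) e by simp
      then have "sqrt (C * ?e * (norm w)\<^sup>2) * sqrt (C * ?e * (norm w')\<^sup>2) = (C * ?e) * (norm w * norm w')"
        by (simp only: real_sqrt_mult real_sqrt_abs abs_norm_cancel) (simp add: algebra_simps)
      then show ?thesis by (simp add: mult_ac)
    qed
    also have "\<dots> \<le> (K * C) * norm w * norm w' * sqrt \<rho>"
    proof (rule mult_left_mono)
      have "\<rho> \<le> sqrt \<rho>" using \<rho> by (intro real_le_rsqrt) (simp add: power2_eq_square)
      then show "?e \<le> sqrt \<rho>" using eps_le[OF \<rho>, of x] by linarith
    qed (use K(1) C(1) in auto)
    finally show ?thesis .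
  qed
  then show ?thesis using K(1) C(1) by (intro exI[of _ "K * C"]) auto
qed

lemma qk_bound: "\<exists>C\<ge>0. \<forall>\<rho> x. 0 < \<rho> \<longrightarrow> \<rho> < 1/2 \<longrightarrow> \<bar>qk k \<rho> x\<bar> \<le> C"
proof -
  obtain K where K: "K \<ge> 0" "\<And>\<epsilon> v w. 0 < \<epsilon> \<Longrightarrow> \<epsilon> < 1 \<Longrightarrow>
        \<bar>v \<bullet> Pd k \<epsilon> w\<bar> \<le> K / \<epsilon> ^ k * (sqrt (v \<bullet> Pd 0 \<epsilon> v) * sqrt (w \<bullet> Pd 0 \<epsilon> w))"
    using Pd_bound[of k] by blast
  have "\<bar>qk k \<rho> x\<bar> \<le> K" if \<rho>: "0 < \<rho>" "\<rho> < 1/2" for \<rho> x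
  proof -
    let ?e = "eps \<rho> x"
    note e = eps_pos[OF \<rho>, of x] eps_lt[OF \<rho>, of x]
    have "\<bar>qk k \<rho> x\<bar> = tau \<rho> x * (?e ^ k * \<bar>x \<bullet> Pd k ?e x\<bar>)" using e tau_pos[OF \<rho>, of x] by (simp add: qk_def abs_mult)
    also have "\<dots> \<le> tau \<rho> x * (?e ^ k * (K / ?e ^ k * (sqrt (x \<bullet> Pd 0 ?e x) * sqrt (x \<bullet> Pd 0 ?e x))))"
      by (intro mult_left_mono K(2)[OF e]) (use e tau_pos[OF \<rho>, of x] in auto)
    also have "\<dots> = K * (tau \<rho> x * Vl \<rho> x)" using e P_pos[OF e, of x] by (simp add: Vl_def)
    also have "\<dots> \<le> K * 1" using K(1) tau_Vl[OF \<rho>, of x] by (intro mult_left_mono) auto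
    finally show ?thesis by simp
  qed
  then show ?thesis using K(1) by blast
qed

text \<open>Each derivative along \<open>F\<close> is rewritten as a polynomial in the same
  families: the differentiated Riccati equation replaces \<open>Pd k\<close> applied to
  \<open>A x\<close> by a term with \<open>A\<close> on the fixed vector, lower-order terms and
  products of bounded quantities. The signals \<open>g\<close> enter only the Lie derivative, so to
  reach order \<open>j + 1\<close> their bounds are needed at order \<open>j\<close> alone; that is
  why they may themselves depend on the families at the same order.\<close>

lemma LB_generators:
  assumes wt: "weight \<omega>"
    and F: "\<And>\<rho> x. 0 < \<rho> \<Longrightarrow> \<rho> < 1/2 \<Longrightarrow> pr (F \<rho> x) = A x + (\<Sum>r\<in>Basis. g r \<rho> x *\<^sub>R r)"
    and g: "\<And>j r. (\<And>k w. lie_bd F \<omega> j 1 0 (ak k w)) \<Longrightarrow> r \<in> Basis \<Longrightarrow> lie_bd F \<omega> j 0 1 (g r)"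
  shows "(\<forall>k w. lie_bd F \<omega> j 1 0 (ak k w)) \<and> (\<forall>k w w'. lie_bd F \<omega> j 1 0 (bk k w w')) \<and>
    (\<forall>k. lie_bd F \<omega> j 0 0 (qk k)) \<and> lie_bd F \<omega> j 0 0 tau"
proof -
  interpret weight F \<omega> by (rule wt)
  have wa: "wt_bd \<omega> 1 0 (ak k w)" for k w
  proof -
    obtain C where "C \<ge> 0" "\<And>\<rho> x w. 0 < \<rho> \<Longrightarrow> \<rho> < 1/2 \<Longrightarrow> \<bar>ak k w \<rho> x\<bar> \<le> C * norm w * sqrt \<rho>"
      using ak_bound by blast
    then show ?thesis unfolding wt_bd_def by (intro exI[of _ "C * norm w"]) simp
  qed
  have wb: "wt_bd \<omega> 1 0 (bk k w w')" for k w w'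
  proof -
    obtain C where "C \<ge> 0" "\<And>\<rho> x w w'. 0 < \<rho> \<Longrightarrow> \<rho> < 1/2 \<Longrightarrow> \<bar>bk k w w' \<rho> x\<bar> \<le> C * norm w * norm w' * sqrt \<rho>"
      using bk_bound by blast
    then show ?thesis unfolding wt_bd_def by (intro exI[of _ "C * norm w * norm w'"]) simp
  qed
  have wq: "wt_bd \<omega> 0 0 (qk k)" for k
    using qk_bound unfolding wt_bd_def by simp
  have wta: "wt_bd \<omega> 0 0 tau"
    unfolding wt_bd_def by (intro exI[of _ 1]) (use tau_pos tau_le in \<open>simp add: abs_of_pos\<close>)
  have we: "wt_bd \<omega> 0 (- 0) (\<lambda>\<rho> x. inverse (1 + qk 1 \<rho> x))"
  proof -
    have "\<bar>eta \<rho> x\<bar> \<le> 1" if "0 < \<rho>" "\<rho> < 1/2" for \<rho> x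
      using eta_pos[OF that, of x] eta_le[OF that, of x] by simp
    then show ?thesis unfolding wt_bd_def eta_def by (intro exI[of _ 1]) simp
  qed
  show ?thesis
  proof (induction j)
    case 0
    then show ?case using wa wb wq wta by simp
  next
    case (Suc j)
    then have a: "\<And>k w. LB j 1 0 (ak k w)" and bb: "\<And>k w w'. LB j 1 0 (bk k w w')"
      and q: "\<And>k. LB j 0 0 (qk k)" and t: "LB j 0 0 tau" by auto
    have G: "LB j 0 1 (g r)" if "r \<in> Basis" for r by (rule g[OF a that])
    have "LB j 0 (- 0) (\<lambda>\<rho> x. inverse (1 + qk 1 \<rho> x))"
    proof (rule LB_inverse[OF we])
      show "1 + qk 1 \<rho> x \<noteq> 0" if "0 < \<rho>" "\<rho> < 1/2" for \<rho> x using q1_nonneg[OF that, of x] by linarith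
      show "LB j 0 0 (\<lambda>\<rho> x. 1 + qk 1 \<rho> x)" by (intro LB_add LB_const q)
    qed
    then have e: "LB j 0 0 eta" by (simp add: eta_def[abs_def])
    have rt: "LB j 1 1 (\<lambda>\<rho> x. \<rho> * (tau \<rho> x * f \<rho> x))" if "LB j 0 0 f" for f
      by (rule LB_mult_weaken[OF LB_rho LB_mult[OF t that]]) auto
    have a0: "LB j 0 0 (ak k w)" for k w by (rule LB_weaken[OF a]) auto
    \<comment> \<open>The logarithmic derivative of the schedule along \<open>F\<close>, after the
      Riccati equation has removed \<open>A x\<close>.\<close>
    define EL where "EL = (\<lambda>\<rho> x. - 1 * (eta \<rho> x * ((- 1 * (\<rho> * (tau \<rho> x * qk 0 \<rho> x)) + tau \<rho> x * (ak 0 b \<rho> x * ak 0 b \<rho> x))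
        + tau \<rho> x * (2 * (\<Sum>r\<in>Basis. g r \<rho> x * ak 0 r \<rho> x)))))"
    have EL: "LB j 1 1 EL"
    proof -
      have 1: "LB j 1 1 (\<lambda>\<rho> x. - 1 * (\<rho> * (tau \<rho> x * qk 0 \<rho> x)))" by (rule LB_cmult[OF rt[OF q]])
      have 2: "LB j 1 1 (\<lambda>\<rho> x. tau \<rho> x * (ak 0 b \<rho> x * ak 0 b \<rho> x))"
        by (rule LB_mult_weaken[OF t LB_mult[OF a a]]) auto
      have "LB j 1 1 (\<lambda>\<rho> x. 2 * (\<Sum>r\<in>Basis. g r \<rho> x * ak 0 r \<rho> x))"
        by (intro LB_cmult LB_sum, rule LB_mult_weaken[OF G a]) auto
      from LB_mult_weaken[OF t this]
      have 3: "LB j 1 1 (\<lambda>\<rho> x. tau \<rho> x * (2 * (\<Sum>r\<in>Basis. g r \<rho> x * ak 0 r \<rho> x)))" by simp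
      show ?thesis
        unfolding EL_def by (rule LB_cmult, rule LB_mult_weaken[OF e LB_add[OF LB_add[OF 1 2] 3]]) auto
    qed
    have PF: "w \<bullet> Pd k (eps \<rho> x) (F \<rho> x) = w \<bullet> Pd k (eps \<rho> x) (A x) + (\<Sum>r\<in>Basis. g r \<rho> x * (w \<bullet> Pd k (eps \<rho> x) r))"
      if "0 < \<rho>" "\<rho> < 1/2" for \<rho> x k w
      unfolding Pd_pr[OF eps_pos[OF that] eps_lt[OF that], symmetric, of _ _ "F \<rho> x"] F[OF that]
      by (simp add: blinfun.add_right blinfun.sum_right blinfun.scaleR_right inner_add_right inner_sum_right)
    have elF: "ell \<rho> x (F \<rho> x) = EL \<rho> x" if \<rho>: "0 < \<rho>" "\<rho> < 1/2" for \<rho> x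
    proof -
      note e = eps_pos[OF \<rho>, of x] eps_lt[OF \<rho>, of x]
      have ric: "2 * (x \<bullet> Pd 0 (eps \<rho> x) (A x)) = - (eps \<rho> x * (x \<bullet> Pd 0 (eps \<rho> x) x)) + ak 0 b \<rho> x * ak 0 b \<rho> x"
        using riccati[OF e, of x x] Pd_sym[OF e, of "A x" 0 x] Pd_sym[OF e, of x 0 b] by (simp add: ak_def)
      have "ell \<rho> x (F \<rho> x) = - (tau \<rho> x * (eta \<rho> x * (2 * (x \<bullet> Pd 0 (eps \<rho> x) (A x)) + 2 * (\<Sum>r\<in>Basis. g r \<rho> x * (x \<bullet> Pd 0 (eps \<rho> x) r)))))"
        unfolding ell_def PF[OF \<rho>] by (simp add: algebra_simps)
      also have "(\<Sum>r\<in>Basis. g r \<rho> x * (x \<bullet> Pd 0 (eps \<rho> x) r)) = (\<Sum>r\<in>Basis. g r \<rho> x * ak 0 r \<rho> x)"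
        using Pd_sym[OF e, of x 0] by (simp add: ak_def)
      finally show ?thesis
        unfolding ric EL_def using eps_tau[OF \<rho>, of x] by (simp add: qk_def algebra_simps)
    qed
    show ?case
    proof (intro conjI allI)
      fix k w
      obtain c :: "nat \<Rightarrow> real" where c: "\<And>\<epsilon> v w. 0 < \<epsilon> \<Longrightarrow> \<epsilon> < 1 \<Longrightarrow>
         v \<bullet> Pd k \<epsilon> (A w) + A v \<bullet> Pd k \<epsilon> w + \<epsilon> * (v \<bullet> Pd k \<epsilon> w) + real k * (v \<bullet> Pd (k - 1) \<epsilon> w)
         = (\<Sum>i\<le>k. c i * ((v \<bullet> Pd i \<epsilon> b) * (b \<bullet> Pd (k - i) \<epsilon> w)))"
        using riccati_k[of k] by blast
      \<comment> \<open>One power of \<open>eps\<close> is split off to form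
        \<open>ak (k - 1)\<close> or \<open>qk (k - 1)\<close>; for \<open>k = 0\<close> the
        coefficient makes both sides zero.\<close>
      have kshift: "eps \<rho> x ^ k * (real k * z) = real k * (eps \<rho> x * (eps \<rho> x ^ (k - 1) * z))" for \<rho> x z
        by (cases k) auto
      have esplit: "eps \<rho> x ^ k = eps \<rho> x ^ i * eps \<rho> x ^ (k - i)" if "i \<le> k" for \<rho> x i
        using that by (simp flip: power_add)
      \<comment> \<open>The part of the derivative of \<open>ak k w\<close> due to the motion of the
        state at frozen \<open>\<epsilon>\<close>, with \<open>A\<close> already moved onto
        \<open>w\<close>.\<close>
      define AF where "AF = (\<lambda>\<rho> x. (- 1 * ak k (A w) \<rho> x + - 1 * (\<rho> * (tau \<rho> x * ak k w \<rho> x)))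
         + (- real k * (\<rho> * (tau \<rho> x * ak (k - 1) w \<rho> x)) + (\<Sum>i\<le>k. c i * (bk i w b \<rho> x * ak (k - i) b \<rho> x)))
         + (\<Sum>r\<in>Basis. g r \<rho> x * bk k w r \<rho> x))"
      have AF: "LB j 1 1 AF"
        unfolding AF_def
      proof (intro LB_add LB_sum LB_cmult rt a0)
        show "LB j 1 1 (ak k (A w))" by (rule LB_weaken[OF a]) auto
        show "LB j 1 1 (\<lambda>\<rho> x. bk i w b \<rho> x * ak (k - i) b \<rho> x)" for i by (rule LB_mult_weaken[OF bb a]) auto
        show "LB j 1 1 (\<lambda>\<rho> x. g r \<rho> x * bk k w r \<rho> x)" if "r \<in> Basis" for r by (rule LB_mult_weaken[OF G[OF that] bb]) auto
      qed
      have bF: "bk k w (F \<rho> x) \<rho> x = AF \<rho> x" if \<rho>: "0 < \<rho>" "\<rho> < 1/2" for \<rho> x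
      proof -
        let ?e = "eps \<rho> x"
        note e = eps_pos[OF \<rho>, of x] eps_lt[OF \<rho>, of x]
        have "bk k w (F \<rho> x) \<rho> x = ?e ^ k * (w \<bullet> Pd k ?e (A x)) + (\<Sum>r\<in>Basis. g r \<rho> x * bk k w r \<rho> x)"
          unfolding bk_def PF[OF \<rho>] by (simp add: distrib_left sum_distrib_left mult_ac)
        also have "w \<bullet> Pd k ?e (A x) = - (A w \<bullet> Pd k ?e x) - ?e * (w \<bullet> Pd k ?e x) - real k * (w \<bullet> Pd (k - 1) ?e x)
            + (\<Sum>i\<le>k. c i * ((w \<bullet> Pd i ?e b) * (b \<bullet> Pd (k - i) ?e x)))"
          using c[OF e, of w x] by linarith
        also have "?e ^ k * \<dots> = - ak k (A w) \<rho> x - ?e * ak k w \<rho> x - real k * (?e * ak (k - 1) w \<rho> x)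
            + (\<Sum>i\<le>k. ?e ^ k * (c i * ((w \<bullet> Pd i ?e b) * (b \<bullet> Pd (k - i) ?e x))))"
          by (simp add: ak_def right_diff_distrib distrib_left sum_distrib_left kshift)
        also have "(\<Sum>i\<le>k. ?e ^ k * (c i * ((w \<bullet> Pd i ?e b) * (b \<bullet> Pd (k - i) ?e x)))) = (\<Sum>i\<le>k. c i * (bk i w b \<rho> x * ak (k - i) b \<rho> x))"
          by (intro sum.cong refl) (simp add: esplit bk_def ak_def mult_ac)
        finally show ?thesis unfolding AF_def using eps_tau[OF \<rho>, of x] by (simp add: mult.assoc)
      qed
      show "LB (Suc j) 1 0 (ak k w)"
      proof (rule LB_SucI[OF wa ak_has_derivative])
        show "LB j 1 (0 + 1) (\<lambda>\<rho> x. real k * (EL \<rho> x * ak k w \<rho> x) + EL \<rho> x * ak (Suc k) w \<rho> x + AF \<rho> x)"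
          by (intro LB_add LB_cmult LB_mult_weaken[OF EL a]) (use AF in auto)
        show "real k * ell \<rho> x (F \<rho> x) * ak k w \<rho> x + ell \<rho> x (F \<rho> x) * ak (Suc k) w \<rho> x + bk k w (F \<rho> x) \<rho> x
            = real k * (EL \<rho> x * ak k w \<rho> x) + EL \<rho> x * ak (Suc k) w \<rho> x + AF \<rho> x" if "0 < \<rho>" "\<rho> < 1/2" for \<rho> x
          by (simp add: elF[OF that] bF[OF that])
      qed
      \<comment> \<open>The analogous part for \<open>qk k\<close>. Here only boundedness and no
        smallness in \<open>\<rho>\<close> is recorded, since the \<open>qk\<close> are bounded but
        need not be small.\<close>
      define QF where "QF = (\<lambda>\<rho> x. (- 1 * (\<rho> * (tau \<rho> x * qk k \<rho> x)) + - real k * (\<rho> * (tau \<rho> x * qk (k - 1) \<rho> x)))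
         + tau \<rho> x * (\<Sum>i\<le>k. c i * (ak i b \<rho> x * ak (k - i) b \<rho> x)) + tau \<rho> x * (2 * (\<Sum>r\<in>Basis. g r \<rho> x * ak k r \<rho> x)))"
      have QF: "LB j 0 1 QF"
        unfolding QF_def
      proof (intro LB_add LB_cmult)
        show "LB j 0 1 (\<lambda>\<rho> x. \<rho> * (tau \<rho> x * qk k \<rho> x))" by (rule LB_weaken[OF rt[OF q]]) auto
        show "LB j 0 1 (\<lambda>\<rho> x. \<rho> * (tau \<rho> x * qk (k - 1) \<rho> x))" by (rule LB_weaken[OF rt[OF q]]) auto
        have "LB j 0 1 (\<lambda>\<rho> x. \<Sum>i\<le>k. c i * (ak i b \<rho> x * ak (k - i) b \<rho> x))"
          by (intro LB_sum LB_cmult, rule LB_mult_weaken[OF a a]) auto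
        then show "LB j 0 1 (\<lambda>\<rho> x. tau \<rho> x * (\<Sum>i\<le>k. c i * (ak i b \<rho> x * ak (k - i) b \<rho> x)))"
          by (intro LB_mult_weaken[OF t]) auto
        have "LB j 0 1 (\<lambda>\<rho> x. 2 * (\<Sum>r\<in>Basis. g r \<rho> x * ak k r \<rho> x))"
          by (intro LB_cmult LB_sum, rule LB_mult_weaken[OF G a]) auto
        then show "LB j 0 1 (\<lambda>\<rho> x. tau \<rho> x * (2 * (\<Sum>r\<in>Basis. g r \<rho> x * ak k r \<rho> x)))"
          by (intro LB_mult_weaken[OF t]) auto
      qed
      have qF: "2 * tau \<rho> x * ak k (F \<rho> x) \<rho> x = QF \<rho> x" if \<rho>: "0 < \<rho>" "\<rho> < 1/2" for \<rho> x
      proof -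
        let ?e = "eps \<rho> x"
        note e = eps_pos[OF \<rho>, of x] eps_lt[OF \<rho>, of x]
        have "2 * ak k (F \<rho> x) \<rho> x = 2 * (?e ^ k * (x \<bullet> Pd k ?e (F \<rho> x)))"
          using Pd_sym[OF e, of x k] by (simp add: ak_def)
        also have "\<dots> = ?e ^ k * (2 * (x \<bullet> Pd k ?e (A x))) + 2 * (\<Sum>r\<in>Basis. g r \<rho> x * ak k r \<rho> x)"
          unfolding PF[OF \<rho>] using Pd_sym[OF e, of x k] by (simp add: ak_def distrib_left sum_distrib_left mult_ac)
        also have "2 * (x \<bullet> Pd k ?e (A x)) = - (?e * (x \<bullet> Pd k ?e x)) - real k * (x \<bullet> Pd (k - 1) ?e x)
            + (\<Sum>i\<le>k. c i * ((x \<bullet> Pd i ?e b) * (b \<bullet> Pd (k - i) ?e x)))"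
          using c[OF e, of x x] Pd_sym[OF e, of "A x" k x] by linarith
        also have "?e ^ k * \<dots> = - (?e * (?e ^ k * (x \<bullet> Pd k ?e x))) - real k * (?e * (?e ^ (k - 1) * (x \<bullet> Pd (k - 1) ?e x)))
            + (\<Sum>i\<le>k. ?e ^ k * (c i * ((x \<bullet> Pd i ?e b) * (b \<bullet> Pd (k - i) ?e x))))"
          by (simp add: right_diff_distrib distrib_left sum_distrib_left kshift)
        also have "(\<Sum>i\<le>k. ?e ^ k * (c i * ((x \<bullet> Pd i ?e b) * (b \<bullet> Pd (k - i) ?e x)))) = (\<Sum>i\<le>k. c i * (ak i b \<rho> x * ak (k - i) b \<rho> x))"
          using Pd_sym[OF e, of x _ b] by (intro sum.cong refl) (simp add: esplit ak_def mult_ac)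
        finally have *: "2 * ak k (F \<rho> x) \<rho> x = - (?e * (?e ^ k * (x \<bullet> Pd k ?e x))) - real k * (?e * (?e ^ (k - 1) * (x \<bullet> Pd (k - 1) ?e x)))
            + (\<Sum>i\<le>k. c i * (ak i b \<rho> x * ak (k - i) b \<rho> x)) + 2 * (\<Sum>r\<in>Basis. g r \<rho> x * ak k r \<rho> x)" .
        have "2 * tau \<rho> x * ak k (F \<rho> x) \<rho> x = tau \<rho> x * (2 * ak k (F \<rho> x) \<rho> x)" by simp
        also have "\<dots> = - (?e * qk k \<rho> x) - real k * (?e * qk (k - 1) \<rho> x)
            + tau \<rho> x * (\<Sum>i\<le>k. c i * (ak i b \<rho> x * ak (k - i) b \<rho> x)) + tau \<rho> x * (2 * (\<Sum>r\<in>Basis. g r \<rho> x * ak k r \<rho> x))"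
          unfolding * qk_def by (simp add: algebra_simps)
        also have "\<dots> = QF \<rho> x"
          unfolding QF_def using eps_tau[OF \<rho>, of x] by (simp add: mult.assoc)
        finally show ?thesis .
      qed
      show "LB (Suc j) 0 0 (qk k)"
      proof (rule LB_SucI[OF wq qk_has_derivative])
        have EL0: "LB j 0 1 EL" by (rule LB_weaken[OF EL]) auto
        show "LB j 0 (0 + 1) (\<lambda>\<rho> x. (1 + real k) * (EL \<rho> x * qk k \<rho> x) + EL \<rho> x * qk (Suc k) \<rho> x + QF \<rho> x)"
          by (intro LB_add LB_cmult LB_mult_weaken[OF EL0 q]) (use QF in auto)
        show "(1 + real k) * ell \<rho> x (F \<rho> x) * qk k \<rho> x + ell \<rho> x (F \<rho> x) * qk (Suc k) \<rho> x + 2 * tau \<rho> x * ak k (F \<rho> x) \<rho> x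
            = (1 + real k) * (EL \<rho> x * qk k \<rho> x) + EL \<rho> x * qk (Suc k) \<rho> x + QF \<rho> x" if "0 < \<rho>" "\<rho> < 1/2" for \<rho> x
          by (simp add: elF[OF that] qF[OF that])
      qed
    next
      fix k w w'
      show "LB (Suc j) 1 0 (bk k w w')"
      proof (rule LB_SucI[OF wb bk_has_derivative])
        show "LB j 1 (0 + 1) (\<lambda>\<rho> x. real k * (EL \<rho> x * bk k w w' \<rho> x) + EL \<rho> x * bk (Suc k) w w' \<rho> x)"
          by (intro LB_add LB_cmult LB_mult_weaken[OF EL bb]) auto
        show "real k * ell \<rho> x (F \<rho> x) * bk k w w' \<rho> x + ell \<rho> x (F \<rho> x) * bk (Suc k) w w' \<rho> x
            = real k * (EL \<rho> x * bk k w w' \<rho> x) + EL \<rho> x * bk (Suc k) w w' \<rho> x" if "0 < \<rho>" "\<rho> < 1/2" for \<rho> x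
          by (simp add: elF[OF that])
      qed
    next
      show "LB (Suc j) 0 0 tau"
      proof (rule LB_SucI[OF wta tau_has_derivative])
        show "LB j 0 (0 + 1) (\<lambda>\<rho> x. tau \<rho> x * EL \<rho> x)"
          by (rule LB_mult_weaken[OF t EL]) auto
        show "tau \<rho> x * ell \<rho> x (F \<rho> x) = tau \<rho> x * EL \<rho> x" if "0 < \<rho>" "\<rho> < 1/2" for \<rho> x
          by (simp add: elF[OF that])
      qed
    qed
  qed
qed

context
  fixes \<rho> :: real
  assumes \<rho>: "0 < \<rho>" "\<rho> < 1/2"
begin

lemma kappa_zero: "kappa \<rho> 0 = 0" by (simp add: kappa_def ak_def)

lemma kappa_bounded: "\<exists>K\<ge>0. \<forall>x. \<bar>kappa \<rho> x\<bar> \<le> K"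
proof -
  obtain C where "C \<ge> 0" "\<And>\<rho> x w. 0 < \<rho> \<Longrightarrow> \<rho> < 1/2 \<Longrightarrow> \<bar>ak 0 w \<rho> x\<bar> \<le> C * norm w * sqrt \<rho>"
    using ak_bound by blast
  then show ?thesis using \<rho> by (intro exI[of _ "C * norm b * sqrt \<rho>"]) (simp add: kappa_def)
qed

text \<open>The differential of \<open>ak 0 b\<close> is bounded uniformly in the state, because
  \<open>ell\<close> is linear in an \<open>ak\<close> term and \<open>tau\<close>,
  \<open>eta\<close> are at most 1.\<close>

lemma kappa_lipschitz: "\<exists>L\<ge>0. \<forall>x y. \<bar>kappa \<rho> x - kappa \<rho> y\<bar> \<le> L * norm (x - y)"
proof -
  obtain C0 where C0: "C0 \<ge> 0" "\<And>\<rho> x w. 0 < \<rho> \<Longrightarrow> \<rho> < 1/2 \<Longrightarrow> \<bar>ak 0 w \<rho> x\<bar> \<le> C0 * norm w * sqrt \<rho>"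
    using ak_bound by blast
  obtain C1 where C1: "C1 \<ge> 0" "\<And>\<rho> x w. 0 < \<rho> \<Longrightarrow> \<rho> < 1/2 \<Longrightarrow> \<bar>ak (Suc 0) w \<rho> x\<bar> \<le> C1 * norm w * sqrt \<rho>"
    using ak_bound by blast
  obtain C2 where C2: "C2 \<ge> 0" "\<And>\<rho> x w w'. 0 < \<rho> \<Longrightarrow> \<rho> < 1/2 \<Longrightarrow> \<bar>bk 0 w w' \<rho> x\<bar> \<le> C2 * norm w * norm w' * sqrt \<rho>"
    using bk_bound by blast
  have sr: "sqrt \<rho> \<le> 1" using \<rho> by simp
  define L where "L = 2 * C0 * (C1 * norm b) + C2 * norm b"
  have L: "L \<ge> 0" using C0 C1 C2 by (simp add: L_def)
  let ?d = "\<lambda>x h. real 0 * ell \<rho> x h * ak 0 b \<rho> x + ell \<rho> x h * ak (Suc 0) b \<rho> x + bk 0 b h \<rho> x"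
  have dn: "\<bar>?d x h\<bar> \<le> L * norm h" for x h
  proof -
    have "\<bar>ell \<rho> x h\<bar> = 2 * (tau \<rho> x * (eta \<rho> x * \<bar>ak 0 h \<rho> x\<bar>))"
      using tau_pos[OF \<rho>, of x] eta_pos[OF \<rho>, of x] by (simp add: ell_ak[OF \<rho>] abs_mult)
    also have "\<dots> \<le> 2 * (1 * (1 * (C0 * norm h * 1)))"
    proof (intro mult_mono mult_left_mono)
      have "\<bar>ak 0 h \<rho> x\<bar> \<le> C0 * norm h * sqrt \<rho>" by (rule C0(2)[OF \<rho>])
      also have "\<dots> \<le> C0 * norm h * 1" using sr C0(1) by (intro mult_left_mono) auto
      finally show "\<bar>ak 0 h \<rho> x\<bar> \<le> C0 * norm h * 1" .
    qed (use tau_pos[OF \<rho>, of x] tau_le[OF \<rho>, of x] eta_pos[OF \<rho>, of x] eta_le[OF \<rho>, of x] in auto)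
    finally have l: "\<bar>ell \<rho> x h\<bar> \<le> 2 * C0 * norm h" by simp
    have "\<bar>ak (Suc 0) b \<rho> x\<bar> \<le> C1 * norm b * sqrt \<rho>" by (rule C1(2)[OF \<rho>])
    also have "\<dots> \<le> C1 * norm b * 1" using sr C1(1) by (intro mult_left_mono) auto
    finally have 1: "\<bar>ak (Suc 0) b \<rho> x\<bar> \<le> C1 * norm b" by simp
    have "\<bar>bk 0 b h \<rho> x\<bar> \<le> C2 * norm b * norm h * sqrt \<rho>" by (rule C2(2)[OF \<rho>])
    also have "\<dots> \<le> C2 * norm b * norm h * 1" using sr C2(1) by (intro mult_left_mono) auto
    finally have 2: "\<bar>bk 0 b h \<rho> x\<bar> \<le> C2 * norm b * norm h" by simp
    have "\<bar>?d x h\<bar> \<le> \<bar>ell \<rho> x h\<bar> * \<bar>ak (Suc 0) b \<rho> x\<bar> + \<bar>bk 0 b h \<rho> x\<bar>"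
      by (simp add: abs_mult[symmetric] abs_triangle_ineq)
    also have "\<dots> \<le> (2 * C0 * norm h) * (C1 * norm b) + C2 * norm b * norm h"
      using C0(1) by (intro add_mono mult_mono l 1 2) auto
    finally show ?thesis by (simp add: L_def algebra_simps)
  qed
  have "\<bar>kappa \<rho> x - kappa \<rho> y\<bar> \<le> L * norm (x - y)" for x y
  proof -
    have "norm (ak 0 b \<rho> x - ak 0 b \<rho> y) \<le> L * norm (x - y)"
    proof (rule differentiable_bound[of UNIV])
      show "(ak 0 b \<rho> has_derivative ?d z) (at z within UNIV)" for z
        using ak_has_derivative[OF \<rho>, of 0 b z] by simp
      show "onorm (?d z) \<le> L" for z
        using dn by (intro onorm_bound L) simp
    qed auto
    then show ?thesis by (simp add: kappa_def)
  qed
  then show ?thesis using L by blast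
qed

text \<open>Obtained from \<open>Vl = 1 / tau - 1\<close>. Compared with a frozen gain, the motion
  of the schedule changes the gradient only by the positive factor \<open>eta\<close>, so the sign
  of the Riccati decrease survives.\<close>

lemma Vl_has_derivative: "(Vl \<rho> has_derivative (\<lambda>h. 2 * (eta \<rho> x * ak 0 h \<rho> x))) (at x)"
proof -
  have V: "Vl \<rho> x = inverse (tau \<rho> x) - 1" for x
    using tau_eq[OF \<rho>, of x] tau_pos[OF \<rho>, of x] by (simp add: field_simps)
  have t0: "tau \<rho> x \<noteq> 0" using tau_pos[OF \<rho>, of x] by simp
  have "((\<lambda>x. inverse (tau \<rho> x) - 1) has_derivative (\<lambda>h. - (inverse (tau \<rho> x) * (tau \<rho> x * ell \<rho> x h) * inverse (tau \<rho> x)) - 0)) (at x)"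
    by (intro has_derivative_diff has_derivative_const Deriv.has_derivative_inverse tau_has_derivative \<rho> t0)
  moreover have "- (inverse (tau \<rho> x) * (tau \<rho> x * ell \<rho> x h) * inverse (tau \<rho> x)) - 0 = 2 * (eta \<rho> x * ak 0 h \<rho> x)" for h
    using t0 by (simp add: ell_ak[OF \<rho>])
  moreover have "Vl \<rho> = (\<lambda>x. inverse (tau \<rho> x) - 1)" using V by auto
  ultimately show ?thesis by simp
qed

text \<open>With \<open>s x * s x = eps \<rho> x * Vl \<rho> x\<close>, the Riccati equation makes
  \<open>Vl\<close> decrease along the undisturbed loop at least at the rate
  \<open>eta * (s x)\<close> times \<open>s x\<close>, while a disturbance of size
  \<open>\<delta>\<close> contributes at most \<open>2 * eta * D * s x * \<delta>\<close>. Since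
  \<open>(s x)\<close> squared equals \<open>\<rho> * Vl / (1 + Vl)\<close> and never exceeds
  \<open>\<rho>\<close>, the balance is favourable for large states only if \<open>\<delta>\<close>
  is small; hence the bound \<open>\<Delta>\<close>.\<close>

lemma lin_gain_kappa: "lin_gain X (\<lambda>x. A x + kappa \<rho> x *\<^sub>R b)"
proof -
  obtain C where C: "C > 0" "\<And>\<epsilon> v. 0 < \<epsilon> \<Longrightarrow> \<epsilon> < 1 \<Longrightarrow> v \<bullet> Pd 0 \<epsilon> v \<le> C * \<epsilon> * (norm v)\<^sup>2"
    using P_up by blast
  obtain C0 where C0: "C0 \<ge> 0" "\<And>\<epsilon> v w. 0 < \<epsilon> \<Longrightarrow> \<epsilon> < 1 \<Longrightarrow>
        \<bar>v \<bullet> Pd 0 \<epsilon> w\<bar> \<le> C0 / \<epsilon> ^ 0 * (sqrt (v \<bullet> Pd 0 \<epsilon> v) * sqrt (w \<bullet> Pd 0 \<epsilon> w))"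
    using Pd_bound[of 0] by blast
  obtain C1 where C1: "C1 \<ge> 0" "\<And>\<rho> x. 0 < \<rho> \<Longrightarrow> \<rho> < 1/2 \<Longrightarrow> \<bar>qk 1 \<rho> x\<bar> \<le> C1"
    using qk_bound by blast
  obtain K where K: "K > 0" "\<And>\<epsilon> v. \<rho> / 2 \<le> \<epsilon> \<Longrightarrow> \<epsilon> < 1 \<Longrightarrow> v \<in> X \<Longrightarrow> (norm v)\<^sup>2 \<le> K * (v \<bullet> Pd 0 \<epsilon> v)"
    using P_low[of "\<rho> / 2"] \<rho> by auto
  define D where "D = (C0 + 1) * sqrt C"
  have D: "D > 0" using C0 C by (simp add: D_def add_nonneg_pos)
  define s where "s = (\<lambda>x. sqrt (eps \<rho> x * Vl \<rho> x))"
  have s0: "s x \<ge> 0" for x using eps_pos[OF \<rho>, of x] Vl_nonneg[OF \<rho>, of x] by (simp add: s_def)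
  have ss: "s x * s x = eps \<rho> x * Vl \<rho> x" for x using eps_pos[OF \<rho>, of x] Vl_nonneg[OF \<rho>, of x] by (simp add: s_def)
  have ah: "\<bar>ak 0 h \<rho> x\<bar> \<le> D * s x * norm h" for x h
  proof -
    let ?e = "eps \<rho> x"
    note e = eps_pos[OF \<rho>, of x] eps_lt[OF \<rho>, of x]
    have "\<bar>ak 0 h \<rho> x\<bar> \<le> C0 * (sqrt (h \<bullet> Pd 0 ?e h) * sqrt (Vl \<rho> x))"
      using C0(2)[OF e, of h x] by (simp add: ak_def Vl_def)
    also have "\<dots> \<le> (C0 + 1) * (sqrt (C * ?e * (norm h)\<^sup>2) * sqrt (Vl \<rho> x))"
      using C0(1) C(1) e C(2)[OF e, of h] Vl_nonneg[OF \<rho>, of x] P_pos[OF e, of h]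
      by (intro mult_mono real_sqrt_le_mono) (auto intro!: mult_nonneg_nonneg)
    also have "\<dots> = D * s x * norm h" by (simp add: D_def s_def real_sqrt_mult)
    finally show ?thesis .
  qed
  \<comment> \<open>The first entry forces \<open>s x \<ge> 4 * D * \<delta>\<close> above the level
    \<open>E * \<delta>\<^sup>2\<close>; the second puts the ball of radius \<open>\<delta>\<close>
    below that level.\<close>
  define E where "E = max (32 * D\<^sup>2 / \<rho>) C"
  have E: "E > 0" "E \<ge> C" "E \<ge> 32 * D\<^sup>2 / \<rho>" using C by (auto simp: E_def)
  \<comment> \<open>Keeps the level \<open>\<theta>\<close> at most 1. Then
    \<open>Vl / (1 + Vl) \<ge> \<theta> / 2\<close> above the level, and below it the gain is at
    least \<open>\<rho> / 2\<close>, where \<open>P\<close> has a lower bound.\<close>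
  define \<Delta> where "\<Delta> = 1 / sqrt E"
  have \<Delta>: "\<Delta> > 0" using E by (simp add: \<Delta>_def)
  have bl: "bounded_linear A" using linA by (simp add: linear_conv_bounded_linear)
  obtain L where L: "L \<ge> 0" "\<And>x y. \<bar>kappa \<rho> x - kappa \<rho> y\<bar> \<le> L * norm (x - y)" using kappa_lipschitz by blast
  have ck: "continuous_on UNIV (kappa \<rho>)"
    by (rule lipschitz_on_continuous_on[where L = L], rule lipschitz_onI) (use L in \<open>auto simp: dist_norm\<close>)
  have XS: "c *\<^sub>R v \<in> X" "v + w \<in> X" if "v \<in> X" "w \<in> X" for c v w
    using that pr_iff linear_add[OF linpr] linear_scale[OF linpr] by metis+
  show ?thesis
  proof (rule lyapunov_lin_gain[OF bl_pr _ _ _ Vl_has_derivative, where \<Delta> = \<Delta> and N = "sqrt (K * E)" and \<alpha> = "\<lambda>x. 2 * (eta \<rho> x * (D * s x))"])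
    show "pr y = y \<longleftrightarrow> y \<in> X" for y by (rule pr_iff)
    show "continuous_on UNIV (\<lambda>x. A x + kappa \<rho> x *\<^sub>R b)"
      by (intro continuous_intros bounded_linear.continuous_on[OF bl] ck)
    show "A y + kappa \<rho> y *\<^sub>R b \<in> X" for y using XS A_mem b_mem by auto
    show "2 * (eta \<rho> x * ak 0 h \<rho> x) \<le> 2 * (eta \<rho> x * (D * s x)) * norm h" for x h
    proof -
      have "eta \<rho> x * ak 0 h \<rho> x \<le> eta \<rho> x * (D * s x * norm h)"
        using ah[of h x] eta_pos[OF \<rho>, of x] by (intro mult_left_mono) auto
      then show ?thesis by (simp add: mult_ac)
    qed
    show "2 * (eta \<rho> x * (D * s x)) \<ge> 0" for x using D s0[of x] eta_pos[OF \<rho>, of x] by simp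
    show "sqrt (K * E) > 0" using K E by simp
    show "\<Delta> > 0" by (rule \<Delta>)
    fix \<delta> :: real assume \<delta>: "0 < \<delta>" "\<delta> \<le> \<Delta>"
    define \<theta> where "\<theta> = E * \<delta>\<^sup>2"
    have "\<delta>\<^sup>2 \<le> \<Delta>\<^sup>2" using \<delta> by (intro power_mono) auto
    then have "\<theta> \<le> E * \<Delta>\<^sup>2" using E by (simp add: \<theta>_def)
    also have "\<dots> = 1" using E by (simp add: \<Delta>_def power_divide)
    finally have \<theta>1: "\<theta> \<le> 1" .
    \<comment> \<open>Half of the decrease obtained below, so that the inequality becomes strict;
      \<open>1 / (1 + C1)\<close> is the lower bound for \<open>eta\<close>.\<close>
    define \<gamma> where "\<gamma> = 4 * D\<^sup>2 * \<delta>\<^sup>2 / (1 + C1)"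
    have g: "\<gamma> > 0" using D \<delta> C1 by (simp add: \<gamma>_def)
    show "\<exists>\<theta> \<gamma>. \<gamma> > 0 \<and>
      (\<forall>x\<in>X. Vl \<rho> x \<ge> \<theta> \<longrightarrow> 2 * (eta \<rho> x * ak 0 (A x + kappa \<rho> x *\<^sub>R b) \<rho> x) + 2 * (eta \<rho> x * (D * s x)) * \<delta> < - \<gamma>) \<and>
      (\<forall>x\<in>X. Vl \<rho> x \<le> \<theta> \<longrightarrow> norm x \<le> sqrt (K * E) * \<delta>) \<and> (\<forall>x\<in>X. norm x \<le> \<delta> \<longrightarrow> Vl \<rho> x \<le> \<theta>)"
    proof (rule exI[of _ \<theta>], rule exI[of _ \<gamma>], intro conjI ballI impI)
      show "\<gamma> > 0" by (rule g)
    next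
      fix x assume x: "x \<in> X" "Vl \<rho> x \<ge> \<theta>"
      note e = eps_pos[OF \<rho>, of x] eps_lt[OF \<rho>, of x]
      have ric: "2 * ak 0 (A x) \<rho> x = - (eps \<rho> x * Vl \<rho> x) + (ak 0 b \<rho> x)\<^sup>2"
        using riccati[OF e, of x x] Pd_sym[OF e, of "A x" 0 x] Pd_sym[OF e, of x 0 b]
        by (simp add: ak_def Vl_def power2_eq_square)
      have lin: "ak 0 (A x + kappa \<rho> x *\<^sub>R b) \<rho> x = ak 0 (A x) \<rho> x + kappa \<rho> x * ak 0 b \<rho> x"
        by (simp add: ak_def inner_add_left)
      have 1: "2 * ak 0 (A x + kappa \<rho> x *\<^sub>R b) \<rho> x \<le> - (s x * s x)"
        unfolding lin distrib_left ric ss by (simp add: kappa_def power2_eq_square)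
      have sV: "s x * s x = \<rho> * (Vl \<rho> x / (1 + Vl \<rho> x))"
        unfolding ss using eps_Vl[OF \<rho>, of x] Vl_nonneg[OF \<rho>, of x] by (simp add: field_simps)
      have "\<theta> / 2 \<le> Vl \<rho> x / (1 + Vl \<rho> x)"
      proof (cases "Vl \<rho> x \<le> 1")
        case True
        have "\<theta> / 2 \<le> Vl \<rho> x / 2" using x by simp
        also have "\<dots> \<le> Vl \<rho> x / (1 + Vl \<rho> x)" using True Vl_nonneg[OF \<rho>, of x] by (intro divide_left_mono) auto
        finally show ?thesis .
      next
        case False
        have "\<theta> / 2 \<le> 1 / 2" using \<theta>1 by simp
        also have "\<dots> \<le> Vl \<rho> x / (1 + Vl \<rho> x)" using False by (simp add: field_simps)
        finally show ?thesis .
      qed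
      then have "\<rho> * (\<theta> / 2) \<le> s x * s x" unfolding sV using \<rho> by (intro mult_left_mono) auto
      moreover have "16 * D\<^sup>2 * \<delta>\<^sup>2 \<le> \<rho> * (\<theta> / 2)"
      proof -
        have "\<rho> * (32 * D\<^sup>2 / \<rho>) \<le> \<rho> * E" using E \<rho> by (intro mult_left_mono) auto
        then have "32 * D\<^sup>2 \<le> \<rho> * E" using \<rho> by simp
        then have "32 * D\<^sup>2 * \<delta>\<^sup>2 \<le> \<rho> * E * \<delta>\<^sup>2" by (rule mult_right_mono) simp
        then show ?thesis by (simp add: \<theta>_def mult_ac)
      qed
      ultimately have sl: "16 * D\<^sup>2 * \<delta>\<^sup>2 \<le> s x * s x" by linarith
      then have "(4 * D * \<delta>)\<^sup>2 \<le> (s x)\<^sup>2" by (simp add: power_mult_distrib power2_eq_square[of "s x"])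
      then have s4: "4 * D * \<delta> \<le> s x" by (rule power2_le_imp_le[OF _ s0])
      have "4 * D * \<delta> * s x \<le> s x * s x" by (rule mult_right_mono[OF s4 s0])
      then have "2 * ak 0 (A x + kappa \<rho> x *\<^sub>R b) \<rho> x + 2 * (D * s x) * \<delta> \<le> - (s x * s x) / 2"
        using 1 by (simp add: algebra_simps)
      also have "\<dots> \<le> - (8 * D\<^sup>2 * \<delta>\<^sup>2)" using sl by simp
      finally have 2: "2 * ak 0 (A x + kappa \<rho> x *\<^sub>R b) \<rho> x + 2 * (D * s x) * \<delta> \<le> - (8 * D\<^sup>2 * \<delta>\<^sup>2)" .
      have el: "1 / (1 + C1) \<le> eta \<rho> x"
        unfolding eta_def inverse_eq_divide using q1_nonneg[OF \<rho>, of x] C1(2)[OF \<rho>, of x] by (intro divide_left_mono) auto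
      have "2 * (eta \<rho> x * ak 0 (A x + kappa \<rho> x *\<^sub>R b) \<rho> x) + 2 * (eta \<rho> x * (D * s x)) * \<delta>
        = eta \<rho> x * (2 * ak 0 (A x + kappa \<rho> x *\<^sub>R b) \<rho> x + 2 * (D * s x) * \<delta>)"
        by (simp add: algebra_simps)
      also have "\<dots> \<le> eta \<rho> x * (- (8 * D\<^sup>2 * \<delta>\<^sup>2))"
        using 2 eta_pos[OF \<rho>, of x] by (intro mult_left_mono) auto
      also have "\<dots> = - (eta \<rho> x * (8 * D\<^sup>2 * \<delta>\<^sup>2))" by simp
      also have "\<dots> \<le> - (1 / (1 + C1) * (8 * D\<^sup>2 * \<delta>\<^sup>2))"
        unfolding neg_le_iff_le by (rule mult_right_mono[OF el]) simp
      also have "\<dots> = - (2 * \<gamma>)" by (simp add: \<gamma>_def)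
      also have "\<dots> < - \<gamma>" using g by simp
      finally show "2 * (eta \<rho> x * ak 0 (A x + kappa \<rho> x *\<^sub>R b) \<rho> x) + 2 * (eta \<rho> x * (D * s x)) * \<delta> < - \<gamma>" .
    next
      fix x assume x: "x \<in> X" "Vl \<rho> x \<le> \<theta>"
      have "Vl \<rho> x \<le> 1" using x \<theta>1 by simp
      then have "eps \<rho> x * (1 + Vl \<rho> x) \<le> eps \<rho> x * 2" using eps_pos[OF \<rho>, of x] by (intro mult_left_mono) auto
      then have "\<rho> / 2 \<le> eps \<rho> x" using eps_Vl[OF \<rho>, of x] by simp
      from K(2)[OF this eps_lt[OF \<rho>] x(1)] have "(norm x)\<^sup>2 \<le> K * Vl \<rho> x" by (simp add: Vl_def)
      also have "\<dots> \<le> K * \<theta>" using K(1) x(2) by (intro mult_left_mono) auto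
      also have "\<dots> = (sqrt (K * E) * \<delta>)\<^sup>2" using K E by (simp add: \<theta>_def power_mult_distrib)
      finally show "norm x \<le> sqrt (K * E) * \<delta>"
        using \<delta> K E by (intro power2_le_imp_le[of "norm x"]) auto
    next
      fix x assume x: "x \<in> X" "norm x \<le> \<delta>"
      have "Vl \<rho> x \<le> C * eps \<rho> x * (norm x)\<^sup>2" unfolding Vl_def by (rule C(2)[OF eps_pos[OF \<rho>] eps_lt[OF \<rho>]])
      also have "\<dots> \<le> E * 1 * \<delta>\<^sup>2"
        using E C eps_pos[OF \<rho>, of x] eps_lt[OF \<rho>, of x] x by (intro mult_mono power_mono) auto
      finally show "Vl \<rho> x \<le> \<theta>" by (simp add: \<theta>_def)
    qed
  qed
qed

end

end

section \<open>Feedback for a single block\<close>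

text \<open>In the last condition \<open>g\<close> collects everything that drives the block besides its own drift;
  it may involve the feedback itself, whence the implication at each order \<open>j\<close>.\<close>

definition sched_feedback :: "('a \<Rightarrow> 'a) \<Rightarrow> ('a \<Rightarrow> 'a) \<Rightarrow> 'a \<Rightarrow> 'a set \<Rightarrow> (real \<Rightarrow> 'a::euclidean_space \<Rightarrow> real) \<Rightarrow> bool" where
  "sched_feedback A pr b X \<kappa> \<longleftrightarrow>
     (\<forall>\<rho>. 0 < \<rho> \<longrightarrow> \<rho> < 1/2 \<longrightarrow>
        (\<forall>x. \<kappa> \<rho> (pr x) = \<kappa> \<rho> x) \<and> \<kappa> \<rho> 0 = 0 \<and> (\<exists>K\<ge>0. \<forall>x. \<bar>\<kappa> \<rho> x\<bar> \<le> K) \<and>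
        (\<exists>L\<ge>0. \<forall>x y. \<bar>\<kappa> \<rho> x - \<kappa> \<rho> y\<bar> \<le> L * norm (x - y)) \<and> (\<forall>j. Cp j (\<kappa> \<rho>)) \<and>
        lin_gain X (\<lambda>x. A x + \<kappa> \<rho> x *\<^sub>R b)) \<and>
     (\<forall>F \<omega> g. weight \<omega> \<longrightarrow>
        (\<forall>\<rho> x. 0 < \<rho> \<longrightarrow> \<rho> < 1/2 \<longrightarrow> pr (F \<rho> x) = A x + (\<Sum>r\<in>Basis. g r \<rho> x *\<^sub>R r)) \<longrightarrow>
        (\<forall>j. lie_bd F \<omega> j 1 0 \<kappa> \<longrightarrow> (\<forall>r\<in>Basis. lie_bd F \<omega> j 0 1 (g r))) \<longrightarrow>
        (\<forall>j. lie_bd F \<omega> j 1 0 \<kappa>))"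

lemma sched_feedbackD:
  assumes "sched_feedback A pr b X \<kappa>" "0 < \<rho>" "\<rho> < 1/2"
  shows "\<kappa> \<rho> (pr x) = \<kappa> \<rho> x" "\<kappa> \<rho> 0 = 0" "\<exists>K\<ge>0. \<forall>x. \<bar>\<kappa> \<rho> x\<bar> \<le> K"
    "\<exists>L\<ge>0. \<forall>x y. \<bar>\<kappa> \<rho> x - \<kappa> \<rho> y\<bar> \<le> L * norm (x - y)" "Cp j (\<kappa> \<rho>)"
    "lin_gain X (\<lambda>x. A x + \<kappa> \<rho> x *\<^sub>R b)"
  using assms unfolding sched_feedback_def by simp_all

lemma sched_feedback_LB:
  assumes "sched_feedback A pr b X \<kappa>" "weight \<omega>"
    and "\<And>\<rho> x. 0 < \<rho> \<Longrightarrow> \<rho> < 1/2 \<Longrightarrow> pr (F \<rho> x) = A x + (\<Sum>r\<in>Basis. g r \<rho> x *\<^sub>R r)"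
    and "\<And>j r. lie_bd F \<omega> j 1 0 \<kappa> \<Longrightarrow> r \<in> Basis \<Longrightarrow> lie_bd F \<omega> j 0 1 (g r)"
  shows "lie_bd F \<omega> j 1 0 \<kappa>"
  using conjunct2[OF assms(1)[unfolded sched_feedback_def], rule_format, where F = F and \<omega> = \<omega> and g = g and j = j]
    assms(2-4) by blast

lemma low_gain_sched_feedback:
  fixes A pr :: "'a::euclidean_space \<Rightarrow> 'a"
  assumes "low_gain A pr b X Pd"
  shows "sched_feedback A pr b X (low_gain.kappa b Pd)"
proof -
  interpret low_gain A pr b X Pd by fact
  have LBk: "lie_bd F \<omega> j 1 0 kappa"
    if w: "weight \<omega>" and a: "\<And>k w. lie_bd F \<omega> j 1 0 (ak k w)" for F :: "real \<Rightarrow> 'a \<Rightarrow> 'a" and \<omega> j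
  proof -
    interpret weight F \<omega> by fact
    have "lie_bd F \<omega> j 1 0 (\<lambda>\<rho> x. - 1 * ak 0 b \<rho> x)" by (rule LB_cmult[OF a])
    then show ?thesis by (simp add: kappa_def[abs_def])
  qed
  show ?thesis
    unfolding sched_feedback_def
  proof (intro conjI allI impI)
    fix F :: "real \<Rightarrow> 'a \<Rightarrow> 'a" and \<omega> and g :: "'a \<Rightarrow> real \<Rightarrow> 'a \<Rightarrow> real" and j
    assume w: "weight \<omega>"
      and F: "\<forall>\<rho> x. 0 < \<rho> \<longrightarrow> \<rho> < 1/2 \<longrightarrow> pr (F \<rho> x) = A x + (\<Sum>r\<in>Basis. g r \<rho> x *\<^sub>R r)"
      and g: "\<forall>j. lie_bd F \<omega> j 1 0 kappa \<longrightarrow> (\<forall>r\<in>Basis. lie_bd F \<omega> j 0 1 (g r))"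
    have "(\<forall>k w. lie_bd F \<omega> j 1 0 (ak k w)) \<and> (\<forall>k w w'. lie_bd F \<omega> j 1 0 (bk k w w')) \<and>
      (\<forall>k. lie_bd F \<omega> j 0 0 (qk k)) \<and> lie_bd F \<omega> j 0 0 tau"
    proof (rule LB_generators[OF w])
      show "pr (F \<rho> x) = A x + (\<Sum>r\<in>Basis. g r \<rho> x *\<^sub>R r)" if "0 < \<rho>" "\<rho> < 1/2" for \<rho> x using F that by blast
      fix j and r :: 'a assume a: "\<And>k w. lie_bd F \<omega> j 1 0 (ak k w)" and r: "r \<in> Basis"
      show "lie_bd F \<omega> j 0 1 (g r)" using g LBk[OF w a] r by blast
    qed
    then show "lie_bd F \<omega> j 1 0 kappa" by (intro LBk[OF w]) blast
  qed (use kappa_pr kappa_zero kappa_bounded kappa_lipschitz Cp_kappa lin_gain_kappa in blast)+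
qed

section \<open>Coordinate blocks: critical and Hurwitz\<close>

lemma blk_proj_linear: "linear (blk_proj blk i)"
  by (rule linearI) (auto simp: blk_proj_def vec_eq_iff)

lemma blk_proj_sym: "blk_proj blk i v \<bullet> w = v \<bullet> blk_proj blk i w"
  by (auto simp: blk_proj_def inner_vec_def intro!: sum.cong)

lemma blk_proj_mem: "blk_proj blk i v \<in> blk_space blk i"
  by (simp add: blk_proj_def blk_space_def)

lemma blk_proj_id: "v \<in> blk_space blk i \<Longrightarrow> blk_proj blk i v = v"
  by (auto simp: blk_proj_def blk_space_def vec_eq_iff)

lemma blk_mat_proj: "blk_mat blk i A *v blk_proj blk i v = blk_mat blk i A *v v"
  by (auto simp: vec_eq_iff blk_mat_def blk_proj_def matrix_vector_mult_def intro!: sum.cong)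

lemma blk_mat_mem: "blk_mat blk i A *v v \<in> blk_space blk i"
  by (auto simp: blk_space_def blk_mat_def matrix_vector_mult_def)

lemma blk_mat_transpose: "transpose (blk_mat blk i A) = blk_mat blk i (transpose A)"
  by (auto simp: vec_eq_iff transpose_def blk_mat_def)

lemma cvec_mem: "v \<in> blk_space blk i \<Longrightarrow> cvec v \<in> cblk blk i"
  by (auto simp: cvec_def cblk_def blk_space_def)

lemma transpose_adjoint: "(M *v v) \<bullet> w = v \<bullet> (transpose M *v w)" for M :: "real^'n^'n"
  using dot_lmul_matrix[of w M v] by (simp add: inner_commute)

lemma blk_orth_block:
  assumes "b \<in> blk_space blk i"
  shows "orth_block (\<lambda>x. blk_mat blk i A *v x) (blk_proj blk i) b (blk_space blk i)"
  by (rule orth_block.intro[OF matrix_vector_mul_linear blk_proj_linear blk_proj_sym blk_proj_mem blk_proj_id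
        blk_mat_proj blk_mat_mem assms])

lemma invariant_flow:
  assumes d: "\<And>t. t \<ge> 0 \<Longrightarrow> (\<phi> has_vector_derivative G (\<phi> t)) (at t within {0..})"
    and pr: "bounded_linear pr" "\<And>v. pr (G v) = G v" "pr (\<phi> 0) = \<phi> 0" and t: "t \<ge> (0::real)"
  shows "pr (\<phi> t) = \<phi> t"
proof -
  have "((\<lambda>t. pr (\<phi> t) - \<phi> t) has_vector_derivative 0) (at s within {0..})" if "s \<in> {0..}" for s
  proof -
    have "((\<lambda>t. pr (\<phi> t) - \<phi> t) has_vector_derivative pr (G (\<phi> s)) - G (\<phi> s)) (at s within {0..})"
      using that by (intro has_vector_derivative_diff bounded_linear.has_vector_derivative[OF pr(1)] d) auto
    then show ?thesis using pr(2) by simp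
  qed
  then obtain c where "\<And>s. s \<in> {0..} \<Longrightarrow> pr (\<phi> s) - \<phi> s = c"
    using has_vector_derivative_zero_constant[of "{0..}" "\<lambda>t. pr (\<phi> t) - \<phi> t"] by auto
  from this[of 0] this[of t] show ?thesis using pr(3) t by simp
qed

lemma annihil_exp_growth:
  assumes "annihil ls (\<lambda>t. of_real (f t))" "\<forall>l\<in>set ls. Re l < \<gamma>" "continuous_on {0..} f"
  shows "exp_growth \<gamma> f"
  using annihil_growth[OF assms(1,2)] assms(3) unfolding exp_growth_def by auto

text \<open>Only here does the spectral hypothesis enter: it turns the annihilating list of the
  block into the growth bound and the two Turan inequalities required by
  \<open>gram\<close>.\<close>

lemma crit_block_feedback:
  fixes A :: "real^'n^'n"
  assumes crit: "\<forall>lam. blk_eigenvalue blk i A lam \<longrightarrow> Re lam = 0"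
    and ctrb: "blk_controllable blk i A b" and b: "b \<in> blk_space blk i"
  shows "\<exists>\<kappa>. sched_feedback (\<lambda>x. blk_mat blk i A *v x) (blk_proj blk i) b (blk_space blk i) \<kappa>"
proof -
  let ?M = "blk_mat blk i A" and ?X = "blk_space blk i" and ?pr = "blk_proj blk i"
  interpret ob: orth_block "\<lambda>x. ?M *v x" ?pr b ?X by (rule blk_orth_block[OF b])
  obtain ls0 where ls0: "\<forall>l\<in>set ls0. blk_eigenvalue blk i A l" "\<forall>v\<in>cblk blk i. opprod ?M ls0 v = 0"
    using blk_annihilating_list[of blk i A] by blast
  \<comment> \<open>The additional 0 also has real part zero; it makes the list nonempty, as the
    condition \<open>1 \<le> m\<close> of \<open>gram\<close> requires.\<close>
  define ls where "ls = 0 # ls0"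
  have ls: "\<forall>l\<in>set ls. Re l = 0" using ls0(1) crit by (auto simp: ls_def)
  have kill: "opprod ?M ls v = 0" if "v \<in> cblk blk i" for v
  proof -
    have "cmat ?M v - 0 *s v \<in> cblk blk i" using cinv_blk[of blk i A] that unfolding cinv_def by blast
    then show ?thesis using ls0(2) by (simp add: ls_def)
  qed
  \<comment> \<open>The curve \<open>\<phi>\<close> is a flow of \<open>- A\<close>, so the list is
    negated; real parts stay zero.\<close>
  define ms where "ms = map uminus ls"
  have ms: "\<forall>l\<in>set ms. Re l = 0" and len: "length ms = length ls" using ls by (auto simp: ms_def)
  obtain \<phi> where phi0: "\<phi> 0 = b" and phi: "\<And>t. t \<ge> 0 \<Longrightarrow> (\<phi> has_vector_derivative (- ?M) *v \<phi> t) (at t within {0..})"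
    using linear_flow_exists[of "\<lambda>x. (- ?M) *v x" b, OF matrix_vector_mul_linear] by blast
  have neg: "(- ?M) *v v = - (?M *v v)" for v by (simp add: vec_eq_iff matrix_vector_mult_def sum_negf)
  have "?pr (\<phi> t) = \<phi> t" if "t \<ge> 0" for t
  proof (rule invariant_flow[OF phi ob.bl_pr _ _ that])
    show "?pr (- ?M *v v) = - ?M *v v" for v
      by (simp add: neg linear_neg[OF blk_proj_linear] blk_proj_id[OF blk_mat_mem])
    show "?pr (\<phi> 0) = \<phi> 0" by (simp add: phi0 blk_proj_id[OF b])
  qed
  then have phi_mem: "\<phi> t \<in> ?X" if "t \<ge> 0" for t using that by (metis blk_proj_mem)
  have ann: "annihil ms (\<lambda>t. of_real (y \<bullet> \<phi> t))" for y
  proof (rule flow_annihil[OF phi])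
    fix t :: real assume "t \<ge> 0"
    then show "opprod (- ?M) ms (cvec (\<phi> t)) = 0"
      unfolding ms_def opprod_uminus using kill[OF cvec_mem[OF phi_mem]] by simp
  qed
  have "continuous_on {0..} \<phi>"
    by (rule continuous_on_vector_derivative[of _ _ "\<lambda>t. (- ?M) *v \<phi> t"]) (rule phi, simp)
  then have cont: "continuous_on {0..} (\<lambda>t. y \<bullet> \<phi> t)" for y
    by (intro continuous_on_inner continuous_on_const)
  interpret gram "\<lambda>x. ?M *v x" ?pr b ?X "\<lambda>x. transpose ?M *v x" \<phi> "3 ^ length ls" "length ls"
  proof (rule gram.intro[OF ob.orth_block_axioms gram_axioms.intro])
    show "linear (\<lambda>x. transpose ?M *v x)" by (rule matrix_vector_mul_linear)
    show "(?M *v v) \<bullet> w = v \<bullet> (transpose ?M *v w)" for v w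
      by (rule transpose_adjoint)
    show "transpose ?M *v v \<in> ?X" for v unfolding blk_mat_transpose by (rule blk_mat_mem)
    show "?X \<subseteq> span (range (\<lambda>k. ((\<lambda>x. ?M *v x) ^^ k) b))"
      using ctrb unfolding blk_controllable_def by simp
    show "\<phi> 0 = b" by (rule phi0)
    show "(\<phi> has_vector_derivative - (?M *v \<phi> t)) (at t within {0..})" if "t \<ge> 0" for t
      using phi[OF that] by (simp add: neg)
    show "\<phi> t \<in> ?X" if "t \<ge> 0" for t by (rule phi_mem[OF that])
    show "exp_growth \<gamma> (\<lambda>t. v \<bullet> \<phi> t)" if "\<gamma> > 0" for \<gamma> v
      by (rule annihil_exp_growth[OF ann _ cont]) (use ms that in auto)
    show "1 \<le> length ls" by (simp add: ls_def)
    show "\<bar>v \<bullet> \<phi> t\<bar> \<le> 3 ^ length ls * (\<Sum>k=1..length ls. \<bar>v \<bullet> \<phi> (t + real k * h)\<bar>)" if "0 \<le> t" "0 \<le> h" for v t h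
      using turan_backward[OF ann ms that, of v] by (simp only: len norm_of_real)
    show "\<bar>v \<bullet> \<phi> (t + real (length ls) * h)\<bar> \<le> 3 ^ length ls * (\<Sum>k<length ls. \<bar>v \<bullet> \<phi> (t + real k * h)\<bar>)" if "0 \<le> t" "0 \<le> h" for v t h
      using turan_forward[OF ann ms that, of v] by (simp only: len norm_of_real)
  qed
  obtain Pd where "low_gain (\<lambda>x. ?M *v x) ?pr b ?X Pd" using low_gain_exists by blast
  then show ?thesis using low_gain_sched_feedback by blast
qed

text \<open>\<open>Q v v\<close> is the classical Lyapunov integral of the squared norm of
  \<open>exp (t A) v\<close>: each \<open>\<phi> r\<close> is a flow of the transpose, so
  \<open>v \<bullet> \<phi> r t\<close> is the \<open>r\<close>-th coordinate of that vector for
  \<open>v\<close> in the block. The growth rate is negative, which allows the Laplace transform at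
  0.\<close>

lemma hurwitz_block_lin_gain:
  fixes A :: "real^'n^'n"
  assumes hur: "\<forall>lam. blk_eigenvalue blk i A lam \<longrightarrow> Re lam < 0"
  shows "lin_gain (blk_space blk i) (\<lambda>x. blk_mat blk i A *v x)"
proof -
  let ?M = "blk_mat blk i A" and ?X = "blk_space blk i" and ?pr = "blk_proj blk i"
  have blpr: "bounded_linear ?pr" using blk_proj_linear by (simp add: linear_conv_bounded_linear)
  obtain ls where ls0: "\<forall>l\<in>set ls. blk_eigenvalue blk i A l" "\<forall>v\<in>cblk blk i. opprod ?M ls v = 0"
    using blk_annihilating_list[of blk i A] by blast
  have "\<forall>l\<in>set ls. Re l < 0" using ls0(1) hur by auto
  then have "\<exists>\<gamma><0. \<forall>l\<in>set ls. Re l < \<gamma>"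
  proof (induction ls)
    case Nil
    then show ?case by (auto intro: exI[of _ "-1"])
  next
    case (Cons l ls)
    then obtain \<gamma> where "\<gamma> < 0" "\<forall>l\<in>set ls. Re l < \<gamma>" by auto
    then show ?case using Cons.prems by (intro exI[of _ "max \<gamma> (Re l / 2)"]) auto
  qed
  then obtain \<gamma> where \<gamma>: "\<gamma> < 0" "\<forall>l\<in>set ls. Re l < \<gamma>" by blast
  have "\<forall>r. \<exists>\<phi>. \<phi> 0 = ?pr (axis r 1) \<and> (\<forall>t\<ge>0. (\<phi> has_vector_derivative transpose ?M *v \<phi> t) (at t within {0..}))"
  proof
    fix r
    obtain \<phi> where "\<phi> 0 = ?pr (axis r 1)" "\<And>t. t \<ge> 0 \<Longrightarrow> (\<phi> has_vector_derivative transpose ?M *v \<phi> t) (at t within {0..})"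
      using linear_flow_exists[of "\<lambda>x. transpose ?M *v x" "?pr (axis r 1)", OF matrix_vector_mul_linear] by blast
    then show "\<exists>\<phi>. \<phi> 0 = ?pr (axis r 1) \<and> (\<forall>t\<ge>0. (\<phi> has_vector_derivative transpose ?M *v \<phi> t) (at t within {0..}))" by blast
  qed
  then obtain \<phi> where phi0: "\<And>r. \<phi> r 0 = ?pr (axis r 1)"
    and phi: "\<And>r t. t \<ge> 0 \<Longrightarrow> (\<phi> r has_vector_derivative transpose ?M *v \<phi> r t) (at t within {0..})" by metis
  have "?pr (\<phi> r t) = \<phi> r t" if "t \<ge> 0" for r t
  proof (rule invariant_flow[OF phi blpr _ _ that])
    show "?pr (transpose ?M *v v) = transpose ?M *v v" for v
      unfolding blk_mat_transpose by (rule blk_proj_id[OF blk_mat_mem])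
    show "?pr (\<phi> r 0) = \<phi> r 0" unfolding phi0 by (rule blk_proj_id[OF blk_proj_mem])
  qed
  then have phi_mem: "\<phi> r t \<in> ?X" if "t \<ge> 0" for r t using that by (metis blk_proj_mem)
  have ann: "annihil ls (\<lambda>t. of_real (y \<bullet> \<phi> r t))" for y r
    by (rule flow_annihil[OF phi blk_annihilating_transpose[OF ls0(2) cvec_mem[OF phi_mem]]])
  have "continuous_on {0..} (\<phi> r)" for r
    by (rule continuous_on_vector_derivative[of _ _ "\<lambda>t. transpose ?M *v \<phi> r t"]) (rule phi, simp)
  then have cont: "continuous_on {0..} (\<lambda>t. y \<bullet> \<phi> r t)" for y r
    by (intro continuous_on_inner continuous_on_const)
  have gr: "exp_growth \<gamma> (\<lambda>t. v \<bullet> \<phi> r t)" for v r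
    by (rule annihil_exp_growth[OF ann \<gamma>(2) cont])
  have gr2: "exp_growth (\<gamma> + \<gamma>) (\<lambda>t. (v \<bullet> \<phi> r t) * (w \<bullet> \<phi> r t))" for v w r
    by (rule exp_growth_mult[OF gr gr])
  have g0: "\<gamma> + \<gamma> < 0" using \<gamma> by simp
  define Q where "Q = (\<lambda>v w. \<Sum>r\<in>UNIV. Lap (\<lambda>t. (v \<bullet> \<phi> r t) * (w \<bullet> \<phi> r t)) 0)"
  have Qsym: "Q v w = Q w v" for v w by (simp add: Q_def mult.commute)
  have Qlin: "Q (c *\<^sub>R v + d *\<^sub>R v') w = c * Q v w + d * Q v' w" for c d v v' w
  proof -
    have "Lap (\<lambda>t. ((c *\<^sub>R v + d *\<^sub>R v') \<bullet> \<phi> r t) * (w \<bullet> \<phi> r t)) 0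
      = c * Lap (\<lambda>t. (v \<bullet> \<phi> r t) * (w \<bullet> \<phi> r t)) 0 + d * Lap (\<lambda>t. (v' \<bullet> \<phi> r t) * (w \<bullet> \<phi> r t)) 0" for r
      by (subst Lap_lincomb[OF gr2 gr2 g0, symmetric]) (simp add: inner_add_left algebra_simps)
    then show ?thesis by (simp add: Q_def sum.distrib sum_distrib_left)
  qed
  have "bilinear Q"
    unfolding bilinear_def
  proof (intro conjI allI)
    show "linear (\<lambda>v. Q v w)" for w
      using Qlin[of 1 _ 1] Qlin[of _ _ 0] by (intro linearI) auto
    then show "linear (Q w)" for w by (subst Qsym[abs_def]) simp
  qed
  then have bbl: "bounded_bilinear Q" by (simp add: bilinear_conv_bounded_bilinear)
  then obtain K where K: "K > 0" "\<And>v w. norm (Q v w) \<le> norm v * norm w * K" using bounded_bilinear.pos_bounded by blast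
  have Qpos: "Q v v \<ge> 0" for v unfolding Q_def by (intro sum_nonneg Lap_nonneg) simp
  have CS: "\<bar>Q v w\<bar> \<le> sqrt (Q v v) * sqrt (Q w w)" for v w
  proof (rule psd_Cauchy_Schwarz)
    fix s
    have "0 \<le> Q (1 *\<^sub>R v + s *\<^sub>R w) (1 *\<^sub>R v + s *\<^sub>R w)" by (rule Qpos)
    also have "\<dots> = Q v (1 *\<^sub>R v + s *\<^sub>R w) + s * Q w (1 *\<^sub>R v + s *\<^sub>R w)" by (subst Qlin) simp
    also have "Q v (1 *\<^sub>R v + s *\<^sub>R w) = Q v v + s * Q v w" by (subst Qsym, subst Qlin) (simp add: Qsym)
    also have "Q w (1 *\<^sub>R v + s *\<^sub>R w) = Q v w + s * Q w w" by (subst Qsym, subst Qlin) (simp add: Qsym)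
    finally show "0 \<le> Q v v + 2 * s * Q v w + s\<^sup>2 * Q w w" by (simp add: algebra_simps power2_eq_square)
  qed
  have lyap: "2 * Q v (?M *v v) = - (norm v)\<^sup>2" if v: "v \<in> ?X" for v
  proof -
    have "2 * Lap (\<lambda>t. (v \<bullet> \<phi> r t) * ((?M *v v) \<bullet> \<phi> r t)) 0 = - (v $ r)\<^sup>2" for r
    proof -
      let ?H = "\<lambda>t. (v \<bullet> \<phi> r t) * (v \<bullet> \<phi> r t)" and ?f = "\<lambda>t. (v \<bullet> \<phi> r t) * ((?M *v v) \<bullet> \<phi> r t)"
      have "Lap (\<lambda>t. 1 * ?f t + 1 * ?f t) 0 = 0 * Lap ?H 0 - ?H 0"
      proof (rule Lap_parts[OF gr2 exp_growth_lincomb[OF gr2 gr2] g0])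
        fix t :: real assume t: "t \<ge> 0"
        have "v \<bullet> (transpose ?M *v \<phi> r t) = (?M *v v) \<bullet> \<phi> r t"
          by (rule transpose_adjoint[symmetric])
        then have d: "((\<lambda>t. v \<bullet> \<phi> r t) has_vector_derivative (?M *v v) \<bullet> \<phi> r t) (at t within {0..})"
          using bounded_linear.has_vector_derivative[OF bounded_linear_inner_right phi[OF t], of v r] by simp
        from has_vector_derivative_mult[OF d d]
        show "(?H has_vector_derivative 1 * ?f t + 1 * ?f t) (at t within {0..})" by (simp add: algebra_simps)
      qed
      moreover have "Lap (\<lambda>t. 1 * ?f t + 1 * ?f t) 0 = 1 * Lap ?f 0 + 1 * Lap ?f 0"
        by (rule Lap_lincomb[OF gr2 gr2 g0])
      moreover have "v \<bullet> \<phi> r 0 = v $ r"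
        unfolding phi0 blk_proj_sym[symmetric] blk_proj_id[OF v] by (simp add: inner_axis)
      ultimately show ?thesis by (simp add: power2_eq_square)
    qed
    then have "2 * Q v (?M *v v) = (\<Sum>r\<in>UNIV. - (v $ r)\<^sup>2)"
      unfolding Q_def by (simp add: sum_distrib_left)
    also have "\<dots> = - (norm v)\<^sup>2"
      by (simp add: norm_vec_def L2_set_def sum_negf sum_nonneg)
    finally show ?thesis .
  qed
  obtain a where a: "a > 0" "\<And>x. norm (?M *v x) \<le> a * norm x"
    using linear_bounded_pos[of "\<lambda>x. ?M *v x"] by auto
  \<comment> \<open>A lower bound for \<open>Q\<close> from the Lyapunov equation itself:
    Cauchy-Schwarz for \<open>Q\<close> applied to \<open>v\<close> and \<open>A v\<close>, then one
    factor \<open>norm v\<close> cancels.\<close>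
  have coer: "norm v \<le> 2 * sqrt K * a * sqrt (Q v v)" if v: "v \<in> ?X" for v
  proof -
    have "(norm v)\<^sup>2 \<le> 2 * \<bar>Q v (?M *v v)\<bar>" using lyap[OF v] by linarith
    also have "\<dots> \<le> 2 * (sqrt (Q v v) * sqrt (Q (?M *v v) (?M *v v)))" using CS by simp
    also have "\<dots> \<le> 2 * (sqrt (Q v v) * sqrt ((a * norm v)\<^sup>2 * K))"
    proof (intro mult_left_mono real_sqrt_le_mono)
      have "Q (?M *v v) (?M *v v) \<le> norm (?M *v v) * norm (?M *v v) * K" using K(2)[of "?M *v v" "?M *v v"] by simp
      also have "\<dots> \<le> (a * norm v) * (a * norm v) * K" using a K(1) by (intro mult_right_mono mult_mono) auto
      finally show "Q (?M *v v) (?M *v v) \<le> (a * norm v)\<^sup>2 * K" by (simp add: power2_eq_square)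
    qed (use Qpos in auto)
    also have "\<dots> = (2 * sqrt K * a * sqrt (Q v v)) * norm v" using a by (simp add: real_sqrt_mult)
    finally have "norm v * norm v \<le> (2 * sqrt K * a * sqrt (Q v v)) * norm v" by (simp add: power2_eq_square)
    then show ?thesis using Qpos[of v] K(1) a(1)
      by (cases "v = 0") (auto dest: mult_right_le_imp_le)
  qed
  \<comment> \<open>Since \<open>Q x x\<close> is at most \<open>K\<close> times the squared norm,
    the term \<open>16 * K ^ 3\<close> gives \<open>norm x \<ge> 4 * K * \<delta>\<close> above the
    level \<open>E * \<delta>\<^sup>2\<close>; the summand \<open>K\<close> puts the ball of radius
    \<open>\<delta>\<close> below it.\<close>
  define E where "E = 16 * K ^ 3 + K"
  have E: "E > 0" "E \<ge> K" "E \<ge> 16 * K ^ 3"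
    using K(1) zero_less_power[OF K(1), of 3] unfolding E_def by linarith+
  define N where "N = 2 * sqrt K * a * sqrt E"
  show ?thesis
  proof (rule lyapunov_lin_gain[OF blpr, where \<Delta> = 1 and N = N and \<alpha> = "\<lambda>x. 2 * K * norm x" and V = "\<lambda>x. Q x x" and V' = "\<lambda>x h. Q x h + Q h x"])
    show "?pr y = y \<longleftrightarrow> y \<in> ?X" for y
      using blk_proj_id[of y blk i] blk_proj_mem[of blk i y] by auto
    show "continuous_on UNIV (\<lambda>x. ?M *v x)" by (rule linear_continuous_on[OF matrix_vector_mul_bounded_linear])
    show "?M *v y \<in> ?X" for y by (rule blk_mat_mem)
    show "((\<lambda>x. Q x x) has_derivative (\<lambda>h. Q x h + Q h x)) (at x)" for x
      by (rule bounded_bilinear.FDERIV[OF bbl has_derivative_ident has_derivative_ident])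
    show "Q x h + Q h x \<le> 2 * K * norm x * norm h" for x h
      using K(2)[of x h] by (simp add: Qsym[of h x] mult_ac)
    show "0 \<le> 2 * K * norm x" for x :: "real^'n" using K by simp
    show "N > 0" using K a E by (simp add: N_def)
    show "(1::real) > 0" by simp
    fix \<delta> :: real assume \<delta>: "0 < \<delta>" "\<delta> \<le> 1"
    show "\<exists>\<theta> \<gamma>. \<gamma> > 0 \<and>
      (\<forall>x\<in>?X. Q x x \<ge> \<theta> \<longrightarrow> Q x (?M *v x) + Q (?M *v x) x + 2 * K * norm x * \<delta> < - \<gamma>) \<and>
      (\<forall>x\<in>?X. Q x x \<le> \<theta> \<longrightarrow> norm x \<le> N * \<delta>) \<and> (\<forall>x\<in>?X. norm x \<le> \<delta> \<longrightarrow> Q x x \<le> \<theta>)"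
    proof (rule exI[of _ "E * \<delta>\<^sup>2"], rule exI[of _ "4 * K\<^sup>2 * \<delta>\<^sup>2"], intro conjI ballI impI)
      show "4 * K\<^sup>2 * \<delta>\<^sup>2 > 0" using K \<delta> by simp
    next
      fix x assume x: "x \<in> ?X" "Q x x \<ge> E * \<delta>\<^sup>2"
      have "16 * K ^ 3 * \<delta>\<^sup>2 \<le> E * \<delta>\<^sup>2" using E by (intro mult_right_mono) auto
      also have "\<dots> \<le> (norm x)\<^sup>2 * K" using x K(2)[of x x] by (simp add: power2_eq_square)
      finally have "K * (16 * K\<^sup>2 * \<delta>\<^sup>2) \<le> K * (norm x)\<^sup>2" by (simp add: power3_eq_cube power2_eq_square mult_ac)
      then have q: "16 * K\<^sup>2 * \<delta>\<^sup>2 \<le> (norm x)\<^sup>2" using K(1) by simp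
      then have "(4 * K * \<delta>)\<^sup>2 \<le> (norm x)\<^sup>2" by (simp add: power_mult_distrib)
      then have "4 * K * \<delta> \<le> norm x" by (rule power2_le_imp_le) simp
      then have "4 * K * \<delta> * norm x \<le> norm x * norm x" by (rule mult_right_mono) simp
      then have "Q x (?M *v x) + Q (?M *v x) x + 2 * K * norm x * \<delta> \<le> - (norm x)\<^sup>2 / 2"
        using lyap[OF x(1)] Qsym[of "?M *v x" x] by (simp add: power2_eq_square mult_ac)
      also have "\<dots> \<le> - (8 * K\<^sup>2 * \<delta>\<^sup>2)" using q by simp
      also have "\<dots> < - (4 * K\<^sup>2 * \<delta>\<^sup>2)" using K \<delta> by simp
      finally show "Q x (?M *v x) + Q (?M *v x) x + 2 * K * norm x * \<delta> < - (4 * K\<^sup>2 * \<delta>\<^sup>2)" .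
    next
      fix x assume x: "x \<in> ?X" "Q x x \<le> E * \<delta>\<^sup>2"
      have "sqrt (Q x x) \<le> sqrt (E * \<delta>\<^sup>2)" using x by simp
      also have "\<dots> = sqrt E * \<delta>" using \<delta> by (simp add: real_sqrt_mult)
      finally have "2 * sqrt K * a * sqrt (Q x x) \<le> 2 * sqrt K * a * (sqrt E * \<delta>)"
        using K a by (intro mult_left_mono) auto
      then show "norm x \<le> N * \<delta>" using coer[OF x(1)] by (simp add: N_def)
    next
      fix x assume x: "x \<in> ?X" "norm x \<le> \<delta>"
      have "Q x x \<le> norm x * norm x * K" using K(2)[of x x] by simp
      also have "\<dots> \<le> \<delta> * \<delta> * E" using x \<delta> E K by (intro mult_mono) auto
      finally show "Q x x \<le> E * \<delta>\<^sup>2" by (simp add: power2_eq_square mult_ac)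
    qed
  qed
qed

text \<open>Iterated derivatives are defined by a choice operator relative to \<open>{0..}\<close>,
  so they are identified with a known sequence \<open>W\<close> by uniqueness. This includes the
  endpoint 0, where the one-sided filter is still nontrivial.\<close>

lemma vder_sequence:
  assumes d: "\<And>a t. a < p \<Longrightarrow> t \<ge> 0 \<Longrightarrow> (W a has_vector_derivative W (Suc a) t) (at t within {0..})"
  shows "a \<le> p \<Longrightarrow> t \<ge> 0 \<Longrightarrow> vder a (W 0) t = W a t"
    and "a < p \<Longrightarrow> t \<ge> 0 \<Longrightarrow> (vder a (W 0) has_vector_derivative vder (Suc a) (W 0) t) (at t within {0..})"
proof -
  have nb: "at t within {0::real..} \<noteq> bot" if "t \<ge> 0" for t
  proof -
    have "at t within {t<..} \<le> at t within {0..}" using that by (intro at_le) auto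
    then show ?thesis by (metis bot.extremum_uniqueI trivial_limit_at_right_real)
  qed
  have main: "a \<le> p \<longrightarrow> (\<forall>t\<ge>0. vder a (W 0) t = W a t)" for a
  proof (induction a)
    case (Suc a)
    show ?case
    proof (intro impI allI)
      fix t :: real assume a: "Suc a \<le> p" and t: "t \<ge> 0"
      have "vder a (W 0) s = W a s" if "s \<in> {0..}" for s using Suc a that by simp
      then have "(vder a (W 0) has_vector_derivative W (Suc a) t) (at t within {0..})"
        using has_vector_derivative_transform[OF _ _ d[of a t]] a t by auto
      then show "vder (Suc a) (W 0) t = W (Suc a) t"
        by (simp add: vector_derivative_within[OF nb[OF t]])
    qed
  qed simp
  show "a \<le> p \<Longrightarrow> t \<ge> 0 \<Longrightarrow> vder a (W 0) t = W a t" using main by blast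
  assume a: "a < p" and t: "t \<ge> 0"
  have "vder a (W 0) s = W a s" if "s \<in> {0..}" for s using main[of a] a that by simp
  then have "(vder a (W 0) has_vector_derivative W (Suc a) t) (at t within {0..})"
    using has_vector_derivative_transform[OF _ _ d[of a t]] a t by auto
  then show "(vder a (W 0) has_vector_derivative vder (Suc a) (W 0) t) (at t within {0..})"
    using main[of "Suc a"] a t by simp
qed

text \<open>An isolated block is driven only by its own bounded feedback, so the constant weight 1
  is enough and all Lie derivatives are bounded outright.\<close>

lemma sched_feedback_fb_bounded:
  assumes "sched_feedback A pr b X \<kappa>" "orth_block A pr b X" "0 < \<rho>" "\<rho> < 1/2"
  shows "fb_bounded X (\<lambda>x u. A x + u *\<^sub>R b) (\<kappa> \<rho>) p"
proof -
  interpret orth_block A pr b X by fact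
  define F where "F = (\<lambda>\<rho> x. A x + \<kappa> \<rho> x *\<^sub>R b)"
  interpret weight F "\<lambda>_. 1" by unfold_locales simp
  have "LB p 1 0 \<kappa>"
  proof (rule sched_feedback_LB[OF assms(1) weight_axioms, where g = "\<lambda>r \<rho> x. (b \<bullet> r) * \<kappa> \<rho> x"])
    show "LB j 0 1 (\<lambda>\<rho> x. (b \<bullet> r) * \<kappa> \<rho> x)" if "LB j 1 0 \<kappa>" for j r
      by (rule LB_cmult[OF LB_weaken[OF that]]) auto
    show "pr (F \<rho> x) = A x + (\<Sum>r\<in>Basis. ((b \<bullet> r) * \<kappa> \<rho> x) *\<^sub>R r)" for \<rho> x
    proof -
      have "(\<Sum>r\<in>Basis. ((b \<bullet> r) * \<kappa> \<rho> x) *\<^sub>R r) = \<kappa> \<rho> x *\<^sub>R (\<Sum>r\<in>Basis. (b \<bullet> r) *\<^sub>R r)"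
        by (simp add: scaleR_sum_right mult.commute)
      then show ?thesis
        by (simp add: F_def linear_add[OF linpr] linear_scale[OF linpr] pr_id[OF A_mem] pr_id[OF b_mem] euclidean_representation)
    qed
  qed
  from LB_sequence[OF this] obtain G where G: "G 0 = \<kappa>" "\<And>i. i \<le> p \<Longrightarrow> wt_bd (\<lambda>_. 1) 1 (0 + int i) (G i)"
    "\<And>i. i < p \<Longrightarrow> \<exists>g'. (\<forall>\<rho> x. 0 < \<rho> \<longrightarrow> \<rho> < 1/2 \<longrightarrow> (G i \<rho> has_derivative g' \<rho> x) (at x)) \<and> G (Suc i) = (\<lambda>\<rho> x. g' \<rho> x (F \<rho> x))"
    by blast
  have "\<forall>i. \<exists>C. i \<le> p \<longrightarrow> (\<forall>x. \<bar>G i \<rho> x\<bar> \<le> C)"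
  proof
    fix i
    show "\<exists>C. i \<le> p \<longrightarrow> (\<forall>x. \<bar>G i \<rho> x\<bar> \<le> C)"
    proof (cases "i \<le> p")
      case True
      from G(2)[OF this] obtain C where "\<And>x. \<bar>G i \<rho> x\<bar> \<le> C * sqrt \<rho> ^ 1 * 1 powi (0 + int i)"
        unfolding wt_bd_def using assms(3,4) by blast
      then show ?thesis by blast
    qed simp
  qed
  then obtain C where C: "\<And>i x. i \<le> p \<Longrightarrow> \<bar>G i \<rho> x\<bar> \<le> C i" by metis
  have d: "((\<lambda>t. G a \<rho> (x t)) has_vector_derivative G (Suc a) \<rho> (x t)) (at t within {0..})"
    if x: "traj X (\<lambda>y. A y + \<kappa> \<rho> y *\<^sub>R b) x" and a: "a < p" and t: "t \<ge> 0" for x a t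
  proof -
    obtain g' where g': "(G a \<rho> has_derivative g' \<rho> (x t)) (at (x t))" "G (Suc a) = (\<lambda>\<rho> x. g' \<rho> x (F \<rho> x))"
      using G(3)[OF a] assms(3,4) by blast
    have "(x has_vector_derivative F \<rho> (x t)) (at t within {0..})"
      using x t unfolding traj_def F_def by blast
    from vector_derivative_diff_chain_within[OF this has_derivative_at_withinI[OF g'(1)]]
    show ?thesis by (simp add: o_def g'(2))
  qed
  have "fb_bounded_by X (\<lambda>x u. A x + u *\<^sub>R b) (\<kappa> \<rho>) p (\<lambda>i. \<bar>C i\<bar> + 1)"
    unfolding fb_bounded_by_def
  proof (intro conjI allI impI)
    show "Cp p (\<kappa> \<rho>)" using assms unfolding sched_feedback_def by blast
    fix x assume x: "traj X (\<lambda>y. A y + \<kappa> \<rho> y *\<^sub>R b) x"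
    have W0: "\<kappa> \<rho> \<circ> x = (\<lambda>a t. G a \<rho> (x t)) 0" by (simp add: o_def G(1))
    show "(vder j (\<kappa> \<rho> \<circ> x) has_vector_derivative vder (Suc j) (\<kappa> \<rho> \<circ> x) t) (at t within {0..})" if "j < p" "0 \<le> t" for j t
      unfolding W0 by (rule vder_sequence(2)[where W = "\<lambda>a t. G a \<rho> (x t)", OF d[OF x] that])
    show "norm (vder j (\<kappa> \<rho> \<circ> x) t) \<le> \<bar>C j\<bar> + 1" if "j \<le> p" "0 \<le> t" for j t
    proof -
      have "vder j (\<kappa> \<rho> \<circ> x) t = G j \<rho> (x t)"
        unfolding W0 by (rule vder_sequence(1)[where W = "\<lambda>a t. G a \<rho> (x t)", OF d[OF x] that])
      then show ?thesis using C[OF that(1), of "x t"] by simp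
    qed
  qed
  then show ?thesis unfolding fb_bounded_def by (intro exI[of _ "\<lambda>i. \<bar>C i\<bar> + 1"]) (auto intro: add_nonneg_pos)
qed

section \<open>The cascade\<close>

definition tail_proj :: "('n \<Rightarrow> nat) \<Rightarrow> nat \<Rightarrow> real^'n \<Rightarrow> real^'n" where
  "tail_proj blk i x = (\<chi> r. if i \<le> blk r then x $ r else 0)"

lemma norm_vec_sq: "(norm x)\<^sup>2 = (\<Sum>r\<in>UNIV. (x $ r)\<^sup>2)" for x :: "real^'n"
  by (simp add: norm_vec_def L2_set_def sum_nonneg)

lemma norm_tail_sq: "(norm (tail_proj blk i x))\<^sup>2 = (\<Sum>r\<in>{r. i \<le> blk r}. (x $ r)\<^sup>2)"
  unfolding norm_vec_sq tail_proj_def by (rule sum.mono_neutral_cong_right) auto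

lemma sum_norm_proj:
  assumes "\<And>r. blk r \<le> q"
  shows "(\<Sum>j\<in>{i..q}. (norm (blk_proj blk j x))\<^sup>2) = (norm (tail_proj blk i x))\<^sup>2"
proof -
  have "(\<Sum>j\<in>{i..q}. (norm (blk_proj blk j x))\<^sup>2) = (\<Sum>j\<in>{i..q}. \<Sum>r\<in>UNIV. if j = blk r then (x $ r)\<^sup>2 else 0)"
    unfolding norm_vec_sq blk_proj_def by (intro sum.cong) auto
  also have "\<dots> = (\<Sum>r\<in>UNIV. \<Sum>j\<in>{i..q}. if j = blk r then (x $ r)\<^sup>2 else 0)" by (rule sum.swap)
  also have "\<dots> = (\<Sum>r\<in>UNIV. (tail_proj blk i x $ r)\<^sup>2)"
    using assms by (intro sum.cong) (auto simp: tail_proj_def sum.delta)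
  finally show ?thesis by (simp add: norm_vec_sq)
qed

lemma tail_proj_linear: "linear (tail_proj blk i)"
  by (rule linearI) (auto simp: tail_proj_def vec_eq_iff)

lemma tail_proj_nth_le: "i \<le> blk r \<Longrightarrow> \<bar>x $ r\<bar> \<le> norm (tail_proj blk i x)"
  using component_le_norm_cart[of "tail_proj blk i x" r] by (simp add: tail_proj_def)

lemma norm_tail_le: "norm (tail_proj blk i x) \<le> norm x"
proof (rule power2_le_imp_le)
  show "(norm (tail_proj blk i x))\<^sup>2 \<le> (norm x)\<^sup>2"
    unfolding norm_vec_sq by (intro sum_mono) (auto simp: tail_proj_def)
qed simp

lemma norm_tail_mono: "i \<le> j \<Longrightarrow> norm (tail_proj blk j x) \<le> norm (tail_proj blk i x)"
proof (rule power2_le_imp_le)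
  assume "i \<le> j"
  then show "(norm (tail_proj blk j x))\<^sup>2 \<le> (norm (tail_proj blk i x))\<^sup>2"
    unfolding norm_vec_sq by (intro sum_mono) (auto simp: tail_proj_def)
qed simp

lemma norm_proj_le_tail: "i \<le> j \<Longrightarrow> norm (blk_proj blk j x) \<le> norm (tail_proj blk i x)"
proof (rule power2_le_imp_le)
  assume "i \<le> j"
  then show "(norm (blk_proj blk j x))\<^sup>2 \<le> (norm (tail_proj blk i x))\<^sup>2"
    unfolding norm_vec_sq by (intro sum_mono) (auto simp: tail_proj_def blk_proj_def)
qed simp

lemma tail_proj_split: "tail_proj blk i x = blk_proj blk i x + tail_proj blk (Suc i) x"
  by (auto simp: tail_proj_def blk_proj_def vec_eq_iff)

text \<open>Descending induction over the blocks. Once the tail beyond block \<open>i\<close> is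
  known to be at most \<open>N * \<delta>\<close>, it acts on block \<open>i\<close> as a
  disturbance, of total size at most \<open>(1 + M * N) * \<delta>\<close> together with the
  external one. Linearity of the gain keeps all bounds proportional to \<open>\<delta>\<close>, and
  only the admissible range of \<open>\<delta>\<close> shrinks.\<close>

lemma cascade_lin_gain:
  fixes F :: "real^'n \<Rightarrow> real^'n"
  assumes range: "\<And>r. blk r \<le> q" and gain: "\<And>i. i \<le> q \<Longrightarrow> lin_gain (blk_space blk i) (G i)"
    and mem: "\<And>i y. G i y \<in> blk_space blk i"
    and M: "\<And>i x. norm (blk_proj blk i (F x) - G i (blk_proj blk i x)) \<le> M * norm (tail_proj blk (Suc i) x)" "M \<ge> 0"
  shows "lin_gain UNIV F"
proof -
  define gain_at where "gain_at = (\<lambda>i. \<exists>\<Delta>>0. \<exists>N>0. \<forall>\<delta> e x. 0 < \<delta> \<longrightarrow> \<delta> \<le> \<Delta> \<longrightarrow> csol UNIV F e x \<longrightarrow>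
     (ev_bdd e \<delta> \<longrightarrow> ev_bdd (\<lambda>t. tail_proj blk i (x t)) (N * \<delta>)) \<and>
     ((\<forall>t\<ge>0. norm (e t) \<le> \<delta>) \<longrightarrow> norm (x 0) \<le> \<delta> \<longrightarrow> (\<forall>t\<ge>0. norm (tail_proj blk i (x t)) \<le> N * \<delta>)))"
  have step: "gain_at i" if S: "gain_at (Suc i)" and i: "i \<le> q" for i
  proof -
    obtain \<Delta> N where \<Delta>N: "\<Delta> > 0" "N > 0"
      and all: "\<forall>\<delta> e x. 0 < \<delta> \<longrightarrow> \<delta> \<le> \<Delta> \<longrightarrow> csol UNIV F e x \<longrightarrow>
       (ev_bdd e \<delta> \<longrightarrow> ev_bdd (\<lambda>t. tail_proj blk (Suc i) (x t)) (N * \<delta>)) \<and>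
       ((\<forall>t\<ge>0. norm (e t) \<le> \<delta>) \<longrightarrow> norm (x 0) \<le> \<delta> \<longrightarrow> (\<forall>t\<ge>0. norm (tail_proj blk (Suc i) (x t)) \<le> N * \<delta>))"
      using S unfolding gain_at_def by (elim exE conjE)
    have ev: "ev_bdd (\<lambda>t. tail_proj blk (Suc i) (x t)) (N * \<delta>)"
      if "0 < \<delta>" "\<delta> \<le> \<Delta>" "csol UNIV F e x" "ev_bdd e \<delta>" for \<delta> e x
      using all[rule_format, OF that(1-3), THEN conjunct1] that(4) by (rule mp)
    have un: "norm (tail_proj blk (Suc i) (x t)) \<le> N * \<delta>"
      if "0 < \<delta>" "\<delta> \<le> \<Delta>" "csol UNIV F e x" "\<forall>t\<ge>0. norm (e t) \<le> \<delta>" "norm (x 0) \<le> \<delta>" "t \<ge> 0" for \<delta> e x t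
      using all[rule_format, OF that(1-3), THEN conjunct2] that(4-6) by simp
    obtain \<Delta>' N' where \<Delta>N': "\<Delta>' > 0" "N' > 0" and lg: "lin_gain_param (blk_space blk i) (G i) \<Delta>' N'"
      using gain[OF i] unfolding lin_gain_def by blast
    define c where "c = 1 + M * N"
    have c: "c \<ge> 1" using M(2) \<Delta>N by (simp add: c_def)
    let ?\<Delta> = "min \<Delta> (\<Delta>' / c)" and ?N = "N' * c + N"
    have sol: "csol (blk_space blk i) (G i) (\<lambda>t. blk_proj blk i (F (x t) + e t) - G i (blk_proj blk i (x t))) (\<lambda>t. blk_proj blk i (x t))"
      if "csol UNIV F e x" for e x
      by (rule csol_linear_image[OF that _ blk_proj_mem]) (simp add: blk_proj_linear linear_conv_bounded_linear[symmetric])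
    have mem': "blk_proj blk i (F y + v) - G i z \<in> blk_space blk i" for y v z
      using mem[of i z] blk_proj_mem[of blk i "F y + v"] by (simp add: blk_space_def)
    have dist: "norm (blk_proj blk i (F y + v) - G i (blk_proj blk i y)) \<le> c * \<delta>"
      if "norm v \<le> \<delta>" "norm (tail_proj blk (Suc i) y) \<le> N * \<delta>" for y v \<delta>
    proof -
      have "blk_proj blk i (F y + v) - G i (blk_proj blk i y) = (blk_proj blk i (F y) - G i (blk_proj blk i y)) + blk_proj blk i v"
        by (simp add: linear_add[OF blk_proj_linear])
      also have "norm \<dots> \<le> M * norm (tail_proj blk (Suc i) y) + norm v"
        by (rule norm_triangle_le) (intro add_mono M(1) order_trans[OF norm_proj_le_tail[OF order_refl] norm_tail_le])
      also have "\<dots> \<le> M * (N * \<delta>) + \<delta>" using that M(2) by (intro add_mono mult_left_mono) auto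
      finally show ?thesis by (simp add: c_def algebra_simps)
    qed
    have c\<delta>: "0 < c * \<delta>" "c * \<delta> \<le> \<Delta>'" "\<delta> \<le> \<Delta>" "\<delta> \<le> c * \<delta>" if "0 < \<delta>" "\<delta> \<le> ?\<Delta>" for \<delta>
      using that c mult_right_mono[of 1 c \<delta>] by (auto simp: field_simps)
    have pos: "?\<Delta> > 0" "?N > 0" using \<Delta>N \<Delta>N' c by (auto intro: add_nonneg_pos)
    show ?thesis
      unfolding gain_at_def
    proof (rule exI[of _ ?\<Delta>], rule conjI[OF pos(1)], rule exI[of _ ?N], rule conjI[OF pos(2)], intro allI impI conjI)
      fix \<delta> e x assume \<delta>: "0 < \<delta>" "\<delta> \<le> ?\<Delta>" and s: "csol UNIV F e x"
      {
        assume e: "ev_bdd e \<delta>"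
        have t: "ev_bdd (\<lambda>t. tail_proj blk (Suc i) (x t)) (N * \<delta>)" by (rule ev[OF \<delta>(1) c\<delta>(3)[OF \<delta>] s e])
        from e t have "ev_bdd (\<lambda>t. blk_proj blk i (F (x t) + e t) - G i (blk_proj blk i (x t))) (c * \<delta>)"
          unfolding ev_bdd_def
        proof (elim exE conjE)
          fix T U assume "T > 0" and T: "\<forall>t\<ge>T. norm (e t) \<le> \<delta>"
            and "U > 0" and U: "\<forall>t\<ge>U. norm (tail_proj blk (Suc i) (x t)) \<le> N * \<delta>"
          have "norm (blk_proj blk i (F (x t) + e t) - G i (blk_proj blk i (x t))) \<le> c * \<delta>" if "t \<ge> max T U" for t
            using T U that by (intro dist) auto
          then show "\<exists>T>0. \<forall>t\<ge>T. norm (blk_proj blk i (F (x t) + e t) - G i (blk_proj blk i (x t))) \<le> c * \<delta>"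
            using \<open>T > 0\<close> by (intro exI[of _ "max T U"]) auto
        qed
        then have b: "ev_bdd (\<lambda>t. blk_proj blk i (x t)) (N' * (c * \<delta>))"
          by (intro lin_gain_param_ev[OF lg c\<delta>(1,2)[OF \<delta>] sol[OF s] mem'])
        from b t show "ev_bdd (\<lambda>t. tail_proj blk i (x t)) (?N * \<delta>)"
          unfolding ev_bdd_def
        proof (elim exE conjE)
          fix T U assume "T > 0" and T: "\<forall>t\<ge>T. norm (blk_proj blk i (x t)) \<le> N' * (c * \<delta>)"
            and "U > 0" and U: "\<forall>t\<ge>U. norm (tail_proj blk (Suc i) (x t)) \<le> N * \<delta>"
          have "norm (tail_proj blk i (x t)) \<le> ?N * \<delta>" if "t \<ge> max T U" for t
          proof -
            have "norm (blk_proj blk i (x t)) \<le> N' * (c * \<delta>)" "norm (tail_proj blk (Suc i) (x t)) \<le> N * \<delta>"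
              using T U that by auto
            then show ?thesis unfolding tail_proj_split[of blk i] by (intro norm_triangle_le) (simp add: algebra_simps)
          qed
          then show "\<exists>T>0. \<forall>t\<ge>T. norm (tail_proj blk i (x t)) \<le> ?N * \<delta>"
            using \<open>T > 0\<close> by (intro exI[of _ "max T U"]) auto
        qed
      next
        fix t :: real assume e: "\<forall>t\<ge>0. norm (e t) \<le> \<delta>" and x0: "norm (x 0) \<le> \<delta>" and t: "t \<ge> 0"
        have tl: "norm (tail_proj blk (Suc i) (x t)) \<le> N * \<delta>" if "t \<ge> 0" for t
          by (rule un[OF \<delta>(1) c\<delta>(3)[OF \<delta>] s e x0 that])
        have "norm (blk_proj blk i (x t)) \<le> N' * (c * \<delta>)"
        proof (rule lin_gain_param_un[OF lg c\<delta>(1,2)[OF \<delta>] sol[OF s] mem' _ _ t])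
          show "norm (blk_proj blk i (F (x t) + e t) - G i (blk_proj blk i (x t))) \<le> c * \<delta>" if "t \<ge> 0" for t
            using e that by (intro dist tl) auto
          show "norm (blk_proj blk i (x 0)) \<le> c * \<delta>"
            using norm_proj_le_tail[OF order_refl, of blk i "x 0"] norm_tail_le[of blk i "x 0"] x0 c\<delta>(4)[OF \<delta>] by linarith
        qed
        then show "norm (tail_proj blk i (x t)) \<le> ?N * \<delta>"
          unfolding tail_proj_split[of blk i] using tl[OF t] by (intro norm_triangle_le) (simp add: algebra_simps)
      }
    qed
  qed
  have "gain_at (Suc q - m)" if "m \<le> Suc q" for m
    using that
  proof (induction m)
    case 0
    \<comment> \<open>The induction starts beyond the last block, where the tail is zero and any
      gain will do.\<close>
    have "tail_proj blk (Suc q) y = 0" for y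
      using range by (simp add: tail_proj_def vec_eq_iff) (metis not_less_eq_eq)
    moreover have "ev_bdd (\<lambda>t. 0 :: real^'n) \<delta>" if "\<delta> > 0" for \<delta>
      using that unfolding ev_bdd_def by (intro exI[of _ 1]) simp
    ultimately show ?case unfolding gain_at_def
      by (intro exI[of _ 1] conjI[OF zero_less_one]) simp
  next
    case (Suc m)
    then show ?case using step[of "q - m"] by (simp add: Suc_diff_le)
  qed
  from this[of "Suc q"] have "gain_at 0" by simp
  moreover have "tail_proj blk 0 y = y" for y by (simp add: tail_proj_def vec_eq_iff)
  ultimately show ?thesis unfolding gain_at_def lin_gain_def lin_gain_param_def by (simp add: imp_conjL)
qed

lemma wt_bd_mono:
  assumes "\<And>x. 1 \<le> \<omega>' x" "\<And>x. \<omega>' x \<le> \<omega> x" "wt_bd \<omega>' s k g" "k \<ge> 0"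
  shows "wt_bd \<omega> s k g"
proof -
  obtain C where C: "C \<ge> 0 \<and> (\<forall>\<rho> x. 0 < \<rho> \<longrightarrow> \<rho> < 1/2 \<longrightarrow> \<bar>g \<rho> x\<bar> \<le> C * sqrt \<rho> ^ s * \<omega>' x powi k)"
    using assms(3) unfolding wt_bd_def by (elim exE)
  have "\<bar>g \<rho> x\<bar> \<le> C * sqrt \<rho> ^ s * \<omega> x powi k" if r: "0 < \<rho>" "\<rho> < 1/2" for \<rho> x
  proof -
    have "0 \<le> \<omega>' x" using assms(1)[of x] by linarith
    then have "\<omega>' x powi k \<le> \<omega> x powi k"
      unfolding power_int_def using assms(4) power_mono[OF assms(2)[of x]] by simp
    then have "C * sqrt \<rho> ^ s * \<omega>' x powi k \<le> C * sqrt \<rho> ^ s * \<omega> x powi k"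
      using C r by (intro mult_left_mono) auto
    moreover have "\<bar>g \<rho> x\<bar> \<le> C * sqrt \<rho> ^ s * \<omega>' x powi k" using C r by simp
    ultimately show ?thesis by linarith
  qed
  then show ?thesis using C unfolding wt_bd_def by (intro exI[of _ C]) simp
qed

text \<open>Enlarging the weight weakens a bound only for exponents \<open>k \<ge> 0\<close>, and
  Lie derivatives only raise the exponent, so nonnegativity is preserved.\<close>

lemma lie_bd_mono:
  assumes "\<And>x. 1 \<le> \<omega>' x" "\<And>x. \<omega>' x \<le> \<omega> x"
  shows "lie_bd F \<omega>' j s k g \<Longrightarrow> k \<ge> 0 \<Longrightarrow> lie_bd F \<omega> j s k g"
proof (induction j arbitrary: k g)
  case 0
  then show ?case using wt_bd_mono[OF assms] by simp
next
  case (Suc j)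
  obtain g' where g': "\<And>\<rho> x. 0 < \<rho> \<Longrightarrow> \<rho> < 1/2 \<Longrightarrow> (g \<rho> has_derivative g' \<rho> x) (at x)"
    "lie_bd F \<omega>' j s (k + 1) (\<lambda>\<rho> x. g' \<rho> x (F \<rho> x))" using Suc.prems(1) by auto
  have "wt_bd \<omega> s k g" using wt_bd_mono[OF assms, where s = s and k = k and g = g] Suc.prems by simp
  moreover have "lie_bd F \<omega> j s (k + 1) (\<lambda>\<rho> x. g' \<rho> x (F \<rho> x))"
    using Suc.IH[OF g'(2)] Suc.prems(2) by simp
  ultimately show ?case using g'(1) by auto
qed

lemma inverse_sq_lipschitz:
  fixes a b :: real
  assumes "a \<ge> 0" "b \<ge> 0"
  shows "\<bar>inverse (1 + a\<^sup>2) - inverse (1 + b\<^sup>2)\<bar> \<le> \<bar>a - b\<bar>"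
proof -
  have p: "1 + a\<^sup>2 > 0" "1 + b\<^sup>2 > 0" by (auto intro: add_pos_nonneg)
  have "inverse (1 + a\<^sup>2) - inverse (1 + b\<^sup>2) = (b - a) * ((a + b) / ((1 + a\<^sup>2) * (1 + b\<^sup>2)))"
    using p by (simp add: field_simps power2_eq_square)
  moreover have "\<bar>(a + b) / ((1 + a\<^sup>2) * (1 + b\<^sup>2))\<bar> \<le> 1"
  proof -
    have "0 \<le> (a - 1)\<^sup>2" "0 \<le> (b - 1)\<^sup>2" "0 \<le> a\<^sup>2 * b\<^sup>2" "0 \<le> a\<^sup>2" "0 \<le> b\<^sup>2" by simp_all
    moreover have "(1 + a\<^sup>2) * (1 + b\<^sup>2) = 1 + a\<^sup>2 + b\<^sup>2 + a\<^sup>2 * b\<^sup>2" by (simp add: algebra_simps)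
    ultimately have "a + b \<le> (1 + a\<^sup>2) * (1 + b\<^sup>2)" unfolding power2_diff power_one mult_1_right by linarith
    then show ?thesis using p assms by (simp add: divide_le_eq)
  qed
  ultimately show ?thesis
    using mult_left_mono[of "\<bar>(a + b) / ((1 + a\<^sup>2) * (1 + b\<^sup>2))\<bar>" 1 "\<bar>b - a\<bar>"]
    by (simp only: abs_mult) (simp add: abs_minus_commute)
qed

definition damp :: "('n \<Rightarrow> nat) \<Rightarrow> nat \<Rightarrow> nat \<Rightarrow> real^'n \<Rightarrow> real" where
  "damp blk p i x = inverse (1 + (norm (tail_proj blk (Suc i) x))\<^sup>2) ^ (p + 1)"

lemma damp_bounds: "0 \<le> damp blk p i x" "damp blk p i x \<le> 1"
  unfolding damp_def by (simp, intro power_le_one) (simp_all add: inverse_le_1_iff)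

lemma damp_lipschitz:
  "\<bar>damp blk p i x - damp blk p i y\<bar> \<le> real (p + 1) * norm (tail_proj blk (Suc i) x - tail_proj blk (Suc i) y)"
proof -
  let ?a = "norm (tail_proj blk (Suc i) x)" and ?b = "norm (tail_proj blk (Suc i) y)"
  have "\<bar>damp blk p i x - damp blk p i y\<bar> \<le> real (p + 1) * \<bar>inverse (1 + ?a\<^sup>2) - inverse (1 + ?b\<^sup>2)\<bar>"
    unfolding damp_def
    using norm_power_diff[of "inverse (1 + ?a\<^sup>2)" "inverse (1 + ?b\<^sup>2)" "p + 1"] by (simp add: inverse_le_1_iff)
  also have "\<dots> \<le> real (p + 1) * norm (tail_proj blk (Suc i) x - tail_proj blk (Suc i) y)"
    by (intro mult_left_mono order_trans[OF inverse_sq_lipschitz] norm_triangle_ineq3) auto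
  finally show ?thesis .
qed

lemma Cp_norm_tail: "Cp k (\<lambda>x :: real^'n. (norm (tail_proj blk i x))\<^sup>2)"
proof -
  have "Cp k (\<lambda>x :: real^'n. x $ r)" for r using Cp_inner[of k "axis r 1 :: real^'n"] by (simp add: inner_axis')
  then show ?thesis unfolding norm_tail_sq by (intro Cp_sum Cp_power)
qed

lemma Cp_damp: "Cp k (damp blk p i)"
  unfolding damp_def
  by (intro Cp_power Cp_inverse Cp_add Cp_const Cp_norm_tail) (metis add_pos_nonneg less_numeral_extra(1,3) zero_le_power2)

text \<open>All blocks share one design parameter, so that a single small value meets all the
  prescribed bounds.\<close>

locale block_cascade =
  fixes A :: "real^'n^'n" and B :: "real^'m^'n" and blk :: "'n \<Rightarrow> nat" and ord :: "'m \<Rightarrow> nat" and q p :: nat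
    and K :: "'m \<Rightarrow> real \<Rightarrow> real^'n \<Rightarrow> real"
  assumes ord: "bij_betw ord UNIV {1..q}" and blk_le: "\<And>r. blk r \<le> q"
    and A_form: "\<And>r c. 1 \<le> blk r \<Longrightarrow> blk c < blk r \<Longrightarrow> A $ r $ c = 0"
    and B_form: "\<And>r k. 1 \<le> blk r \<Longrightarrow> ord k < blk r \<Longrightarrow> B $ r $ k = 0"
    and stable: "lin_gain (blk_space blk 0) (\<lambda>x. blk_mat blk 0 A *v x)"
    and K: "\<And>k. sched_feedback (\<lambda>x. blk_mat blk (ord k) A *v x) (blk_proj blk (ord k))
      (\<chi> r. if blk r = ord k then B $ r $ k else 0) (blk_space blk (ord k)) (K k)"
begin

definition inp :: "'m \<Rightarrow> real^'n" where "inp k = (\<chi> r. if blk r = ord k then B $ r $ k else 0)"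

definition \<mu> :: "real \<Rightarrow> real^'n \<Rightarrow> real^'m" where "\<mu> \<rho> x = (\<chi> k. K k \<rho> x * damp blk p (ord k) x)"

definition F :: "real \<Rightarrow> real^'n \<Rightarrow> real^'n" where "F \<rho> x = A *v x + B *v \<mu> \<rho> x"

text \<open>The isolated loop of block \<open>i\<close>. As \<open>ord\<close> is a bijection onto
  \<open>{1..q}\<close>, the sum has one term for these \<open>i\<close> and none for
  \<open>i = 0\<close>.\<close>

definition G :: "real \<Rightarrow> nat \<Rightarrow> real^'n \<Rightarrow> real^'n" where
  "G \<rho> i y = blk_mat blk i A *v y + (\<Sum>k | ord k = i. K k \<rho> y *\<^sub>R inp k)"

lemmas Ksf = K[folded inp_def]

lemma ord_inj: "ord k = ord l \<longleftrightarrow> k = l" using ord by (auto simp: bij_betw_def inj_def)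

lemma ord_range: "1 \<le> ord k" "ord k \<le> q" using ord unfolding bij_betw_def by auto

lemma inp_mem: "inp k \<in> blk_space blk (ord k)" by (simp add: inp_def blk_space_def)

lemma drift_comp:
  "(A *v x + B *v u) $ s = (\<Sum>c | blk s \<le> blk c. A $ s $ c * x $ c) + (\<Sum>k | blk s \<le> ord k. B $ s $ k * u $ k)"
proof -
  have "(\<Sum>c\<in>UNIV. A $ s $ c * x $ c) = (\<Sum>c | blk s \<le> blk c. A $ s $ c * x $ c)"
  proof (rule sum.mono_neutral_right)
    show "\<forall>c\<in>UNIV - {c. blk s \<le> blk c}. A $ s $ c * x $ c = 0"
      using A_form[of s] by (auto simp: not_le)
  qed auto
  moreover have "(\<Sum>k\<in>UNIV. B $ s $ k * u $ k) = (\<Sum>k | blk s \<le> ord k. B $ s $ k * u $ k)"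
  proof (rule sum.mono_neutral_right)
    show "\<forall>k\<in>UNIV - {k. blk s \<le> ord k}. B $ s $ k * u $ k = 0"
      using B_form[of s] by (auto simp: not_le)
  qed auto
  ultimately show ?thesis by (simp add: matrix_vector_mult_def)
qed

lemma drift_split:
  "(A *v x + B *v u) $ s = (blk_mat blk (blk s) A *v x) $ s + (\<Sum>c | blk s < blk c. A $ s $ c * x $ c)
     + (\<Sum>k | blk s \<le> ord k. B $ s $ k * u $ k)"
proof -
  have "(\<Sum>c | blk s \<le> blk c. A $ s $ c * x $ c) = (\<Sum>c | blk c = blk s. A $ s $ c * x $ c) + (\<Sum>c | blk s < blk c. A $ s $ c * x $ c)"
    by (subst sum.union_disjoint[symmetric]) (auto intro!: sum.cong)
  moreover have "(blk_mat blk (blk s) A *v x) $ s = (\<Sum>c | blk c = blk s. A $ s $ c * x $ c)"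
    unfolding matrix_vector_mult_def blk_mat_def by simp (rule sum.mono_neutral_cong_right, auto)
  ultimately show ?thesis unfolding drift_comp by simp
qed

context
  fixes \<rho> :: real
  assumes \<rho>: "0 < \<rho>" "\<rho> < 1/2"
begin

lemmas KD = sched_feedbackD[OF Ksf \<rho>]

lemma block_gain: "i \<le> q \<Longrightarrow> lin_gain (blk_space blk i) (G \<rho> i)"
proof (cases "i = 0")
  case True
  have "{k. ord k = 0} = {}" using ord_range(1) by (auto simp: Suc_le_eq)
  then show ?thesis using stable True by (simp only: G_def[abs_def]) simp
next
  case False
  assume "i \<le> q"
  with False have "i \<in> ord ` UNIV" using ord by (auto simp: bij_betw_def)
  then obtain k where k: "i = ord k" by auto
  have "{l. ord l = ord k} = {k}" using ord_inj by auto
  then show ?thesis using KD(6)[of k] unfolding k G_def by simp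
qed

lemma K_bounds: "\<exists>C\<ge>0. \<forall>k x y. \<bar>K k \<rho> x\<bar> \<le> C \<and> \<bar>K k \<rho> x - K k \<rho> y\<bar> \<le> C * norm (x - y)"
proof -
  have "\<forall>k. \<exists>c\<ge>0. \<forall>x. \<bar>K k \<rho> x\<bar> \<le> c" using KD(3) by blast
  then obtain c where c: "\<And>k. c k \<ge> 0" "\<And>k x. \<bar>K k \<rho> x\<bar> \<le> c k" by metis
  have "\<forall>k. \<exists>d\<ge>0. \<forall>x y. \<bar>K k \<rho> x - K k \<rho> y\<bar> \<le> d * norm (x - y)" using KD(4) by blast
  then obtain d where d: "\<And>k. d k \<ge> 0" "\<And>k x y. \<bar>K k \<rho> x - K k \<rho> y\<bar> \<le> d k * norm (x - y)" by metis
  define C where "C = (\<Sum>k\<in>UNIV. c k + d k)"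
  have le: "c k + d k \<le> C" for k unfolding C_def using c(1) d(1) by (intro member_le_sum) auto
  show ?thesis
  proof (intro exI[of _ C] conjI allI)
    show "C \<ge> 0" unfolding C_def using c(1) d(1) by (intro sum_nonneg) auto
    fix k x y
    show "\<bar>K k \<rho> x\<bar> \<le> C" using c(2)[of k x] le[of k] d(1)[of k] by linarith
    have "d k * norm (x - y) \<le> C * norm (x - y)" using le[of k] c(1)[of k] by (intro mult_right_mono) auto
    then show "\<bar>K k \<rho> x - K k \<rho> y\<bar> \<le> C * norm (x - y)" using d(2)[of k x y] by linarith
  qed
qed

lemma F_lipschitz: "\<exists>L>0. \<forall>x y. norm (F \<rho> x - F \<rho> y) \<le> L * norm (x - y)"
proof -
  obtain C where C: "C \<ge> 0" "\<And>k x. \<bar>K k \<rho> x\<bar> \<le> C" "\<And>k x y. \<bar>K k \<rho> x - K k \<rho> y\<bar> \<le> C * norm (x - y)"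
    using K_bounds by metis
  define D where "D = C + C * real (p + 1)"
  have D: "D \<ge> 0" using C(1) by (simp add: D_def)
  have m: "\<bar>\<mu> \<rho> x $ k - \<mu> \<rho> y $ k\<bar> \<le> D * norm (x - y)" for x y k
  proof -
    let ?w = "damp blk p (ord k)"
    have "\<bar>?w x - ?w y\<bar> \<le> real (p + 1) * norm (tail_proj blk (Suc (ord k)) (x - y))"
      unfolding linear_diff[OF tail_proj_linear] by (rule damp_lipschitz)
    also have "\<dots> \<le> real (p + 1) * norm (x - y)" by (intro mult_left_mono norm_tail_le) simp
    finally have w: "\<bar>?w x - ?w y\<bar> \<le> real (p + 1) * norm (x - y)" .
    have "\<mu> \<rho> x $ k - \<mu> \<rho> y $ k = (K k \<rho> x - K k \<rho> y) * ?w x + K k \<rho> y * (?w x - ?w y)"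
      by (simp add: \<mu>_def algebra_simps)
    also have "\<bar>\<dots>\<bar> \<le> \<bar>K k \<rho> x - K k \<rho> y\<bar> * \<bar>?w x\<bar> + \<bar>K k \<rho> y\<bar> * \<bar>?w x - ?w y\<bar>"
      unfolding abs_mult[symmetric] by (rule abs_triangle_ineq)
    also have "\<dots> \<le> (C * norm (x - y)) * 1 + C * (real (p + 1) * norm (x - y))"
      using C damp_bounds[of blk p "ord k" x] w by (intro add_mono mult_mono) auto
    finally show ?thesis by (simp add: D_def algebra_simps)
  qed
  obtain a where a: "a > 0" "\<And>x. norm (A *v x) \<le> a * norm x"
    using linear_bounded_pos[OF matrix_vector_mul_linear[of A]] by blast
  obtain b where b: "b > 0" "\<And>x. norm (B *v x) \<le> b * norm x"
    using linear_bounded_pos[OF matrix_vector_mul_linear[of B]] by blast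
  have "norm (F \<rho> x - F \<rho> y) \<le> (a + b * (real CARD('m) * D)) * norm (x - y)" for x y
  proof -
    have "norm (\<mu> \<rho> x - \<mu> \<rho> y) \<le> (\<Sum>k\<in>UNIV. \<bar>(\<mu> \<rho> x - \<mu> \<rho> y) $ k\<bar>)" by (rule norm_le_l1_cart)
    also have "\<dots> \<le> (\<Sum>k\<in>(UNIV :: 'm set). D * norm (x - y))" by (intro sum_mono) (simp add: m)
    finally have "b * norm (\<mu> \<rho> x - \<mu> \<rho> y) \<le> b * (real CARD('m) * (D * norm (x - y)))"
      using b(1) by (intro mult_left_mono) auto
    moreover have "F \<rho> x - F \<rho> y = A *v (x - y) + B *v (\<mu> \<rho> x - \<mu> \<rho> y)"
      by (simp add: F_def matrix_vector_mult_diff_distrib)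
    then have "norm (F \<rho> x - F \<rho> y) \<le> a * norm (x - y) + b * norm (\<mu> \<rho> x - \<mu> \<rho> y)"
      by (simp only:) (intro norm_triangle_le add_mono a(2) b(2))
    ultimately show ?thesis by (simp add: algebra_simps)
  qed
  moreover have "a + b * (real CARD('m) * D) > 0" using a b D by (intro add_pos_nonneg) auto
  ultimately show ?thesis by blast
qed

text \<open>Everything outside the isolated loop vanishes with the tail. Later states do so
  directly; later inputs because the feedback laws vanish at 0 and are Lipschitz; and the own input
  differs from the undamped one by a bounded law times \<open>damp - 1\<close>, which is Lipschitz
  in the tail and zero there.\<close>

lemma interconnection_bound:
  "\<exists>M\<ge>0. \<forall>i x. norm (blk_proj blk i (F \<rho> x) - G \<rho> i (blk_proj blk i x)) \<le> M * norm (tail_proj blk (Suc i) x)"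
proof -
  obtain C where C: "C \<ge> 0" "\<And>k x. \<bar>K k \<rho> x\<bar> \<le> C" "\<And>k x y. \<bar>K k \<rho> x - K k \<rho> y\<bar> \<le> C * norm (x - y)"
    using K_bounds by metis
  define D where "D = 1 + C * real (p + 1)"
  have D: "D \<ge> 1" "C \<le> D" using C(1) mult_left_mono[of 1 "real (p + 1)" C] by (auto simp: D_def)
  define M where "M = (\<Sum>s\<in>UNIV. (\<Sum>c\<in>UNIV. \<bar>A $ s $ c\<bar>) + (\<Sum>k\<in>UNIV. \<bar>B $ s $ k\<bar> * D))"
  have "norm (blk_proj blk i (F \<rho> x) - G \<rho> i (blk_proj blk i x)) \<le> M * norm (tail_proj blk (Suc i) x)" for i x
  proof -
    let ?T = "norm (tail_proj blk (Suc i) x)"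
    have Kpr: "K k \<rho> (blk_proj blk j x) = K k \<rho> x" if "ord k = j" for k j using KD(1)[of k x] that by simp
    \<comment> \<open>The inputs with the undamped feedback of block \<open>i\<close> removed: what
      is left after subtracting the isolated loop.\<close>
    define v where "v = (\<lambda>k. \<mu> \<rho> x $ k - (if ord k = i then K k \<rho> x else 0))"
    have v: "\<bar>v k\<bar> \<le> D * ?T" if "i \<le> ord k" for k
    proof (cases "ord k = i")
      case True
      have "damp blk p i 0 = 1" by (simp add: damp_def linear_0[OF tail_proj_linear])
      then have "\<bar>damp blk p i x - 1\<bar> \<le> real (p + 1) * ?T"
        using damp_lipschitz[of blk p i x 0] by (simp add: linear_0[OF tail_proj_linear])
      then have "\<bar>K k \<rho> x\<bar> * \<bar>damp blk p i x - 1\<bar> \<le> C * (real (p + 1) * ?T)" using C by (intro mult_mono) auto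
      moreover have "v k = K k \<rho> x * (damp blk p i x - 1)" using True by (simp add: v_def \<mu>_def algebra_simps)
      ultimately have "\<bar>v k\<bar> \<le> C * real (p + 1) * ?T" by (simp add: abs_mult mult.assoc)
      also have "\<dots> \<le> D * ?T" by (intro mult_right_mono) (auto simp: D_def)
      finally show ?thesis .
    next
      case False
      have "\<bar>K k \<rho> x\<bar> \<le> C * norm (blk_proj blk (ord k) x)"
        using C(3)[of k "blk_proj blk (ord k) x" 0] by (simp add: Kpr KD(2))
      also have "\<dots> \<le> D * ?T" using D C(1) that False by (intro mult_mono norm_proj_le_tail) auto
      finally have "\<bar>K k \<rho> x\<bar> * \<bar>damp blk p (ord k) x\<bar> \<le> (D * ?T) * 1"
        using damp_bounds[of blk p "ord k" x] D by (intro mult_mono) auto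
      then show ?thesis using False by (simp add: v_def \<mu>_def abs_mult)
    qed
    have comp: "\<bar>(blk_proj blk i (F \<rho> x) - G \<rho> i (blk_proj blk i x)) $ s\<bar>
      \<le> ((\<Sum>c\<in>UNIV. \<bar>A $ s $ c\<bar>) + (\<Sum>k\<in>UNIV. \<bar>B $ s $ k\<bar> * D)) * ?T" (is "_ \<le> ?R") for s
    proof (cases "blk s = i")
      case True
      have Gs: "G \<rho> i (blk_proj blk i x) $ s = (blk_mat blk i A *v x) $ s + (\<Sum>k | ord k = i. B $ s $ k * K k \<rho> x)"
        using True by (auto simp: G_def blk_mat_proj inp_def Kpr mult.commute intro!: sum.cong)
      have "(\<Sum>k | i \<le> ord k. B $ s $ k * v k) = (\<Sum>k | i \<le> ord k. B $ s $ k * \<mu> \<rho> x $ k) - (\<Sum>k | i \<le> ord k. B $ s $ k * (if ord k = i then K k \<rho> x else 0))"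
        by (simp add: v_def algebra_simps sum_subtractf)
      also have "(\<Sum>k | i \<le> ord k. B $ s $ k * (if ord k = i then K k \<rho> x else 0)) = (\<Sum>k | ord k = i. B $ s $ k * K k \<rho> x)"
        by (rule sum.mono_neutral_cong_right) auto
      finally have "(blk_proj blk i (F \<rho> x) - G \<rho> i (blk_proj blk i x)) $ s
        = (\<Sum>c | i < blk c. A $ s $ c * x $ c) + (\<Sum>k | i \<le> ord k. B $ s $ k * v k)"
        using True drift_split[of x "\<mu> \<rho> x" s] by (simp add: Gs F_def blk_proj_def[of _ _ "A *v x + B *v \<mu> \<rho> x"])
      moreover have "\<bar>\<Sum>c | i < blk c. A $ s $ c * x $ c\<bar> \<le> (\<Sum>c\<in>UNIV. \<bar>A $ s $ c\<bar> * ?T)"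
      proof (rule order_trans[OF sum_abs order_trans[OF sum_mono sum_mono2]])
        show "\<bar>A $ s $ c * x $ c\<bar> \<le> \<bar>A $ s $ c\<bar> * ?T" if "c \<in> {c. i < blk c}" for c
          using that unfolding abs_mult by (intro mult_left_mono tail_proj_nth_le) auto
      qed auto
      moreover have "\<bar>\<Sum>k | i \<le> ord k. B $ s $ k * v k\<bar> \<le> (\<Sum>k\<in>UNIV. \<bar>B $ s $ k\<bar> * (D * ?T))"
      proof (rule order_trans[OF sum_abs order_trans[OF sum_mono sum_mono2]])
        show "\<bar>B $ s $ k * v k\<bar> \<le> \<bar>B $ s $ k\<bar> * (D * ?T)" if "k \<in> {k. i \<le> ord k}" for k
          using that unfolding abs_mult by (intro mult_left_mono v) auto
        show "0 \<le> \<bar>B $ s $ k\<bar> * (D * ?T)" for k using D by simp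
      qed auto
      ultimately show ?thesis by (simp add: algebra_simps sum_distrib_left sum_distrib_right)
    next
      case False
      have "(blk_proj blk i (F \<rho> x) - G \<rho> i (blk_proj blk i x)) $ s = 0"
        using False by (auto simp: G_def blk_proj_def inp_def blk_mat_def matrix_vector_mult_def intro!: sum.neutral)
      moreover have "0 \<le> ?R" using D by (intro mult_nonneg_nonneg add_nonneg_nonneg sum_nonneg) auto
      ultimately show ?thesis by simp
    qed
    show ?thesis unfolding M_def sum_distrib_right
      by (intro order_trans[OF norm_le_l1_cart] sum_mono comp)
  qed
  moreover have "M \<ge> 0" unfolding M_def using D by (intro sum_nonneg add_nonneg_nonneg mult_nonneg_nonneg) auto
  ultimately show ?thesis by blast
qed

lemma F_lin_gain: "lin_gain UNIV (F \<rho>)"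
proof -
  obtain M where M: "M \<ge> 0" "\<And>i x. norm (blk_proj blk i (F \<rho> x) - G \<rho> i (blk_proj blk i x)) \<le> M * norm (tail_proj blk (Suc i) x)"
    using interconnection_bound by blast
  have "\<And>i y. G \<rho> i y \<in> blk_space blk i"
    by (auto simp: G_def blk_space_def inp_def blk_mat_def matrix_vector_mult_def intro!: sum.neutral)
  from cascade_lin_gain[where G = "G \<rho>", OF blk_le block_gain this M(2,1)] show ?thesis .
qed

lemma F_stabilizing: "SISS_L_stabilizing UNIV (\<lambda>x u. A *v x + B *v u) (\<mu> \<rho>)"
proof -
  obtain L where "L > 0" "\<And>x y. norm (F \<rho> x - F \<rho> y) \<le> L * norm (x - y)" using F_lipschitz by blast
  then have "GAS UNIV (F \<rho>)" "SISS_L UNIV (F \<rho>)"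
    using lin_gain_GAS[OF F_lin_gain] lin_gain_SISS_L[OF F_lin_gain] by auto
  then show ?thesis unfolding SISS_L_stabilizing_def stabilizing_def F_def[abs_def] by simp
qed

lemma block_stabilizing:
  "SISS_L_stabilizing (blk_space blk (ord k)) (\<lambda>x u. blk_mat blk (ord k) A *v x + u *\<^sub>R inp k) (K k \<rho>)"
proof -
  let ?M = "blk_mat blk (ord k) A" and ?H = "\<lambda>x. blk_mat blk (ord k) A *v x + K k \<rho> x *\<^sub>R inp k"
  obtain d where d: "d \<ge> 0" "\<And>x y. \<bar>K k \<rho> x - K k \<rho> y\<bar> \<le> d * norm (x - y)" using KD(4)[of k] by blast
  obtain a where a: "a > 0" "\<And>x. norm (?M *v x) \<le> a * norm x"
    using linear_bounded_pos[OF matrix_vector_mul_linear[of ?M]] by blast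
  have "norm (?H x - ?H y) \<le> (a + d * norm (inp k)) * norm (x - y)" for x y
  proof -
    have "?H x - ?H y = ?M *v (x - y) + (K k \<rho> x - K k \<rho> y) *\<^sub>R inp k"
      by (simp add: matrix_vector_mult_diff_distrib algebra_simps)
    also have "norm \<dots> \<le> a * norm (x - y) + (d * norm (x - y)) * norm (inp k)"
      using a(2)[of "x - y"] mult_right_mono[OF d(2)[of x y], of "norm (inp k)"] by (intro norm_triangle_le) simp
    finally show ?thesis by (simp add: algebra_simps)
  qed
  moreover have "a + d * norm (inp k) > 0" using a d by (intro add_pos_nonneg) auto
  ultimately have "SISS_L (blk_space blk (ord k)) ?H" using lin_gain_SISS_L[OF KD(6)[of k]] by blast
  moreover have "GAS (blk_space blk (ord k)) ?H"
    by (rule lin_gain_GAS[OF KD(6)]) (simp add: blk_space_def)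
  ultimately show ?thesis unfolding SISS_L_stabilizing_def stabilizing_def by simp
qed

lemma Cp_\<mu>: "Cp j (\<mu> \<rho>)"
  by (rule Cp_vec) (simp add: \<mu>_def Cp_mult KD(5) Cp_damp)

end

end

lemma Basis_axisE:
  fixes r :: "real^'n"
  assumes "r \<in> Basis"
  obtains s where "r = axis s 1"
  using assms by (auto simp: Basis_vec_def)

section \<open>Weighted Lie derivative bounds along the cascade\<close>

context block_cascade
begin

text \<open>The size of the states that drive block \<open>i\<close>. The square root is chosen so
  that the square of the weight is exactly the base of the denominator in the feedback.\<close>

definition wgt :: "nat \<Rightarrow> real^'n \<Rightarrow> real" where
  "wgt i x = sqrt (1 + (norm (tail_proj blk (Suc i) x))\<^sup>2)"

lemma wgt_ge: "1 \<le> wgt i x" by (simp add: wgt_def)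

lemma wgt_mono: "i \<le> j \<Longrightarrow> wgt j x \<le> wgt i x"
  unfolding wgt_def by (intro real_sqrt_le_mono add_left_mono power_mono norm_tail_mono) auto

lemma weight_wgt: "weight (wgt i)" by unfold_locales (rule wgt_ge)

lemma wgt_sq: "(wgt i x)\<^sup>2 = 1 + (norm (tail_proj blk (Suc i) x))\<^sup>2"
  unfolding wgt_def by (rule real_sqrt_pow2) simp

text \<open>The negative exponent is first weakened to 1, and only then is the weight enlarged from
  that of block \<open>ord l\<close> to that of block \<open>i\<close>, because the latter step
  requires a nonnegative exponent.\<close>

lemma LB_input:
  assumes "\<And>j. lie_bd F (wgt (ord l)) j 1 (- 2 * (int p + 1)) (\<lambda>\<rho> x. \<mu> \<rho> x $ l)" "i \<le> ord l"
  shows "lie_bd F (wgt i) j 0 1 (\<lambda>\<rho> x. \<mu> \<rho> x $ l)"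
proof -
  interpret w: weight F "wgt (ord l)" by (rule weight_wgt)
  have "lie_bd F (wgt (ord l)) j 0 1 (\<lambda>\<rho> x. \<mu> \<rho> x $ l)" by (rule w.LB_weaken[OF assms(1)]) auto
  then show ?thesis by (rule lie_bd_mono[OF wgt_ge wgt_mono[OF assms(2)]]) simp
qed

text \<open>The derivative of a coordinate beyond block \<open>i\<close> is linear in coordinates
  and inputs that are again beyond block \<open>i\<close>; these have weight exponent 1, and one
  more would be allowed.\<close>

lemma LB_coord:
  assumes "\<And>l j. i < ord l \<Longrightarrow> lie_bd F (wgt (ord l)) j 1 (- 2 * (int p + 1)) (\<lambda>\<rho> x. \<mu> \<rho> x $ l)"
  shows "i < blk s \<Longrightarrow> lie_bd F (wgt i) j 0 1 (\<lambda>\<rho> x. x $ s)"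
proof (induction j arbitrary: s)
  interpret w: weight F "wgt i" by (rule weight_wgt)
  have wt: "wt_bd (wgt i) 0 1 (\<lambda>\<rho> x. x $ s)" if "i < blk s" for s
  proof -
    have "\<bar>x $ s\<bar> \<le> wgt i x" for x
    proof -
      have "\<bar>x $ s\<bar> \<le> norm (tail_proj blk (Suc i) x)" using that by (intro tail_proj_nth_le) simp
      also have "\<dots> \<le> wgt i x" unfolding wgt_def by (rule real_le_rsqrt) simp
      finally show ?thesis .
    qed
    then show ?thesis unfolding wt_bd_def by (intro exI[of _ 1]) simp
  qed
  {
    case 0
    then show ?case using wt by simp
  next
    case (Suc j)
    show ?case
    proof (rule w.LB_SucI[OF wt[OF Suc.prems], where g' = "\<lambda>\<rho> x h. h $ s"])
      show "((\<lambda>x. x $ s) has_derivative (\<lambda>h. h $ s)) (at x)" for x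
        by (rule bounded_linear_imp_has_derivative[OF bounded_linear_vec_nth])
      show "lie_bd F (wgt i) j 0 (1 + 1) (\<lambda>\<rho> x. (\<Sum>c | blk s \<le> blk c. A $ s $ c * x $ c) + (\<Sum>k | blk s \<le> ord k. B $ s $ k * \<mu> \<rho> x $ k))"
      proof (rule w.LB_add)
        show "lie_bd F (wgt i) j 0 (1 + 1) (\<lambda>\<rho> x. \<Sum>c | blk s \<le> blk c. A $ s $ c * x $ c)"
          by (intro w.LB_sum w.LB_cmult w.LB_weaken[OF Suc.IH]) (use Suc.prems in auto)
        show "lie_bd F (wgt i) j 0 (1 + 1) (\<lambda>\<rho> x. \<Sum>k | blk s \<le> ord k. B $ s $ k * \<mu> \<rho> x $ k)"
          by (intro w.LB_sum w.LB_cmult w.LB_weaken[OF LB_input[OF assms]]) (use Suc.prems in auto)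
      qed
      show "F \<rho> x $ s = (\<Sum>c | blk s \<le> blk c. A $ s $ c * x $ c) + (\<Sum>k | blk s \<le> ord k. B $ s $ k * \<mu> \<rho> x $ k)" for \<rho> x
        unfolding F_def by (rule drift_comp)
    qed
  }
qed

text \<open>Induction from block \<open>q\<close> downwards. The inputs of later blocks are bounded
  already, hence so are the later coordinates; these form the driving signal of block
  \<open>ord k\<close>, and the single-block result applies to \<open>K k\<close>. Multiplication by
  the damping factor then brings in the exponent \<open>- 2 * (p + 1)\<close>.\<close>

lemma LB_\<mu>: "lie_bd F (wgt (ord k)) j 1 (- 2 * (int p + 1)) (\<lambda>\<rho> x. \<mu> \<rho> x $ k)"
proof (induction k arbitrary: j rule: measure_induct_rule[of "\<lambda>k. q - ord k"])
  case (less k)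
  let ?i = "ord k"
  interpret w: weight F "wgt ?i" by (rule weight_wgt)
  have IH: "lie_bd F (wgt (ord l)) j 1 (- 2 * (int p + 1)) (\<lambda>\<rho> x. \<mu> \<rho> x $ l)" if "?i < ord l" for l j
    using that ord_range(2)[of l] by (intro less) linarith
  note X = LB_coord[OF IH]
  define D where "D = (\<lambda>x :: real^'n. 1 + (norm (tail_proj blk (Suc ?i) x))\<^sup>2)"
  have D0: "D x > 0" for x unfolding D_def by (intro add_pos_nonneg) auto
  have D: "w.LB j 0 2 (\<lambda>\<rho>. D)" for j
  proof -
    have "w.LB j 0 2 (\<lambda>\<rho> x. 1 + (\<Sum>c | Suc ?i \<le> blk c. x $ c * x $ c))"
    proof (rule w.LB_add)
      show "w.LB j 0 2 (\<lambda>\<rho> x. 1)" by (rule w.LB_weaken[OF w.LB_const]) auto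
      show "w.LB j 0 2 (\<lambda>\<rho> x. \<Sum>c | Suc ?i \<le> blk c. x $ c * x $ c)"
        by (intro w.LB_sum w.LB_mult_weaken[OF X X]) auto
    qed
    moreover have "D = (\<lambda>x. 1 + (\<Sum>c | Suc ?i \<le> blk c. x $ c * x $ c))"
      unfolding D_def norm_tail_sq by (simp add: power2_eq_square)
    ultimately show ?thesis by (simp only:)
  qed
  have invD: "w.LB j 0 (- 2) (\<lambda>\<rho> x. inverse (D x))" for j
  proof (rule w.LB_inverse[OF _ _ D])
    have "\<bar>inverse (D x)\<bar> = wgt ?i x powi - 2" for x
      using D0[of x] by (simp add: power_int_minus D_def wgt_sq)
    then show "wt_bd (wgt ?i) 0 (- 2) (\<lambda>\<rho> x. inverse (D x))"
      unfolding wt_bd_def by (intro exI[of _ 1]) simp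
    show "D x \<noteq> 0" for x using D0[of x] by simp
  qed
  have damp: "w.LB j 0 (- 2 * (int p + 1)) (\<lambda>\<rho>. damp blk p ?i)" for j
  proof -
    have "damp blk p ?i = (\<lambda>x. inverse (D x) ^ (p + 1))" by (simp only: damp_def[abs_def] D_def)
    moreover have "int (p + 1) * - 2 = - 2 * (int p + 1)" by simp
    ultimately show ?thesis using w.LB_power[OF invD, of j "p + 1"] by (simp only:)
  qed
  \<comment> \<open>Stated as an implication at each order, because the driving signal of the block
    contains its own damped input; the bound on \<open>K k\<close> at order \<open>j\<close> is
    exactly what is available inside the single-block induction.\<close>
  have \<mu>: "w.LB j 1 (- 2 * (int p + 1)) (\<lambda>\<rho> x. \<mu> \<rho> x $ k)" if "w.LB j 1 0 (K k)" for j
  proof -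
    have "(\<lambda>\<rho> x. \<mu> \<rho> x $ k) = (\<lambda>\<rho> x. K k \<rho> x * damp blk p ?i x)" by (simp add: \<mu>_def)
    moreover have "w.LB j 1 (- 2 * (int p + 1)) (\<lambda>\<rho> x. K k \<rho> x * damp blk p ?i x)"
      by (rule w.LB_mult_weaken[OF that damp]) auto
    ultimately show ?thesis by (simp only:)
  qed
  define g where "g = (\<lambda>r \<rho> x. (blk_proj blk ?i (F \<rho> x) - blk_mat blk ?i A *v x) \<bullet> r)"
  have "w.LB j 1 0 (K k)" for j
  proof (rule sched_feedback_LB[OF Ksf[of k] weight_wgt, where g = g])
    show "blk_proj blk ?i (F \<rho> x) = blk_mat blk ?i A *v x + (\<Sum>r\<in>Basis. g r \<rho> x *\<^sub>R r)" for \<rho> x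
      unfolding g_def euclidean_representation by simp
    fix j and r :: "real^'n" assume Kj: "w.LB j 1 0 (K k)" and "r \<in> Basis"
    then obtain s where r: "r = axis s 1" using Basis_axisE by blast
    show "w.LB j 0 1 (g r)"
    proof (cases "blk s = ?i")
      case True
      have "w.LB j 0 1 (\<lambda>\<rho> x. (\<Sum>c | ?i < blk c. A $ s $ c * x $ c) + (\<Sum>l | ?i \<le> ord l. B $ s $ l * \<mu> \<rho> x $ l))"
      proof (rule w.LB_add)
        show "w.LB j 0 1 (\<lambda>\<rho> x. \<Sum>c | ?i < blk c. A $ s $ c * x $ c)"
          by (intro w.LB_sum w.LB_cmult X) auto
        have "w.LB j 0 1 (\<lambda>\<rho> x. \<mu> \<rho> x $ l)" if "?i \<le> ord l" for l
        proof (cases "l = k")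
          case True
          show ?thesis unfolding True by (rule w.LB_weaken[OF \<mu>[OF Kj]]) auto
        next
          case False
          then have "?i < ord l" using that ord_inj[of k l] by (simp add: less_le)
          then show ?thesis by (intro LB_input[OF IH]) auto
        qed
        then show "w.LB j 0 1 (\<lambda>\<rho> x. \<Sum>l | ?i \<le> ord l. B $ s $ l * \<mu> \<rho> x $ l)"
          by (intro w.LB_sum w.LB_cmult) auto
      qed
      moreover have "g r = (\<lambda>\<rho> x. (\<Sum>c | ?i < blk c. A $ s $ c * x $ c) + (\<Sum>l | ?i \<le> ord l. B $ s $ l * \<mu> \<rho> x $ l))"
      proof (intro ext)
        fix \<rho> x
        show "g r \<rho> x = (\<Sum>c | ?i < blk c. A $ s $ c * x $ c) + (\<Sum>l | ?i \<le> ord l. B $ s $ l * \<mu> \<rho> x $ l)"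
          using True drift_split[of x "\<mu> \<rho> x" s] by (simp add: g_def r inner_axis F_def blk_proj_def)
      qed
      ultimately show ?thesis by (simp only:)
    next
      case False
      then have "g r = (\<lambda>\<rho> x. 0)"
        by (intro ext) (simp add: g_def r inner_axis blk_proj_def blk_mat_def matrix_vector_mult_def)
      then show ?thesis by (simp only: w.LB_zero)
    qed
  qed
  then show ?case by (rule \<mu>)
qed

lemma \<mu>_fb_bounded:
  "\<exists>C\<ge>0. \<forall>\<rho>. 0 < \<rho> \<longrightarrow> \<rho> < 1/2 \<longrightarrow> fb_bounded_by UNIV (\<lambda>x u. A *v x + B *v u) (\<mu> \<rho>) p (\<lambda>_. C * sqrt \<rho>)"
proof -
  have "\<forall>k. \<exists>H. H 0 = (\<lambda>\<rho> x. \<mu> \<rho> x $ k) \<and> (\<forall>a\<le>p. wt_bd (wgt (ord k)) 1 (- 2 * (int p + 1) + int a) (H a)) \<and>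
     (\<forall>a<p. \<exists>g'. (\<forall>\<rho> x. 0 < \<rho> \<longrightarrow> \<rho> < 1/2 \<longrightarrow> (H a \<rho> has_derivative g' \<rho> x) (at x)) \<and> H (Suc a) = (\<lambda>\<rho> x. g' \<rho> x (F \<rho> x)))"
    by (intro allI weight.LB_sequence[OF weight_wgt LB_\<mu>])
  from choice[OF this] obtain H where H: "\<forall>k. H k 0 = (\<lambda>\<rho> x. \<mu> \<rho> x $ k) \<and> (\<forall>a\<le>p. wt_bd (wgt (ord k)) 1 (- 2 * (int p + 1) + int a) (H k a)) \<and>
     (\<forall>a<p. \<exists>g'. (\<forall>\<rho> x. 0 < \<rho> \<longrightarrow> \<rho> < 1/2 \<longrightarrow> (H k a \<rho> has_derivative g' \<rho> x) (at x)) \<and> H k (Suc a) = (\<lambda>\<rho> x. g' \<rho> x (F \<rho> x)))"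
    by (elim exE)
  have H0: "\<And>k. H k 0 = (\<lambda>\<rho> x. \<mu> \<rho> x $ k)"
    and Hwt: "\<And>k a. a \<le> p \<Longrightarrow> wt_bd (wgt (ord k)) 1 (- 2 * (int p + 1) + int a) (H k a)"
    and Hd: "\<And>k a. a < p \<Longrightarrow> \<exists>g'. (\<forall>\<rho> x. 0 < \<rho> \<longrightarrow> \<rho> < 1/2 \<longrightarrow> (H k a \<rho> has_derivative g' \<rho> x) (at x)) \<and> H k (Suc a) = (\<lambda>\<rho> x. g' \<rho> x (F \<rho> x))"
    using H by simp_all
  have "\<exists>C\<ge>0. a \<le> p \<longrightarrow> (\<forall>\<rho> x. 0 < \<rho> \<longrightarrow> \<rho> < 1/2 \<longrightarrow> \<bar>H k a \<rho> x\<bar> \<le> C * sqrt \<rho>)" for k a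
  proof (cases "a \<le> p")
    case True
    interpret w: weight F "wgt (ord k)" by (rule weight_wgt)
    have "wt_bd (wgt (ord k)) 1 0 (H k a)" by (rule w.wt_bd_weaken[OF Hwt[OF True]]) (use True in auto)
    then show ?thesis using True unfolding wt_bd_def by simp
  qed auto
  then have ex: "\<exists>C. C \<ge> 0 \<and> (a \<le> p \<longrightarrow> (\<forall>\<rho> x. 0 < \<rho> \<longrightarrow> \<rho> < 1/2 \<longrightarrow> \<bar>H k a \<rho> x\<bar> \<le> C * sqrt \<rho>))" for k a .
  define C where "C = (\<lambda>k a. SOME C. C \<ge> 0 \<and> (a \<le> p \<longrightarrow> (\<forall>\<rho> x. 0 < \<rho> \<longrightarrow> \<rho> < 1/2 \<longrightarrow> \<bar>H k a \<rho> x\<bar> \<le> C * sqrt \<rho>)))"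
  have C_all: "C k a \<ge> 0 \<and> (a \<le> p \<longrightarrow> (\<forall>\<rho> x. 0 < \<rho> \<longrightarrow> \<rho> < 1/2 \<longrightarrow> \<bar>H k a \<rho> x\<bar> \<le> C k a * sqrt \<rho>))" for k a
    unfolding C_def by (rule someI_ex[OF ex])
  have C: "\<And>k a. C k a \<ge> 0"
    "\<And>k a \<rho> x. a \<le> p \<Longrightarrow> 0 < \<rho> \<Longrightarrow> \<rho> < 1/2 \<Longrightarrow> \<bar>H k a \<rho> x\<bar> \<le> C k a * sqrt \<rho>"
    using C_all by simp_all
  define S where "S = (\<Sum>a\<le>p. \<Sum>k\<in>UNIV. C k a)"
  have S: "(\<Sum>k\<in>UNIV. C k a) \<le> S" if "a \<le> p" for a
    unfolding S_def using that C(1) by (intro member_le_sum[of a _ "\<lambda>a. \<Sum>k\<in>UNIV. C k a"]) (auto intro: sum_nonneg)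
  have "fb_bounded_by UNIV (\<lambda>x u. A *v x + B *v u) (\<mu> \<rho>) p (\<lambda>_. S * sqrt \<rho>)" if \<rho>: "0 < \<rho>" "\<rho> < 1/2" for \<rho>
    unfolding fb_bounded_by_def
  proof (intro conjI allI impI)
    show "Cp p (\<mu> \<rho>)" by (rule Cp_\<mu>[OF \<rho>])
    fix x assume x: "traj UNIV (\<lambda>y. A *v y + B *v \<mu> \<rho> y) x"
    define W where "W = (\<lambda>a t. \<chi> k. H k a \<rho> (x t))"
    have W0: "\<mu> \<rho> \<circ> x = W 0" by (simp add: W_def H0 fun_eq_iff)
    have d: "(W a has_vector_derivative W (Suc a) t) (at t within {0..})" if a: "a < p" and t: "t \<ge> 0" for a t
    proof -
      have "((\<lambda>t. H k a \<rho> (x t)) has_vector_derivative H k (Suc a) \<rho> (x t)) (at t within {0..})" for k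
      proof -
        obtain g' where g': "(H k a \<rho> has_derivative g' \<rho> (x t)) (at (x t))" "H k (Suc a) = (\<lambda>\<rho> x. g' \<rho> x (F \<rho> x))"
          using Hd[OF a, of k] \<rho> by blast
        have "(x has_vector_derivative F \<rho> (x t)) (at t within {0..})"
          using x t unfolding traj_def F_def by blast
        from vector_derivative_diff_chain_within[OF this has_derivative_at_withinI[OF g'(1)]]
        show ?thesis by (simp add: o_def g'(2))
      qed
      then show ?thesis
        unfolding has_vector_derivative_def has_derivative_componentwise_within[of "W a"]
        by (auto simp: W_def Basis_vec_def inner_axis)
    qed
    show "(vder j (\<mu> \<rho> \<circ> x) has_vector_derivative vder (Suc j) (\<mu> \<rho> \<circ> x) t) (at t within {0..})" if "j < p" "0 \<le> t" for j t
      unfolding W0 by (rule vder_sequence(2)[where W = W, OF d that])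
    show "norm (vder j (\<mu> \<rho> \<circ> x) t) \<le> S * sqrt \<rho>" if j: "j \<le> p" and t: "0 \<le> t" for j t
    proof -
      have "vder j (\<mu> \<rho> \<circ> x) t = W j t" unfolding W0 by (rule vder_sequence(1)[where W = W, OF d j t])
      moreover have "norm (W j t) \<le> (\<Sum>k\<in>UNIV. \<bar>W j t $ k\<bar>)" by (rule norm_le_l1_cart)
      moreover have "(\<Sum>k\<in>UNIV. \<bar>W j t $ k\<bar>) \<le> (\<Sum>k\<in>UNIV. C k j * sqrt \<rho>)"
        using C(2)[OF j \<rho>] by (intro sum_mono) (simp add: W_def)
      moreover have "\<dots> \<le> S * sqrt \<rho>"
        using S[OF j] \<rho> unfolding sum_distrib_right[symmetric] by (intro mult_right_mono) auto
      ultimately show ?thesis by simp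
    qed
  qed
  moreover have "S \<ge> 0" unfolding S_def using C(1) by (intro sum_nonneg) auto
  ultimately show ?thesis by blast
qed

end

theorem theorem2:
  fixes A :: "real^'n^'n" and B :: "real^'m^'n"
    and blk :: "'n \<Rightarrow> nat" and ord :: "'m \<Rightarrow> nat" and q p :: nat and R :: "nat \<Rightarrow> real"
  assumes Rpos: "\<forall>j\<le>p. R j > 0"
    and q: "q \<ge> 1"
    and ord: "bij_betw ord UNIV {1..q}"
    and blk_range: "\<forall>r. blk r \<le> q"
    and blk_nonempty: "\<forall>i\<in>{1..q}. \<exists>r. blk r = i"
    and A_form: "\<forall>r c. 1 \<le> blk r \<and> blk c < blk r \<longrightarrow> A $ r $ c = 0"
    and B_form: "\<forall>r k. 1 \<le> blk r \<and> ord k < blk r \<longrightarrow> B $ r $ k = 0"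
    and hurwitz: "\<forall>lam. blk_eigenvalue blk 0 A lam \<longrightarrow> Re lam < 0"
    and crit: "\<forall>i\<in>{1..q}. \<forall>lam. blk_eigenvalue blk i A lam \<longrightarrow> Re lam = 0"
    and ctrb: "\<forall>k. blk_controllable blk (ord k) A (\<chi> r. if blk r = ord k then B $ r $ k else 0)"
  shows "\<exists>\<kappa> :: nat \<Rightarrow> real^'n \<Rightarrow> real.
     (\<forall>k. let i = ord k; b = (\<chi> r. if blk r = i then B $ r $ k else 0);
              fi = (\<lambda>x (u::real). blk_mat blk i A *v x + u *\<^sub>R b)
          in (\<forall>x. \<kappa> i x = \<kappa> i (blk_proj blk i x)) \<and>
             fb_bounded (blk_space blk i) fi (\<kappa> i) p \<and>
             SISS_L_stabilizing (blk_space blk i) fi (\<kappa> i)) \<and>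
     (let \<mu> = (\<lambda>x. \<chi> k. \<kappa> (ord k) (blk_proj blk (ord k) x) /
                   (1 + (\<Sum>j\<in>{ord k + 1..q}. (norm (blk_proj blk j x))\<^sup>2)) ^ (p + 1));
          f = (\<lambda>x u. A *v x + B *v u)
      in fb_bounded_by UNIV f \<mu> p R \<and> SISS_L_stabilizing UNIV f \<mu>)"
proof -
  have "\<forall>k. \<exists>\<kappa>. sched_feedback (\<lambda>x. blk_mat blk (ord k) A *v x) (blk_proj blk (ord k))
      (\<chi> r. if blk r = ord k then B $ r $ k else 0) (blk_space blk (ord k)) \<kappa>"
  proof (rule allI, rule crit_block_feedback)
    fix k
    have "ord k \<in> {1..q}" using ord by (auto simp: bij_betw_def)
    then show "\<forall>lam. blk_eigenvalue blk (ord k) A lam \<longrightarrow> Re lam = 0" using crit by blast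
    show "blk_controllable blk (ord k) A (\<chi> r. if blk r = ord k then B $ r $ k else 0)" using ctrb by blast
    show "(\<chi> r. if blk r = ord k then B $ r $ k else 0) \<in> blk_space blk (ord k)" by (simp add: blk_space_def)
  qed
  then obtain K where K: "\<And>k. sched_feedback (\<lambda>x. blk_mat blk (ord k) A *v x) (blk_proj blk (ord k))
      (\<chi> r. if blk r = ord k then B $ r $ k else 0) (blk_space blk (ord k)) (K k)" by metis
  interpret block_cascade A B blk ord q p K
    by (rule block_cascade.intro[OF ord _ _ _ hurwitz_block_lin_gain[OF hurwitz] K]) (use A_form B_form blk_range in blast)+
  obtain C where C: "C \<ge> 0"
    "\<And>\<rho>. 0 < \<rho> \<Longrightarrow> \<rho> < 1/2 \<Longrightarrow> fb_bounded_by UNIV (\<lambda>x u. A *v x + B *v u) (\<mu> \<rho>) p (\<lambda>_. C * sqrt \<rho>)"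
    using \<mu>_fb_bounded by blast
  \<comment> \<open>It suffices that \<open>sqrt \<rho> \<le> r\<close>, since then
    \<open>C * sqrt \<rho>\<close> is below the smallest prescribed bound; \<open>C + 1\<close>
    avoids division by zero.\<close>
  define r where "r = Min (R ` {..p}) / (C + 1)"
  have r0: "Min (R ` {..p}) > 0" using Rpos by (subst Min_gr_iff) auto
  then have r: "r > 0" using C(1) by (simp add: r_def)
  \<comment> \<open>The entry 1/4 keeps the parameter inside the admissible range below 1/2.\<close>
  define \<rho> where "\<rho> = min (1/4) (r\<^sup>2)"
  have \<rho>: "0 < \<rho>" "\<rho> < 1/2" using r by (auto simp: \<rho>_def)
  have "sqrt \<rho> \<le> r" using r real_sqrt_le_mono[of \<rho> "r\<^sup>2"] by (simp add: \<rho>_def)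
  then have "C * sqrt \<rho> \<le> (C + 1) * r" using C(1) r \<rho> by (intro mult_mono) auto
  also have "\<dots> = Min (R ` {..p})" using C(1) by (simp add: r_def)
  finally have small: "C * sqrt \<rho> \<le> R j" if "j \<le> p" for j
    using that Min_le[of "R ` {..p}" "R j"] by force
  define \<kappa> where "\<kappa> = (\<lambda>i. K (inv ord i) \<rho>)"
  have \<kappa>: "\<kappa> (ord k) = K k \<rho>" for k
    using ord by (simp add: \<kappa>_def bij_betw_def inv_f_f)
  \<comment> \<open>The squared norms of the later blocks add up to the squared norm of the tail.
    For block \<open>q\<close> the sum is empty and the denominator is 1, so the undamped last
    component is covered by the same formula.\<close>
  have \<mu>_eq: "(\<lambda>x. \<chi> k. \<kappa> (ord k) (blk_proj blk (ord k) x) /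
      (1 + (\<Sum>j\<in>{ord k + 1..q}. (norm (blk_proj blk j x))\<^sup>2)) ^ (p + 1)) = \<mu> \<rho>"
    unfolding \<kappa> sum_norm_proj[OF blk_le]
    by (rule ext) (simp add: \<mu>_def damp_def vec_eq_iff KD(1)[OF \<rho>] divide_inverse power_inverse)
  show ?thesis
    unfolding Let_def
  proof (rule exI[of _ \<kappa>], unfold \<mu>_eq, unfold \<kappa> inp_def[symmetric], intro conjI allI)
    fix k
    show "K k \<rho> x = K k \<rho> (blk_proj blk (ord k) x)" for x by (rule KD(1)[OF \<rho>, symmetric])
    show "fb_bounded (blk_space blk (ord k)) (\<lambda>x u. blk_mat blk (ord k) A *v x + u *\<^sub>R inp k) (K k \<rho>) p"
      by (rule sched_feedback_fb_bounded[OF Ksf blk_orth_block[OF inp_mem] \<rho>])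
    show "SISS_L_stabilizing (blk_space blk (ord k)) (\<lambda>x u. blk_mat blk (ord k) A *v x + u *\<^sub>R inp k) (K k \<rho>)"
      by (rule block_stabilizing[OF \<rho>])
  next
    show "fb_bounded_by UNIV (\<lambda>x u. A *v x + B *v u) (\<mu> \<rho>) p R"
      using C(2)[OF \<rho>] small unfolding fb_bounded_by_def by (meson order_trans)
    show "SISS_L_stabilizing UNIV (\<lambda>x u. A *v x + B *v u) (\<mu> \<rho>)" by (rule F_stabilizing[OF \<rho>])
  qed
qed

end
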